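(* Let $\alpha,\beta\in(0,1]$. Let $X$ be a solution of the SDE $X_t=x_0+\int_0^t b(X_s)\,ds+\sigma W_t$, $t\in[0,T]$, and let $X^h$ be its Euler-Maruyama approximation with $h=T/n$ for some $n\in\mathbb{N}$, $n\geq 1$. If the drift coefficient $b\in\mathcal{B}(\alpha)$ is bounded, then for any Lipschitz continuous function $f:\mathbb{R}^d\to\mathbb{R}$ and any $g\in\mathcal{B}(\beta)$ there exists a constant $C$ which does not depend on $h$ (i.e. on $n$) such that $$\left|\mathbb{E}\Big[f\Big(\int_0^T g(X_s)\,ds\Big)\Big]-\mathbb{E}\Big[f\Big(\int_0^T g(X^h_{\eta_h(s)})\,ds\Big)\Big]\right|\le C\,h^{\frac{\alpha}{2}\wedge\frac{\beta}{2}\wedge\frac14}.$$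
   Context: Setting. Fix $T>0$, $d\ge1$, $x_0\in\mathbb{R}^d$. Let $(\Omega,\mathcal{F},(\mathcal{F}_t)_{t\ge0},\mathbb{P})$ be a filtered probability space with a $d$-dimensional standard Brownian motion $W$. Let $\sigma$ be a deterministic $d\times d$ matrix which is uniformly elliptic: with $a=\sigma\sigma^*$ there are $0<\underline{a}<\overline{a}<\infty$ such that $\underline{a}|\xi|^2\le\langle a\xi,\xi\rangle\le\overline{a}|\xi|^2$ for all $\xi\in\mathbb{R}^d$. Let $b:\mathbb{R}^d\to\mathbb{R}^d$ be Borel measurable. Standing assumption: the equation $X_t=x_0+\int_0^t b(X_s)\,ds+\sigma W_t$, $t\in[0,T]$, has a weak solution which is unique in the sense of probability law. Euler-Maruyama approximation. For $h>0$, $X^h_t=x_0+\int_0^t b(X^h_{\eta_h(s)})\,ds+\sigma W_t$, $t\in[0,T]$, where $\eta_h(s)=kh$ if $kh\le s<(k+1)h$, $k\in\{0,1,2,\dots\}$. Class $\mathcal{A}$: the class of exponentially bounded functions $\zeta:\mathbb{R}^d\to\mathbb{R}$ (i.e. $|\zeta(x)|\le Ke^{K|x|}$ for some constant $K>0$) for which there exist a sequence $(\zeta_N)_{N\in\mathbb{N}}\subset C^1(\mathbb{R}^d)$ and a constant $K>0$ such that: (i) $\zeta_N\to\zeta$ in $L^1_{loc}(\mathbb{R}^d)$; (ii) $\sup_N|\zeta_N(x)|+|\zeta(x)|\le Ke^{K|x|}$ for all $x\in\mathbb{R}^d$; (iii) $\sup_{N\in\mathbb{N},\,u>0,\,a\in\mathbb{R}^d}e^{-K|a|-Ku}\int_{\mathbb{R}^d}|\nabla\zeta_N(x+a)|\frac{e^{-|x|^2/u}}{u^{(d-1)/2}}\,dx<K$.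 Class $\mathcal{B}(\alpha)$, $\alpha\in(0,1]$: all measurable $b:\mathbb{R}^d\to\mathbb{R}^d$ of the form $b=b^H+b^A$, where $b^H$ is $\alpha$-Hölder continuous ($|b^H(x)-b^H(y)|\le C|x-y|^\alpha$ for all $x,y$, for some constant $C>0$) and each component $b^A_j\in\mathcal{A}$, $j=1,\dots,d$. *)

theory Defs
  imports "HOL-Probability.Probability"
begin

section \<open>Filtered probability spaces and Brownian motion\<close>

text \<open>Time is the half-line of nonnegative reals; values of processes and filtrations at
  negative times play no role. The usual conditions are not imposed.\<close>

locale filtered_prob_space = prob_space M for M :: "'w measure" +
  fixes F :: "real \<Rightarrow> 'w measure"
  assumes subalgebra_F: "\<And>t. 0 \<le> t \<Longrightarrow> subalgebra M (F t)"
    and sets_F_mono: "\<And>s t. 0 \<le> s \<Longrightarrow> s \<le> t \<Longrightarrow> sets (F s) \<subseteq> sets (F t)"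

locale brownian_motion = filtered_prob_space M F for M :: "'w measure" and F +
  fixes W :: "real \<Rightarrow> 'w \<Rightarrow> real^'d"
  assumes adapted: "\<And>t. 0 \<le> t \<Longrightarrow> W t \<in> borel_measurable (F t)"
    and continuous_paths: "\<And>\<omega>. \<omega> \<in> space M \<Longrightarrow> continuous_on {0..} (\<lambda>t. W t \<omega>)"
    and start: "AE \<omega> in M. W 0 \<omega> = 0"
    and indep_increments: "\<And>s t. 0 \<le> s \<Longrightarrow> s < t \<Longrightarrow>
      indep_set (sets (F s)) (sets (vimage_algebra (space M) (\<lambda>\<omega>. W t \<omega> - W s \<omega>) borel))"
    and normal_increments: "\<And>s t. 0 \<le> s \<Longrightarrow> s < t \<Longrightarrow>
      distributed M lborel (\<lambda>\<omega>. W t \<omega> - W s \<omega>)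
        (\<lambda>x. ennreal (\<Prod>i\<in>UNIV. normal_density 0 (sqrt (t - s)) (x $ i)))"

section \<open>The stochastic differential equation\<close>

definition uniformly_elliptic :: "real^'d^'d \<Rightarrow> bool" where
  "uniformly_elliptic \<sigma> \<longleftrightarrow> (let a = \<sigma> ** transpose \<sigma> in
     \<exists>al au. 0 < al \<and> al < au \<and>
       (\<forall>\<xi>. al * (norm \<xi>)\<^sup>2 \<le> (a *v \<xi>) \<bullet> \<xi> \<and> (a *v \<xi>) \<bullet> \<xi> \<le> au * (norm \<xi>)\<^sup>2))"

definition weak_solution :: "real \<Rightarrow> (real^'d \<Rightarrow> real^'d) \<Rightarrow> real^'d^'d \<Rightarrow> real^'d \<Rightarrow>
    'w measure \<Rightarrow> (real \<Rightarrow> 'w measure) \<Rightarrow> (real \<Rightarrow> 'w \<Rightarrow> real^'d) \<Rightarrow> (real \<Rightarrow> 'w \<Rightarrow> real^'d) \<Rightarrow> bool" where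
  "weak_solution T b \<sigma> x0 M F W X \<longleftrightarrow>
     brownian_motion M F W \<and>
     (\<forall>t\<in>{0..T}. X t \<in> borel_measurable (F t)) \<and>
     (\<forall>\<omega>\<in>space M. continuous_on {0..T} (\<lambda>t. X t \<omega>)) \<and>
     (AE \<omega> in M. set_integrable lborel {0..T} (\<lambda>s. b (X s \<omega>))) \<and>
     (AE \<omega> in M. \<forall>t\<in>{0..T}. X t \<omega> = x0 + (LINT s:{0..t}|lborel. b (X s \<omega>)) + \<sigma> *v W t \<omega>)"

text \<open>The law of the path on \<open>[0,T]\<close>. It is taken on the product \<open>\<sigma>\<close>-algebra; for continuous
  processes this carries the same information as the law on the space of continuous functions,
  whose Borel sets are the traces of the cylinder sets.\<close>

definition path_law :: "real \<Rightarrow> 'w measure \<Rightarrow> (real \<Rightarrow> 'w \<Rightarrow> real^'d) \<Rightarrow> (real \<Rightarrow> real^'d) measure" where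
  "path_law T M X = distr M (\<Pi>\<^sub>M t\<in>{0..T}. borel) (\<lambda>\<omega>. \<lambda>t\<in>{0..T}. X t \<omega>)"

text \<open>HOL cannot quantify over the type of the sample space inside a formula, so in the next
  definition the (otherwise arbitrary) filtered probability spaces live on pairs of paths. This is
  no restriction: a weak solution on any sample space is transported by \<open>\<omega> \<mapsto> (X(\<omega>), W(\<omega>))\<close>
  to one of this type with the same path law, so both existence and uniqueness
  have the same meaning as over all sample spaces.\<close>

type_synonym 'd path_pair = "(real \<Rightarrow> real^'d) \<times> (real \<Rightarrow> real^'d)"

definition weak_existence :: "real \<Rightarrow> (real^'d \<Rightarrow> real^'d) \<Rightarrow> real^'d^'d \<Rightarrow> real^'d \<Rightarrow> bool" where
  "weak_existence T b \<sigma> x0 \<longleftrightarrow>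
     (\<exists>(M :: 'd path_pair measure) F W X. weak_solution T b \<sigma> x0 M F W X)"

definition uniqueness_in_law :: "real \<Rightarrow> (real^'d \<Rightarrow> real^'d) \<Rightarrow> real^'d^'d \<Rightarrow> real^'d \<Rightarrow> bool" where
  "uniqueness_in_law T b \<sigma> x0 \<longleftrightarrow>
     (\<forall>(M :: 'd path_pair measure) F W X (M' :: 'd path_pair measure) F' W' X'.
        weak_solution T b \<sigma> x0 M F W X \<longrightarrow> weak_solution T b \<sigma> x0 M' F' W' X' \<longrightarrow>
        path_law T M X = path_law T M' X')"

section \<open>The Euler--Maruyama approximation\<close>

definition grid_floor :: "real \<Rightarrow> real \<Rightarrow> real" where
  "grid_floor h s = of_int \<lfloor>s / h\<rfloor> * h"

lemma grid_floor_eq: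
  fixes k :: nat
  assumes "0 < h" "real k * h \<le> s" "s < (real k + 1) * h"
  shows "grid_floor h s = real k * h"
proof -
  have "\<lfloor>s / h\<rfloor> = int k"
    using assms by (intro floor_unique) (auto simp: field_simps)
  then show ?thesis by (simp add: grid_floor_def)
qed

definition euler_maruyama :: "real \<Rightarrow> (real^'d \<Rightarrow> real^'d) \<Rightarrow> real^'d^'d \<Rightarrow> real^'d \<Rightarrow>
    'w measure \<Rightarrow> (real \<Rightarrow> 'w \<Rightarrow> real^'d) \<Rightarrow> real \<Rightarrow> (real \<Rightarrow> 'w \<Rightarrow> real^'d) \<Rightarrow> bool" where
  "euler_maruyama T b \<sigma> x0 M W h Xh \<longleftrightarrow>
     (\<forall>t\<in>{0..T}. Xh t \<in> borel_measurable M) \<and>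
     (AE \<omega> in M. \<forall>t\<in>{0..T}.
        Xh t \<omega> = x0 + (LINT s:{0..t}|lborel. b (Xh (grid_floor h s) \<omega>)) + \<sigma> *v W t \<omega>)"

section \<open>The function classes\<close>

definition exponentially_bounded :: "(real^'d \<Rightarrow> real) \<Rightarrow> bool" where
  "exponentially_bounded \<zeta> \<longleftrightarrow> (\<exists>K>0. \<forall>x. \<bar>\<zeta> x\<bar> \<le> K * exp (K * norm x))"

definition tendsto_L1_loc :: "(nat \<Rightarrow> real^'d \<Rightarrow> real) \<Rightarrow> (real^'d \<Rightarrow> real) \<Rightarrow> bool" where
  "tendsto_L1_loc u v \<longleftrightarrow> (\<forall>S. compact S \<longrightarrow>
     (\<forall>N. set_integrable lebesgue S (u N)) \<and> set_integrable lebesgue S v \<and>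
     (\<lambda>N. LINT x:S|lebesgue. \<bar>u N x - v x\<bar>) \<longlonglongrightarrow> 0)"

text \<open>\<open>G N\<close> is the gradient of \<open>\<zeta>N N\<close>; its continuity expresses that \<open>\<zeta>N N\<close> is of class \<open>C\<^sup>1\<close>.
  The supremum is formed in the extended nonnegative reals, so no finiteness is presupposed.\<close>

definition class_A :: "(real^'d \<Rightarrow> real) set" where
  "class_A = {\<zeta>. exponentially_bounded \<zeta> \<and>
     (\<exists>(\<zeta>N :: nat \<Rightarrow> real^'d \<Rightarrow> real) (G :: nat \<Rightarrow> real^'d \<Rightarrow> real^'d) K.
        0 < K \<and>
        (\<forall>N x. GDERIV (\<zeta>N N) x :> G N x) \<and> (\<forall>N. continuous_on UNIV (G N)) \<and>
        tendsto_L1_loc \<zeta>N \<zeta> \<and>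
        (\<forall>N x. \<bar>\<zeta>N N x\<bar> + \<bar>\<zeta> x\<bar> \<le> K * exp (K * norm x)) \<and>
        (SUP N. SUP u\<in>{0<..}. SUP a.
            ennreal (exp (- K * norm a - K * u)) *
            (\<integral>\<^sup>+ x. ennreal (norm (G N (x + a)) *
                 (exp (- (norm x)\<^sup>2 / u) / u powr ((real CARD('d) - 1) / 2))) \<partial>lborel))
          < ennreal K)}"

definition holder_continuous :: "real \<Rightarrow> (real^'d \<Rightarrow> real^'d) \<Rightarrow> bool" where
  "holder_continuous \<alpha> b \<longleftrightarrow> (\<exists>C>0. \<forall>x y. norm (b x - b y) \<le> C * norm (x - y) powr \<alpha>)"

definition class_B :: "real \<Rightarrow> (real^'d \<Rightarrow> real^'d) set" where
  "class_B \<alpha> = {b. b \<in> borel_measurable borel \<and>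
     (\<exists>bH bA. (\<forall>x. b x = bH x + bA x) \<and> holder_continuous \<alpha> bH \<and>
        (\<forall>j. (\<lambda>x. bA x $ j) \<in> class_A))}"

end

theory Submission
  imports Defs
begin

text \<open>For a drift that is only bounded and measurable the two processes cannot be compared path by
  path. They are compared through their laws: by Girsanov's theorem the solution and the Euler scheme
  are both obtained from the driftless process \<open>x0 + \<sigma> *v W\<close> by a change of measure, and two
  such changes of measure are close in mean as soon as the drifts that define them are close in
  mean square under the driftless law. The drifts are \<open>b\<close> at the present time and \<open>b\<close> at the last grid
  point, so what has to be estimated is an increment of \<open>b\<close> along Brownian motion.

  For such increments the function classes are made: integrating the gradients of the smooth
  approximations against a Gaussian law of variance \<open>s\<close> costs a factor \<open>s powr (-1/2)\<close>, and the
  mean square of \<open>\<phi> (x0 + \<sigma> *v W t) - \<phi> (x0 + \<sigma> *v W s)\<close> is of the order of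
  \<open>(t - s) powr \<beta> + s powr (-1/2) * sqrt (t - s)\<close> (\<open>class_B_increment_bound\<close>). The singularity
  at \<open>s = 0\<close> is integrable, so summing over the grid leaves \<open>h powr \<beta> + sqrt h\<close>
  (\<open>driftless_grid_increments\<close>). Taking square roots gives the two kinds of exponents, half of the
  Hoelder exponent and 1/4. The estimate is used twice: for \<open>b\<close>, to compare the densities, and for \<open>g\<close>,
  to replace the time integral of \<open>g\<close> along the solution by a Riemann sum.

  The change of measure is carried out in discrete time, where the stochastic exponential is a finite
  product and Girsanov's theorem is the shift formula for a Gaussian density, applied step by step
  with the past frozen (\<open>girsanov\<close>). To this end each of the \<open>n\<close> Euler steps is divided into \<open>m\<close>
  smaller ones, and on the resulting grid the solution is replaced by a chain whose drift is the
  average of the drift over the preceding step. This drift is known when the step begins, and the chain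
  still follows the solution up to one step. Under a measure \<open>Q\<close> the chain has the
  law of the driftless process, with a density that has bounded moments; hence functions of the chain
  that are small in mean square under Gaussian laws are small in mean (\<open>chain_krylov_pair\<close>).
  Together with Lipschitz approximation of functions this shows that the chain converges to the solution
  even inside discontinuous functions (\<open>chain_converges\<close>), so that the averaged drift approaches
  \<open>b\<close> evaluated along the chain (\<open>delayed_drift_error\<close>). Under a second measure the
  same chain, looked at on the coarse grid, is the Euler scheme (\<open>chain_is_euler\<close>). The two densities
  are compared by \<open>girsanov_density_stability\<close>, and all errors that come from the fine grid
  disappear as \<open>m\<close> tends to infinity with \<open>n\<close> fixed.\<close>

section \<open>Gaussian measures\<close>

definition gauss_density :: "real \<Rightarrow> real^'d \<Rightarrow> real" where
  "gauss_density \<tau> x = (1 / sqrt (2 * pi * \<tau>)) ^ CARD('d) * exp (- (norm x)\<^sup>2 / (2 * \<tau>))"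

definition gauss :: "real \<Rightarrow> (real^'d) measure" where
  "gauss \<tau> = density lborel (\<lambda>x. ennreal (gauss_density \<tau> x))"

lemma sets_gauss [simp, measurable_cong]: "sets (gauss \<tau>) = sets borel"
  by (simp add: gauss_def)

lemma space_gauss [simp]: "space (gauss \<tau>) = UNIV"
  by (simp add: gauss_def)

lemma borel_measurable_gauss_density [measurable]: "gauss_density \<tau> \<in> borel_measurable borel"
  unfolding gauss_density_def by measurable

lemma gauss_density_nonneg [simp]: "0 \<le> \<tau> \<Longrightarrow> 0 \<le> gauss_density \<tau> x"
  by (simp add: gauss_density_def)

lemma gauss_density_eq_prod:
  fixes x :: "real^'d"
  assumes "0 < \<tau>"
  shows "(\<Prod>i\<in>UNIV. normal_density 0 (sqrt \<tau>) (x $ i)) = gauss_density \<tau> x"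
proof -
  have "(norm x)\<^sup>2 = (\<Sum>i\<in>UNIV. (x $ i)\<^sup>2)"
    by (simp add: norm_vec_def L2_set_def sum_nonneg)
  then have "exp (- (norm x)\<^sup>2 / (2 * \<tau>)) = (\<Prod>i\<in>UNIV. exp (- (x $ i)\<^sup>2 / (2 * \<tau>)))"
    by (simp add: exp_sum[symmetric] sum_negf sum_divide_distrib)
  with assms show ?thesis
    by (simp add: normal_density_def gauss_density_def prod_dividef power_divide)
qed

lemma prob_space_gauss:
  assumes "0 < \<tau>"
  shows "prob_space (gauss \<tau> :: (real^'d) measure)"
proof
  have "emeasure (gauss \<tau> :: (real^'d) measure) UNIV = (\<integral>\<^sup>+x. ennreal (gauss_density \<tau> (x :: real^'d)) \<partial>lborel)"
    by (simp add: gauss_def emeasure_density)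
  also have "\<dots> = (\<integral>\<^sup>+x. (\<Prod>b\<in>Basis. ennreal (normal_density 0 (sqrt \<tau>) ((x :: real^'d) \<bullet> b))) \<partial>lborel)"
  proof (rule nn_integral_cong)
    fix x :: "real^'d"
    have "gauss_density \<tau> x = (\<Prod>i\<in>UNIV. normal_density 0 (sqrt \<tau>) (x $ i))"
      by (rule gauss_density_eq_prod[OF assms, symmetric])
    also have "\<dots> = (\<Prod>b\<in>Basis. normal_density 0 (sqrt \<tau>) (x \<bullet> b))"
    proof -
      have "(Basis :: (real^'d) set) = (\<lambda>i. axis i 1) ` UNIV"
        by (auto simp: Basis_vec_def)
      moreover have "inj (\<lambda>i::'d. axis i (1::real))"
        by (auto simp: inj_on_def axis_eq_axis)
      ultimately show ?thesis
        using prod.reindex[of "\<lambda>i::'d. axis i (1::real)" UNIV "\<lambda>b. normal_density 0 (sqrt \<tau>) (x \<bullet> b)"]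
        by (simp add: inner_axis)
    qed
    finally show "ennreal (gauss_density \<tau> x) = (\<Prod>b\<in>Basis. ennreal (normal_density 0 (sqrt \<tau>) (x \<bullet> b)))"
      by (simp add: prod_ennreal)
  qed
  also have "\<dots> = (\<Prod>b\<in>(Basis :: (real^'d) set). (\<integral>\<^sup>+x. ennreal (normal_density 0 (sqrt \<tau>) x) \<partial>lborel))"
    by (rule nn_integral_lborel_prod) auto
  also have "(\<integral>\<^sup>+x. ennreal (normal_density 0 (sqrt \<tau>) x) \<partial>lborel) = 1"
    using assms integrable_normal_density[of "sqrt \<tau>" 0] integral_normal_density[of "sqrt \<tau>" 0]
    by (subst nn_integral_eq_integral) auto
  finally show "emeasure (gauss \<tau> :: (real^'d) measure) (space (gauss \<tau>)) = 1"
    by simp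
qed

lemma nn_integral_gauss:
  fixes f :: "real^'d \<Rightarrow> ennreal"
  assumes [measurable]: "f \<in> borel_measurable borel"
  shows "(\<integral>\<^sup>+x. f x \<partial>gauss \<tau>) = (\<integral>\<^sup>+x. ennreal (gauss_density \<tau> x) * f x \<partial>lborel)"
  unfolding gauss_def by (rule nn_integral_density) auto

lemma nn_integral_lborel_translation:
  fixes f :: "'a::euclidean_space \<Rightarrow> ennreal"
  assumes [measurable]: "f \<in> borel_measurable borel"
  shows "(\<integral>\<^sup>+x. f (x + c) \<partial>lborel) = (\<integral>\<^sup>+x. f x \<partial>lborel)"
proof -
  have "(\<integral>\<^sup>+x. f x \<partial>lborel) = (\<integral>\<^sup>+x. f x \<partial>distr lborel borel ((+) c))"
    by (simp add: lborel_distr_plus)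
  also have "\<dots> = (\<integral>\<^sup>+x. f (c + x) \<partial>lborel)"
    by (rule nn_integral_distr) auto
  finally show ?thesis by (simp add: add.commute)
qed

lemma nn_integral_lborel_reflection:
  fixes f :: "'a::euclidean_space \<Rightarrow> ennreal"
  assumes [measurable]: "f \<in> borel_measurable borel"
  shows "(\<integral>\<^sup>+x. f (- x) \<partial>lborel) = (\<integral>\<^sup>+x. f x \<partial>lborel)"
proof -
  have "lborel = distr lborel borel (uminus :: 'a \<Rightarrow> 'a)"
    using lborel_affine[of "-1" "0::'a"] by (simp add: density_1)
  then have "(\<integral>\<^sup>+x. f x \<partial>lborel) = (\<integral>\<^sup>+x. f x \<partial>distr lborel borel uminus)"
    by simp
  then show ?thesis by (simp add: nn_integral_distr)
qed

lemma nn_integral_gauss_reflection: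
  fixes f :: "real^'d \<Rightarrow> ennreal"
  assumes [measurable]: "f \<in> borel_measurable borel"
  shows "(\<integral>\<^sup>+x. f (- x) \<partial>gauss \<tau>) = (\<integral>\<^sup>+x. f x \<partial>gauss \<tau>)"
proof -
  have "gauss_density \<tau> (- x) = gauss_density \<tau> x" for x :: "real^'d"
    by (simp add: gauss_density_def)
  then show ?thesis
    using nn_integral_lborel_reflection[of "\<lambda>x. ennreal (gauss_density \<tau> x) * f x"]
    by (simp add: nn_integral_gauss)
qed

text \<open>The finite-dimensional Cameron--Martin formula, by completing the square.\<close>

lemma nn_integral_gauss_shift:
  fixes f :: "real^'d \<Rightarrow> ennreal"
  assumes [measurable]: "f \<in> borel_measurable borel" and "0 < \<tau>"
  shows "(\<integral>\<^sup>+x. ennreal (exp (u \<bullet> x - \<tau> / 2 * (norm u)\<^sup>2)) * f (x - \<tau> *\<^sub>R u) \<partial>gauss \<tau>) = (\<integral>\<^sup>+x. f x \<partial>gauss \<tau>)"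
proof -
  have eq: "gauss_density \<tau> x * exp (u \<bullet> x - \<tau> / 2 * (norm u)\<^sup>2) = gauss_density \<tau> (x - \<tau> *\<^sub>R u)" for x
  proof -
    have "(norm (x - \<tau> *\<^sub>R u))\<^sup>2 = (norm x)\<^sup>2 - 2 * \<tau> * (u \<bullet> x) + \<tau>\<^sup>2 * (norm u)\<^sup>2"
      unfolding power2_norm_eq_inner by (simp add: inner_diff_left inner_diff_right inner_commute power2_eq_square algebra_simps)
    then have "- (norm (x - \<tau> *\<^sub>R u))\<^sup>2 / (2 * \<tau>) = - (norm x)\<^sup>2 / (2 * \<tau>) + (u \<bullet> x - \<tau> / 2 * (norm u)\<^sup>2)"
      using assms(2) by (simp add: field_simps power2_eq_square)
    then show ?thesis
      by (simp add: gauss_density_def exp_add[symmetric])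
  qed
  have "(\<integral>\<^sup>+x. ennreal (exp (u \<bullet> x - \<tau> / 2 * (norm u)\<^sup>2)) * f (x - \<tau> *\<^sub>R u) \<partial>gauss \<tau>) =
      (\<integral>\<^sup>+x. ennreal (gauss_density \<tau> (x + - \<tau> *\<^sub>R u)) * f (x + - \<tau> *\<^sub>R u) \<partial>lborel)"
    using assms(2) by (subst nn_integral_gauss) (auto simp: eq[symmetric] ennreal_mult' mult.assoc[symmetric])
  also have "\<dots> = (\<integral>\<^sup>+x. f x \<partial>gauss \<tau>)"
    by (subst nn_integral_lborel_translation[where f = "\<lambda>x. ennreal (gauss_density \<tau> x) * f x"])
       (auto simp: nn_integral_gauss)
  finally show ?thesis .
qed

text \<open>All moments below come from this: against the density of variance \<open>\<tau>\<close> a weight up to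
  \<open>exp (norm x ^ 2 / (4 * \<tau>))\<close> only turns it into a multiple of the density of variance \<open>2 * \<tau>\<close>.\<close>

lemma gauss_density_double:
  fixes x :: "real^'d"
  assumes "0 < \<tau>"
  shows "gauss_density \<tau> x * exp ((norm x)\<^sup>2 / (4 * \<tau>)) = sqrt 2 ^ CARD('d) * gauss_density (2 * \<tau>) x"
proof -
  have "- (norm x)\<^sup>2 / (2 * \<tau>) + (norm x)\<^sup>2 / (4 * \<tau>) = - (norm x)\<^sup>2 / (2 * (2 * \<tau>))"
    using assms by (simp add: field_simps)
  moreover have "(1 / sqrt (2 * pi * \<tau>)) = sqrt 2 * (1 / sqrt (2 * pi * (2 * \<tau>)))"
    using assms by (simp add: real_sqrt_mult field_simps)
  ultimately show ?thesis
    unfolding gauss_density_def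
    by (metis (no_types, lifting) exp_add mult.assoc power_mult_distrib)
qed

lemma nn_integral_gauss_exp_square_weight:
  assumes "0 < \<tau>" and [measurable]: "f \<in> borel_measurable borel"
    and le: "\<And>x :: real^'d. f x \<le> C * exp ((norm x)\<^sup>2 / (4 * \<tau>))" and "0 \<le> C"
  shows "(\<integral>\<^sup>+x. ennreal (f x) \<partial>gauss \<tau>) \<le> ennreal (C * sqrt 2 ^ CARD('d))"
proof -
  interpret prob_space "gauss (2 * \<tau>) :: (real^'d) measure"
    using assms(1) by (intro prob_space_gauss) auto
  have "(\<integral>\<^sup>+x. ennreal (f x) \<partial>gauss \<tau>) \<le> (\<integral>\<^sup>+x. ennreal (C * exp ((norm (x :: real^'d))\<^sup>2 / (4 * \<tau>))) \<partial>gauss \<tau>)"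
    by (intro nn_integral_mono ennreal_leI le)
  also have "\<dots> = (\<integral>\<^sup>+x. ennreal (C * sqrt 2 ^ CARD('d)) * ennreal (gauss_density (2 * \<tau>) (x :: real^'d)) \<partial>lborel)"
    using assms(1,4)
    by (subst nn_integral_gauss)
       (auto intro!: nn_integral_cong
         simp: ennreal_mult'[symmetric] gauss_density_double[OF assms(1), symmetric] mult.assoc mult.left_commute)
  also have "\<dots> = ennreal (C * sqrt 2 ^ CARD('d)) * emeasure (gauss (2 * \<tau>)) (space (gauss (2 * \<tau>) :: (real^'d) measure))"
    by (subst nn_integral_cmult) (auto simp: gauss_def emeasure_density)
  finally show ?thesis by (simp add: emeasure_space_1 del: space_gauss)
qed

lemma mult_le_square_add_square:
  fixes l y r :: real
  assumes "0 < r"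
  shows "l * y \<le> r * l\<^sup>2 + y\<^sup>2 / (4 * r)"
proof -
  have "0 \<le> (2 * r * l - y)\<^sup>2 / (4 * r)" using assms by simp
  also have "\<dots> = r * l\<^sup>2 + y\<^sup>2 / (4 * r) - l * y"
    using assms by (simp add: field_simps power2_eq_square)
  finally show ?thesis by simp
qed

lemma nn_integral_gauss_exp_norm:
  assumes "0 < \<tau>"
  shows "(\<integral>\<^sup>+x. ennreal (exp (l * norm x)) \<partial>(gauss \<tau> :: (real^'d) measure)) \<le> ennreal (exp (\<tau> * l\<^sup>2) * sqrt 2 ^ CARD('d))"
proof (rule nn_integral_gauss_exp_square_weight[OF assms])
  show "exp (l * norm x) \<le> exp (\<tau> * l\<^sup>2) * exp ((norm x)\<^sup>2 / (4 * \<tau>))" for x :: "real^'d"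
    using mult_le_square_add_square[OF assms, of l "norm x"] by (simp add: exp_add[symmetric])
qed auto

lemma norm_exp_weight:
  fixes x :: "'a::real_normed_vector"
  assumes "0 < \<tau>"
  shows "norm x * exp (l * norm x) \<le> sqrt (8 * \<tau>) * exp (2 * \<tau> * l\<^sup>2) * exp ((norm x)\<^sup>2 / (4 * \<tau>))"
proof -
  define y where "y = norm x / sqrt (8 * \<tau>)"
  have y: "0 \<le> y" "norm x = sqrt (8 * \<tau>) * y" "y\<^sup>2 = (norm x)\<^sup>2 / (8 * \<tau>)"
    using assms by (auto simp: y_def power_divide)
  have "y \<le> 1 + y\<^sup>2"
    using zero_le_power2[of "y - 1 / 2"] by (simp add: power2_eq_square algebra_simps)
  also have "\<dots> \<le> exp (y\<^sup>2)" by (rule exp_ge_add_one_self)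
  finally have "norm x \<le> sqrt (8 * \<tau>) * exp ((norm x)\<^sup>2 / (8 * \<tau>))"
    using assms y by (simp add: mult_left_mono)
  moreover have "exp (l * norm x) \<le> exp (2 * \<tau> * l\<^sup>2 + (norm x)\<^sup>2 / (8 * \<tau>))"
    using mult_le_square_add_square[of "2 * \<tau>" l "norm x"] assms by simp
  ultimately have "norm x * exp (l * norm x) \<le> (sqrt (8 * \<tau>) * exp ((norm x)\<^sup>2 / (8 * \<tau>))) * exp (2 * \<tau> * l\<^sup>2 + (norm x)\<^sup>2 / (8 * \<tau>))"
    by (intro mult_mono) (use assms in auto)
  also have "\<dots> = sqrt (8 * \<tau>) * exp (2 * \<tau> * l\<^sup>2) * exp ((norm x)\<^sup>2 / (8 * \<tau>) + (norm x)\<^sup>2 / (8 * \<tau>))"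
    by (simp only: exp_add mult_ac)
  also have "(norm x)\<^sup>2 / (8 * \<tau>) + (norm x)\<^sup>2 / (8 * \<tau>) = (norm x)\<^sup>2 / (4 * \<tau>)"
    using assms by (simp add: field_simps)
  finally show ?thesis .
qed

lemma nn_integral_gauss_norm_exp_norm:
  assumes "0 < \<tau>"
  shows "(\<integral>\<^sup>+x. ennreal (norm x * exp (l * norm x)) \<partial>(gauss \<tau> :: (real^'d) measure))
    \<le> ennreal (sqrt (8 * \<tau>) * exp (2 * \<tau> * l\<^sup>2) * sqrt 2 ^ CARD('d))"
  by (rule nn_integral_gauss_exp_square_weight[OF assms]) (use norm_exp_weight[OF assms] assms in auto)

lemma nn_integral_gauss_norm_square:
  assumes "0 < \<tau>"
  shows "(\<integral>\<^sup>+x. ennreal ((norm x)\<^sup>2) \<partial>(gauss \<tau> :: (real^'d) measure)) \<le> ennreal (4 * \<tau> * sqrt 2 ^ CARD('d))"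
proof (rule nn_integral_gauss_exp_square_weight[OF assms])
  fix x :: "real^'d"
  have "(norm x)\<^sup>2 / (4 * \<tau>) \<le> exp ((norm x)\<^sup>2 / (4 * \<tau>))"
    using exp_ge_add_one_self[of "(norm x)\<^sup>2 / (4 * \<tau>)"] by linarith
  then show "(norm x)\<^sup>2 \<le> 4 * \<tau> * exp ((norm x)\<^sup>2 / (4 * \<tau>))"
    using assms by (simp add: field_simps)
qed (use assms in auto)

text \<open>The odd part of the square integrates to zero by symmetry; this orthogonality of a centred
  increment to the past is what makes the isometry inequality for the walk below work.\<close>

lemma nn_integral_gauss_affine_square:
  fixes v :: "real^'d"
  assumes "0 < \<tau>"
  shows "(\<integral>\<^sup>+x. ennreal ((a + v \<bullet> x)\<^sup>2) \<partial>gauss \<tau>) \<le> ennreal (a\<^sup>2 + 4 * \<tau> * sqrt 2 ^ CARD('d) * (norm v)\<^sup>2)"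
proof -
  interpret prob_space "gauss \<tau> :: (real^'d) measure"
    using assms(1) by (rule prob_space_gauss)
  have "2 * (\<integral>\<^sup>+x. ennreal ((a + v \<bullet> x)\<^sup>2) \<partial>gauss \<tau>) =
      (\<integral>\<^sup>+x. ennreal ((a + v \<bullet> x)\<^sup>2) \<partial>gauss \<tau>) + (\<integral>\<^sup>+x. ennreal ((a + v \<bullet> (- x))\<^sup>2) \<partial>gauss \<tau>)"
    by (subst nn_integral_gauss_reflection[where f = "\<lambda>x. ennreal ((a + v \<bullet> x)\<^sup>2)"]) (auto simp: mult_2)
  also have "\<dots> = (\<integral>\<^sup>+x. ennreal ((a + v \<bullet> x)\<^sup>2) + ennreal ((a + v \<bullet> (- x))\<^sup>2) \<partial>gauss \<tau>)"
    by (rule nn_integral_add[symmetric]) auto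
  also have "\<dots> \<le> (\<integral>\<^sup>+x. 2 * (ennreal (a\<^sup>2) + ennreal ((norm v)\<^sup>2) * ennreal ((norm (x :: real^'d))\<^sup>2)) \<partial>gauss \<tau>)"
  proof (intro nn_integral_mono)
    fix x :: "real^'d"
    have "(v \<bullet> x)\<^sup>2 \<le> (norm v)\<^sup>2 * (norm x)\<^sup>2"
      using Cauchy_Schwarz_ineq[of v x] by (simp add: power2_norm_eq_inner)
    then have "(a + v \<bullet> x)\<^sup>2 + (a + v \<bullet> (- x))\<^sup>2 \<le> 2 * (a\<^sup>2 + (norm v)\<^sup>2 * (norm x)\<^sup>2)"
      by (simp add: power2_eq_square algebra_simps)
    then have "ennreal ((a + v \<bullet> x)\<^sup>2 + (a + v \<bullet> (- x))\<^sup>2) \<le> ennreal (2 * (a\<^sup>2 + (norm v)\<^sup>2 * (norm x)\<^sup>2))"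
      by (rule ennreal_leI)
    then show "ennreal ((a + v \<bullet> x)\<^sup>2) + ennreal ((a + v \<bullet> (- x))\<^sup>2)
        \<le> 2 * (ennreal (a\<^sup>2) + ennreal ((norm v)\<^sup>2) * ennreal ((norm x)\<^sup>2))"
      by (simp add: ennreal_plus ennreal_mult)
  qed
  also have "\<dots> = 2 * (ennreal (a\<^sup>2) + ennreal ((norm v)\<^sup>2) * (\<integral>\<^sup>+x. ennreal ((norm x)\<^sup>2) \<partial>(gauss \<tau> :: (real^'d) measure)))"
    using emeasure_space_1 by (simp add: nn_integral_cmult nn_integral_add)
  also have "\<dots> \<le> 2 * (ennreal (a\<^sup>2) + ennreal ((norm v)\<^sup>2) * ennreal (4 * \<tau> * sqrt 2 ^ CARD('d)))"
    by (intro mult_left_mono add_left_mono nn_integral_gauss_norm_square assms) auto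
  also have "\<dots> = 2 * ennreal (a\<^sup>2 + 4 * \<tau> * sqrt 2 ^ CARD('d) * (norm v)\<^sup>2)"
    using assms by (simp add: ennreal_plus ennreal_mult algebra_simps)
  finally show ?thesis
    by (subst (asm) ennreal_mult_le_mult_iff) auto
qed

text \<open>As in the proof that a Haar measure is unique, Tonelli's theorem and translation invariance exchange the two measures.\<close>

lemma nn_integral_lborel_linear:
  fixes A B :: "'a::euclidean_space \<Rightarrow> 'a"
  assumes "linear A" "linear B" and AB: "\<And>x. A (B x) = x" and BA: "\<And>x. B (A x) = x"
  shows "\<exists>c\<ge>0. \<forall>f \<in> borel_measurable borel. (\<integral>\<^sup>+x. f (A x) \<partial>lborel) = ennreal c * (\<integral>\<^sup>+x. f x \<partial>lborel)"
proof -
  have [measurable]: "A \<in> borel_measurable borel" "B \<in> borel_measurable borel"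
    using assms by (auto intro!: borel_measurable_continuous_onI linear_continuous_on linear_linear[THEN iffD2] simp: linear_conv_bounded_linear)
  let ?b = "ball (0::'a) 1"
  have [simp, measurable]: "(indicator ?b :: 'a \<Rightarrow> ennreal) \<in> borel_measurable borel"
    by (intro borel_measurable_indicator) auto
  have b: "emeasure lborel ?b \<noteq> 0" "emeasure lborel ?b \<noteq> \<infinity>"
    using emeasure_lborel_ball_finite[of "0::'a" 1] content_ball_pos[of 1 "0::'a"]
    by (auto simp: measure_def)
  define mB where "mB = (\<integral>\<^sup>+y. indicator ?b (- A y) \<partial>lborel)"
  have mB: "mB \<noteq> \<infinity>"
  proof -
    have "mB \<le> (\<integral>\<^sup>+y. indicator (cball 0 (onorm B)) (y :: 'a) \<partial>lborel)"
      unfolding mB_def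
    proof (intro nn_integral_mono)
      fix y
      have "norm y \<le> onorm B" if "norm (A y) < 1"
        using onorm[of B "A y"] assms(2) that onorm_pos_le[of B]
        by (simp add: BA linear_conv_bounded_linear) (meson less_imp_le mult_left_le order_trans)
      then show "indicator ?b (- A y) \<le> (indicator (cball 0 (onorm B)) y :: ennreal)"
        by (auto simp: indicator_def)
    qed
    also have "\<dots> < \<infinity>" using emeasure_bounded_finite[OF bounded_cball, of "0::'a" "onorm B"] by (simp add: less_top)
    finally show ?thesis by simp
  qed
  define c where "c = enn2real (mB / emeasure lborel ?b)"
  have c: "ennreal c = mB / emeasure lborel ?b"
    using mB b by (simp add: c_def ennreal_enn2real_if ennreal_divide_eq_top_iff less_top[symmetric])
  have "(\<integral>\<^sup>+x. f (A x) \<partial>lborel) = ennreal c * (\<integral>\<^sup>+x. f x \<partial>lborel)" if [measurable]: "f \<in> borel_measurable borel" for f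
  proof -
    have "emeasure lborel ?b * (\<integral>\<^sup>+y. f (A y) \<partial>lborel) = (\<integral>\<^sup>+x. (\<integral>\<^sup>+y. indicator ?b x * f (A y) \<partial>lborel) \<partial>lborel)"
      using nn_integral_multc[of "indicator ?b" lborel "\<integral>\<^sup>+y. f (A y) \<partial>lborel"]
      by (simp add: nn_integral_cmult)
    also have "\<dots> = (\<integral>\<^sup>+x. (\<integral>\<^sup>+y. indicator ?b x * f (A (y + B x)) \<partial>lborel) \<partial>lborel)"
    proof (rule nn_integral_cong)
      show "(\<integral>\<^sup>+y. indicator ?b x * f (A y) \<partial>lborel) = (\<integral>\<^sup>+y. indicator ?b x * f (A (y + B x)) \<partial>lborel)" for x
        by (rule nn_integral_lborel_translation[symmetric]) measurable
    qed
    also have "\<dots> = (\<integral>\<^sup>+x. (\<integral>\<^sup>+y. indicator ?b x * f (A y + x) \<partial>lborel) \<partial>lborel)"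
      using assms(1) by (simp add: linear_add AB)
    also have "\<dots> = (\<integral>\<^sup>+y. (\<integral>\<^sup>+x. indicator ?b x * f (A y + x) \<partial>lborel) \<partial>lborel)"
      by (rule lborel_pair.Fubini') measurable
    also have "\<dots> = (\<integral>\<^sup>+y. (\<integral>\<^sup>+x. indicator ?b (x - A y) * f x \<partial>lborel) \<partial>lborel)"
    proof (rule nn_integral_cong)
      show "(\<integral>\<^sup>+x. indicator ?b x * f (A y + x) \<partial>lborel) = (\<integral>\<^sup>+x. indicator ?b (x - A y) * f x \<partial>lborel)" for y
        using nn_integral_lborel_translation[of "\<lambda>x. indicator ?b (x - A y) * f x" "A y"] by (simp add: add.commute)
    qed
    also have "\<dots> = (\<integral>\<^sup>+x. (\<integral>\<^sup>+y. indicator ?b (x - A y) * f x \<partial>lborel) \<partial>lborel)"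
      by (rule lborel_pair.Fubini') measurable
    also have "\<dots> = (\<integral>\<^sup>+x. mB * f x \<partial>lborel)"
    proof (rule nn_integral_cong)
      fix x
      have "(\<integral>\<^sup>+y. indicator ?b (x - A y) * f x \<partial>lborel) = (\<integral>\<^sup>+y. indicator ?b (x - A (y + B x)) \<partial>lborel) * f x"
        by (subst nn_integral_lborel_translation[where f = "\<lambda>y. indicator ?b (x - A y)"]) (auto simp: nn_integral_multc)
      then show "(\<integral>\<^sup>+y. indicator ?b (x - A y) * f x \<partial>lborel) = mB * f x"
        using assms(1) by (simp add: linear_add AB mB_def)
    qed
    finally have "emeasure lborel ?b * (\<integral>\<^sup>+y. f (A y) \<partial>lborel) = mB * (\<integral>\<^sup>+x. f x \<partial>lborel)"
      by (simp add: nn_integral_cmult)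
    then have "((\<integral>\<^sup>+y. f (A y) \<partial>lborel) * emeasure lborel ?b) / emeasure lborel ?b = ennreal c * (\<integral>\<^sup>+x. f x \<partial>lborel)"
      by (simp add: c ennreal_times_divide mult.commute)
    then show ?thesis
      using b by (simp add: mult_divide_eq_ennreal)
  qed
  then show ?thesis by (intro exI[of _ c]) (simp add: c_def)
qed

section \<open>Elementary inequalities for integrals\<close>

lemma nn_integral_Cauchy_Schwarz_real:
  fixes f g :: "'a \<Rightarrow> real"
  assumes [measurable]: "f \<in> borel_measurable M" "g \<in> borel_measurable M"
    and nonneg: "\<And>x. 0 \<le> f x" "\<And>x. 0 \<le> g x"
    and f: "(\<integral>\<^sup>+x. ennreal ((f x)\<^sup>2) \<partial>M) \<le> ennreal a" and g: "(\<integral>\<^sup>+x. ennreal ((g x)\<^sup>2) \<partial>M) \<le> ennreal b"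
    and "0 \<le> a" "0 \<le> b"
  shows "(\<integral>\<^sup>+x. ennreal (f x * g x) \<partial>M) \<le> ennreal (sqrt a * sqrt b)"
proof -
  have "(\<integral>\<^sup>+x. ennreal (f x * g x) \<partial>M)\<^sup>2 = (\<integral>\<^sup>+x. ennreal (f x) * ennreal (g x) \<partial>M)\<^sup>2"
    by (simp add: ennreal_mult nonneg)
  also have "\<dots> \<le> (\<integral>\<^sup>+x. ennreal (f x) ^ 2 \<partial>M) * (\<integral>\<^sup>+x. ennreal (g x) ^ 2 \<partial>M)"
    by (rule Cauchy_Schwarz_nn_integral) auto
  also have "\<dots> = (\<integral>\<^sup>+x. ennreal ((f x)\<^sup>2) \<partial>M) * (\<integral>\<^sup>+x. ennreal ((g x)\<^sup>2) \<partial>M)"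
    by (simp add: ennreal_power nonneg)
  also have "\<dots> \<le> ennreal a * ennreal b"
    by (rule mult_mono) (auto intro: f g)
  also have "\<dots> = ennreal ((sqrt a * sqrt b)\<^sup>2)"
    using \<open>0 \<le> a\<close> \<open>0 \<le> b\<close> by (simp add: power_mult_distrib ennreal_mult)
  finally have *: "(\<integral>\<^sup>+x. ennreal (f x * g x) \<partial>M)\<^sup>2 \<le> ennreal ((sqrt a * sqrt b)\<^sup>2)" .
  have c: "0 \<le> sqrt a * sqrt b" using \<open>0 \<le> a\<close> \<open>0 \<le> b\<close> by simp
  show ?thesis
  proof (cases "\<integral>\<^sup>+x. ennreal (f x * g x) \<partial>M")
    case (real r)
    then have "ennreal (r\<^sup>2) \<le> ennreal ((sqrt a * sqrt b)\<^sup>2)"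
      using * by (simp add: ennreal_power)
    then have "r\<^sup>2 \<le> (sqrt a * sqrt b)\<^sup>2"
      by (subst (asm) ennreal_le_iff) auto
    then have "r \<le> sqrt a * sqrt b"
      by (rule power2_le_imp_le) (rule c)
    then show ?thesis unfolding real(2) by (rule ennreal_leI)
  next
    case top
    then show ?thesis using * by (simp add: power2_eq_square top_unique)
  qed
qed

lemma exp_diff_le: "\<bar>exp a - exp b\<bar> \<le> \<bar>a - b\<bar> * (exp a + exp (b::real))"
proof -
  have *: "exp y - exp x \<le> (y - x) * exp y" for x y :: real
  proof -
    have "1 + (x - y) \<le> exp (x - y)" by (rule exp_ge_add_one_self)
    then have "(1 + (x - y)) * exp y \<le> exp (x - y) * exp y" by (rule mult_right_mono) simp
    then show ?thesis by (simp add: exp_diff algebra_simps)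
  qed
  show ?thesis
  proof (cases "a \<le> b")
    case True
    then have "\<bar>exp a - exp b\<bar> = exp b - exp a" by simp
    also have "\<dots> \<le> (b - a) * exp b" by (rule *)
    also have "\<dots> \<le> \<bar>a - b\<bar> * (exp a + exp b)" using True by (intro mult_mono) auto
    finally show ?thesis .
  next
    case False
    then have "\<bar>exp a - exp b\<bar> = exp a - exp b" by simp
    also have "\<dots> \<le> (a - b) * exp a" by (rule *)
    also have "\<dots> \<le> \<bar>a - b\<bar> * (exp a + exp b)" using False by (intro mult_mono) auto
    finally show ?thesis .
  qed
qed

lemma square_add_le: "(a + b)\<^sup>2 \<le> 2 * (a::real)\<^sup>2 + 2 * b\<^sup>2"
  using zero_le_power2[of "a - b"] by (simp add: power2_eq_square algebra_simps)

lemma power4_add_le: "(a + b) ^ 4 \<le> 8 * (a::real) ^ 4 + 8 * b ^ 4"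
proof -
  have "(a + b) ^ 4 = ((a + b)\<^sup>2)\<^sup>2" by simp
  also have "\<dots> \<le> (2 * a\<^sup>2 + 2 * b\<^sup>2)\<^sup>2" by (intro power_mono square_add_le) auto
  also have "\<dots> \<le> 2 * (2 * a\<^sup>2)\<^sup>2 + 2 * (2 * b\<^sup>2)\<^sup>2" by (rule square_add_le)
  finally show ?thesis by (simp add: power_mult_distrib)
qed

lemma sum_inverse_sqrt_le: "(\<Sum>j<Suc n. if j = 0 then 0 else 1 / sqrt (real j)) \<le> 2 * sqrt (real n)"
proof (induction n)
  case (Suc n)
  define x y where "x = sqrt (real (Suc n))" and "y = sqrt (real n)"
  have x: "0 < x" "x\<^sup>2 = y\<^sup>2 + 1" by (simp_all add: x_def y_def)
  have "2 * x * y \<le> x\<^sup>2 + y\<^sup>2"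
    using zero_le_power2[of "x - y"] by (simp add: power2_eq_square algebra_simps)
  then have "2 * y * x + 1 \<le> 2 * x * x"
    using x(2) by (simp add: power2_eq_square algebra_simps)
  then have "2 * y + 1 / x \<le> 2 * x"
    using x(1) by (simp add: field_simps)
  then show ?case
    using Suc.IH by (simp add: x_def y_def)
qed simp

lemma sum_sqrt_le:
  fixes a :: "nat \<Rightarrow> real"
  assumes "0 \<le> d" "\<And>k. 0 \<le> a k"
  shows "(\<Sum>k<N. d * sqrt (a k)) \<le> sqrt (d * real N) * sqrt (d * (\<Sum>k<N. a k))"
proof -
  have "(\<Sum>k<N. d * sqrt (a k))\<^sup>2 \<le> (\<Sum>k<N. (d * sqrt (a k))\<^sup>2) * real (card {..<N})"
    by (rule sum_squared_le_sum_of_squares)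
  also have "(\<Sum>k<N. (d * sqrt (a k))\<^sup>2) = (\<Sum>k<N. d\<^sup>2 * a k)"
    using assms(2) by (intro sum.cong refl) (simp add: power_mult_distrib)
  also have "\<dots> * real (card {..<N}) = (d * real N) * (d * (\<Sum>k<N. a k))"
    unfolding sum_distrib_left[symmetric] by (simp add: power2_eq_square)
  finally have "(\<Sum>k<N. d * sqrt (a k)) \<le> sqrt ((d * real N) * (d * (\<Sum>k<N. a k)))"
    by (rule real_le_rsqrt)
  then show ?thesis by (simp add: real_sqrt_mult)
qed

lemma exp_bounded_square:
  assumes "\<bar>y\<bar> \<le> K * exp (K * r)"
  shows "(y::real)\<^sup>2 \<le> K\<^sup>2 * exp (2 * K * r)"
proof -
  have "\<bar>y\<bar>\<^sup>2 \<le> (K * exp (K * r))\<^sup>2" by (rule power_mono[OF assms]) simp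
  also have "\<dots> = K\<^sup>2 * exp (2 * K * r)"
    by (simp add: power_mult_distrib exp_double[symmetric] mult.assoc)
  finally show ?thesis by simp
qed

lemma nn_integral_sqrt_le:
  assumes "prob_space M" and [measurable]: "f \<in> borel_measurable M" and "\<And>x. 0 \<le> f x"
    and "(\<integral>\<^sup>+x. ennreal ((f x)\<^sup>2) \<partial>M) \<le> ennreal a" "0 \<le> a"
  shows "(\<integral>\<^sup>+x. ennreal (f x) \<partial>M) \<le> ennreal (sqrt a)"
proof -
  interpret prob_space M by fact
  have one: "(\<integral>\<^sup>+\<omega>. ennreal (1\<^sup>2) \<partial>M) \<le> ennreal 1"
    using emeasure_space_1 by simp
  have "(\<integral>\<^sup>+x. ennreal (f x * 1) \<partial>M) \<le> ennreal (sqrt a * sqrt 1)"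
    using assms by (intro nn_integral_Cauchy_Schwarz_real one) auto
  then show ?thesis by simp
qed

lemma nn_integral_scaled_sum:
  assumes [measurable]: "\<And>k. k < N \<Longrightarrow> h k \<in> borel_measurable P"
  shows "c * (\<Sum>k<N. \<integral>\<^sup>+\<omega>. h k \<omega> \<partial>P) = (\<integral>\<^sup>+\<omega>. (\<Sum>k<(N::nat). c * h k \<omega>) \<partial>P)"
proof -
  have "(\<integral>\<^sup>+\<omega>. (\<Sum>k<N. c * h k \<omega>) \<partial>P) = (\<Sum>k<N. \<integral>\<^sup>+\<omega>. c * h k \<omega> \<partial>P)"
    by (rule nn_integral_sum) simp
  also have "\<dots> = (\<Sum>k<N. c * (\<integral>\<^sup>+\<omega>. h k \<omega> \<partial>P))"
    by (intro sum.cong refl nn_integral_cmult) simp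
  finally show ?thesis by (simp only: sum_distrib_left)
qed

section \<open>Gaussian random walks and the discrete Girsanov theorem\<close>

text \<open>Independence of the past and normality of the increments are used only through the following
  consequence: in an expectation the past may be frozen while the next increment is integrated out
  against its Gaussian law. This form survives a change of measure without any conditioning.\<close>

locale gaussian_walk = prob_space P for P :: "'w measure" +
  fixes G :: "nat \<Rightarrow> 'w measure" and \<xi> :: "nat \<Rightarrow> 'w \<Rightarrow> real^'d" and \<delta> :: real and N :: nat
  assumes step_pos: "0 < \<delta>"
    and subalgebra_past: "\<And>k. k \<le> N \<Longrightarrow> subalgebra P (G k)"
    and past_mono_Suc: "\<And>k. k < N \<Longrightarrow> sets (G k) \<subseteq> sets (G (Suc k))"
    and increment_measurable: "\<And>k. k < N \<Longrightarrow> \<xi> k \<in> borel_measurable (G (Suc k))"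
    and freezing: "\<And>k H. k < N \<Longrightarrow> H \<in> borel_measurable (G k \<Otimes>\<^sub>M borel) \<Longrightarrow>
      (\<integral>\<^sup>+\<omega>. H (\<omega>, \<xi> k \<omega>) \<partial>P) = (\<integral>\<^sup>+\<omega>. (\<integral>\<^sup>+x. H (\<omega>, x) \<partial>gauss \<delta>) \<partial>P)"

text \<open>The discrete stochastic exponential of the drift \<open>u\<close> against increments of variance \<open>\<delta>\<close>.\<close>

definition girsanov_density ::
    "real \<Rightarrow> (nat \<Rightarrow> 'w \<Rightarrow> real^'d) \<Rightarrow> (nat \<Rightarrow> 'w \<Rightarrow> real^'d) \<Rightarrow> nat \<Rightarrow> 'w \<Rightarrow> real" where
  "girsanov_density \<delta> u \<xi> k \<omega> = exp (\<Sum>j<k. u j \<omega> \<bullet> \<xi> j \<omega> - \<delta> / 2 * (norm (u j \<omega>))\<^sup>2)"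

lemma girsanov_density_pos [simp]: "0 < girsanov_density \<delta> u \<xi> k \<omega>"
  by (simp add: girsanov_density_def)

lemma girsanov_density_nonneg [simp]: "0 \<le> girsanov_density \<delta> u \<xi> k \<omega>"
  by (simp add: girsanov_density_def)

lemma girsanov_density_Suc:
  "girsanov_density \<delta> u \<xi> (Suc k) \<omega> =
    girsanov_density \<delta> u \<xi> k \<omega> * exp (u k \<omega> \<bullet> \<xi> k \<omega> - \<delta> / 2 * (norm (u k \<omega>))\<^sup>2)"
  by (simp add: girsanov_density_def exp_add)

text \<open>Changing the drift by \<open>-u\<close> and then back by \<open>u\<close> has no effect on the measure.\<close>

lemma girsanov_density_inverse:
  "girsanov_density \<delta> (\<lambda>k \<omega>. - u k \<omega>) \<xi> k \<omega> * girsanov_density \<delta> u (\<lambda>k \<omega>. \<xi> k \<omega> + \<delta> *\<^sub>R u k \<omega>) k \<omega> = 1"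
  unfolding girsanov_density_def exp_add[symmetric] sum.distrib[symmetric]
  by (simp add: inner_add_right power2_norm_eq_inner)

context gaussian_walk
begin

lemma subalgebra_past_le: "j \<le> k \<Longrightarrow> k \<le> N \<Longrightarrow> subalgebra (G k) (G j)"
proof (induction k)
  case (Suc k)
  show ?case
  proof (cases "j = Suc k")
    case False
    then have "subalgebra (G k) (G j)" using Suc by auto
    with Suc.prems past_mono_Suc[of k] subalgebra_past[of k] subalgebra_past[of "Suc k"] show ?thesis
      by (auto simp: subalgebra_def)
  qed (simp add: subalgebra_def)
qed (simp add: subalgebra_def)

lemma past_measurable: "f \<in> measurable (G j) R \<Longrightarrow> j \<le> k \<Longrightarrow> k \<le> N \<Longrightarrow> f \<in> measurable (G k) R"
  by (rule measurable_from_subalg[OF subalgebra_past_le])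

lemma past_measurable_P: "f \<in> measurable (G j) R \<Longrightarrow> j \<le> N \<Longrightarrow> f \<in> measurable P R"
  by (rule measurable_from_subalg[OF subalgebra_past])

lemma increment_measurable_past: "j < k \<Longrightarrow> k \<le> N \<Longrightarrow> \<xi> j \<in> borel_measurable (G k)"
  by (rule past_measurable[OF increment_measurable]) auto

lemma increment_measurable_P: "j < N \<Longrightarrow> \<xi> j \<in> borel_measurable P"
  by (rule past_measurable_P[OF increment_measurable]) auto

lemma girsanov_density_measurable:
  assumes u: "\<And>j. j < N \<Longrightarrow> u j \<in> borel_measurable (G j)" and "k \<le> N"
  shows "girsanov_density \<delta> u \<xi> k \<in> borel_measurable (G k)"
proof -
  have [measurable]: "u j \<in> borel_measurable (G k)" "\<xi> j \<in> borel_measurable (G k)" if "j \<in> {..<k}" for j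
    using past_measurable[OF u] increment_measurable_past that assms(2) by auto
  show ?thesis unfolding girsanov_density_def by measurable
qed

text \<open>With the past frozen, one step of the change of measure is the shift formula for a single
  Gaussian variable, in which the past only plays the part of a parameter.\<close>

lemma girsanov_step:
  assumes k: "k < N" and [measurable]: "u \<in> borel_measurable (G k)" "Y \<in> borel_measurable (G k)"
    "H \<in> borel_measurable (G k \<Otimes>\<^sub>M borel)"
  shows "(\<integral>\<^sup>+\<omega>. Y \<omega> * ennreal (exp (u \<omega> \<bullet> \<xi> k \<omega> - \<delta> / 2 * (norm (u \<omega>))\<^sup>2)) * H (\<omega>, \<xi> k \<omega> - \<delta> *\<^sub>R u \<omega>) \<partial>P)
    = (\<integral>\<^sup>+\<omega>. Y \<omega> * (\<integral>\<^sup>+x. H (\<omega>, x) \<partial>gauss \<delta>) \<partial>P)"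
proof -
  have space: "space (G k) = space P"
    using subalgebra_past[of k] k by (simp add: subalgebra_def)
  let ?H = "\<lambda>(\<omega>, x). Y \<omega> * (ennreal (exp (u \<omega> \<bullet> x - \<delta> / 2 * (norm (u \<omega>))\<^sup>2)) * H (\<omega>, x - \<delta> *\<^sub>R u \<omega>))"
  have "?H \<in> borel_measurable (G k \<Otimes>\<^sub>M borel)" by measurable
  from freezing[OF k this] have "(\<integral>\<^sup>+\<omega>. Y \<omega> * ennreal (exp (u \<omega> \<bullet> \<xi> k \<omega> - \<delta> / 2 * (norm (u \<omega>))\<^sup>2)) * H (\<omega>, \<xi> k \<omega> - \<delta> *\<^sub>R u \<omega>) \<partial>P)
      = (\<integral>\<^sup>+\<omega>. (\<integral>\<^sup>+x. ?H (\<omega>, x) \<partial>gauss \<delta>) \<partial>P)"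
    by (simp add: mult.assoc)
  also have "\<dots> = (\<integral>\<^sup>+\<omega>. Y \<omega> * (\<integral>\<^sup>+x. H (\<omega>, x) \<partial>gauss \<delta>) \<partial>P)"
  proof (rule nn_integral_cong)
    fix \<omega> assume "\<omega> \<in> space P"
    then have [measurable]: "(\<lambda>x. H (\<omega>, x)) \<in> borel_measurable borel"
      using space by (intro measurable_compose[OF measurable_Pair1' assms(4)]) auto
    have "(\<integral>\<^sup>+x. ?H (\<omega>, x) \<partial>gauss \<delta>) = Y \<omega> * (\<integral>\<^sup>+x. ennreal (exp (u \<omega> \<bullet> x - \<delta> / 2 * (norm (u \<omega>))\<^sup>2)) * H (\<omega>, x - \<delta> *\<^sub>R u \<omega>) \<partial>gauss \<delta>)"
      by (simp add: nn_integral_cmult)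
    also have "\<dots> = Y \<omega> * (\<integral>\<^sup>+x. H (\<omega>, x) \<partial>gauss \<delta>)"
      by (subst nn_integral_gauss_shift[where f = "\<lambda>x. H (\<omega>, x)"]) (auto simp: step_pos)
    finally show "(\<integral>\<^sup>+x. ?H (\<omega>, x) \<partial>gauss \<delta>) = Y \<omega> * (\<integral>\<^sup>+x. H (\<omega>, x) \<partial>gauss \<delta>)" .
  qed
  finally show ?thesis .
qed

text \<open>The exponential is a martingale, so an integrand known at time \<open>k\<close> only sees its value then.\<close>

lemma girsanov_density_martingale:
  assumes u: "\<And>j. j < N \<Longrightarrow> u j \<in> borel_measurable (G j)"
    and Y: "Y \<in> borel_measurable (G k)" and "k \<le> l" "l \<le> N"
  shows "(\<integral>\<^sup>+\<omega>. ennreal (girsanov_density \<delta> u \<xi> l \<omega>) * Y \<omega> \<partial>P) = (\<integral>\<^sup>+\<omega>. ennreal (girsanov_density \<delta> u \<xi> k \<omega>) * Y \<omega> \<partial>P)"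
  using assms(3,4)
proof (induction l)
  case (Suc l)
  show ?case
  proof (cases "k = Suc l")
    case False
    with Suc.prems have l: "k \<le> l" "l < N" by auto
    interpret gs: prob_space "gauss \<delta> :: (real^'d) measure" by (rule prob_space_gauss[OF step_pos])
    have [measurable]: "u l \<in> borel_measurable (G l)" "Y \<in> borel_measurable (G l)"
      "girsanov_density \<delta> u \<xi> l \<in> borel_measurable (G l)"
      using u l past_measurable[OF Y] girsanov_density_measurable[OF u, of l] by auto
    have "(\<integral>\<^sup>+\<omega>. ennreal (girsanov_density \<delta> u \<xi> (Suc l) \<omega>) * Y \<omega> \<partial>P) =
      (\<integral>\<^sup>+\<omega>. (ennreal (girsanov_density \<delta> u \<xi> l \<omega>) * Y \<omega>) * ennreal (exp (u l \<omega> \<bullet> \<xi> l \<omega> - \<delta> / 2 * (norm (u l \<omega>))\<^sup>2)) * (\<lambda>_. 1) (\<omega>, \<xi> l \<omega> - \<delta> *\<^sub>R u l \<omega>) \<partial>P)"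
      by (simp add: girsanov_density_Suc ennreal_mult' mult_ac)
    also have "\<dots> = (\<integral>\<^sup>+\<omega>. (ennreal (girsanov_density \<delta> u \<xi> l \<omega>) * Y \<omega>) * (\<integral>\<^sup>+x. 1 \<partial>(gauss \<delta> :: (real^'d) measure)) \<partial>P)"
      by (rule girsanov_step) (use l in auto)
    also have "\<dots> = (\<integral>\<^sup>+\<omega>. ennreal (girsanov_density \<delta> u \<xi> l \<omega>) * Y \<omega> \<partial>P)"
      using gs.emeasure_space_1 by simp
    finally show ?thesis using Suc.IH l by simp
  qed simp
qed simp

lemma nn_integral_girsanov_density:
  assumes u: "\<And>j. j < N \<Longrightarrow> u j \<in> borel_measurable (G j)"
  shows "(\<integral>\<^sup>+\<omega>. ennreal (girsanov_density \<delta> u \<xi> N \<omega>) \<partial>P) = 1"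
  using girsanov_density_martingale[OF u, of "\<lambda>_. 1" 0 N] emeasure_space_1 by (simp add: girsanov_density_def)

text \<open>Factors of the density beyond step \<open>k\<close> average out by the martingale property, and those before it
  belong to the past; only one factor interacts with the increment, and it performs the shift.\<close>

theorem girsanov:
  assumes u: "\<And>j. j < N \<Longrightarrow> u j \<in> borel_measurable (G j)"
  shows "gaussian_walk (density P (\<lambda>\<omega>. ennreal (girsanov_density \<delta> u \<xi> N \<omega>))) G (\<lambda>k \<omega>. \<xi> k \<omega> - \<delta> *\<^sub>R u k \<omega>) \<delta> N"
proof -
  have [measurable]: "girsanov_density \<delta> u \<xi> N \<in> borel_measurable P"
    by (rule past_measurable_P[OF girsanov_density_measurable[OF u]]) auto
  let ?D = "\<lambda>k \<omega>. ennreal (girsanov_density \<delta> u \<xi> k \<omega>)"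
  show ?thesis
  proof (intro gaussian_walk.intro prob_spaceI gaussian_walk_axioms.intro)
    show "emeasure (density P (?D N)) (space (density P (?D N))) = 1"
    proof -
      have "emeasure (density P (?D N)) (space (density P (?D N))) = (\<integral>\<^sup>+\<omega>. 1 \<partial>density P (?D N))"
        by simp
      also have "\<dots> = (\<integral>\<^sup>+\<omega>. ?D N \<omega> * 1 \<partial>P)"
        by (rule nn_integral_density) auto
      finally show ?thesis using nn_integral_girsanov_density[OF u] by simp
    qed
    show "0 < \<delta>" by (rule step_pos)
    show "subalgebra (density P (?D N)) (G k)" if "k \<le> N" for k
      using subalgebra_past[OF that] by (simp add: subalgebra_def)
    show "sets (G k) \<subseteq> sets (G (Suc k))" if "k < N" for k
      by (rule past_mono_Suc[OF that])
    show "(\<lambda>\<omega>. \<xi> k \<omega> - \<delta> *\<^sub>R u k \<omega>) \<in> borel_measurable (G (Suc k))" if "k < N" for k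
    proof -
      have [measurable]: "u k \<in> borel_measurable (G (Suc k))" "\<xi> k \<in> borel_measurable (G (Suc k))"
        using past_measurable[OF u] increment_measurable that by auto
      show ?thesis by measurable
    qed
    fix k and H :: "'w \<times> (real^'d) \<Rightarrow> ennreal"
    assume k: "k < N" and H[measurable]: "H \<in> borel_measurable (G k \<Otimes>\<^sub>M borel)"
    interpret gs: prob_space "gauss \<delta> :: (real^'d) measure" by (rule prob_space_gauss[OF step_pos])
    have [measurable]: "u k \<in> borel_measurable (G (Suc k))" "\<xi> k \<in> borel_measurable (G (Suc k))"
      using past_measurable[OF u] increment_measurable k by auto
    have id: "(\<lambda>\<omega>. \<omega>) \<in> measurable (G (Suc k)) (G k)"
      using k by (auto intro: past_measurable[OF measurable_ident_sets[OF refl], of k])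
    have H1: "(\<lambda>\<omega>. H (\<omega>, \<xi> k \<omega> - \<delta> *\<^sub>R u k \<omega>)) \<in> borel_measurable (G (Suc k))"
      by (rule measurable_compose[OF measurable_Pair[OF id] H]) measurable
    have [measurable]: "(\<lambda>\<omega>. H (\<omega>, \<xi> k \<omega> - \<delta> *\<^sub>R u k \<omega>)) \<in> borel_measurable P"
      using k by (intro past_measurable_P[OF H1]) auto
    have sets_gs: "sets (G k \<Otimes>\<^sub>M gauss \<delta>) = sets (G k \<Otimes>\<^sub>M borel)"
      by (rule sets_pair_measure_cong) auto
    have H2: "(\<lambda>\<omega>. \<integral>\<^sup>+x. H (\<omega>, x) \<partial>gauss \<delta>) \<in> borel_measurable (G k)"
      by (rule gs.borel_measurable_nn_integral) (simp add: measurable_cong_sets[OF sets_gs refl])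
    have [measurable]: "(\<lambda>\<omega>. \<integral>\<^sup>+x. H (\<omega>, x) \<partial>gauss \<delta>) \<in> borel_measurable P"
      using k by (intro past_measurable_P[OF H2]) auto
    have "(\<integral>\<^sup>+\<omega>. H (\<omega>, \<xi> k \<omega> - \<delta> *\<^sub>R u k \<omega>) \<partial>density P (?D N)) = (\<integral>\<^sup>+\<omega>. ?D N \<omega> * H (\<omega>, \<xi> k \<omega> - \<delta> *\<^sub>R u k \<omega>) \<partial>P)"
      by (rule nn_integral_density) auto
    also have "\<dots> = (\<integral>\<^sup>+\<omega>. ?D (Suc k) \<omega> * H (\<omega>, \<xi> k \<omega> - \<delta> *\<^sub>R u k \<omega>) \<partial>P)"
      using k by (intro girsanov_density_martingale[OF u] H1) auto
    also have "\<dots> = (\<integral>\<^sup>+\<omega>. ?D k \<omega> * ennreal (exp (u k \<omega> \<bullet> \<xi> k \<omega> - \<delta> / 2 * (norm (u k \<omega>))\<^sup>2)) * H (\<omega>, \<xi> k \<omega> - \<delta> *\<^sub>R u k \<omega>) \<partial>P)"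
      by (simp add: girsanov_density_Suc ennreal_mult')
    also have "\<dots> = (\<integral>\<^sup>+\<omega>. ?D k \<omega> * (\<integral>\<^sup>+x. H (\<omega>, x) \<partial>gauss \<delta>) \<partial>P)"
      using girsanov_density_measurable[OF u, of k] k u by (intro girsanov_step) auto
    also have "\<dots> = (\<integral>\<^sup>+\<omega>. ?D N \<omega> * (\<integral>\<^sup>+x. H (\<omega>, x) \<partial>gauss \<delta>) \<partial>P)"
      using k by (intro girsanov_density_martingale[OF u, symmetric] H2) auto
    also have "\<dots> = (\<integral>\<^sup>+\<omega>. (\<integral>\<^sup>+x. H (\<omega>, x) \<partial>gauss \<delta>) \<partial>density P (?D N))"
      by (rule nn_integral_density[symmetric]) auto
    finally show "(\<integral>\<^sup>+\<omega>. H (\<omega>, \<xi> k \<omega> - \<delta> *\<^sub>R u k \<omega>) \<partial>density P (?D N)) = (\<integral>\<^sup>+\<omega>. (\<integral>\<^sup>+x. H (\<omega>, x) \<partial>gauss \<delta>) \<partial>density P (?D N))" .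
  qed
qed

text \<open>The law of the increments does not depend on the walk, so expectations can be moved between
  the different measures under which different processes are Gaussian walks.\<close>

lemma increments_law:
  assumes "\<Theta> \<in> borel_measurable (\<Pi>\<^sub>M i\<in>{..<k}. borel)" and "k \<le> N"
  shows "(\<integral>\<^sup>+\<omega>. \<Theta> (\<lambda>i\<in>{..<k}. \<xi> i \<omega>) \<partial>P) = (\<integral>\<^sup>+x. \<Theta> x \<partial>(\<Pi>\<^sub>M i\<in>{..<k}. gauss \<delta>))"
  using assms
proof (induction k arbitrary: \<Theta>)
  case 0
  then show ?case
    using emeasure_space_1 by (simp add: PiM_empty nn_integral_count_space_finite restrict_def cong: if_cong)
next
  case (Suc k)
  interpret gs: prob_space "gauss \<delta> :: (real^'d) measure" by (rule prob_space_gauss[OF step_pos])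
  interpret product_sigma_finite "\<lambda>_::nat. gauss \<delta> :: (real^'d) measure" by standard
  have insert: "{..<Suc k} = insert k {..<k}" by auto
  have sets_eq: "sets (\<Pi>\<^sub>M i\<in>I. (gauss \<delta> :: (real^'d) measure)) = sets (\<Pi>\<^sub>M i\<in>I. borel)" for I :: "nat set"
    by (rule sets_PiM_cong) auto
  have \<Theta>[measurable]: "\<Theta> \<in> borel_measurable (\<Pi>\<^sub>M i\<in>insert k {..<k}. borel)"
    using Suc.prems(1) by (simp add: insert)
  have \<xi>[measurable]: "\<xi> i \<in> borel_measurable (G k)" if "i \<in> {..<k}" for i
    using that Suc.prems by (intro increment_measurable_past) auto
  have m1: "(\<lambda>(x, y). \<Theta> (x(k := y))) \<in> borel_measurable ((\<Pi>\<^sub>M i\<in>{..<k}. borel) \<Otimes>\<^sub>M borel)"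
    by (rule measurable_compose[OF _ \<Theta>, THEN measurable_cong[THEN iffD1, rotated]])
       (auto intro!: measurable_add_dim simp: split_beta')
  have m2: "(\<lambda>(\<omega>, y). \<Theta> ((\<lambda>i\<in>{..<k}. \<xi> i \<omega>)(k := y))) \<in> borel_measurable (G k \<Otimes>\<^sub>M borel)"
  proof -
    have "(\<lambda>(\<omega>, y). (\<lambda>i\<in>{..<k}. \<xi> i \<omega>, y)) \<in> G k \<Otimes>\<^sub>M borel \<rightarrow>\<^sub>M (\<Pi>\<^sub>M i\<in>{..<k}. borel) \<Otimes>\<^sub>M borel"
      by measurable
    from measurable_compose[OF this m1] show ?thesis by (simp add: split_beta')
  qed
  have m3: "(\<lambda>x. \<integral>\<^sup>+y. \<Theta> (x(k := y)) \<partial>gauss \<delta>) \<in> borel_measurable (\<Pi>\<^sub>M i\<in>{..<k}. borel)"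
    using m1 by (intro gs.borel_measurable_nn_integral)
      (simp add: split_beta' measurable_cong_sets[OF sets_pair_measure_cong[OF refl sets_gauss] refl])
  have "(\<integral>\<^sup>+\<omega>. \<Theta> (\<lambda>i\<in>{..<Suc k}. \<xi> i \<omega>) \<partial>P) = (\<integral>\<^sup>+\<omega>. \<Theta> ((\<lambda>i\<in>{..<k}. \<xi> i \<omega>)(k := \<xi> k \<omega>)) \<partial>P)"
    by (intro nn_integral_cong arg_cong[of _ _ \<Theta>]) (auto simp: fun_eq_iff)
  also have "\<dots> = (\<integral>\<^sup>+\<omega>. (\<integral>\<^sup>+y. \<Theta> ((\<lambda>i\<in>{..<k}. \<xi> i \<omega>)(k := y)) \<partial>gauss \<delta>) \<partial>P)"
    using freezing[OF _ m2] Suc.prems(2) by (simp only: split_conv Suc_le_eq)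
  also have "\<dots> = (\<integral>\<^sup>+x. (\<integral>\<^sup>+y. \<Theta> (x(k := y)) \<partial>gauss \<delta>) \<partial>(\<Pi>\<^sub>M i\<in>{..<k}. gauss \<delta>))"
    by (rule Suc.IH[OF m3 Suc_leD[OF Suc.prems(2)]])
  also have "\<dots> = (\<integral>\<^sup>+x. \<Theta> x \<partial>(\<Pi>\<^sub>M i\<in>insert k {..<k}. gauss \<delta>))"
    using \<Theta> by (intro product_nn_integral_insert[symmetric]) (auto simp: measurable_cong_sets[OF sets_eq refl])
  finally show ?case unfolding insert .
qed

text \<open>A new increment is centred given the past, so the mixed terms vanish. Only an inequality is claimed
  because the second moment of a Gaussian vector enters through a crude bound.\<close>

lemma walk_isometry:
  assumes v: "\<And>j. j < N \<Longrightarrow> v j \<in> borel_measurable (G j)" and "k \<le> N"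
  shows "(\<integral>\<^sup>+\<omega>. ennreal ((\<Sum>j<k. v j \<omega> \<bullet> \<xi> j \<omega>)\<^sup>2) \<partial>P)
    \<le> ennreal (4 * \<delta> * sqrt 2 ^ CARD('d)) * (\<Sum>j<k. \<integral>\<^sup>+\<omega>. ennreal ((norm (v j \<omega>))\<^sup>2) \<partial>P)"
  using assms(2)
proof (induction k)
  case (Suc k)
  let ?c = "ennreal (4 * \<delta> * sqrt 2 ^ CARD('d))"
  have vk[measurable]: "v k \<in> borel_measurable (G k)" using v Suc by auto
  have [measurable]: "v j \<in> borel_measurable (G k)" "\<xi> j \<in> borel_measurable (G k)" if "j \<in> {..<k}" for j
    using past_measurable[OF v] increment_measurable_past that Suc.prems by auto
  define S where "S = (\<lambda>\<omega>. \<Sum>j<k. v j \<omega> \<bullet> \<xi> j \<omega>)"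
  have S[measurable]: "S \<in> borel_measurable (G k)" unfolding S_def by measurable
  have [measurable]: "S \<in> borel_measurable P" "v k \<in> borel_measurable P"
    using past_measurable_P[OF S] past_measurable_P[OF vk] Suc.prems by auto
  have "(\<integral>\<^sup>+\<omega>. ennreal ((\<Sum>j<Suc k. v j \<omega> \<bullet> \<xi> j \<omega>)\<^sup>2) \<partial>P) = (\<integral>\<^sup>+\<omega>. (\<lambda>(\<omega>, x). ennreal ((S \<omega> + v k \<omega> \<bullet> x)\<^sup>2)) (\<omega>, \<xi> k \<omega>) \<partial>P)"
    by (simp add: S_def)
  also have "\<dots> = (\<integral>\<^sup>+\<omega>. (\<integral>\<^sup>+x. (\<lambda>(\<omega>, x). ennreal ((S \<omega> + v k \<omega> \<bullet> x)\<^sup>2)) (\<omega>, x) \<partial>gauss \<delta>) \<partial>P)"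
    using Suc.prems by (intro freezing) auto
  also have "\<dots> \<le> (\<integral>\<^sup>+\<omega>. ennreal ((S \<omega>)\<^sup>2) + ?c * ennreal ((norm (v k \<omega>))\<^sup>2) \<partial>P)"
    using nn_integral_gauss_affine_square[OF step_pos] step_pos
    by (intro nn_integral_mono) (simp add: ennreal_plus[symmetric] ennreal_mult[symmetric] del: ennreal_plus)
  also have "\<dots> = (\<integral>\<^sup>+\<omega>. ennreal ((S \<omega>)\<^sup>2) \<partial>P) + ?c * (\<integral>\<^sup>+\<omega>. ennreal ((norm (v k \<omega>))\<^sup>2) \<partial>P)"
    by (simp add: nn_integral_add nn_integral_cmult)
  also have "\<dots> \<le> ?c * (\<Sum>j<k. \<integral>\<^sup>+\<omega>. ennreal ((norm (v j \<omega>))\<^sup>2) \<partial>P) + ?c * (\<integral>\<^sup>+\<omega>. ennreal ((norm (v k \<omega>))\<^sup>2) \<partial>P)"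
    using Suc by (intro add_right_mono) (auto simp: S_def)
  finally show ?case by (simp add: distrib_left)
qed simp

text \<open>The \<open>p\<close>-th power of the density with drift \<open>u\<close> is, up to a bounded factor, the density with
  drift \<open>p * u\<close>, whose expectation is 1.\<close>

lemma girsanov_density_moment:
  assumes u: "\<And>j. j < N \<Longrightarrow> u j \<in> borel_measurable (G j)"
    and c: "\<And>j \<omega>. j < N \<Longrightarrow> norm (u j \<omega>) \<le> c" and "1 \<le> p"
  shows "(\<integral>\<^sup>+\<omega>. ennreal (girsanov_density \<delta> u \<xi> N \<omega> ^ p) \<partial>P) \<le> ennreal (exp ((real p ^ 2 - real p) / 2 * (\<delta> * real N) * c\<^sup>2))"
proof -
  let ?pu = "\<lambda>j \<omega>. real p *\<^sub>R u j \<omega>"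
  let ?K = "exp ((real p ^ 2 - real p) / 2 * (\<delta> * real N) * c\<^sup>2)"
  have pu: "?pu j \<in> borel_measurable (G j)" if "j < N" for j
    using u[OF that] by measurable
  have [measurable]: "girsanov_density \<delta> ?pu \<xi> N \<in> borel_measurable P"
    by (rule past_measurable_P[OF girsanov_density_measurable[OF pu]]) auto
  have "girsanov_density \<delta> u \<xi> N \<omega> ^ p \<le> ?K * girsanov_density \<delta> ?pu \<xi> N \<omega>" for \<omega>
  proof -
    have "real p \<le> real p ^ 2" using assms(3) by (simp add: power2_eq_square)
    have "real p * (\<Sum>j<N. u j \<omega> \<bullet> \<xi> j \<omega> - \<delta> / 2 * (norm (u j \<omega>))\<^sup>2)
        = (\<Sum>j<N. (?pu j \<omega> \<bullet> \<xi> j \<omega> - \<delta> / 2 * (norm (?pu j \<omega>))\<^sup>2) + (real p ^ 2 - real p) / 2 * \<delta> * (norm (u j \<omega>))\<^sup>2)"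
      unfolding sum_distrib_left by (rule sum.cong[OF refl]) (simp add: power_mult_distrib field_simps)
    also have "\<dots> \<le> (\<Sum>j<N. (?pu j \<omega> \<bullet> \<xi> j \<omega> - \<delta> / 2 * (norm (?pu j \<omega>))\<^sup>2) + (real p ^ 2 - real p) / 2 * \<delta> * c\<^sup>2)"
      using c step_pos \<open>real p \<le> real p ^ 2\<close> by (intro sum_mono add_left_mono mult_left_mono power_mono) auto
    also have "\<dots> = (\<Sum>j<N. ?pu j \<omega> \<bullet> \<xi> j \<omega> - \<delta> / 2 * (norm (?pu j \<omega>))\<^sup>2) + (real p ^ 2 - real p) / 2 * (\<delta> * real N) * c\<^sup>2"
      by (subst sum.distrib) (simp add: mult_ac)
    finally show ?thesis
      unfolding girsanov_density_def exp_of_nat_mult[symmetric] exp_add[symmetric] by (subst exp_le_cancel_iff) linarith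
  qed
  then have "(\<integral>\<^sup>+\<omega>. ennreal (girsanov_density \<delta> u \<xi> N \<omega> ^ p) \<partial>P) \<le> (\<integral>\<^sup>+\<omega>. ennreal ?K * ennreal (girsanov_density \<delta> ?pu \<xi> N \<omega>) \<partial>P)"
    by (intro nn_integral_mono) (simp add: ennreal_mult'[symmetric] ennreal_leI)
  also have "\<dots> = ennreal ?K"
    using nn_integral_girsanov_density[OF pu] by (simp add: nn_integral_cmult)
  finally show ?thesis .
qed

text \<open>The difference of the logarithms of the two densities is a martingale part, bounded by the isometry, and a part bounded pointwise;
  the exponentials themselves are absorbed by their fourth moments.\<close>

lemma girsanov_density_stability:
  assumes u: "\<And>j. j < N \<Longrightarrow> u j \<in> borel_measurable (G j)" and v: "\<And>j. j < N \<Longrightarrow> v j \<in> borel_measurable (G j)"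
    and uc: "\<And>j \<omega>. j < N \<Longrightarrow> norm (u j \<omega>) \<le> c" and vc: "\<And>j \<omega>. j < N \<Longrightarrow> norm (v j \<omega>) \<le> c"
    and "0 \<le> c" and [measurable]: "\<Psi> \<in> borel_measurable P" and \<Psi>: "\<And>\<omega>. 0 \<le> \<Psi> \<omega>"
    and A: "(\<integral>\<^sup>+\<omega>. ennreal (\<Psi> \<omega> ^ 4) \<partial>P) \<le> ennreal A" "0 \<le> A"
    and E: "ennreal \<delta> * (\<Sum>j<N. \<integral>\<^sup>+\<omega>. ennreal ((norm (u j \<omega> - v j \<omega>))\<^sup>2) \<partial>P) \<le> ennreal E" "0 \<le> E"
  shows "(\<integral>\<^sup>+\<omega>. ennreal (\<Psi> \<omega> * \<bar>girsanov_density \<delta> u \<xi> N \<omega> - girsanov_density \<delta> v \<xi> N \<omega>\<bar>) \<partial>P)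
    \<le> ennreal (sqrt (8 * sqrt 2 ^ CARD('d) + 2 * c\<^sup>2 * (\<delta> * real N)) * sqrt E
        * sqrt (sqrt A * sqrt (16 * exp (6 * (\<delta> * real N) * c\<^sup>2))))"
proof -
  let ?C = "8 * sqrt 2 ^ CARD('d) + 2 * c\<^sup>2 * (\<delta> * real N)"
  let ?Du = "girsanov_density \<delta> u \<xi> N" and ?Dv = "girsanov_density \<delta> v \<xi> N"
  let ?a = "\<lambda>u \<omega>. \<Sum>j<N. u j \<omega> \<bullet> \<xi> j \<omega> - \<delta> / 2 * (norm (u j \<omega>))\<^sup>2"
  have d0: "0 \<le> \<delta>" using step_pos by simp
  have [measurable]: "?Du \<in> borel_measurable P" "?Dv \<in> borel_measurable P"
    using past_measurable_P[OF girsanov_density_measurable[OF u]] past_measurable_P[OF girsanov_density_measurable[OF v]] by auto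
  have [measurable]: "u j \<in> borel_measurable P" "v j \<in> borel_measurable P" "\<xi> j \<in> borel_measurable P" if "j \<in> {..<N}" for j
    using that past_measurable_P[OF u] past_measurable_P[OF v] increment_measurable_P by auto
  define L where "L = (\<lambda>\<omega>. \<bar>?a u \<omega> - ?a v \<omega>\<bar>)"
  define I where "I = (\<lambda>\<omega>. \<Sum>j<N. (u j \<omega> - v j \<omega>) \<bullet> \<xi> j \<omega>)"
  have [measurable]: "L \<in> borel_measurable P" "I \<in> borel_measurable P"
    unfolding L_def I_def by measurable
  have L_le: "(L \<omega>)\<^sup>2 \<le> 2 * (I \<omega>)\<^sup>2 + 2 * (c\<^sup>2 * (\<delta> * real N)) * (\<delta> * (\<Sum>j<N. (norm (u j \<omega> - v j \<omega>))\<^sup>2))" for \<omega>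
  proof -
    define J where "J = (\<Sum>j<N. \<delta> / 2 * ((norm (v j \<omega>))\<^sup>2 - (norm (u j \<omega>))\<^sup>2))"
    have "\<bar>J\<bar> \<le> (\<Sum>j<N. \<delta> * c * norm (u j \<omega> - v j \<omega>))"
      unfolding J_def
    proof (rule sum_abs[THEN order_trans], rule sum_mono)
      fix j assume "j \<in> {..<N}"
      have "\<bar>(norm (v j \<omega>))\<^sup>2 - (norm (u j \<omega>))\<^sup>2\<bar> = (norm (v j \<omega>) + norm (u j \<omega>)) * \<bar>norm (v j \<omega>) - norm (u j \<omega>)\<bar>"
        by (simp add: power2_eq_square square_diff_square_factored abs_mult)
      also have "\<dots> \<le> (2 * c) * norm (u j \<omega> - v j \<omega>)"
        using uc[of j \<omega>] vc[of j \<omega>] \<open>j \<in> {..<N}\<close> norm_triangle_ineq3[of "v j \<omega>" "u j \<omega>"] \<open>0 \<le> c\<close>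
        by (intro mult_mono) (auto simp: norm_minus_commute)
      finally have "\<delta> / 2 * \<bar>(norm (v j \<omega>))\<^sup>2 - (norm (u j \<omega>))\<^sup>2\<bar> \<le> \<delta> / 2 * ((2 * c) * norm (u j \<omega> - v j \<omega>))"
        using d0 by (intro mult_left_mono) auto
      then show "\<bar>\<delta> / 2 * ((norm (v j \<omega>))\<^sup>2 - (norm (u j \<omega>))\<^sup>2)\<bar> \<le> \<delta> * c * norm (u j \<omega> - v j \<omega>)"
        using d0 by (simp add: abs_mult)
    qed
    then have "\<bar>J\<bar>\<^sup>2 \<le> (\<Sum>j<N. \<delta> * c * norm (u j \<omega> - v j \<omega>))\<^sup>2"
      by (rule power_mono) simp
    also have "\<dots> = (\<delta> * c)\<^sup>2 * (\<Sum>j<N. norm (u j \<omega> - v j \<omega>))\<^sup>2"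
      by (simp add: sum_distrib_left[symmetric] power_mult_distrib)
    also have "\<dots> \<le> (\<delta> * c)\<^sup>2 * ((\<Sum>j<N. (norm (u j \<omega> - v j \<omega>))\<^sup>2) * real (card {..<N}))"
      by (intro mult_left_mono sum_squared_le_sum_of_squares) auto
    finally have J: "J\<^sup>2 \<le> c\<^sup>2 * (\<delta> * real N) * (\<delta> * (\<Sum>j<N. (norm (u j \<omega> - v j \<omega>))\<^sup>2))"
      by (simp add: power2_eq_square mult_ac)
    have "?a u \<omega> - ?a v \<omega> = I \<omega> + J"
      by (simp add: I_def J_def sum_subtractf[symmetric] sum.distrib[symmetric] inner_diff_left algebra_simps)
    then have "(L \<omega>)\<^sup>2 \<le> 2 * (I \<omega>)\<^sup>2 + 2 * J\<^sup>2"
      unfolding L_def by (simp add: square_add_le)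
    with J show ?thesis by linarith
  qed
  have "(\<integral>\<^sup>+\<omega>. ennreal ((L \<omega>)\<^sup>2) \<partial>P) \<le> (\<integral>\<^sup>+\<omega>. 2 * ennreal ((I \<omega>)\<^sup>2)
      + ennreal (2 * (c\<^sup>2 * (\<delta> * real N))) * (ennreal \<delta> * (\<Sum>j<N. ennreal ((norm (u j \<omega> - v j \<omega>))\<^sup>2))) \<partial>P)"
  proof (intro nn_integral_mono)
    fix \<omega>
    have "ennreal ((L \<omega>)\<^sup>2) \<le> ennreal (2 * (I \<omega>)\<^sup>2 + 2 * (c\<^sup>2 * (\<delta> * real N)) * (\<delta> * (\<Sum>j<N. (norm (u j \<omega> - v j \<omega>))\<^sup>2)))"
      by (rule ennreal_leI[OF L_le])
    also have "\<dots> = 2 * ennreal ((I \<omega>)\<^sup>2)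
      + ennreal (2 * (c\<^sup>2 * (\<delta> * real N))) * (ennreal \<delta> * (\<Sum>j<N. ennreal ((norm (u j \<omega> - v j \<omega>))\<^sup>2)))"
      using d0 by (simp add: ennreal_plus ennreal_mult sum_nonneg)
    finally show "ennreal ((L \<omega>)\<^sup>2) \<le> 2 * ennreal ((I \<omega>)\<^sup>2)
      + ennreal (2 * (c\<^sup>2 * (\<delta> * real N))) * (ennreal \<delta> * (\<Sum>j<N. ennreal ((norm (u j \<omega> - v j \<omega>))\<^sup>2)))" .
  qed
  also have "\<dots> = 2 * (\<integral>\<^sup>+\<omega>. ennreal ((I \<omega>)\<^sup>2) \<partial>P)
      + ennreal (2 * (c\<^sup>2 * (\<delta> * real N))) * (ennreal \<delta> * (\<Sum>j<N. \<integral>\<^sup>+\<omega>. ennreal ((norm (u j \<omega> - v j \<omega>))\<^sup>2) \<partial>P))"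
    by (simp add: nn_integral_add nn_integral_cmult nn_integral_sum del: sum_ennreal)
  also have "\<dots> \<le> 2 * (ennreal (4 * sqrt 2 ^ CARD('d)) * ennreal E) + ennreal (2 * (c\<^sup>2 * (\<delta> * real N))) * ennreal E"
  proof (intro add_mono mult_left_mono E(1))
    have "(\<integral>\<^sup>+\<omega>. ennreal ((I \<omega>)\<^sup>2) \<partial>P) \<le> ennreal (4 * \<delta> * sqrt 2 ^ CARD('d)) * (\<Sum>j<N. \<integral>\<^sup>+\<omega>. ennreal ((norm (u j \<omega> - v j \<omega>))\<^sup>2) \<partial>P)"
      unfolding I_def by (rule walk_isometry) (use u v in auto)
    also have "\<dots> = ennreal (4 * sqrt 2 ^ CARD('d)) * (ennreal \<delta> * (\<Sum>j<N. \<integral>\<^sup>+\<omega>. ennreal ((norm (u j \<omega> - v j \<omega>))\<^sup>2) \<partial>P))"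
    proof -
      have "4 * \<delta> * sqrt 2 ^ CARD('d) = (4 * sqrt 2 ^ CARD('d)) * \<delta>" by simp
      then show ?thesis
        using d0 by (simp only: ennreal_mult mult.assoc[symmetric]) (simp add: ennreal_mult mult_ac)
    qed
    also have "\<dots> \<le> ennreal (4 * sqrt 2 ^ CARD('d)) * ennreal E"
      by (intro mult_left_mono E(1)) auto
    finally show "(\<integral>\<^sup>+\<omega>. ennreal ((I \<omega>)\<^sup>2) \<partial>P) \<le> ennreal (4 * sqrt 2 ^ CARD('d)) * ennreal E" .
  qed auto
  also have "\<dots> = ennreal (2 * (4 * sqrt 2 ^ CARD('d) * E) + 2 * (c\<^sup>2 * (\<delta> * real N)) * E)"
    using d0 E(2)
    by (simp add: ennreal_plus[symmetric] ennreal_mult[symmetric] ennreal_numeral[symmetric]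
        del: ennreal_plus ennreal_numeral)
  also have "2 * (4 * sqrt 2 ^ CARD('d) * E) + 2 * (c\<^sup>2 * (\<delta> * real N)) * E = ?C * E"
    by (simp add: algebra_simps)
  finally have L2: "(\<integral>\<^sup>+\<omega>. ennreal ((L \<omega>)\<^sup>2) \<partial>P) \<le> ennreal (?C * E)" .
  let ?M = "exp (6 * (\<delta> * real N) * c\<^sup>2)"
  have "(\<integral>\<^sup>+\<omega>. ennreal (((?Du \<omega> + ?Dv \<omega>)\<^sup>2)\<^sup>2) \<partial>P) \<le> (\<integral>\<^sup>+\<omega>. 8 * ennreal (?Du \<omega> ^ 4) + 8 * ennreal (?Dv \<omega> ^ 4) \<partial>P)"
  proof (intro nn_integral_mono)
    fix \<omega>
    have "ennreal (((?Du \<omega> + ?Dv \<omega>)\<^sup>2)\<^sup>2) \<le> ennreal (8 * ?Du \<omega> ^ 4 + 8 * ?Dv \<omega> ^ 4)"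
      using power4_add_le[of "?Du \<omega>" "?Dv \<omega>"] by (intro ennreal_leI) simp
    also have "\<dots> = 8 * ennreal (?Du \<omega> ^ 4) + 8 * ennreal (?Dv \<omega> ^ 4)"
      by (simp add: ennreal_plus ennreal_mult)
    finally show "ennreal (((?Du \<omega> + ?Dv \<omega>)\<^sup>2)\<^sup>2) \<le> 8 * ennreal (?Du \<omega> ^ 4) + 8 * ennreal (?Dv \<omega> ^ 4)" .
  qed
  also have "\<dots> = 8 * (\<integral>\<^sup>+\<omega>. ennreal (?Du \<omega> ^ 4) \<partial>P) + 8 * (\<integral>\<^sup>+\<omega>. ennreal (?Dv \<omega> ^ 4) \<partial>P)"
    by (simp add: nn_integral_add nn_integral_cmult)
  also have "\<dots> \<le> 8 * ennreal ?M + 8 * ennreal ?M"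
    using girsanov_density_moment[OF u uc, of 4] girsanov_density_moment[OF v vc, of 4]
    by (intro add_mono mult_left_mono) auto
  also have "\<dots> = ennreal (8 * ?M + 8 * ?M)"
    by (simp add: ennreal_plus[symmetric] ennreal_mult[symmetric] ennreal_numeral[symmetric]
        del: ennreal_plus ennreal_numeral)
  finally have D4: "(\<integral>\<^sup>+\<omega>. ennreal (((?Du \<omega> + ?Dv \<omega>)\<^sup>2)\<^sup>2) \<partial>P) \<le> ennreal (16 * ?M)" by simp
  have "(\<integral>\<^sup>+\<omega>. ennreal ((\<Psi> \<omega>)\<^sup>2 * (?Du \<omega> + ?Dv \<omega>)\<^sup>2) \<partial>P) \<le> ennreal (sqrt A * sqrt (16 * ?M))"
    using A by (intro nn_integral_Cauchy_Schwarz_real D4) auto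
  then have \<Psi>D: "(\<integral>\<^sup>+\<omega>. ennreal ((\<Psi> \<omega> * (?Du \<omega> + ?Dv \<omega>))\<^sup>2) \<partial>P) \<le> ennreal (sqrt A * sqrt (16 * ?M))"
    by (simp add: power_mult_distrib)
  have "(\<integral>\<^sup>+\<omega>. ennreal (\<Psi> \<omega> * \<bar>?Du \<omega> - ?Dv \<omega>\<bar>) \<partial>P) \<le> (\<integral>\<^sup>+\<omega>. ennreal (L \<omega> * (\<Psi> \<omega> * (?Du \<omega> + ?Dv \<omega>))) \<partial>P)"
  proof (intro nn_integral_mono ennreal_leI)
    fix \<omega>
    have "\<bar>?Du \<omega> - ?Dv \<omega>\<bar> \<le> L \<omega> * (?Du \<omega> + ?Dv \<omega>)"
      unfolding girsanov_density_def L_def by (rule exp_diff_le)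
    then have "\<Psi> \<omega> * \<bar>?Du \<omega> - ?Dv \<omega>\<bar> \<le> \<Psi> \<omega> * (L \<omega> * (?Du \<omega> + ?Dv \<omega>))"
      by (rule mult_left_mono) (rule \<Psi>)
    then show "\<Psi> \<omega> * \<bar>?Du \<omega> - ?Dv \<omega>\<bar> \<le> L \<omega> * (\<Psi> \<omega> * (?Du \<omega> + ?Dv \<omega>))"
      by (simp add: mult_ac)
  qed
  also have "\<dots> \<le> ennreal (sqrt (?C * E) * sqrt (sqrt A * sqrt (16 * ?M)))"
    using E(2) A(2) \<Psi> d0 by (intro nn_integral_Cauchy_Schwarz_real L2 \<Psi>D) (auto simp: L_def intro!: mult_nonneg_nonneg add_nonneg_nonneg)
  finally show ?thesis
    by (simp add: real_sqrt_mult)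
qed

end

section \<open>Regularity of the function classes along Brownian motion\<close>

lemma uniformly_elliptic_imp_invertible:
  fixes \<sigma> :: "real^'d^'d"
  assumes "uniformly_elliptic \<sigma>"
  obtains \<sigma>' where "\<sigma> ** \<sigma>' = mat 1" "\<sigma>' ** \<sigma> = mat 1"
proof -
  from assms obtain al where al: "0 < al" "\<And>\<xi>. al * (norm \<xi>)\<^sup>2 \<le> ((\<sigma> ** transpose \<sigma>) *v \<xi>) \<bullet> \<xi>"
    unfolding uniformly_elliptic_def Let_def by blast
  have "\<xi> = 0" if "transpose \<sigma> *v \<xi> = 0" for \<xi>
  proof -
    have "(\<sigma> ** transpose \<sigma>) *v \<xi> = 0"
      using that by (simp add: matrix_vector_mul_assoc[symmetric])
    with al(2)[of \<xi>] have "al * (norm \<xi>)\<^sup>2 \<le> 0" by simp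
    with al(1) show ?thesis by (simp add: mult_le_0_iff)
  qed
  then obtain B where "B ** transpose \<sigma> = mat 1"
    using matrix_left_invertible_ker[of "transpose \<sigma>"] by blast
  then have "transpose (B ** transpose \<sigma>) = mat 1" by simp
  then have "\<sigma> ** transpose B = mat 1"
    by (simp add: matrix_transpose_mul)
  moreover from this have "transpose B ** \<sigma> = mat 1"
    by (simp add: matrix_left_right_inverse)
  ultimately show ?thesis by (rule that)
qed

text \<open>What is used of the diffusion matrix when integrating against Gaussian measures: \<open>c\<close> bounds it
  from above and \<open>J\<close> compares the image of Lebesgue measure with Lebesgue measure.\<close>

locale nondegenerate_matrix =
  fixes \<sigma> :: "real^'d^'d" and c J :: real
  assumes c_pos: "0 < c" and norm_mult_le: "\<And>w. norm (\<sigma> *v w) \<le> c * norm w"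
    and J_nonneg: "0 \<le> J"
    and image_lborel: "\<And>f. f \<in> borel_measurable borel \<Longrightarrow>
      (\<integral>\<^sup>+w. f (\<sigma> *v w) \<partial>lborel) = ennreal J * (\<integral>\<^sup>+x. f x \<partial>lborel)"

lemma nondegenerate_matrix_exists:
  fixes \<sigma> :: "real^'d^'d"
  assumes "\<sigma> ** \<sigma>' = mat 1" "\<sigma>' ** \<sigma> = mat 1"
  shows "\<exists>c J. nondegenerate_matrix \<sigma> c J"
proof -
  obtain c where c: "0 < c" "\<And>w. norm (\<sigma> *v w) \<le> norm w * c"
    using bounded_linear.pos_bounded[OF matrix_vector_mul_bounded_linear[of \<sigma>]] by blast
  then have "norm (\<sigma> *v w) \<le> c * norm w" for w
    by (simp add: mult.commute)
  moreover obtain J where "0 \<le> J" "\<And>f. f \<in> borel_measurable borel \<Longrightarrow>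
      (\<integral>\<^sup>+w. f (\<sigma> *v w) \<partial>lborel) = ennreal J * (\<integral>\<^sup>+x. f x \<partial>lborel)"
    using nn_integral_lborel_linear[of "(*v) \<sigma>" "(*v) \<sigma>'"] assms
    by (auto simp: matrix_vector_mul_assoc)
  ultimately have "nondegenerate_matrix \<sigma> c J"
    using c(1) by unfold_locales
  then show ?thesis by blast
qed

lemma matrix_vector_mult_borel_measurable [measurable]:
  fixes \<sigma> :: "real^'d^'d"
  assumes "f \<in> borel_measurable M"
  shows "(\<lambda>x. \<sigma> *v f x) \<in> borel_measurable M"
  by (rule measurable_compose[OF assms borel_measurable_continuous_onI])
     (rule linear_continuous_on[OF matrix_vector_mul_bounded_linear])

lemma gradient_increment:
  fixes \<zeta> :: "real^'d \<Rightarrow> real"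
  assumes G: "\<And>x. GDERIV \<zeta> x :> G x" and cont: "continuous_on UNIV G"
  shows "ennreal \<bar>\<zeta> (x + y) - \<zeta> x\<bar> \<le> (\<integral>\<^sup>+\<theta>. indicator {0..1} \<theta> * ennreal (norm y * norm (G (x + \<theta> *\<^sub>R y))) \<partial>lborel)"
proof -
  let ?f = "\<lambda>\<theta>. y \<bullet> G (x + \<theta> *\<^sub>R y)" and ?F = "\<lambda>\<theta>. \<zeta> (x + \<theta> *\<^sub>R y)"
  have cf: "continuous_on {0..1} ?f"
    by (intro continuous_intros continuous_on_compose2[OF cont]) auto
  have "(?F has_vector_derivative ?f \<theta>) (at \<theta> within {0..1})" for \<theta>
  proof -
    have "((\<lambda>\<theta>. x + \<theta> *\<^sub>R y) has_derivative (\<lambda>h. h *\<^sub>R y)) (at \<theta> within {0..1})"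
      by (auto intro!: derivative_eq_intros)
    moreover have "(\<zeta> has_derivative (\<lambda>h. h \<bullet> G (x + \<theta> *\<^sub>R y))) (at (x + \<theta> *\<^sub>R y))"
      using G unfolding gderiv_def .
    ultimately have "(?F has_derivative (\<lambda>h. (h *\<^sub>R y) \<bullet> G (x + \<theta> *\<^sub>R y))) (at \<theta> within {0..1})"
      by (rule has_derivative_compose)
    then show ?thesis unfolding has_vector_derivative_def by simp
  qed
  then have "(\<integral>\<theta>. indicator {0..1} \<theta> *\<^sub>R ?f \<theta> \<partial>lborel) = ?F 1 - ?F 0"
    by (intro integral_FTC_Icc cf) auto
  moreover have "integrable lborel (\<lambda>\<theta>. indicator {0..1} \<theta> *\<^sub>R ?f \<theta>)"
    using borel_integrable_atLeastAtMost'[OF cf] unfolding set_integrable_def .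
  ultimately have "ennreal (norm (\<zeta> (x + y) - \<zeta> x)) \<le> (\<integral>\<^sup>+\<theta>. ennreal (norm (indicator {0..1} \<theta> *\<^sub>R ?f \<theta>)) \<partial>lborel)"
    using integral_norm_bound_ennreal[of lborel "\<lambda>\<theta>. indicator {0..1} \<theta> *\<^sub>R ?f \<theta>"] by simp
  also have "\<dots> \<le> (\<integral>\<^sup>+\<theta>. indicator {0..1} \<theta> * ennreal (norm y * norm (G (x + \<theta> *\<^sub>R y))) \<partial>lborel)"
    using Cauchy_Schwarz_ineq2[of y] by (intro nn_integral_mono) (auto simp: indicator_def intro!: ennreal_leI)
  finally show ?thesis by simp
qed

lemma gauss_density_le:
  fixes w :: "real^'d"
  shows "0 < s \<Longrightarrow> gauss_density s w \<le> (1 / sqrt (2 * pi * s)) ^ CARD('d)"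
  unfolding gauss_density_def by (rule mult_left_le) simp_all

context nondegenerate_matrix
begin

text \<open>Half of the Gaussian exponent absorbs the exponential weight; the other half is a kernel
  of variance proportional to \<open>s\<close>, whose normalisation exceeds the one in the definition of the
  class by the factor \<open>s powr (-1/2)\<close>.\<close>

lemma gradient_gauss_bound:
  fixes G :: "real^'d \<Rightarrow> real^'d"
  assumes [measurable]: "G \<in> borel_measurable borel" and K: "0 < K" and T: "0 < T"
    and bound: "\<And>u a. 0 < u \<Longrightarrow> ennreal (exp (- K * norm a - K * u)) *
            (\<integral>\<^sup>+ x. ennreal (norm (G (x + a)) *
                 (exp (- (norm x)\<^sup>2 / u) / u powr ((real CARD('d) - 1) / 2))) \<partial>lborel) \<le> ennreal K"
    and s: "0 < s" "s \<le> T"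
  shows "(\<integral>\<^sup>+w. ennreal (exp (K * norm (\<sigma> *v w)) * norm (G (\<sigma> *v w + a))) \<partial>gauss s)
    \<le> ennreal (J * exp (K\<^sup>2 * c\<^sup>2 * T) * (2 * pi) powr (- real CARD('d) / 2) * (4 * c\<^sup>2) powr ((real CARD('d) - 1) / 2)
        * K * exp (4 * K * c\<^sup>2 * T) * exp (K * norm a) * s powr (- 1 / 2))"
proof -
  \<comment> \<open>the kernel that remains once half of the exponent has been spent on the weight\<close>
  define u where "u = 4 * c\<^sup>2 * s"
  define p where "p = (real CARD('d) - 1) / 2"
  have u: "0 < u" using s c_pos by (simp add: u_def)
  define A where "A = exp (K\<^sup>2 * c\<^sup>2 * T) * (1 / sqrt (2 * pi * s)) ^ CARD('d)"
  have A: "0 \<le> A" using s by (simp add: A_def)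
  define I where "I = (\<integral>\<^sup>+ x. ennreal (norm (G (x + a)) * (exp (- (norm x)\<^sup>2 / u) / u powr p)) \<partial>lborel)"
  have dens: "gauss_density s w * exp (K * norm (\<sigma> *v w)) \<le> A * exp (- (norm (\<sigma> *v w))\<^sup>2 / u)" for w :: "real^'d"
  proof -
    have "(norm (\<sigma> *v w))\<^sup>2 \<le> (c * norm w)\<^sup>2"
      using norm_mult_le by (intro power_mono) auto
    then have 1: "(norm (\<sigma> *v w))\<^sup>2 / u \<le> (norm w)\<^sup>2 / (4 * s)"
      using c_pos s by (simp add: u_def field_simps power_mult_distrib)
    have "K * norm (\<sigma> *v w) \<le> K * c * norm w"
      using norm_mult_le[of w] K by (simp add: mult.assoc)
    also have "\<dots> \<le> s * (K * c)\<^sup>2 + (norm w)\<^sup>2 / (4 * s)"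
      by (rule mult_le_square_add_square[OF s(1)])
    also have "s * (K * c)\<^sup>2 \<le> T * (K * c)\<^sup>2"
      using s by (intro mult_right_mono) auto
    finally have 2: "K * norm (\<sigma> *v w) \<le> K\<^sup>2 * c\<^sup>2 * T + (norm w)\<^sup>2 / (4 * s)"
      by (simp add: power_mult_distrib mult_ac)
    have "(norm w)\<^sup>2 / (2 * s) = (norm w)\<^sup>2 / (4 * s) + (norm w)\<^sup>2 / (4 * s)"
      using s by (simp add: field_simps)
    with 1 2 have "- (norm w)\<^sup>2 / (2 * s) + K * norm (\<sigma> *v w) \<le> K\<^sup>2 * c\<^sup>2 * T + - (norm (\<sigma> *v w))\<^sup>2 / u"
      by simp
    then have "exp (- (norm w)\<^sup>2 / (2 * s)) * exp (K * norm (\<sigma> *v w)) \<le> exp (K\<^sup>2 * c\<^sup>2 * T) * exp (- (norm (\<sigma> *v w))\<^sup>2 / u)"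
      unfolding exp_add[symmetric] by (subst exp_le_cancel_iff)
    then have "(1 / sqrt (2 * pi * s)) ^ CARD('d) * (exp (- (norm w)\<^sup>2 / (2 * s)) * exp (K * norm (\<sigma> *v w)))
        \<le> (1 / sqrt (2 * pi * s)) ^ CARD('d) * (exp (K\<^sup>2 * c\<^sup>2 * T) * exp (- (norm (\<sigma> *v w))\<^sup>2 / u))"
      using s by (intro mult_left_mono) auto
    then show ?thesis
      unfolding gauss_density_def A_def by (simp only: mult_ac)
  qed
  have I: "I \<le> ennreal (exp (K * norm a + K * u) * K)"
  proof -
    have "I = ennreal (exp (K * norm a + K * u)) * (ennreal (exp (- K * norm a - K * u)) * I)"
      unfolding mult.assoc[symmetric] by (subst ennreal_mult[symmetric]) (auto simp: exp_add[symmetric])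
    also have "\<dots> \<le> ennreal (exp (K * norm a + K * u)) * ennreal K"
      using bound[OF u, of a] by (intro mult_left_mono) (auto simp: I_def p_def)
    finally show ?thesis using K by (simp add: ennreal_mult)
  qed
  have "(\<integral>\<^sup>+w. ennreal (exp (K * norm (\<sigma> *v w)) * norm (G (\<sigma> *v w + a))) \<partial>gauss s)
    = (\<integral>\<^sup>+w. ennreal (gauss_density s w * exp (K * norm (\<sigma> *v w)) * norm (G (\<sigma> *v w + a))) \<partial>lborel)"
    using s by (subst nn_integral_gauss) (auto simp: ennreal_mult' mult.assoc)
  also have "\<dots> \<le> (\<integral>\<^sup>+w. (\<lambda>x. ennreal (A * u powr p) * ennreal (norm (G (x + a)) * (exp (- (norm x)\<^sup>2 / u) / u powr p))) (\<sigma> *v w) \<partial>lborel)"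
  proof (rule nn_integral_mono)
    fix w :: "real^'d"
    have "gauss_density s w * exp (K * norm (\<sigma> *v w)) * norm (G (\<sigma> *v w + a)) \<le> A * exp (- (norm (\<sigma> *v w))\<^sup>2 / u) * norm (G (\<sigma> *v w + a))"
      by (intro mult_right_mono dens) auto
    also have "\<dots> = (A * u powr p) * (norm (G (\<sigma> *v w + a)) * (exp (- (norm (\<sigma> *v w))\<^sup>2 / u) / u powr p))"
      using u by simp
    finally show "ennreal (gauss_density s w * exp (K * norm (\<sigma> *v w)) * norm (G (\<sigma> *v w + a)))
      \<le> (\<lambda>x. ennreal (A * u powr p) * ennreal (norm (G (x + a)) * (exp (- (norm x)\<^sup>2 / u) / u powr p))) (\<sigma> *v w)"
      using A by (simp add: ennreal_mult'[symmetric] ennreal_leI)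
  qed
  also have "\<dots> = ennreal J * (ennreal (A * u powr p) * I)"
    by (subst image_lborel) (auto simp: nn_integral_cmult I_def)
  also have "\<dots> \<le> ennreal J * (ennreal (A * u powr p) * ennreal (exp (K * norm a + K * u) * K))"
    by (intro mult_left_mono I) auto
  also have "\<dots> = ennreal (J * (A * u powr p * (exp (K * norm a + K * u) * K)))"
    using A K J_nonneg by (simp add: ennreal_mult)
  also have "\<dots> \<le> ennreal (J * exp (K\<^sup>2 * c\<^sup>2 * T) * (2 * pi) powr (- real CARD('d) / 2) * (4 * c\<^sup>2) powr p
        * K * exp (4 * K * c\<^sup>2 * T) * exp (K * norm a) * s powr (- 1 / 2))"
  proof (rule ennreal_leI)
    have "(1 / sqrt (2 * pi * s)) ^ CARD('d) = (2 * pi * s) powr (- real CARD('d) / 2)"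
    proof -
      have "1 / sqrt (2 * pi * s) = (2 * pi * s) powr (- (1 / 2))"
        unfolding powr_minus_divide by (subst powr_half_sqrt) (use s in auto)
      then have "(1 / sqrt (2 * pi * s)) ^ CARD('d) = ((2 * pi * s) powr (- (1 / 2))) ^ CARD('d)"
        by (rule arg_cong)
      also have "\<dots> = ((2 * pi * s) powr (- (1 / 2))) powr real CARD('d)"
        by (rule powr_realpow[symmetric]) (use s in simp)
      also have "\<dots> = (2 * pi * s) powr (- real CARD('d) / 2)"
        unfolding powr_powr by simp
      finally show ?thesis .
    qed
    then have "(1 / sqrt (2 * pi * s)) ^ CARD('d) * u powr p
        = (2 * pi) powr (- real CARD('d) / 2) * (4 * c\<^sup>2) powr p * (s powr (- real CARD('d) / 2) * s powr p)"
      using s by (simp add: u_def powr_mult mult_ac)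
    also have "s powr (- real CARD('d) / 2) * s powr p = s powr (- 1 / 2)"
      unfolding powr_add[symmetric] p_def by (simp add: field_simps)
    finally have eq: "A * u powr p = exp (K\<^sup>2 * c\<^sup>2 * T) * ((2 * pi) powr (- real CARD('d) / 2) * (4 * c\<^sup>2) powr p * s powr (- 1 / 2))"
      by (simp add: A_def mult.assoc)
    have alg: "j * (a * (b * d * e) * (f * g * k)) = j * a * b * d * k * f * g * e" for a b d e f g j k :: real
      by simp
    have "K * u \<le> 4 * K * c\<^sup>2 * T"
      using mult_left_mono[OF s(2), of "4 * K * c\<^sup>2"] K by (simp add: u_def mult_ac)
    then have "exp (K * norm a + K * u) \<le> exp (4 * K * c\<^sup>2 * T) * exp (K * norm a)"
      by (simp add: exp_add[symmetric])
    then have "J * (A * u powr p * (exp (K * norm a + K * u) * K)) \<le> J * (A * u powr p * ((exp (4 * K * c\<^sup>2 * T) * exp (K * norm a)) * K))"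
      using J_nonneg A K by (intro mult_left_mono mult_right_mono) auto
    then show "J * (A * u powr p * (exp (K * norm a + K * u) * K)) \<le> J * exp (K\<^sup>2 * c\<^sup>2 * T) * (2 * pi) powr (- real CARD('d) / 2) * (4 * c\<^sup>2) powr p
        * K * exp (4 * K * c\<^sup>2 * T) * exp (K * norm a) * s powr (- 1 / 2)"
      unfolding eq alg .
  qed
  finally show ?thesis by (simp add: p_def)
qed

text \<open>The constant depends on the function only through \<open>K\<close>. It is therefore common to all members of an
  approximating sequence, which allows the passage to the limit.\<close>

definition increment_const :: "real \<Rightarrow> real \<Rightarrow> real^'d \<Rightarrow> real" where
  "increment_const K T x0 = 2 * K * exp (2 * K * norm x0) * c
     * (J * exp (K\<^sup>2 * c\<^sup>2 * T) * (2 * pi) powr (- real CARD('d) / 2) * (4 * c\<^sup>2) powr ((real CARD('d) - 1) / 2)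
        * K * exp (4 * K * c\<^sup>2 * T))
     * (sqrt 8 * exp (2 * T * (2 * K * c)\<^sup>2) * sqrt 2 ^ CARD('d))"

lemma increment_const_nonneg: "0 < K \<Longrightarrow> 0 \<le> increment_const K T x0"
  unfolding increment_const_def using J_nonneg c_pos by (intro mult_nonneg_nonneg) auto

text \<open>In the square one factor is bounded by the growth of the function and the other one by its gradient
  along the segment between the two points. Hence only the first power of the displacement
  is gained, that is \<open>sqrt \<tau>\<close>; this loss is the origin of the exponent 1/4.\<close>

lemma smooth_increment_bound:
  fixes x0 :: "real^'d" and K T :: real
  assumes K: "0 < K" and T: "0 < T"
    and G: "\<And>x. GDERIV \<zeta> x :> G x" and cont: "continuous_on UNIV G"
    and bound: "\<And>u a. 0 < u \<Longrightarrow> ennreal (exp (- K * norm a - K * u)) *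
            (\<integral>\<^sup>+ x. ennreal (norm (G (x + a)) *
                 (exp (- (norm x)\<^sup>2 / u) / u powr ((real CARD('d) - 1) / 2))) \<partial>lborel) \<le> ennreal K"
    and \<zeta>: "\<And>x. \<bar>\<zeta> x\<bar> \<le> K * exp (K * norm x)" and s: "0 < s" "s \<le> T" and \<tau>: "0 < \<tau>" "\<tau> \<le> T"
  shows "(\<integral>\<^sup>+z. (\<integral>\<^sup>+w. ennreal ((\<zeta> (x0 + \<sigma> *v w + \<sigma> *v z) - \<zeta> (x0 + \<sigma> *v w))\<^sup>2) \<partial>gauss s) \<partial>gauss \<tau>)
       \<le> ennreal (increment_const K T x0 * (s powr (- 1 / 2) * sqrt \<tau>))"
proof -
  define C1 where "C1 = J * exp (K\<^sup>2 * c\<^sup>2 * T) * (2 * pi) powr (- real CARD('d) / 2) * (4 * c\<^sup>2) powr ((real CARD('d) - 1) / 2)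
        * K * exp (4 * K * c\<^sup>2 * T)"
  have C1: "0 \<le> C1" using J_nonneg K by (simp add: C1_def)
  define C2 where "C2 = 2 * K * exp (2 * K * norm x0) * c * C1"
  have C2: "0 \<le> C2" using C1 K c_pos by (simp add: C2_def)
  define C where "C = C2 * (sqrt 8 * exp (2 * T * (2 * K * c)\<^sup>2) * sqrt 2 ^ CARD('d))"
  have C_eq: "increment_const K T x0 = C"
    unfolding increment_const_def C_def C2_def C1_def ..
  have "(\<integral>\<^sup>+z. (\<integral>\<^sup>+w. ennreal ((\<zeta> (x0 + \<sigma> *v w + \<sigma> *v z) - \<zeta> (x0 + \<sigma> *v w))\<^sup>2) \<partial>gauss s) \<partial>gauss \<tau>)
       \<le> ennreal (C * (s powr (- 1 / 2) * sqrt \<tau>))"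
  proof -
    interpret gs: prob_space "gauss s :: (real^'d) measure" by (rule prob_space_gauss[OF s(1)])
    interpret P: pair_sigma_finite "gauss s :: (real^'d) measure" "lborel :: real measure"
      by (intro pair_sigma_finite.intro gs.sigma_finite_measure_axioms sigma_finite_lborel)
    have [measurable]: "G \<in> borel_measurable borel"
      by (rule borel_measurable_continuous_onI[OF cont])
    have inner: "(\<integral>\<^sup>+w. ennreal ((\<zeta> (x0 + \<sigma> *v w + \<sigma> *v z) - \<zeta> (x0 + \<sigma> *v w))\<^sup>2) \<partial>gauss s)
        \<le> ennreal (C2 * s powr (- 1 / 2)) * ennreal (norm z * exp (2 * K * c * norm z))" for z
    proof -
      define y where "y = \<sigma> *v z"
      define B where "B = 2 * K * exp (K * norm x0) * exp (K * norm y) * norm y"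
      have B: "0 \<le> B" using K by (simp add: B_def)
      have sz: "sets (gauss s \<Otimes>\<^sub>M (lborel :: real measure)) = sets (borel \<Otimes>\<^sub>M borel :: ((real^'d) \<times> real) measure)"
        by (rule sets_pair_measure_cong) auto
      have "(\<integral>\<^sup>+w. ennreal ((\<zeta> (x0 + \<sigma> *v w + y) - \<zeta> (x0 + \<sigma> *v w))\<^sup>2) \<partial>gauss s)
        \<le> (\<integral>\<^sup>+w. (\<integral>\<^sup>+\<theta>. indicator {0..1} \<theta> * (ennreal B * ennreal (exp (K * norm (\<sigma> *v w)) * norm (G (\<sigma> *v w + (x0 + \<theta> *\<^sub>R y))))) \<partial>lborel) \<partial>gauss s)"
      proof (rule nn_integral_mono)
        fix w :: "real^'d"
        let ?x = "x0 + \<sigma> *v w"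
        let ?b = "2 * K * exp (K * (norm x0 + norm (\<sigma> *v w) + norm y))"
        have "\<bar>\<zeta> (?x + y)\<bar> \<le> K * exp (K * (norm x0 + norm (\<sigma> *v w) + norm y))"
          using K norm_triangle_ineq[of ?x y] norm_triangle_ineq[of x0 "\<sigma> *v w"]
          by (intro order_trans[OF \<zeta>]) auto
        moreover have "\<bar>\<zeta> ?x\<bar> \<le> K * exp (K * (norm x0 + norm (\<sigma> *v w) + norm y))"
          using K norm_triangle_ineq[of x0 "\<sigma> *v w"] norm_ge_zero[of y]
          by (intro order_trans[OF \<zeta>]) (auto simp del: norm_ge_zero)
        ultimately have "\<bar>\<zeta> (?x + y) - \<zeta> ?x\<bar> \<le> ?b" by linarith
        then have "(\<zeta> (?x + y) - \<zeta> ?x)\<^sup>2 \<le> ?b * \<bar>\<zeta> (?x + y) - \<zeta> ?x\<bar>"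
          using mult_right_mono[of "\<bar>\<zeta> (?x + y) - \<zeta> ?x\<bar>" ?b "\<bar>\<zeta> (?x + y) - \<zeta> ?x\<bar>"]
          by (simp add: power2_eq_square)
        then have "ennreal ((\<zeta> (?x + y) - \<zeta> ?x)\<^sup>2) \<le> ennreal ?b * ennreal \<bar>\<zeta> (?x + y) - \<zeta> ?x\<bar>"
          using K by (simp add: ennreal_mult[symmetric] ennreal_leI)
        also have "\<dots> \<le> ennreal ?b * (\<integral>\<^sup>+\<theta>. indicator {0..1} \<theta> * ennreal (norm y * norm (G (?x + \<theta> *\<^sub>R y))) \<partial>lborel)"
          by (intro mult_left_mono gradient_increment G cont) auto
        also have "\<dots> = (\<integral>\<^sup>+\<theta>. ennreal ?b * (indicator {0..1} \<theta> * ennreal (norm y * norm (G (?x + \<theta> *\<^sub>R y)))) \<partial>lborel)"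
          by (rule nn_integral_cmult[symmetric]) measurable
        also have "\<dots> = (\<integral>\<^sup>+\<theta>. indicator {0..1} \<theta> * (ennreal B * ennreal (exp (K * norm (\<sigma> *v w)) * norm (G (\<sigma> *v w + (x0 + \<theta> *\<^sub>R y))))) \<partial>lborel)"
        proof (rule nn_integral_cong)
          fix \<theta> :: real
          have arg: "?x + \<theta> *\<^sub>R y = \<sigma> *v w + (x0 + \<theta> *\<^sub>R y)" by simp
          have "?b * (norm y * norm (G (?x + \<theta> *\<^sub>R y))) = B * (exp (K * norm (\<sigma> *v w)) * norm (G (\<sigma> *v w + (x0 + \<theta> *\<^sub>R y))))"
            unfolding arg by (simp add: B_def distrib_left exp_add)
          then have "ennreal ?b * ennreal (norm y * norm (G (?x + \<theta> *\<^sub>R y))) = ennreal B * ennreal (exp (K * norm (\<sigma> *v w)) * norm (G (\<sigma> *v w + (x0 + \<theta> *\<^sub>R y))))"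
            using K B by (simp add: ennreal_mult[symmetric])
          then show "ennreal ?b * (indicator {0..1} \<theta> * ennreal (norm y * norm (G (?x + \<theta> *\<^sub>R y))))
            = indicator {0..1} \<theta> * (ennreal B * ennreal (exp (K * norm (\<sigma> *v w)) * norm (G (\<sigma> *v w + (x0 + \<theta> *\<^sub>R y)))))"
            by (simp only: mult.left_commute[of "ennreal ?b"])
        qed
        finally show "ennreal ((\<zeta> (?x + y) - \<zeta> ?x)\<^sup>2)
          \<le> (\<integral>\<^sup>+\<theta>. indicator {0..1} \<theta> * (ennreal B * ennreal (exp (K * norm (\<sigma> *v w)) * norm (G (\<sigma> *v w + (x0 + \<theta> *\<^sub>R y))))) \<partial>lborel)" .
      qed
      also have "\<dots> = (\<integral>\<^sup>+\<theta>. (\<integral>\<^sup>+w. indicator {0..1} \<theta> * (ennreal B * ennreal (exp (K * norm (\<sigma> *v w)) * norm (G (\<sigma> *v w + (x0 + \<theta> *\<^sub>R y))))) \<partial>gauss s) \<partial>lborel)"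
        by (rule P.Fubini'[symmetric]) (unfold measurable_cong_sets[OF sz refl], measurable)
      also have "\<dots> = (\<integral>\<^sup>+\<theta>. indicator {0..1} \<theta> * (ennreal B * (\<integral>\<^sup>+w. ennreal (exp (K * norm (\<sigma> *v w)) * norm (G (\<sigma> *v w + (x0 + \<theta> *\<^sub>R y)))) \<partial>gauss s)) \<partial>lborel)"
        by (simp add: nn_integral_cmult)
      also have "\<dots> \<le> (\<integral>\<^sup>+\<theta>. indicator {0..1} (\<theta> :: real) * (ennreal B * ennreal (C1 * exp (K * (norm x0 + norm y)) * s powr (- 1 / 2))) \<partial>lborel)"
      proof (rule nn_integral_mono)
        fix \<theta> :: real
        show "indicator {0..1} \<theta> * (ennreal B * (\<integral>\<^sup>+w. ennreal (exp (K * norm (\<sigma> *v w)) * norm (G (\<sigma> *v w + (x0 + \<theta> *\<^sub>R y)))) \<partial>gauss s))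
          \<le> indicator {0..1} \<theta> * (ennreal B * ennreal (C1 * exp (K * (norm x0 + norm y)) * s powr (- 1 / 2)))"
        proof (cases "\<theta> \<in> {0..1}")
          case True
          then have "norm (\<theta> *\<^sub>R y) \<le> norm y"
            using mult_right_mono[of "\<bar>\<theta>\<bar>" 1 "norm y"] by simp
          then have n: "norm (x0 + \<theta> *\<^sub>R y) \<le> norm x0 + norm y"
            using norm_triangle_ineq[of x0 "\<theta> *\<^sub>R y"] by linarith
          have "(\<integral>\<^sup>+w. ennreal (exp (K * norm (\<sigma> *v w)) * norm (G (\<sigma> *v w + (x0 + \<theta> *\<^sub>R y)))) \<partial>gauss s)
             \<le> ennreal (C1 * exp (K * norm (x0 + \<theta> *\<^sub>R y)) * s powr (- 1 / 2))"
            unfolding C1_def by (rule gradient_gauss_bound[OF _ K T bound s]) auto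
          also have "\<dots> \<le> ennreal (C1 * exp (K * (norm x0 + norm y)) * s powr (- 1 / 2))"
            using n C1 K by (intro ennreal_leI mult_right_mono mult_left_mono) auto
          finally show ?thesis by (rule mult_left_mono[OF mult_left_mono]) simp_all
        qed simp
      qed
      also have "\<dots> = ennreal B * ennreal (C1 * exp (K * (norm x0 + norm y)) * s powr (- 1 / 2))"
        by (simp add: nn_integral_multc)
      also have "\<dots> = ennreal (B * (C1 * exp (K * (norm x0 + norm y)) * s powr (- 1 / 2)))"
        using B C1 by (simp add: ennreal_mult)
      also have "\<dots> \<le> ennreal (C2 * s powr (- 1 / 2) * (norm z * exp (2 * K * c * norm z)))"
      proof (rule ennreal_leI)
        have y: "norm y \<le> c * norm z" unfolding y_def by (rule norm_mult_le)
        have "B * (C1 * exp (K * (norm x0 + norm y)) * s powr (- 1 / 2))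
            = (2 * K * C1 * s powr (- 1 / 2) * exp (2 * K * norm x0)) * (norm y * exp (2 * K * norm y))"
        proof -
          have "exp (2 * K * norm x0) = exp (K * norm x0) * exp (K * norm x0)" "exp (2 * K * norm y) = exp (K * norm y) * exp (K * norm y)"
            by (simp_all add: exp_add[symmetric])
          then show ?thesis by (simp add: B_def distrib_left exp_add mult_ac)
        qed
        also have "\<dots> \<le> (2 * K * C1 * s powr (- 1 / 2) * exp (2 * K * norm x0)) * ((c * norm z) * exp (2 * K * (c * norm z)))"
          using y K C1 c_pos by (intro mult_left_mono mult_mono) auto
        finally show "B * (C1 * exp (K * (norm x0 + norm y)) * s powr (- 1 / 2)) \<le> C2 * s powr (- 1 / 2) * (norm z * exp (2 * K * c * norm z))"
          by (simp add: C2_def mult_ac)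
      qed
      also have "\<dots> = ennreal (C2 * s powr (- 1 / 2)) * ennreal (norm z * exp (2 * K * c * norm z))"
        using C2 by (simp add: ennreal_mult)
      finally show ?thesis unfolding y_def .
    qed
    have "(\<integral>\<^sup>+z. (\<integral>\<^sup>+w. ennreal ((\<zeta> (x0 + \<sigma> *v w + \<sigma> *v z) - \<zeta> (x0 + \<sigma> *v w))\<^sup>2) \<partial>gauss s) \<partial>gauss \<tau>)
        \<le> (\<integral>\<^sup>+z. ennreal (C2 * s powr (- 1 / 2)) * ennreal (norm z * exp (2 * K * c * norm z)) \<partial>(gauss \<tau> :: (real^'d) measure))"
      by (intro nn_integral_mono inner)
    also have "\<dots> = ennreal (C2 * s powr (- 1 / 2)) * (\<integral>\<^sup>+z. ennreal (norm z * exp (2 * K * c * norm z)) \<partial>(gauss \<tau> :: (real^'d) measure))"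
      by (rule nn_integral_cmult) auto
    also have "\<dots> \<le> ennreal (C2 * s powr (- 1 / 2)) * ennreal (sqrt (8 * \<tau>) * exp (2 * \<tau> * (2 * K * c)\<^sup>2) * sqrt 2 ^ CARD('d))"
      by (intro mult_left_mono nn_integral_gauss_norm_exp_norm \<tau>) auto
    also have "\<dots> = ennreal (C2 * s powr (- 1 / 2) * (sqrt (8 * \<tau>) * exp (2 * \<tau> * (2 * K * c)\<^sup>2) * sqrt 2 ^ CARD('d)))"
      using C2 \<tau> by (simp add: ennreal_mult)
    also have "\<dots> \<le> ennreal (C * (s powr (- 1 / 2) * sqrt \<tau>))"
    proof (rule ennreal_leI)
      have "exp (2 * \<tau> * (2 * K * c)\<^sup>2) \<le> exp (2 * T * (2 * K * c)\<^sup>2)"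
        using \<tau> by (simp add: mult_right_mono)
      then have "C2 * s powr (- 1 / 2) * (sqrt (8 * \<tau>) * exp (2 * \<tau> * (2 * K * c)\<^sup>2) * sqrt 2 ^ CARD('d))
          \<le> C2 * s powr (- 1 / 2) * (sqrt (8 * \<tau>) * exp (2 * T * (2 * K * c)\<^sup>2) * sqrt 2 ^ CARD('d))"
        using C2 \<tau> by (intro mult_left_mono mult_right_mono) auto
      then show "C2 * s powr (- 1 / 2) * (sqrt (8 * \<tau>) * exp (2 * \<tau> * (2 * K * c)\<^sup>2) * sqrt 2 ^ CARD('d)) \<le> C * (s powr (- 1 / 2) * sqrt \<tau>)"
        by (simp add: C_def real_sqrt_mult mult_ac)
    qed
    finally show ?thesis .
  qed
  then show ?thesis unfolding C_eq .
qed

lemma gauss_image_bound: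
  fixes f :: "real^'d \<Rightarrow> ennreal"
  assumes [measurable]: "f \<in> borel_measurable borel" and "0 < s"
  shows "(\<integral>\<^sup>+w. f (a + \<sigma> *v w) \<partial>gauss s) \<le> ennreal ((1 / sqrt (2 * pi * s)) ^ CARD('d) * J) * (\<integral>\<^sup>+x. f x \<partial>lborel)"
proof -
  have "(\<integral>\<^sup>+w. f (a + \<sigma> *v w) \<partial>gauss s) = (\<integral>\<^sup>+w. ennreal (gauss_density s w) * f (a + \<sigma> *v w) \<partial>lborel)"
    by (rule nn_integral_gauss) measurable
  also have "\<dots> \<le> (\<integral>\<^sup>+w. (\<lambda>x. ennreal ((1 / sqrt (2 * pi * s)) ^ CARD('d)) * f (x + a)) (\<sigma> *v w) \<partial>lborel)"
    using gauss_density_le[OF assms(2)]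
    by (intro nn_integral_mono) (auto intro!: mult_right_mono ennreal_leI simp: add.commute)
  also have "\<dots> = ennreal J * (ennreal ((1 / sqrt (2 * pi * s)) ^ CARD('d)) * (\<integral>\<^sup>+x. f (x + a) \<partial>lborel))"
    by (subst image_lborel) (auto simp: nn_integral_cmult)
  also have "(\<integral>\<^sup>+x. f (x + a) \<partial>lborel) = (\<integral>\<^sup>+x. f x \<partial>lborel)"
    by (rule nn_integral_lborel_translation) auto
  finally show ?thesis
    using J_nonneg assms(2) by (simp add: ennreal_mult mult_ac)
qed

text \<open>The bound passes from the smooth approximations to their limit on bounded sets first: there the
  functions are uniformly bounded, so convergence in \<open>L\<^sup>1\<close> gives convergence in \<open>L\<^sup>2\<close> under any
  law with bounded density. The truncation is then removed by monotone convergence.\<close>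

lemma class_A_increment_bound:
  fixes x0 :: "real^'d"
  assumes "\<zeta> \<in> class_A" and [measurable]: "\<zeta> \<in> borel_measurable borel" and T: "0 < T"
  shows "\<exists>C\<ge>0. \<forall>s \<tau>. 0 < s \<longrightarrow> s \<le> T \<longrightarrow> 0 < \<tau> \<longrightarrow> \<tau> \<le> T \<longrightarrow>
     (\<integral>\<^sup>+z. (\<integral>\<^sup>+w. ennreal ((\<zeta> (x0 + \<sigma> *v w + \<sigma> *v z) - \<zeta> (x0 + \<sigma> *v w))\<^sup>2) \<partial>gauss s) \<partial>gauss \<tau>)
       \<le> ennreal (C * (s powr (- 1 / 2) * sqrt \<tau>))"
proof -
  from assms(1) obtain \<zeta>N :: "nat \<Rightarrow> real^'d \<Rightarrow> real" and G :: "nat \<Rightarrow> real^'d \<Rightarrow> real^'d" and K where K: "0 < K"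
    and G: "\<And>N x. GDERIV (\<zeta>N N) x :> G N x" and cont: "\<And>N. continuous_on UNIV (G N)"
    and L1: "tendsto_L1_loc \<zeta>N \<zeta>" and bnd: "\<And>N x. \<bar>\<zeta>N N x\<bar> + \<bar>\<zeta> x\<bar> \<le> K * exp (K * norm x)"
    and SUP: "(SUP N. SUP u\<in>{0<..}. SUP a.
            ennreal (exp (- K * norm a - K * u)) *
            (\<integral>\<^sup>+ x. ennreal (norm (G N (x + a)) *
                 (exp (- (norm x)\<^sup>2 / u) / u powr ((real CARD('d) - 1) / 2))) \<partial>lborel))
          < ennreal K"
    unfolding class_A_def by blast
  have bound: "ennreal (exp (- K * norm a - K * u)) *
            (\<integral>\<^sup>+ x. ennreal (norm (G N (x + a)) *
                 (exp (- (norm x)\<^sup>2 / u) / u powr ((real CARD('d) - 1) / 2))) \<partial>lborel) \<le> ennreal K" if "0 < u" for N u a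
  proof -
    let ?f = "\<lambda>N u a. ennreal (exp (- K * norm a - K * u)) *
            (\<integral>\<^sup>+ x. ennreal (norm (G N (x + a)) *
                 (exp (- (norm x)\<^sup>2 / u) / u powr ((real CARD('d) - 1) / 2))) \<partial>lborel)"
    have "?f N u a \<le> (SUP a. ?f N u a)" by (rule SUP_upper) simp
    also have "\<dots> \<le> (SUP u\<in>{0<..}. SUP a. ?f N u a)" by (rule SUP_upper) (use that in simp)
    also have "\<dots> \<le> (SUP N. SUP u\<in>{0<..}. SUP a. ?f N u a)" by (rule SUP_upper) simp
    also have "\<dots> \<le> ennreal K" using SUP by simp
    finally show ?thesis .
  qed
  have \<zeta>N_bnd: "\<bar>\<zeta>N N x\<bar> \<le> K * exp (K * norm x)" for N x
    using bnd[of N x] by linarith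
  have [measurable]: "\<zeta>N N \<in> borel_measurable borel" for N
  proof (rule borel_measurable_continuous_onI, rule continuous_at_imp_continuous_on, rule ballI)
    show "isCont (\<zeta>N N) x" for x
      using G[of N x] unfolding gderiv_def by (rule has_derivative_continuous)
  qed
  define C where "C = increment_const K T x0"
  have C: "0 \<le> C" unfolding C_def by (rule increment_const_nonneg[OF K])
  have C_bound: "(\<integral>\<^sup>+z. (\<integral>\<^sup>+w. ennreal ((\<zeta>N N (x0 + \<sigma> *v w + \<sigma> *v z) - \<zeta>N N (x0 + \<sigma> *v w))\<^sup>2) \<partial>gauss s) \<partial>gauss \<tau>)
       \<le> ennreal (C * (s powr (- 1 / 2) * sqrt \<tau>))" if "0 < s" "s \<le> T" "0 < \<tau>" "\<tau> \<le> T" for N s \<tau>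
    unfolding C_def by (rule smooth_increment_bound[OF K T G cont bound \<zeta>N_bnd that])
  have main: "(\<integral>\<^sup>+z. (\<integral>\<^sup>+w. ennreal ((\<zeta> (x0 + \<sigma> *v w + \<sigma> *v z) - \<zeta> (x0 + \<sigma> *v w))\<^sup>2) \<partial>gauss s) \<partial>gauss \<tau>)
       \<le> ennreal (3 * C * (s powr (- 1 / 2) * sqrt \<tau>))" if s: "0 < s" "s \<le> T" and \<tau>: "0 < \<tau>" "\<tau> \<le> T" for s \<tau>
  proof -
    interpret gs: prob_space "gauss s :: (real^'d) measure" by (rule prob_space_gauss[OF s(1)])
    interpret gt: prob_space "gauss \<tau> :: (real^'d) measure" by (rule prob_space_gauss[OF \<tau>(1)])
    define b where "b = C * (s powr (- 1 / 2) * sqrt \<tau>)"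
    have b: "0 \<le> b" using C \<tau> by (simp add: b_def)
    define \<rho> where "\<rho> = (1 / sqrt (2 * pi * s)) ^ CARD('d) * J"
    have \<rho>: "0 \<le> \<rho>" using J_nonneg s by (simp add: \<rho>_def)
    have [measurable]: "cball (0 :: real^'d) r \<in> sets borel" for r by simp
    define f :: "nat \<Rightarrow> real^'d \<Rightarrow> real^'d \<Rightarrow> ennreal" where
      "f = (\<lambda>R z w. indicator (cball 0 (real R)) (x0 + \<sigma> *v w + \<sigma> *v z) * indicator (cball 0 (real R)) (x0 + \<sigma> *v w)
        * ennreal ((\<zeta> (x0 + \<sigma> *v w + \<sigma> *v z) - \<zeta> (x0 + \<sigma> *v w))\<^sup>2))"
    have f_meas[measurable]: "(\<lambda>(z, w). f R z w) \<in> borel_measurable (borel \<Otimes>\<^sub>M borel)" for R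
      unfolding f_def by measurable
    have [measurable]: "f R z \<in> borel_measurable borel" for R z
      unfolding f_def by measurable
    have sets_eq: "sets ((gauss \<tau> :: (real^'d) measure) \<Otimes>\<^sub>M (gauss s :: (real^'d) measure)) = sets (borel \<Otimes>\<^sub>M borel)"
      by (rule sets_pair_measure_cong) auto
    have [measurable]: "(\<lambda>z. \<integral>\<^sup>+w. f R z w \<partial>gauss s) \<in> borel_measurable (gauss \<tau>)" for R
      by (rule gs.borel_measurable_nn_integral) (use f_meas in \<open>simp add: measurable_cong_sets[OF sets_eq refl]\<close>)
    have trunc: "(\<integral>\<^sup>+z. (\<integral>\<^sup>+w. f R z w \<partial>gauss s) \<partial>gauss \<tau>) \<le> ennreal (3 * b)" for R
    proof -
      define L where "L = (\<lambda>N. LINT x:cball 0 (real R)|lebesgue. \<bar>\<zeta>N N x - \<zeta> x\<bar>)"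
      define M where "M = K * exp (K * real R)"
      have M: "0 \<le> M" using K by (simp add: M_def)
      define D where "D = (\<lambda>N x. indicator (cball 0 (real R)) x * ennreal ((\<zeta>N N x - \<zeta> x)\<^sup>2))"
      have [measurable]: "D N \<in> borel_measurable borel" for N
        unfolding D_def by measurable
      have L0: "L \<longlonglongrightarrow> 0" and int: "set_integrable lebesgue (cball 0 (real R)) (\<zeta>N N)" "set_integrable lebesgue (cball 0 (real R)) \<zeta>" for N
        using L1 unfolding tendsto_L1_loc_def L_def by auto
      have L_nonneg: "0 \<le> L N" for N
        unfolding L_def set_lebesgue_integral_def by (rule Bochner_Integration.integral_nonneg) auto
      have D_int: "(\<integral>\<^sup>+x. D N x \<partial>lborel) \<le> ennreal (M * L N)" for N
      proof -
        have "(\<integral>\<^sup>+x. D N x \<partial>lborel) \<le> (\<integral>\<^sup>+x. ennreal M * ennreal (indicator (cball 0 (real R)) x *\<^sub>R \<bar>\<zeta>N N x - \<zeta> x\<bar>) \<partial>lborel)"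
        proof (rule nn_integral_mono)
          fix x :: "real^'d"
          show "D N x \<le> ennreal M * ennreal (indicator (cball 0 (real R)) x *\<^sub>R \<bar>\<zeta>N N x - \<zeta> x\<bar>)"
          proof (cases "x \<in> cball 0 (real R)")
            case True
            have "\<bar>\<zeta>N N x - \<zeta> x\<bar> \<le> K * exp (K * norm x)" using bnd[of N x] by linarith
            also have "\<dots> \<le> M" using True K by (simp add: M_def mult_left_mono)
            finally have "\<bar>\<zeta>N N x - \<zeta> x\<bar> * \<bar>\<zeta>N N x - \<zeta> x\<bar> \<le> M * \<bar>\<zeta>N N x - \<zeta> x\<bar>"
              by (rule mult_right_mono) simp
            then have "(\<zeta>N N x - \<zeta> x)\<^sup>2 \<le> M * \<bar>\<zeta>N N x - \<zeta> x\<bar>"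
              by (simp add: power2_eq_square)
            then show ?thesis using True M by (simp add: D_def ennreal_mult[symmetric] ennreal_leI)
          qed (simp add: D_def)
        qed
        also have "\<dots> = ennreal M * (\<integral>\<^sup>+x. ennreal (indicator (cball 0 (real R)) x *\<^sub>R \<bar>\<zeta>N N x - \<zeta> x\<bar>) \<partial>lborel)"
          by (rule nn_integral_cmult) measurable
        also have "(\<integral>\<^sup>+x. ennreal (indicator (cball 0 (real R)) x *\<^sub>R \<bar>\<zeta>N N x - \<zeta> x\<bar>) \<partial>lborel)
            = (\<integral>\<^sup>+x. ennreal (indicator (cball 0 (real R)) x *\<^sub>R \<bar>\<zeta>N N x - \<zeta> x\<bar>) \<partial>lebesgue)"
          by (rule nn_integral_completion[symmetric])
        also have "\<dots> = ennreal (L N)"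
          unfolding L_def set_lebesgue_integral_def
        proof (rule nn_integral_eq_integral)
          have "integrable lebesgue (\<lambda>x. norm (indicator (cball 0 (real R)) x *\<^sub>R \<zeta>N N x - indicator (cball 0 (real R)) x *\<^sub>R \<zeta> x))"
            using int unfolding set_integrable_def by (intro integrable_norm Bochner_Integration.integrable_diff)
          also have "(\<lambda>x. norm (indicator (cball 0 (real R)) x *\<^sub>R \<zeta>N N x - indicator (cball 0 (real R)) x *\<^sub>R \<zeta> x))
              = (\<lambda>x. indicator (cball 0 (real R)) x *\<^sub>R \<bar>\<zeta>N N x - \<zeta> x\<bar>)"
            by (auto simp: fun_eq_iff indicator_def)
          finally show "integrable lebesgue (\<lambda>x. indicator (cball 0 (real R)) x *\<^sub>R \<bar>\<zeta>N N x - \<zeta> x\<bar>)" .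
        qed auto
        finally show ?thesis using M L_nonneg by (simp add: ennreal_mult)
      qed
      have D_gauss: "(\<integral>\<^sup>+w. D N (a + \<sigma> *v w) \<partial>gauss s) \<le> ennreal (\<rho> * (M * L N))" for N a
      proof -
        have "(\<integral>\<^sup>+w. D N (a + \<sigma> *v w) \<partial>gauss s) \<le> ennreal \<rho> * (\<integral>\<^sup>+x. D N x \<partial>lborel)"
          unfolding \<rho>_def by (rule gauss_image_bound[OF _ s(1)]) measurable
        also have "\<dots> \<le> ennreal \<rho> * ennreal (M * L N)"
          by (intro mult_left_mono D_int) auto
        finally show ?thesis using \<rho> M L_nonneg by (simp add: ennreal_mult)
      qed
      have "(\<integral>\<^sup>+z. (\<integral>\<^sup>+w. f R z w \<partial>gauss s) \<partial>gauss \<tau>) \<le> ennreal (6 * (\<rho> * (M * L N)) + 3 * b)" for N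
      proof -
        let ?S = "\<lambda>z w. ennreal ((\<zeta>N N (x0 + \<sigma> *v w + \<sigma> *v z) - \<zeta>N N (x0 + \<sigma> *v w))\<^sup>2)"
        have [measurable]: "(\<lambda>z. \<integral>\<^sup>+w. ?S z w \<partial>gauss s) \<in> borel_measurable (gauss \<tau>)"
          by (rule gs.borel_measurable_nn_integral) (simp only: measurable_cong_sets[OF sets_eq refl], measurable)
        have "(\<integral>\<^sup>+w. f R z w \<partial>gauss s) \<le> ennreal (6 * (\<rho> * (M * L N))) + 3 * (\<integral>\<^sup>+w. ?S z w \<partial>gauss s)" for z
        proof -
          have "(\<integral>\<^sup>+w. f R z w \<partial>gauss s) \<le> (\<integral>\<^sup>+w. 3 * D N ((x0 + \<sigma> *v z) + \<sigma> *v w) + 3 * ?S z w + 3 * D N (x0 + \<sigma> *v w) \<partial>gauss s)"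
          proof (rule nn_integral_mono)
            fix w :: "real^'d"
            let ?p = "x0 + \<sigma> *v w" and ?q = "x0 + \<sigma> *v w + \<sigma> *v z"
            have q: "(x0 + \<sigma> *v z) + \<sigma> *v w = ?q" by simp
            have "f R z w \<le> 3 * D N ?q + 3 * ?S z w + 3 * D N ?p"
            proof (cases "?p \<in> cball 0 (real R) \<and> ?q \<in> cball 0 (real R)")
              case True
              have sq: "(x + y + z)\<^sup>2 \<le> 3 * x\<^sup>2 + 3 * y\<^sup>2 + 3 * z\<^sup>2" for x y z :: real
                using zero_le_power2[of "x - y"] zero_le_power2[of "x - z"] zero_le_power2[of "y - z"]
                by (simp add: power2_eq_square algebra_simps)
              have "(\<zeta> ?q - \<zeta> ?p)\<^sup>2 = ((\<zeta> ?q - \<zeta>N N ?q) + (\<zeta>N N ?q - \<zeta>N N ?p) + (\<zeta>N N ?p - \<zeta> ?p))\<^sup>2" by simp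
              also have "\<dots> \<le> 3 * (\<zeta> ?q - \<zeta>N N ?q)\<^sup>2 + 3 * (\<zeta>N N ?q - \<zeta>N N ?p)\<^sup>2 + 3 * (\<zeta>N N ?p - \<zeta> ?p)\<^sup>2" by (rule sq)
              finally have "ennreal ((\<zeta> ?q - \<zeta> ?p)\<^sup>2) \<le> ennreal (3 * (\<zeta>N N ?q - \<zeta> ?q)\<^sup>2 + 3 * (\<zeta>N N ?q - \<zeta>N N ?p)\<^sup>2 + 3 * (\<zeta>N N ?p - \<zeta> ?p)\<^sup>2)"
                by (simp only: power2_commute[of "\<zeta> ?q" "\<zeta>N N ?q"] ennreal_leI)
              also have "\<dots> = 3 * ennreal ((\<zeta>N N ?q - \<zeta> ?q)\<^sup>2) + 3 * ennreal ((\<zeta>N N ?q - \<zeta>N N ?p)\<^sup>2) + 3 * ennreal ((\<zeta>N N ?p - \<zeta> ?p)\<^sup>2)"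
                by (simp add: ennreal_plus[symmetric] ennreal_mult[symmetric] ennreal_numeral[symmetric]
                    del: ennreal_plus ennreal_numeral)
              finally show ?thesis
                using True by (simp add: f_def D_def)
            qed (auto simp: f_def)
            then show "f R z w \<le> 3 * D N ((x0 + \<sigma> *v z) + \<sigma> *v w) + 3 * ?S z w + 3 * D N (x0 + \<sigma> *v w)"
              unfolding q .
          qed
          also have "\<dots> = 3 * (\<integral>\<^sup>+w. D N ((x0 + \<sigma> *v z) + \<sigma> *v w) \<partial>gauss s) + 3 * (\<integral>\<^sup>+w. ?S z w \<partial>gauss s) + 3 * (\<integral>\<^sup>+w. D N (x0 + \<sigma> *v w) \<partial>gauss s)"
            by (simp add: nn_integral_add nn_integral_cmult)
          also have "\<dots> \<le> 3 * ennreal (\<rho> * (M * L N)) + 3 * (\<integral>\<^sup>+w. ?S z w \<partial>gauss s) + 3 * ennreal (\<rho> * (M * L N))"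
            by (intro add_mono mult_left_mono D_gauss order_refl) auto
          also have "\<dots> = (3 * ennreal (\<rho> * (M * L N)) + 3 * ennreal (\<rho> * (M * L N))) + 3 * (\<integral>\<^sup>+w. ?S z w \<partial>gauss s)"
            by (simp add: add_ac)
          also have "3 * ennreal (\<rho> * (M * L N)) + 3 * ennreal (\<rho> * (M * L N)) = ennreal (6 * (\<rho> * (M * L N)))"
            using \<rho> M L_nonneg[of N]
            by (simp add: ennreal_plus[symmetric] ennreal_mult[symmetric] ennreal_numeral[symmetric]
                    del: ennreal_plus ennreal_numeral)
          finally show ?thesis .
        qed
        then have "(\<integral>\<^sup>+z. (\<integral>\<^sup>+w. f R z w \<partial>gauss s) \<partial>gauss \<tau>)
            \<le> (\<integral>\<^sup>+z. ennreal (6 * (\<rho> * (M * L N))) + 3 * (\<integral>\<^sup>+w. ?S z w \<partial>gauss s) \<partial>gauss \<tau>)"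
          by (intro nn_integral_mono)
        also have "\<dots> = ennreal (6 * (\<rho> * (M * L N))) + 3 * (\<integral>\<^sup>+z. (\<integral>\<^sup>+w. ?S z w \<partial>gauss s) \<partial>gauss \<tau>)"
          using gt.emeasure_space_1 by (simp add: nn_integral_add nn_integral_cmult)
        also have "\<dots> \<le> ennreal (6 * (\<rho> * (M * L N))) + 3 * ennreal b"
          unfolding b_def by (intro add_left_mono mult_left_mono C_bound s \<tau>) auto
        also have "\<dots> = ennreal (6 * (\<rho> * (M * L N)) + 3 * b)"
          using \<rho> M L_nonneg[of N] b
          by (simp add: ennreal_plus[symmetric] ennreal_mult[symmetric] ennreal_numeral[symmetric]
                    del: ennreal_plus ennreal_numeral)
        finally show ?thesis .
      qed
      note trunc_N = this
      have lim: "(\<lambda>N. ennreal (6 * (\<rho> * (M * L N)) + 3 * b)) \<longlonglongrightarrow> ennreal (6 * (\<rho> * (M * 0)) + 3 * b)"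
        by (intro tendsto_ennrealI tendsto_intros L0)
      show ?thesis
        using LIMSEQ_le_const[OF lim exI[of _ 0]] trunc_N by simp
    qed
    have f_mono: "f R z w \<le> f R' z w" if "R \<le> R'" for R R' z w
      using that unfolding f_def by (auto simp: indicator_def)
    have SUP_f: "ennreal ((\<zeta> (x0 + \<sigma> *v w + \<sigma> *v z) - \<zeta> (x0 + \<sigma> *v w))\<^sup>2) = (SUP R. f R z w)" for z w
    proof (rule antisym)
      obtain R where "max (norm (x0 + \<sigma> *v w)) (norm (x0 + \<sigma> *v w + \<sigma> *v z)) \<le> real R"
        using real_arch_simple by blast
      then have "ennreal ((\<zeta> (x0 + \<sigma> *v w + \<sigma> *v z) - \<zeta> (x0 + \<sigma> *v w))\<^sup>2) = f R z w"
        by (simp add: f_def)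
      also have "\<dots> \<le> (SUP R. f R z w)" by (rule SUP_upper) simp
      finally show "ennreal ((\<zeta> (x0 + \<sigma> *v w + \<sigma> *v z) - \<zeta> (x0 + \<sigma> *v w))\<^sup>2) \<le> (SUP R. f R z w)" .
      show "(SUP R. f R z w) \<le> ennreal ((\<zeta> (x0 + \<sigma> *v w + \<sigma> *v z) - \<zeta> (x0 + \<sigma> *v w))\<^sup>2)"
        by (rule SUP_least) (auto simp: f_def indicator_def)
    qed
    have "(\<integral>\<^sup>+z. (\<integral>\<^sup>+w. (SUP R. f R z w) \<partial>gauss s) \<partial>gauss \<tau>) = (\<integral>\<^sup>+z. (SUP R. \<integral>\<^sup>+w. f R z w \<partial>gauss s) \<partial>gauss \<tau>)"
      by (intro nn_integral_cong nn_integral_monotone_convergence_SUP) (auto simp: incseq_def le_fun_def f_mono)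
    also have "\<dots> = (SUP R. \<integral>\<^sup>+z. (\<integral>\<^sup>+w. f R z w \<partial>gauss s) \<partial>gauss \<tau>)"
      by (rule nn_integral_monotone_convergence_SUP) (auto simp: incseq_def le_fun_def intro!: nn_integral_mono f_mono)
    also have "\<dots> \<le> ennreal (3 * b)"
      by (rule SUP_least) (rule trunc)
    finally show ?thesis by (simp add: SUP_f b_def mult.assoc)
  qed
  show ?thesis
    by (rule exI[of _ "3 * C"]) (intro conjI allI impI main mult_nonneg_nonneg C; simp)
qed

text \<open>Measured in units of \<open>sqrt \<tau>\<close> the power of the displacement is at most 1 plus its square, so that
  the second moment of the Gaussian law suffices.\<close>

lemma holder_increment_bound:
  fixes x0 :: "real^'d"
  assumes C: "\<And>x y. norm (b x - b y) \<le> C * norm (x - y) powr \<beta>" "0 < C" and \<beta>: "0 < \<beta>" "\<beta> \<le> 1"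
    and s: "0 < s" and \<tau>: "0 < \<tau>"
  shows "(\<integral>\<^sup>+z. (\<integral>\<^sup>+w. ennreal ((norm (b (x0 + \<sigma> *v w + \<sigma> *v z) - b (x0 + \<sigma> *v w)))\<^sup>2) \<partial>gauss s) \<partial>gauss \<tau>)
       \<le> ennreal (C\<^sup>2 * (1 + c\<^sup>2 * (4 * sqrt 2 ^ CARD('d))) * \<tau> powr \<beta>)"
proof -
  interpret gs: prob_space "gauss s :: (real^'d) measure" by (rule prob_space_gauss[OF s])
  interpret gt: prob_space "gauss \<tau> :: (real^'d) measure" by (rule prob_space_gauss[OF \<tau>])
  define k where "k = c\<^sup>2 / \<tau>"
  have k: "0 \<le> k" using \<tau> by (simp add: k_def)
  have pw: "(norm (b (x + \<sigma> *v z) - b x))\<^sup>2 \<le> C\<^sup>2 * \<tau> powr \<beta> * (1 + k * (norm z)\<^sup>2)" for x z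
  proof -
    have "(norm (b (x + \<sigma> *v z) - b x))\<^sup>2 \<le> (C * norm (\<sigma> *v z) powr \<beta>)\<^sup>2"
      using C(1)[of "x + \<sigma> *v z" x] by (intro power_mono) auto
    also have "\<dots> = C\<^sup>2 * ((norm (\<sigma> *v z))\<^sup>2) powr \<beta>"
      unfolding power2_eq_square by (subst powr_mult) auto
    also have "((norm (\<sigma> *v z))\<^sup>2) powr \<beta> = \<tau> powr \<beta> * ((norm (\<sigma> *v z))\<^sup>2 / \<tau>) powr \<beta>"
      using \<tau> by (simp add: powr_mult[symmetric])
    also have "((norm (\<sigma> *v z))\<^sup>2 / \<tau>) powr \<beta> \<le> 1 + (norm (\<sigma> *v z))\<^sup>2 / \<tau>"
    proof -
      have "y powr \<beta> \<le> 1 + y" if "0 \<le> y" for y :: real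
      proof (cases "y \<le> 1")
        case True
        then show ?thesis using that \<beta> powr_le1[of \<beta> y] by simp
      next
        case False
        then show ?thesis using powr_mono[of \<beta> 1 y] \<beta> by simp
      qed
      then show ?thesis using \<tau> by simp
    qed
    also have "(norm (\<sigma> *v z))\<^sup>2 / \<tau> \<le> (c * norm z)\<^sup>2 / \<tau>"
      using norm_mult_le \<tau> by (intro divide_right_mono power_mono) auto
    finally show ?thesis
      using \<tau> by (simp add: power_mult_distrib mult_left_mono mult.assoc k_def)
  qed
  have "(\<integral>\<^sup>+z. (\<integral>\<^sup>+w. ennreal ((norm (b (x0 + \<sigma> *v w + \<sigma> *v z) - b (x0 + \<sigma> *v w)))\<^sup>2) \<partial>gauss s) \<partial>gauss \<tau>)
    \<le> (\<integral>\<^sup>+z. (\<integral>\<^sup>+w. ennreal (C\<^sup>2 * \<tau> powr \<beta> * (1 + k * (norm z)\<^sup>2)) \<partial>(gauss s :: (real^'d) measure)) \<partial>(gauss \<tau> :: (real^'d) measure))"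
    by (intro nn_integral_mono ennreal_leI pw)
  also have "\<dots> = (\<integral>\<^sup>+z. ennreal (C\<^sup>2 * \<tau> powr \<beta>) * (1 + ennreal (k) * ennreal ((norm z)\<^sup>2)) \<partial>(gauss \<tau> :: (real^'d) measure))"
    using gs.emeasure_space_1 \<tau> k by (auto intro!: nn_integral_cong simp: ennreal_mult)
  also have "\<dots> = ennreal (C\<^sup>2 * \<tau> powr \<beta>) * (1 + ennreal (k) * (\<integral>\<^sup>+z. ennreal ((norm z)\<^sup>2) \<partial>(gauss \<tau> :: (real^'d) measure)))"
    using gt.emeasure_space_1 by (simp add: nn_integral_cmult nn_integral_add)
  also have "\<dots> \<le> ennreal (C\<^sup>2 * \<tau> powr \<beta>) * (1 + ennreal (k) * ennreal (4 * \<tau> * sqrt 2 ^ CARD('d)))"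
    by (intro mult_left_mono add_left_mono nn_integral_gauss_norm_square \<tau>) auto
  also have "\<dots> = ennreal (C\<^sup>2 * \<tau> powr \<beta> * (1 + k * (4 * \<tau> * sqrt 2 ^ CARD('d))))"
    using \<tau> k by (simp add: ennreal_mult)
  also have "C\<^sup>2 * \<tau> powr \<beta> * (1 + k * (4 * \<tau> * sqrt 2 ^ CARD('d))) = C\<^sup>2 * (1 + c\<^sup>2 * (4 * sqrt 2 ^ CARD('d))) * \<tau> powr \<beta>"
    using \<tau> by (simp add: field_simps k_def)
  finally show ?thesis .
qed

end

lemma holder_continuous_imp_continuous:
  fixes b :: "real^'d \<Rightarrow> real^'d"
  assumes "\<And>x y. norm (b x - b y) \<le> C * norm (x - y) powr \<beta>" "0 < \<beta>"
  shows "continuous_on UNIV b"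
proof (rule continuous_at_imp_continuous_on, rule ballI)
  fix x :: "real^'d"
  have "((\<lambda>y. C * norm (y - x) powr \<beta>) \<longlongrightarrow> C * norm (x - x) powr \<beta>) (at x)"
    using assms(2) by (intro tendsto_intros tendsto_powr') auto
  then have "((\<lambda>y. C * norm (y - x) powr \<beta>) \<longlongrightarrow> 0) (at x)" by simp
  then have "((\<lambda>y. b y - b x) \<longlongrightarrow> 0) (at x)"
    by (rule Lim_null_comparison[rotated]) (auto intro!: always_eventually assms(1))
  then show "isCont b x" unfolding isCont_def by (simp add: LIM_zero_iff)
qed

text \<open>The Hoelder part contributes the power of \<open>\<tau>\<close> and the other part the singular term. The first part is
  continuous, so the second one is measurable as a difference of measurable functions.\<close>

lemma (in nondegenerate_matrix) class_B_increment_bound: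
  fixes x0 :: "real^'d"
  assumes "\<phi> \<in> class_B \<beta>" and \<beta>: "0 < \<beta>" "\<beta> \<le> 1" and T: "0 < T"
  shows "\<exists>C\<ge>0. \<forall>s \<tau>. 0 < s \<longrightarrow> s \<le> T \<longrightarrow> 0 < \<tau> \<longrightarrow> \<tau> \<le> T \<longrightarrow>
     (\<integral>\<^sup>+z. (\<integral>\<^sup>+w. ennreal ((norm (\<phi> (x0 + \<sigma> *v w + \<sigma> *v z) - \<phi> (x0 + \<sigma> *v w)))\<^sup>2) \<partial>gauss s) \<partial>gauss \<tau>)
       \<le> ennreal (C * (\<tau> powr \<beta> + s powr (- 1 / 2) * sqrt \<tau>))"
proof -
  from assms(1) obtain bH bA Ch where [measurable]: "\<phi> \<in> borel_measurable borel" and eq: "\<And>x. \<phi> x = bH x + bA x"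
    and Ch: "0 < Ch" "\<And>x y. norm (bH x - bH y) \<le> Ch * norm (x - y) powr \<beta>" and bA: "\<And>j. (\<lambda>x. bA x $ j) \<in> class_A"
    unfolding class_B_def holder_continuous_def by blast
  have [measurable]: "bH \<in> borel_measurable borel"
    by (rule borel_measurable_continuous_onI[OF holder_continuous_imp_continuous[OF Ch(2) \<beta>(1)]])
  have "bA = (\<lambda>x. \<phi> x - bH x)" using eq by (auto simp: fun_eq_iff)
  then have [measurable]: "bA \<in> borel_measurable borel" by simp
  have [measurable]: "(\<lambda>x. bA x $ j) \<in> borel_measurable borel" for j
  proof -
    have "(\<lambda>x. bA x \<bullet> axis j 1) \<in> borel_measurable borel" by measurable
    then show ?thesis by (simp add: inner_axis)
  qed
  let ?P = "\<lambda>j C. 0 \<le> C \<and> (\<forall>s \<tau>. 0 < s \<longrightarrow> s \<le> T \<longrightarrow> 0 < \<tau> \<longrightarrow> \<tau> \<le> T \<longrightarrow>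
     (\<integral>\<^sup>+z. (\<integral>\<^sup>+w. ennreal ((bA (x0 + \<sigma> *v w + \<sigma> *v z) $ j - bA (x0 + \<sigma> *v w) $ j)\<^sup>2) \<partial>gauss s) \<partial>gauss \<tau>)
       \<le> ennreal (C * (s powr (- 1 / 2) * sqrt \<tau>)))"
  have "\<forall>j. \<exists>C. ?P j C"
    by (rule allI, rule class_A_increment_bound[OF bA _ T]) measurable
  then have "\<exists>CA. \<forall>j. ?P j (CA j)" by (rule choice)
  then obtain CA where CA': "\<forall>j. ?P j (CA j)" by (rule exE)
  have CA: "0 \<le> CA j" for j using CA' by (rule allE) (erule conjunct1)
  have CA_bound: "(\<integral>\<^sup>+z. (\<integral>\<^sup>+w. ennreal ((bA (x0 + \<sigma> *v w + \<sigma> *v z) $ j - bA (x0 + \<sigma> *v w) $ j)\<^sup>2) \<partial>gauss s) \<partial>gauss \<tau>)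
       \<le> ennreal (CA j * (s powr (- 1 / 2) * sqrt \<tau>))" if "0 < s" "s \<le> T" "0 < \<tau>" "\<tau> \<le> T" for j s \<tau>
    by (rule CA'[THEN spec, THEN conjunct2, rule_format, OF that])
  define CH where "CH = Ch\<^sup>2 * (1 + c\<^sup>2 * (4 * sqrt 2 ^ CARD('d)))"
  define C where "C = 2 * CH + 2 * (\<Sum>j\<in>UNIV. CA j)"
  have CH: "0 \<le> CH" by (simp add: CH_def)
  have SA: "0 \<le> (\<Sum>j\<in>UNIV. CA j)" by (intro sum_nonneg CA)
  have main: "(\<integral>\<^sup>+z. (\<integral>\<^sup>+w. ennreal ((norm (\<phi> (x0 + \<sigma> *v w + \<sigma> *v z) - \<phi> (x0 + \<sigma> *v w)))\<^sup>2) \<partial>gauss s) \<partial>gauss \<tau>)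
       \<le> ennreal (C * (\<tau> powr \<beta> + s powr (- 1 / 2) * sqrt \<tau>))" if s: "0 < s" "s \<le> T" and \<tau>: "0 < \<tau>" "\<tau> \<le> T" for s \<tau>
  proof -
    interpret gs: prob_space "gauss s :: (real^'d) measure" by (rule prob_space_gauss[OF s(1)])
    have sets_eq: "sets ((gauss \<tau> :: (real^'d) measure) \<Otimes>\<^sub>M (gauss s :: (real^'d) measure)) = sets (borel \<Otimes>\<^sub>M borel)"
      by (rule sets_pair_measure_cong) auto
    let ?q = "\<lambda>z w. x0 + \<sigma> *v w + \<sigma> *v z" and ?p = "\<lambda>w. x0 + \<sigma> *v w"
    let ?H = "\<lambda>z w. ennreal ((norm (bH (?q z w) - bH (?p w)))\<^sup>2)"
    let ?A = "\<lambda>j z w. ennreal ((bA (?q z w) $ j - bA (?p w) $ j)\<^sup>2)"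
    have [measurable]: "(\<lambda>z. \<integral>\<^sup>+w. ?H z w \<partial>gauss s) \<in> borel_measurable (gauss \<tau>)"
      by (rule gs.borel_measurable_nn_integral) (simp only: measurable_cong_sets[OF sets_eq refl], measurable)
    have [measurable]: "(\<lambda>z. \<integral>\<^sup>+w. ?A j z w \<partial>gauss s) \<in> borel_measurable (gauss \<tau>)" for j
      by (rule gs.borel_measurable_nn_integral) (simp only: measurable_cong_sets[OF sets_eq refl], measurable)
    have pw: "ennreal ((norm (\<phi> (?q z w) - \<phi> (?p w)))\<^sup>2) \<le> 2 * ?H z w + 2 * (\<Sum>j\<in>UNIV. ?A j z w)" for z w
    proof -
      let ?h = "bH (?q z w) - bH (?p w)" and ?a = "bA (?q z w) - bA (?p w)"
      have "norm (\<phi> (?q z w) - \<phi> (?p w)) \<le> norm ?h + norm ?a"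
        using norm_triangle_ineq[of ?h ?a] by (simp add: eq algebra_simps)
      then have "(norm (\<phi> (?q z w) - \<phi> (?p w)))\<^sup>2 \<le> (norm ?h + norm ?a)\<^sup>2" by (rule power_mono) simp
      also have "\<dots> \<le> 2 * (norm ?h)\<^sup>2 + 2 * (norm ?a)\<^sup>2" by (rule square_add_le)
      also have "(norm ?a)\<^sup>2 = (\<Sum>j\<in>UNIV. (bA (?q z w) $ j - bA (?p w) $ j)\<^sup>2)"
        by (simp add: norm_vec_def L2_set_def sum_nonneg)
      finally have "ennreal ((norm (\<phi> (?q z w) - \<phi> (?p w)))\<^sup>2) \<le> ennreal (2 * (norm ?h)\<^sup>2 + 2 * (\<Sum>j\<in>UNIV. (bA (?q z w) $ j - bA (?p w) $ j)\<^sup>2))"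
        by (rule ennreal_leI)
      also have "\<dots> = 2 * ?H z w + 2 * (\<Sum>j\<in>UNIV. ?A j z w)"
        by (simp add: ennreal_plus ennreal_mult sum_nonneg)
      finally show ?thesis .
    qed
    have "(\<integral>\<^sup>+z. (\<integral>\<^sup>+w. ennreal ((norm (\<phi> (?q z w) - \<phi> (?p w)))\<^sup>2) \<partial>gauss s) \<partial>gauss \<tau>)
      \<le> (\<integral>\<^sup>+z. (\<integral>\<^sup>+w. 2 * ?H z w + 2 * (\<Sum>j\<in>UNIV. ?A j z w) \<partial>gauss s) \<partial>gauss \<tau>)"
      by (intro nn_integral_mono pw)
    also have "\<dots> = (\<integral>\<^sup>+z. 2 * (\<integral>\<^sup>+w. ?H z w \<partial>gauss s) + 2 * (\<Sum>j\<in>UNIV. \<integral>\<^sup>+w. ?A j z w \<partial>gauss s) \<partial>gauss \<tau>)"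
      by (simp add: nn_integral_add nn_integral_cmult nn_integral_sum del: sum_ennreal)
    also have "\<dots> = 2 * (\<integral>\<^sup>+z. (\<integral>\<^sup>+w. ?H z w \<partial>gauss s) \<partial>gauss \<tau>) + 2 * (\<Sum>j\<in>UNIV. \<integral>\<^sup>+z. (\<integral>\<^sup>+w. ?A j z w \<partial>gauss s) \<partial>gauss \<tau>)"
      by (simp add: nn_integral_add nn_integral_cmult nn_integral_sum del: sum_ennreal)
    also have "\<dots> \<le> 2 * ennreal (CH * \<tau> powr \<beta>) + 2 * (\<Sum>j\<in>UNIV. ennreal (CA j * (s powr (- 1 / 2) * sqrt \<tau>)))"
      unfolding CH_def
      by (intro add_mono mult_left_mono sum_mono CA_bound holder_increment_bound[OF Ch(2,1) \<beta>] s \<tau>) auto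
    also have "\<dots> = ennreal (2 * (CH * \<tau> powr \<beta>) + 2 * ((\<Sum>j\<in>UNIV. CA j) * (s powr (- 1 / 2) * sqrt \<tau>)))"
    proof -
      have "(\<Sum>j\<in>UNIV. ennreal (CA j * (s powr (- 1 / 2) * sqrt \<tau>))) = ennreal ((\<Sum>j\<in>UNIV. CA j) * (s powr (- 1 / 2) * sqrt \<tau>))"
        unfolding sum_distrib_right using CA \<tau> by (intro sum_ennreal) auto
      then show ?thesis
        using CH SA \<tau> by (simp add: ennreal_plus ennreal_mult)
    qed
    also have "\<dots> \<le> ennreal (C * (\<tau> powr \<beta> + s powr (- 1 / 2) * sqrt \<tau>))"
    proof (rule ennreal_leI)
      have "0 \<le> 2 * CH * (s powr (- 1 / 2) * sqrt \<tau>)" "0 \<le> 2 * (\<Sum>j\<in>UNIV. CA j) * \<tau> powr \<beta>"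
        using CH SA \<tau> by auto
      then show "2 * (CH * \<tau> powr \<beta>) + 2 * ((\<Sum>j\<in>UNIV. CA j) * (s powr (- 1 / 2) * sqrt \<tau>)) \<le> C * (\<tau> powr \<beta> + s powr (- 1 / 2) * sqrt \<tau>)"
        unfolding C_def distrib_left distrib_right by linarith
    qed
    finally show ?thesis .
  qed
  have "0 \<le> C" using CH SA by (simp add: C_def)
  show ?thesis
    by (rule exI[of _ C]) (intro conjI allI impI main \<open>0 \<le> C\<close>)
qed

lemma class_B_exp_bound:
  fixes \<phi> :: "real^'d \<Rightarrow> real^'d"
  assumes "\<phi> \<in> class_B \<beta>" and \<beta>: "0 < \<beta>" "\<beta> \<le> 1"
  shows "\<exists>K>0. \<forall>x. norm (\<phi> x) \<le> K * exp (K * norm x)"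
proof -
  from assms(1) obtain bH bA Ch where eq: "\<And>x. \<phi> x = bH x + bA x"
    and Ch: "0 < Ch" "\<And>x y. norm (bH x - bH y) \<le> Ch * norm (x - y) powr \<beta>" and bA: "\<And>j. (\<lambda>x. bA x $ j) \<in> class_A"
    unfolding class_B_def holder_continuous_def by blast
  have "\<forall>j. \<exists>K>0. \<forall>x. \<bar>bA x $ j\<bar> \<le> K * exp (K * norm x)"
    using bA unfolding class_A_def exponentially_bounded_def by blast
  then obtain KA where KA: "\<And>j. 0 < KA j" "\<And>j x. \<bar>bA x $ j\<bar> \<le> KA j * exp (KA j * norm x)" by metis
  define K where "K = norm (bH 0) + Ch + 1 + (\<Sum>j\<in>UNIV. KA j)"
  have SK: "0 \<le> (\<Sum>j\<in>UNIV. KA j)" using KA(1) by (intro sum_nonneg) (auto intro: less_imp_le)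
  have "norm (\<phi> x) \<le> K * exp (K * norm x)" for x
  proof -
    have p: "norm x powr \<beta> \<le> exp (norm x)"
    proof (cases "norm x \<le> 1")
      case True
      then have "norm x powr \<beta> \<le> 1" using powr_le1[of \<beta> "norm x"] \<beta> by simp
      also have "\<dots> \<le> exp (norm x)" by simp
      finally show ?thesis .
    next
      case False
      then have "norm x powr \<beta> \<le> norm x" using powr_mono[of \<beta> 1 "norm x"] \<beta> by simp
      also have "\<dots> \<le> exp (norm x)" using exp_ge_add_one_self[of "norm x"] by linarith
      finally show ?thesis .
    qed
    have e: "exp (l * norm x) \<le> exp (K * norm x)" if "l \<le> K" for l
      using that by (simp add: mult_right_mono)
    have "norm (bH x) \<le> norm (bH 0) + norm (bH x - bH 0)"
      using norm_triangle_ineq[of "bH 0" "bH x - bH 0"] by simp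
    also have "\<dots> \<le> norm (bH 0) + Ch * exp (norm x)"
    proof -
      have "norm (bH x - bH 0) \<le> Ch * norm x powr \<beta>" using Ch(2)[of x 0] by simp
      also have "\<dots> \<le> Ch * exp (norm x)" using p Ch(1) by (intro mult_left_mono) auto
      finally show ?thesis by simp
    qed
    also have "\<dots> \<le> norm (bH 0) * exp (K * norm x) + Ch * exp (K * norm x)"
    proof (rule add_mono)
      have "1 \<le> K" using Ch(1) SK norm_ge_zero[of "bH 0"] unfolding K_def by linarith
      then show "Ch * exp (norm x) \<le> Ch * exp (K * norm x)"
        using e[of 1] Ch(1) by (intro mult_left_mono) auto
      have "1 \<le> exp (K * norm x)" using \<open>1 \<le> K\<close> by simp
      then show "norm (bH 0) \<le> norm (bH 0) * exp (K * norm x)"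
        using mult_left_mono[of 1 "exp (K * norm x)" "norm (bH 0)"] by simp
    qed
    finally have H: "norm (bH x) \<le> (norm (bH 0) + Ch) * exp (K * norm x)" by (simp add: distrib_right)
    have "norm (bA x) \<le> (\<Sum>j\<in>UNIV. \<bar>bA x $ j\<bar>)" by (rule norm_le_l1_cart)
    also have "\<dots> \<le> (\<Sum>j\<in>UNIV. KA j * exp (K * norm x))"
    proof (rule sum_mono)
      fix j
      have "KA j \<le> (\<Sum>j\<in>UNIV. KA j)" using KA(1) by (intro member_le_sum) (auto intro: less_imp_le)
      then have "KA j \<le> K" using Ch(1) norm_ge_zero[of "bH 0"] unfolding K_def by linarith
      then show "\<bar>bA x $ j\<bar> \<le> KA j * exp (K * norm x)"
        using KA(1)[of j] e by (intro order_trans[OF KA(2)] mult_left_mono) auto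
    qed
    also have "\<dots> = (\<Sum>j\<in>UNIV. KA j) * exp (K * norm x)" by (simp add: sum_distrib_right)
    finally have "norm (\<phi> x) \<le> (norm (bH 0) + Ch) * exp (K * norm x) + (\<Sum>j\<in>UNIV. KA j) * exp (K * norm x)"
      unfolding eq using H by (intro order_trans[OF norm_triangle_ineq] add_mono)
    also have "\<dots> \<le> K * exp (K * norm x)"
      by (simp add: K_def distrib_right)
    finally show ?thesis .
  qed
  moreover have "0 < K" using Ch(1) SK by (simp add: K_def add_nonneg_pos add_pos_nonneg)
  ultimately show ?thesis by blast
qed

section \<open>Lipschitz approximation in the mean square\<close>

text \<open>Against an arbitrary finite Borel measure a square integrable function is a limit of Lipschitz
  functions. This will be applied to laws about which nothing is known.\<close>

definition lipschitz_approximable :: "'a::metric_space measure \<Rightarrow> ('a \<Rightarrow> real) \<Rightarrow> bool" where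
  "lipschitz_approximable \<mu> \<phi> \<longleftrightarrow> (\<forall>e>0. \<exists>g L. L-lipschitz_on UNIV g \<and> (\<integral>\<^sup>+x. ennreal ((\<phi> x - g x)\<^sup>2) \<partial>\<mu>) \<le> ennreal e)"

lemma nn_integral_square_add:
  fixes f g :: "'a \<Rightarrow> real"
  assumes [measurable]: "f \<in> borel_measurable M" "g \<in> borel_measurable M"
    and "(\<integral>\<^sup>+x. ennreal ((f x)\<^sup>2) \<partial>M) \<le> ennreal a" "(\<integral>\<^sup>+x. ennreal ((g x)\<^sup>2) \<partial>M) \<le> ennreal b" "0 \<le> a" "0 \<le> b"
  shows "(\<integral>\<^sup>+x. ennreal ((f x + g x)\<^sup>2) \<partial>M) \<le> ennreal (2 * a + 2 * b)"
proof -
  have "(\<integral>\<^sup>+x. ennreal ((f x + g x)\<^sup>2) \<partial>M) \<le> (\<integral>\<^sup>+x. 2 * ennreal ((f x)\<^sup>2) + 2 * ennreal ((g x)\<^sup>2) \<partial>M)"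
  proof (rule nn_integral_mono)
    fix x
    have "ennreal ((f x + g x)\<^sup>2) \<le> ennreal (2 * (f x)\<^sup>2 + 2 * (g x)\<^sup>2)"
      by (rule ennreal_leI[OF square_add_le])
    also have "\<dots> = 2 * ennreal ((f x)\<^sup>2) + 2 * ennreal ((g x)\<^sup>2)"
      by (simp add: ennreal_plus ennreal_mult)
    finally show "ennreal ((f x + g x)\<^sup>2) \<le> 2 * ennreal ((f x)\<^sup>2) + 2 * ennreal ((g x)\<^sup>2)" .
  qed
  also have "\<dots> = 2 * (\<integral>\<^sup>+x. ennreal ((f x)\<^sup>2) \<partial>M) + 2 * (\<integral>\<^sup>+x. ennreal ((g x)\<^sup>2) \<partial>M)"
    by (simp add: nn_integral_add nn_integral_cmult)
  also have "\<dots> \<le> 2 * ennreal a + 2 * ennreal b"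
    by (intro add_mono mult_left_mono assms) auto
  also have "\<dots> = ennreal (2 * a + 2 * b)"
    using assms(5,6) by (simp add: ennreal_plus ennreal_mult)
  finally show ?thesis .
qed

lemma lipschitz_borel_measurable: "L-lipschitz_on UNIV g \<Longrightarrow> g \<in> borel_measurable borel"
  by (rule borel_measurable_continuous_onI[OF lipschitz_on_continuous_on])

lemma lipschitz_approximable_limit:
  assumes "sets \<mu> = sets borel" and [measurable]: "\<phi> \<in> borel_measurable \<mu>"
    and "\<And>e. 0 < e \<Longrightarrow> \<exists>\<psi>. \<psi> \<in> borel_measurable \<mu> \<and> lipschitz_approximable \<mu> \<psi> \<and> (\<integral>\<^sup>+x. ennreal ((\<phi> x - \<psi> x)\<^sup>2) \<partial>\<mu>) \<le> ennreal e"
  shows "lipschitz_approximable \<mu> \<phi>"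
  unfolding lipschitz_approximable_def
proof (intro allI impI)
  fix e :: real assume e: "0 < e"
  obtain \<psi> where [measurable]: "\<psi> \<in> borel_measurable \<mu>" and \<psi>: "lipschitz_approximable \<mu> \<psi>" "(\<integral>\<^sup>+x. ennreal ((\<phi> x - \<psi> x)\<^sup>2) \<partial>\<mu>) \<le> ennreal (e / 4)"
    using assms(3)[of "e / 4"] e by auto
  obtain g L where g: "L-lipschitz_on UNIV g" "(\<integral>\<^sup>+x. ennreal ((\<psi> x - g x)\<^sup>2) \<partial>\<mu>) \<le> ennreal (e / 4)"
    using \<psi>(1)[unfolded lipschitz_approximable_def, rule_format, of "e / 4"] e by auto
  have [measurable]: "g \<in> borel_measurable \<mu>"
    using lipschitz_borel_measurable[OF g(1)] by (simp add: measurable_cong_sets[OF assms(1) refl])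
  have "(\<integral>\<^sup>+x. ennreal (((\<phi> x - \<psi> x) + (\<psi> x - g x))\<^sup>2) \<partial>\<mu>) \<le> ennreal (2 * (e / 4) + 2 * (e / 4))"
    using e by (intro nn_integral_square_add \<psi> g) auto
  then show "\<exists>g L. L-lipschitz_on UNIV g \<and> (\<integral>\<^sup>+x. ennreal ((\<phi> x - g x)\<^sup>2) \<partial>\<mu>) \<le> ennreal e"
    using g(1) by (intro exI[of _ g] exI[of _ L]) simp
qed

lemma lipschitz_approximable_add:
  assumes "sets \<mu> = sets borel" and [measurable]: "\<phi> \<in> borel_measurable \<mu>" "\<psi> \<in> borel_measurable \<mu>"
    and "lipschitz_approximable \<mu> \<phi>" "lipschitz_approximable \<mu> \<psi>"
  shows "lipschitz_approximable \<mu> (\<lambda>x. \<phi> x + \<psi> x)"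
  unfolding lipschitz_approximable_def
proof (intro allI impI)
  fix e :: real assume e: "0 < e"
  obtain g L where g: "L-lipschitz_on UNIV g" "(\<integral>\<^sup>+x. ennreal ((\<phi> x - g x)\<^sup>2) \<partial>\<mu>) \<le> ennreal (e / 4)"
    using assms(4)[unfolded lipschitz_approximable_def, rule_format, of "e / 4"] e by auto
  obtain g' L' where g': "L'-lipschitz_on UNIV g'" "(\<integral>\<^sup>+x. ennreal ((\<psi> x - g' x)\<^sup>2) \<partial>\<mu>) \<le> ennreal (e / 4)"
    using assms(5)[unfolded lipschitz_approximable_def, rule_format, of "e / 4"] e by auto
  have [measurable]: "g \<in> borel_measurable \<mu>" "g' \<in> borel_measurable \<mu>"
    using lipschitz_borel_measurable[OF g(1)] lipschitz_borel_measurable[OF g'(1)]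
    by (simp_all add: measurable_cong_sets[OF assms(1) refl])
  have "(\<integral>\<^sup>+x. ennreal (((\<phi> x - g x) + (\<psi> x - g' x))\<^sup>2) \<partial>\<mu>) \<le> ennreal (2 * (e / 4) + 2 * (e / 4))"
    using e by (intro nn_integral_square_add g g') auto
  also have "(\<lambda>x. ennreal (((\<phi> x - g x) + (\<psi> x - g' x))\<^sup>2)) = (\<lambda>x. ennreal ((\<phi> x + \<psi> x - (g x + g' x))\<^sup>2))"
    by (intro ext arg_cong[where f = "\<lambda>t. ennreal (t\<^sup>2)"]) simp
  finally have "(\<integral>\<^sup>+x. ennreal ((\<phi> x + \<psi> x - (g x + g' x))\<^sup>2) \<partial>\<mu>) \<le> ennreal e" by simp
  then show "\<exists>g L. L-lipschitz_on UNIV g \<and> (\<integral>\<^sup>+x. ennreal ((\<phi> x + \<psi> x - g x)\<^sup>2) \<partial>\<mu>) \<le> ennreal e"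
    by (intro exI[of _ "\<lambda>x. g x + g' x"] exI[of _ "L + L'"] conjI lipschitz_on_add g g')
qed

lemma lipschitz_approximable_cmult:
  assumes "sets \<mu> = sets borel" and [measurable]: "\<phi> \<in> borel_measurable \<mu>" and "lipschitz_approximable \<mu> \<phi>"
  shows "lipschitz_approximable \<mu> (\<lambda>x. c * \<phi> x)"
  unfolding lipschitz_approximable_def
proof (intro allI impI)
  fix e :: real assume e: "0 < e"
  define e' where "e' = e / (c\<^sup>2 + 1)"
  have e': "0 < e'" using e by (simp add: e'_def add_nonneg_pos)
  obtain g L where g: "L-lipschitz_on UNIV g" "(\<integral>\<^sup>+x. ennreal ((\<phi> x - g x)\<^sup>2) \<partial>\<mu>) \<le> ennreal e'"
    using assms(3)[unfolded lipschitz_approximable_def, rule_format, of e'] e' by auto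
  have [measurable]: "g \<in> borel_measurable \<mu>"
    using lipschitz_borel_measurable[OF g(1)] by (simp add: measurable_cong_sets[OF assms(1) refl])
  have L: "0 \<le> L" using g(1) by (rule lipschitz_on_nonneg)
  have "(\<lambda>x. (c * \<phi> x - c * g x)\<^sup>2) = (\<lambda>x. c\<^sup>2 * (\<phi> x - g x)\<^sup>2)"
    by (simp add: right_diff_distrib[symmetric] power_mult_distrib)
  then have "(\<integral>\<^sup>+x. ennreal ((c * \<phi> x - c * g x)\<^sup>2) \<partial>\<mu>) = (\<integral>\<^sup>+x. ennreal (c\<^sup>2) * ennreal ((\<phi> x - g x)\<^sup>2) \<partial>\<mu>)"
    by (simp add: fun_eq_iff ennreal_mult)
  also have "\<dots> = ennreal (c\<^sup>2) * (\<integral>\<^sup>+x. ennreal ((\<phi> x - g x)\<^sup>2) \<partial>\<mu>)"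
    by (rule nn_integral_cmult) measurable
  also have "\<dots> \<le> ennreal (c\<^sup>2) * ennreal e'"
    by (intro mult_left_mono g) auto
  also have "\<dots> = ennreal (c\<^sup>2 * e')" using e' by (simp add: ennreal_mult)
  also have "\<dots> \<le> ennreal e"
  proof (rule ennreal_leI)
    have "c\<^sup>2 * e' \<le> (c\<^sup>2 + 1) * e'" using e' by simp
    also have "\<dots> = e" by (simp add: e'_def add_nonneg_eq_0_iff)
    finally show "c\<^sup>2 * e' \<le> e" .
  qed
  finally have "(\<integral>\<^sup>+x. ennreal ((c * \<phi> x - c * g x)\<^sup>2) \<partial>\<mu>) \<le> ennreal e" .
  moreover have "(\<bar>c\<bar> * L)-lipschitz_on UNIV (\<lambda>x. c * g x)"
  proof (rule lipschitz_onI)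
    fix x y
    have "dist (c * g x) (c * g y) = \<bar>c\<bar> * dist (g x) (g y)"
      by (simp add: dist_real_def right_diff_distrib[symmetric] abs_mult)
    also have "\<dots> \<le> \<bar>c\<bar> * (L * dist x y)"
      using lipschitz_onD[OF g(1), of x y] by (intro mult_left_mono) auto
    finally show "dist (c * g x) (c * g y) \<le> \<bar>c\<bar> * L * dist x y" by (simp add: mult.assoc)
  qed (use L in simp)
  ultimately show "\<exists>g L. L-lipschitz_on UNIV g \<and> (\<integral>\<^sup>+x. ennreal ((c * \<phi> x - g x)\<^sup>2) \<partial>\<mu>) \<le> ennreal e"
    by (intro exI[of _ "\<lambda>x. c * g x"] exI[of _ "\<bar>c\<bar> * L"] conjI)
qed

text \<open>The approximating functions decrease linearly from 1 to 0 with the distance from the set.\<close>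

lemma lipschitz_approximable_indicator_compact:
  fixes \<mu> :: "'a::metric_space measure"
  assumes "finite_measure \<mu>" and sets: "sets \<mu> = sets borel" and K: "compact K"
  shows "lipschitz_approximable \<mu> (indicator K)"
  unfolding lipschitz_approximable_def
proof (intro allI impI)
  interpret finite_measure \<mu> by fact
  fix e :: real assume e: "0 < e"
  show "\<exists>g L. L-lipschitz_on UNIV g \<and> (\<integral>\<^sup>+x. ennreal ((indicator K x - g x)\<^sup>2) \<partial>\<mu>) \<le> ennreal e"
  proof (cases "K = {}")
    case True
    then show ?thesis
      by (intro exI[of _ "\<lambda>_. 0"] exI[of _ 0] conjI lipschitz_onI) auto
  next
    case False
    have [measurable]: "K \<in> sets \<mu>" using K sets by (simp add: borel_compact)
    define g where "g = (\<lambda>(k::nat) x. max 0 (1 - real k * infdist x K))"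
    have lip: "(real k)-lipschitz_on UNIV (g k)" for k
    proof (rule lipschitz_onI)
      fix x y
      have "\<bar>g k x - g k y\<bar> \<le> \<bar>real k * infdist x K - real k * infdist y K\<bar>"
        unfolding g_def by linarith
      also have "\<dots> = real k * \<bar>infdist x K - infdist y K\<bar>"
        by (simp add: right_diff_distrib[symmetric] abs_mult)
      also have "\<dots> \<le> real k * dist x y"
        by (intro mult_left_mono infdist_triangle_abs) auto
      finally show "dist (g k x) (g k y) \<le> real k * dist x y" by (simp add: dist_real_def)
    qed simp
    have [measurable]: "g k \<in> borel_measurable \<mu>" for k
      using lipschitz_borel_measurable[OF lip] by (simp add: measurable_cong_sets[OF sets refl])
    have lim: "(\<lambda>k. g k x) \<longlonglongrightarrow> indicator K x" for x
    proof (cases "x \<in> K")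
      case True
      then have "g k x = 1" for k by (simp add: g_def)
      with True show ?thesis by simp
    next
      case F: False
      then have "infdist x K \<noteq> 0"
        using in_closed_iff_infdist_zero[OF compact_imp_closed[OF K] False] by simp
      then have pos: "0 < infdist x K" using infdist_nonneg[of x K] by linarith
      obtain k0 :: nat where k0: "1 / infdist x K \<le> real k0" using real_arch_simple by blast
      have "g k x = 0" if "k0 \<le> k" for k
      proof -
        have "1 / infdist x K \<le> real k" using k0 that by linarith
        then have "1 \<le> real k * infdist x K" using pos by (simp add: field_simps)
        then show ?thesis by (simp add: g_def)
      qed
      then have "eventually (\<lambda>k. g k x = 0) sequentially"
        by (auto simp: eventually_sequentially)
      with F show ?thesis by (simp add: tendsto_eventually)
    qed
    have "(\<lambda>k. \<integral>\<^sup>+x. ennreal ((indicator K x - g k x)\<^sup>2) \<partial>\<mu>) \<longlonglongrightarrow> (\<integral>\<^sup>+x. 0 \<partial>\<mu>)"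
    proof (rule nn_integral_dominated_convergence[where w = "\<lambda>_. 1"])
      show "AE x in \<mu>. (\<lambda>k. ennreal ((indicator K x - g k x)\<^sup>2)) \<longlonglongrightarrow> 0"
      proof (rule AE_I2)
        fix x
        have "(\<lambda>k. ennreal ((indicator K x - g k x)\<^sup>2)) \<longlonglongrightarrow> ennreal ((indicator K x - indicator K x)\<^sup>2)"
          by (intro tendsto_ennrealI tendsto_intros lim)
        then show "(\<lambda>k. ennreal ((indicator K x - g k x)\<^sup>2)) \<longlonglongrightarrow> 0" by simp
      qed
      show "AE x in \<mu>. ennreal ((indicator K x - g k x)\<^sup>2) \<le> 1" for k
      proof (rule AE_I2)
        fix x
        have "0 \<le> g k x" "g k x \<le> 1" using infdist_nonneg[of x K] by (auto simp: g_def)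
        then have "\<bar>indicator K x - g k x\<bar> \<le> 1" by (cases "x \<in> K") auto
        then have "(indicator K x - g k x)\<^sup>2 \<le> 1" by (simp add: abs_square_le_1)
        then show "ennreal ((indicator K x - g k x)\<^sup>2) \<le> 1" by (metis ennreal_1 ennreal_leI)
      qed
      show "(\<integral>\<^sup>+x. 1 \<partial>\<mu>) < \<infinity>" using emeasure_finite[of "space \<mu>"] by (simp add: less_top[symmetric])
    qed auto
    then have "eventually (\<lambda>k. (\<integral>\<^sup>+x. ennreal ((indicator K x - g k x)\<^sup>2) \<partial>\<mu>) < ennreal e) sequentially"
      using e by (intro order_tendstoD(2)) auto
    then obtain k where "(\<integral>\<^sup>+x. ennreal ((indicator K x - g k x)\<^sup>2) \<partial>\<mu>) < ennreal e"
      by (auto simp: eventually_sequentially)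
    then show ?thesis
      using lip[of k] by (intro exI[of _ "g k"] exI[of _ "real k"] conjI) (auto intro: less_imp_le)
  qed
qed

text \<open>Finite Borel measures on a Polish space are inner regular, which reduces the claim to compact sets.\<close>

lemma lipschitz_approximable_indicator:
  fixes \<mu> :: "'a::{second_countable_topology, complete_space} measure"
  assumes "finite_measure \<mu>" and sets: "sets \<mu> = sets borel" and A: "A \<in> sets borel"
  shows "lipschitz_approximable \<mu> (indicator A)"
proof (rule lipschitz_approximable_limit[OF sets])
  interpret finite_measure \<mu> by fact
  have [measurable]: "A \<in> sets \<mu>" using A sets by simp
  show "(indicator A :: 'a \<Rightarrow> real) \<in> borel_measurable \<mu>" by measurable
  fix e :: real assume e: "0 < e"
  have "\<exists>K. K \<subseteq> A \<and> compact K \<and> measure \<mu> A - e < measure \<mu> K"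
  proof (cases "measure \<mu> A - e < 0")
    case True
    then show ?thesis by (intro exI[of _ "{}"]) simp
  next
    case False
    then have "ennreal (measure \<mu> A - e) < emeasure \<mu> A"
      using e by (simp add: emeasure_eq_measure ennreal_less_iff)
    also have "\<dots> = (SUP K \<in> {K. K \<subseteq> A \<and> compact K}. emeasure \<mu> K)"
      by (rule inner_regular[OF sets _ A]) simp
    finally obtain K where "K \<subseteq> A" "compact K" "ennreal (measure \<mu> A - e) < emeasure \<mu> K"
      unfolding less_SUP_iff by blast
    then show ?thesis
      using False by (intro exI[of _ K]) (simp add: emeasure_eq_measure ennreal_less_iff)
  qed
  then obtain K where K: "K \<subseteq> A" "compact K" "measure \<mu> A - e < measure \<mu> K" by blast
  have [measurable]: "K \<in> sets \<mu>" using K sets by (simp add: borel_compact)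
  have "(\<integral>\<^sup>+x. ennreal ((indicator A x - indicator K x)\<^sup>2) \<partial>\<mu>) = (\<integral>\<^sup>+x. indicator (A - K) x \<partial>\<mu>)"
    using K(1) by (intro nn_integral_cong) (auto simp: indicator_def)
  also have "\<dots> = emeasure \<mu> (A - K)" by simp
  also have "\<dots> = ennreal (measure \<mu> A - measure \<mu> K)"
    using K(1) by (simp add: emeasure_eq_measure finite_measure_Diff)
  also have "\<dots> \<le> ennreal e" using K(3) by (intro ennreal_leI) simp
  finally show "\<exists>\<psi>. \<psi> \<in> borel_measurable \<mu> \<and> lipschitz_approximable \<mu> \<psi> \<and> (\<integral>\<^sup>+x. ennreal ((indicator A x - \<psi> x)\<^sup>2) \<partial>\<mu>) \<le> ennreal e"
    by (intro exI[of _ "indicator K"] conjI lipschitz_approximable_indicator_compact[OF assms(1,2) K(2)]) auto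
qed

lemma lipschitz_approximable_nonneg:
  fixes \<mu> :: "'a::{second_countable_topology, complete_space} measure"
  assumes fin: "finite_measure \<mu>" and sets: "sets \<mu> = sets borel"
    and "\<phi> \<in> borel_measurable \<mu>" "\<And>x. 0 \<le> \<phi> x" and "(\<integral>\<^sup>+x. ennreal ((\<phi> x)\<^sup>2) \<partial>\<mu>) < \<infinity>"
  shows "lipschitz_approximable \<mu> \<phi>"
  using assms(3,4,5)
proof (induction \<phi> rule: borel_measurable_induct_real)
  case (set A)
  then show ?case using lipschitz_approximable_indicator[OF fin sets] sets by simp
next
  case (mult u c)
  show ?case
  proof (cases "c = 0")
    case True
    then show ?thesis
      unfolding lipschitz_approximable_def
      by (intro allI impI exI[of _ "\<lambda>_. 0"] exI[of _ 0] conjI lipschitz_onI) auto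
  next
    case False
    have [measurable]: "u \<in> borel_measurable \<mu>" by (rule mult)
    have "(\<integral>\<^sup>+x. ennreal ((u x)\<^sup>2) \<partial>\<mu>) = (\<integral>\<^sup>+x. ennreal (1 / c\<^sup>2) * ennreal ((c * u x)\<^sup>2) \<partial>\<mu>)"
      using False by (intro nn_integral_cong) (simp add: ennreal_mult[symmetric] power_mult_distrib)
    also have "\<dots> = ennreal (1 / c\<^sup>2) * (\<integral>\<^sup>+x. ennreal ((c * u x)\<^sup>2) \<partial>\<mu>)"
      by (rule nn_integral_cmult) measurable
    also have "\<dots> < \<infinity>" using mult.prems by (simp add: ennreal_mult_less_top)
    finally show ?thesis
      using mult by (intro lipschitz_approximable_cmult[OF sets]) auto
  qed
next
  case (add u v)
  have "(\<integral>\<^sup>+x. ennreal ((u x)\<^sup>2) \<partial>\<mu>) \<le> (\<integral>\<^sup>+x. ennreal ((v x + u x)\<^sup>2) \<partial>\<mu>)"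
    "(\<integral>\<^sup>+x. ennreal ((v x)\<^sup>2) \<partial>\<mu>) \<le> (\<integral>\<^sup>+x. ennreal ((v x + u x)\<^sup>2) \<partial>\<mu>)"
    using add.hyps(2,4) by (auto intro!: nn_integral_mono ennreal_leI power_mono)
  then show ?case
    using add by (intro lipschitz_approximable_add[OF sets]) (auto intro: le_less_trans)
next
  case (seq U)
  have [measurable]: "U i \<in> borel_measurable \<mu>" "\<phi> \<in> borel_measurable \<mu>" for i using seq.hyps(1) assms(3) by auto
  have le: "U i x \<le> \<phi> x" if "x \<in> space \<mu>" for i x
    using seq.hyps(3) seq.hyps(4)[OF that] by (intro incseq_le) (auto simp: incseq_def le_fun_def)
  have U2: "(\<integral>\<^sup>+x. ennreal ((U i x)\<^sup>2) \<partial>\<mu>) < \<infinity>" for i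
  proof -
    have "(\<integral>\<^sup>+x. ennreal ((U i x)\<^sup>2) \<partial>\<mu>) \<le> (\<integral>\<^sup>+x. ennreal ((\<phi> x)\<^sup>2) \<partial>\<mu>)"
      using le seq.hyps(2) by (intro nn_integral_mono ennreal_leI power_mono) auto
    also have "\<dots> < \<infinity>" by fact
    finally show ?thesis .
  qed
  have lim: "(\<lambda>i. \<integral>\<^sup>+x. ennreal ((\<phi> x - U i x)\<^sup>2) \<partial>\<mu>) \<longlonglongrightarrow> (\<integral>\<^sup>+x. 0 \<partial>\<mu>)"
  proof (rule nn_integral_dominated_convergence[where w = "\<lambda>x. ennreal ((\<phi> x)\<^sup>2)"])
    show "AE x in \<mu>. ennreal ((\<phi> x - U i x)\<^sup>2) \<le> ennreal ((\<phi> x)\<^sup>2)" for i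
      using le seq.hyps(2) by (intro AE_I2 ennreal_leI power_mono) auto
    show "AE x in \<mu>. (\<lambda>i. ennreal ((\<phi> x - U i x)\<^sup>2)) \<longlonglongrightarrow> 0"
    proof (rule AE_I2)
      fix x assume "x \<in> space \<mu>"
      then have "(\<lambda>i. ennreal ((\<phi> x - U i x)\<^sup>2)) \<longlonglongrightarrow> ennreal ((\<phi> x - \<phi> x)\<^sup>2)"
        by (intro tendsto_ennrealI tendsto_intros seq.hyps(4))
      then show "(\<lambda>i. ennreal ((\<phi> x - U i x)\<^sup>2)) \<longlonglongrightarrow> 0" by simp
    qed
  qed (use seq.prems in auto)
  show ?case
  proof (rule lipschitz_approximable_limit[OF sets])
    fix e :: real assume e: "0 < e"
    have "eventually (\<lambda>i. (\<integral>\<^sup>+x. ennreal ((\<phi> x - U i x)\<^sup>2) \<partial>\<mu>) < ennreal e) sequentially"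
      using lim e by (intro order_tendstoD(2)) auto
    then obtain i where "(\<integral>\<^sup>+x. ennreal ((\<phi> x - U i x)\<^sup>2) \<partial>\<mu>) < ennreal e"
      by (auto simp: eventually_sequentially)
    then show "\<exists>\<psi>. \<psi> \<in> borel_measurable \<mu> \<and> lipschitz_approximable \<mu> \<psi> \<and> (\<integral>\<^sup>+x. ennreal ((\<phi> x - \<psi> x)\<^sup>2) \<partial>\<mu>) \<le> ennreal e"
      using seq.IH[OF U2] by (intro exI[of _ "U i"] conjI) auto
  qed measurable
qed

theorem lipschitz_approximable_square_integrable:
  fixes \<mu> :: "'a::{second_countable_topology, complete_space} measure"
  assumes fin: "finite_measure \<mu>" and sets: "sets \<mu> = sets borel"
    and [measurable]: "\<phi> \<in> borel_measurable \<mu>" and L2: "(\<integral>\<^sup>+x. ennreal ((\<phi> x)\<^sup>2) \<partial>\<mu>) < \<infinity>"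
  shows "lipschitz_approximable \<mu> \<phi>"
proof -
  have pos: "lipschitz_approximable \<mu> (\<lambda>x. max 0 (s * \<phi> x))" if "\<bar>s\<bar> = 1" for s
  proof (rule lipschitz_approximable_nonneg[OF fin sets])
    have "(\<integral>\<^sup>+x. ennreal ((max 0 (s * \<phi> x))\<^sup>2) \<partial>\<mu>) \<le> (\<integral>\<^sup>+x. ennreal ((\<phi> x)\<^sup>2) \<partial>\<mu>)"
    proof (intro nn_integral_mono ennreal_leI)
      fix x
      have "\<bar>max 0 (s * \<phi> x)\<bar> \<le> \<bar>s * \<phi> x\<bar>" by linarith
      also have "\<dots> = \<bar>\<phi> x\<bar>" using that by (simp add: abs_mult)
      finally show "(max 0 (s * \<phi> x))\<^sup>2 \<le> (\<phi> x)\<^sup>2" by (rule abs_le_square_iff[THEN iffD1])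
    qed
    then show "(\<integral>\<^sup>+x. ennreal ((max 0 (s * \<phi> x))\<^sup>2) \<partial>\<mu>) < \<infinity>" using L2 by (rule le_less_trans)
  qed auto
  have "lipschitz_approximable \<mu> (\<lambda>x. max 0 (1 * \<phi> x) + (-1) * max 0 ((-1) * \<phi> x))"
    by (intro lipschitz_approximable_add[OF sets] lipschitz_approximable_cmult[OF sets] pos) auto
  also have "(\<lambda>x. max 0 (1 * \<phi> x) + (-1) * max 0 ((-1) * \<phi> x)) = \<phi>"
    by (auto simp: fun_eq_iff max_def)
  finally show ?thesis .
qed

section \<open>Processes with continuous paths and Brownian motion\<close>

lemma tendsto_floor_grid: "(\<lambda>n. of_int \<lfloor>real (Suc n) * r\<rfloor> / real (Suc n)) \<longlonglongrightarrow> r"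
proof (rule tendsto_sandwich[of "\<lambda>n. r - 1 / real (Suc n)" _ _ "\<lambda>n. r"])
  show "(\<lambda>n. r - 1 / real (Suc n)) \<longlonglongrightarrow> r"
    using tendsto_diff[OF tendsto_const[of r] LIMSEQ_inverse_real_of_nat] by (simp add: inverse_eq_divide)
  show "\<forall>\<^sub>F n in sequentially. of_int \<lfloor>real (Suc n) * r\<rfloor> / real (Suc n) \<le> r"
    by (intro always_eventually allI) (simp add: divide_le_eq mult.commute)
  show "\<forall>\<^sub>F n in sequentially. r - 1 / real (Suc n) \<le> of_int \<lfloor>real (Suc n) * r\<rfloor> / real (Suc n)"
  proof (intro always_eventually allI)
    fix n
    have "real (Suc n) * r - 1 \<le> of_int \<lfloor>real (Suc n) * r\<rfloor>" by linarith
    then have "(real (Suc n) * r - 1) / real (Suc n) \<le> of_int \<lfloor>real (Suc n) * r\<rfloor> / real (Suc n)"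
      by (rule divide_right_mono) simp
    then show "r - 1 / real (Suc n) \<le> of_int \<lfloor>real (Suc n) * r\<rfloor> / real (Suc n)"
      by (simp add: diff_divide_distrib)
  qed
qed simp

text \<open>A continuous process is the limit of processes that are constant between the points of a grid.
  Clamping the time to the interval extends the process to all times.\<close>

lemma continuous_process_jointly_measurable:
  fixes X :: "real \<Rightarrow> 'w \<Rightarrow> 'b::metric_space"
  assumes "0 \<le> T" and meas: "\<And>t. t \<in> {0..T} \<Longrightarrow> X t \<in> borel_measurable A"
    and cont: "\<And>\<omega>. \<omega> \<in> space A \<Longrightarrow> continuous_on {0..T} (\<lambda>t. X t \<omega>)"
  shows "(\<lambda>(r, \<omega>). X (max 0 (min T r)) \<omega>) \<in> borel_measurable (borel \<Otimes>\<^sub>M A)"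
proof -
  define Z where "Z = (\<lambda>n p. X (max 0 (min T (of_int \<lfloor>real (Suc n) * fst p\<rfloor> / real (Suc n)))) (snd p))"
  have "Z n \<in> borel_measurable (borel \<Otimes>\<^sub>M A)" for n
    unfolding Z_def
  proof (rule measurable_compose_countable[where g = "\<lambda>p. \<lfloor>real (Suc n) * fst p\<rfloor>" and f = "\<lambda>i p. X (max 0 (min T (of_int i / real (Suc n)))) (snd p)"])
    show "(\<lambda>p. X (max 0 (min T (of_int i / real (Suc n)))) (snd p)) \<in> borel_measurable (borel \<Otimes>\<^sub>M A)" for i
      using \<open>0 \<le> T\<close> by (intro measurable_compose[OF measurable_snd meas]) auto
    show "(\<lambda>p. \<lfloor>real (Suc n) * fst p\<rfloor>) \<in> measurable (borel \<Otimes>\<^sub>M A) (count_space UNIV)"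
      by measurable
  qed
  moreover have "(\<lambda>n. Z n p) \<longlonglongrightarrow> (\<lambda>(r, \<omega>). X (max 0 (min T r)) \<omega>) p" if "p \<in> space (borel \<Otimes>\<^sub>M A)" for p
  proof -
    obtain r \<omega> where p: "p = (r, \<omega>)" by (cases p)
    have \<omega>: "\<omega> \<in> space A" using that p by (auto simp: space_pair_measure)
    have "(\<lambda>n. X (max 0 (min T (of_int \<lfloor>real (Suc n) * r\<rfloor> / real (Suc n)))) \<omega>) \<longlonglongrightarrow> X (max 0 (min T r)) \<omega>"
    proof (rule continuous_on_tendsto_compose[OF cont[OF \<omega>]])
      show "(\<lambda>n. max 0 (min T (of_int \<lfloor>real (Suc n) * r\<rfloor> / real (Suc n)))) \<longlonglongrightarrow> max 0 (min T r)"
        by (intro tendsto_max tendsto_min tendsto_const tendsto_floor_grid)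
    qed (use \<open>0 \<le> T\<close> in auto)
    then show ?thesis by (simp add: Z_def p)
  qed
  ultimately show ?thesis by (rule borel_measurable_LIMSEQ_metric)
qed

context brownian_motion
begin

lemma space_F: "0 \<le> t \<Longrightarrow> space (F t) = space M"
  using subalgebra_F by (simp add: subalgebra_def)

lemma measurable_F_M: "f \<in> measurable (F t) R \<Longrightarrow> 0 \<le> t \<Longrightarrow> f \<in> measurable M R"
  by (rule measurable_from_subalg[OF subalgebra_F])

lemma measurable_F_mono:
  assumes "f \<in> measurable (F s) R" "0 \<le> s" "s \<le> t"
  shows "f \<in> measurable (F t) R"
proof (rule measurable_from_subalg[OF _ assms(1)])
  show "subalgebra (F t) (F s)"
    using sets_F_mono[OF assms(2,3)] space_F[of s] space_F[of t] assms by (simp add: subalgebra_def)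
qed

lemma W_measurable: "0 \<le> t \<Longrightarrow> W t \<in> borel_measurable M"
  by (rule measurable_F_M[OF adapted])

lemma increment_law:
  assumes "0 \<le> s" "s < t"
  shows "distr M borel (\<lambda>\<omega>. W t \<omega> - W s \<omega>) = gauss (t - s)"
proof -
  have "distr M borel (\<lambda>\<omega>. W t \<omega> - W s \<omega>) = distr M lborel (\<lambda>\<omega>. W t \<omega> - W s \<omega>)"
    by (rule distr_cong) auto
  also have "\<dots> = density lborel (\<lambda>x. ennreal (\<Prod>i\<in>UNIV. normal_density 0 (sqrt (t - s)) (x $ i)))"
    using normal_increments[OF assms] by (simp add: distributed_def)
  also have "\<dots> = gauss (t - s)"
    unfolding gauss_def using assms by (subst gauss_density_eq_prod) auto
  finally show ?thesis .
qed

text \<open>Independence says that the joint law of the past and the increment is a product; the past is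
  represented by the identity map into the smaller sigma-algebra.\<close>

lemma increment_freezing:
  assumes st: "0 \<le> s" "s < t" and H[measurable]: "H \<in> borel_measurable (F s \<Otimes>\<^sub>M borel)"
  shows "(\<integral>\<^sup>+\<omega>. H (\<omega>, W t \<omega> - W s \<omega>) \<partial>M) = (\<integral>\<^sup>+\<omega>. (\<integral>\<^sup>+x. H (\<omega>, x) \<partial>gauss (t - s)) \<partial>M)"
proof -
  define D where "D = (\<lambda>\<omega>. W t \<omega> - W s \<omega>)"
  interpret gs: prob_space "gauss (t - s) :: (real^'d) measure" using st by (intro prob_space_gauss) auto
  have id: "(\<lambda>\<omega>. \<omega>) \<in> measurable M (F s)"
    by (rule measurable_F_M[OF measurable_ident_sets[OF refl] st(1)])
  have D[measurable]: "D \<in> borel_measurable M"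
    unfolding D_def using st by (intro borel_measurable_diff W_measurable) auto
  have pair: "(\<lambda>\<omega>. (\<omega>, D \<omega>)) \<in> measurable M (F s \<Otimes>\<^sub>M borel)"
    by (rule measurable_Pair[OF id D])
  interpret d1: prob_space "distr M (F s) (\<lambda>\<omega>. \<omega>)" by (rule prob_space_distr[OF id])
  interpret d2: prob_space "distr M borel D" by (rule prob_space_distr[OF D])
  have eq: "distr M (F s) (\<lambda>\<omega>. \<omega>) \<Otimes>\<^sub>M distr M borel D = distr M (F s \<Otimes>\<^sub>M borel) (\<lambda>\<omega>. (\<omega>, D \<omega>))"
  proof (rule pair_measure_eqI)
    show "sigma_finite_measure (distr M (F s) (\<lambda>\<omega>. \<omega>))" by (rule d1.sigma_finite_measure_axioms)
    show "sigma_finite_measure (distr M borel D)" by (rule d2.sigma_finite_measure_axioms)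
    show "sets (distr M (F s) (\<lambda>\<omega>. \<omega>) \<Otimes>\<^sub>M distr M borel D) = sets (distr M (F s \<Otimes>\<^sub>M borel) (\<lambda>\<omega>. (\<omega>, D \<omega>)))"
      unfolding sets_distr by (rule sets_pair_measure_cong) (simp_all only: sets_distr)
    fix A B assume "A \<in> sets (distr M (F s) (\<lambda>\<omega>. \<omega>))" "B \<in> sets (distr M borel D)"
    then have A: "A \<in> sets (F s)" and B: "B \<in> sets borel" by simp_all
    have A': "A \<subseteq> space M" using sets.sets_into_space[OF A] space_F[OF st(1)] by simp
    have "D -` B \<inter> space M \<in> sets (vimage_algebra (space M) D borel)"
      by (rule in_vimage_algebra[OF B])
    then have "prob (A \<inter> (D -` B \<inter> space M)) = prob A * prob (D -` B \<inter> space M)"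
      using indep_setD[OF indep_increments[OF st] A] unfolding D_def by blast
    moreover have "(\<lambda>\<omega>. (\<omega>, D \<omega>)) -` (A \<times> B) \<inter> space M = A \<inter> (D -` B \<inter> space M)"
      by auto
    moreover have "(\<lambda>\<omega>. \<omega>) -` A \<inter> space M = A" using A' by auto
    moreover have "A \<times> B \<in> sets (F s \<Otimes>\<^sub>M borel)" using A B by simp
    ultimately show "emeasure (distr M (F s) (\<lambda>\<omega>. \<omega>)) A * emeasure (distr M borel D) B =
        emeasure (distr M (F s \<Otimes>\<^sub>M borel) (\<lambda>\<omega>. (\<omega>, D \<omega>))) (A \<times> B)"
      using A B by (simp add: emeasure_distr[OF id] emeasure_distr[OF D] emeasure_distr[OF pair] emeasure_eq_measure ennreal_mult)
  qed
  have law: "distr M borel D = gauss (t - s)"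
    unfolding D_def by (rule increment_law[OF st])
  have sets_eq: "sets (F s \<Otimes>\<^sub>M (gauss (t - s) :: (real^'d) measure)) = sets (F s \<Otimes>\<^sub>M borel)"
    by (rule sets_pair_measure_cong) auto
  have sets_eq2: "sets (distr M (F s) (\<lambda>\<omega>. \<omega>) \<Otimes>\<^sub>M (gauss (t - s) :: (real^'d) measure)) = sets (F s \<Otimes>\<^sub>M borel)"
    by (rule sets_pair_measure_cong) auto
  have inner: "(\<lambda>\<omega>. \<integral>\<^sup>+x. H (\<omega>, x) \<partial>gauss (t - s)) \<in> borel_measurable (F s)"
    by (rule gs.borel_measurable_nn_integral) (simp add: measurable_cong_sets[OF sets_eq refl])
  have "(\<integral>\<^sup>+\<omega>. H (\<omega>, D \<omega>) \<partial>M) = (\<integral>\<^sup>+p. H p \<partial>distr M (F s \<Otimes>\<^sub>M borel) (\<lambda>\<omega>. (\<omega>, D \<omega>)))"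
    by (rule nn_integral_distr[OF pair, symmetric]) (use H in simp)
  also have "\<dots> = (\<integral>\<^sup>+p. H p \<partial>(distr M (F s) (\<lambda>\<omega>. \<omega>) \<Otimes>\<^sub>M gauss (t - s)))"
    by (simp add: eq[symmetric] law)
  also have "\<dots> = (\<integral>\<^sup>+\<omega>. (\<integral>\<^sup>+x. H (\<omega>, x) \<partial>gauss (t - s)) \<partial>distr M (F s) (\<lambda>\<omega>. \<omega>))"
    by (rule gs.nn_integral_fst[symmetric]) (simp add: measurable_cong_sets[OF sets_eq2 refl])
  also have "\<dots> = (\<integral>\<^sup>+\<omega>. (\<integral>\<^sup>+x. H (\<omega>, x) \<partial>gauss (t - s)) \<partial>M)"
    by (rule nn_integral_distr[OF id]) (use inner in simp)
  finally show ?thesis unfolding D_def .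
qed

lemma gaussian_walk_increments:
  assumes "0 < \<delta>"
  shows "gaussian_walk M (\<lambda>k. F (real k * \<delta>)) (\<lambda>k \<omega>. W (real (Suc k) * \<delta>) \<omega> - W (real k * \<delta>) \<omega>) \<delta> N"
proof (intro gaussian_walk.intro gaussian_walk_axioms.intro)
  show "prob_space M" by (rule prob_space_axioms)
  show "0 < \<delta>" by fact
  show "subalgebra M (F (real k * \<delta>))" for k
    using assms by (intro subalgebra_F) simp
  have le: "real k * \<delta> \<le> real (Suc k) * \<delta>" for k using assms by (intro mult_right_mono) auto
  show "sets (F (real k * \<delta>)) \<subseteq> sets (F (real (Suc k) * \<delta>))" for k
    using assms le by (intro sets_F_mono) auto
  show "(\<lambda>\<omega>. W (real (Suc k) * \<delta>) \<omega> - W (real k * \<delta>) \<omega>) \<in> borel_measurable (F (real (Suc k) * \<delta>))" for k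
  proof (rule borel_measurable_diff)
    show "W (real (Suc k) * \<delta>) \<in> borel_measurable (F (real (Suc k) * \<delta>))"
      using assms by (intro adapted) auto
    show "W (real k * \<delta>) \<in> borel_measurable (F (real (Suc k) * \<delta>))"
      by (rule measurable_F_mono[OF adapted _ le]) (use assms in auto)
  qed
  show "(\<integral>\<^sup>+\<omega>. H (\<omega>, W (real (Suc k) * \<delta>) \<omega> - W (real k * \<delta>) \<omega>) \<partial>M) = (\<integral>\<^sup>+\<omega>. (\<integral>\<^sup>+x. H (\<omega>, x) \<partial>gauss \<delta>) \<partial>M)"
    if "H \<in> borel_measurable (F (real k * \<delta>) \<Otimes>\<^sub>M borel)" for k H
  proof -
    have "real (Suc k) * \<delta> - real k * \<delta> = \<delta>" by (simp add: distrib_right)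
    moreover have "real k * \<delta> < real (Suc k) * \<delta>" using assms by simp
    ultimately show ?thesis
      using increment_freezing[OF _ _ that, of "real (Suc k) * \<delta>"] assms by simp
  qed
qed

lemma W_law:
  assumes "0 < t" and [measurable]: "f \<in> borel_measurable borel"
  shows "(\<integral>\<^sup>+\<omega>. f (W t \<omega>) \<partial>M) = (\<integral>\<^sup>+x. f x \<partial>gauss t)"
proof -
  have [measurable]: "W t \<in> borel_measurable M" "W 0 \<in> borel_measurable M"
    using assms(1) by (auto intro: W_measurable)
  have "(\<integral>\<^sup>+\<omega>. f (W t \<omega>) \<partial>M) = (\<integral>\<^sup>+\<omega>. f (W t \<omega> - W 0 \<omega>) \<partial>M)"
    using start by (intro nn_integral_cong_AE) auto
  also have "\<dots> = (\<integral>\<^sup>+x. f x \<partial>distr M borel (\<lambda>\<omega>. W t \<omega> - W 0 \<omega>))"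
    by (rule nn_integral_distr[symmetric]) auto
  also have "\<dots> = (\<integral>\<^sup>+x. f x \<partial>gauss t)"
    using increment_law[of 0 t] assms(1) by simp
  finally show ?thesis .
qed

lemma W_pair_law:
  assumes s: "0 < s" "s < t" and H[measurable]: "H \<in> borel_measurable (borel \<Otimes>\<^sub>M borel)"
  shows "(\<integral>\<^sup>+\<omega>. H (W s \<omega>, W t \<omega> - W s \<omega>) \<partial>M) = (\<integral>\<^sup>+z. (\<integral>\<^sup>+w. H (w, z) \<partial>gauss s) \<partial>gauss (t - s))"
proof -
  interpret gs: prob_space "gauss s :: (real^'d) measure" using s by (intro prob_space_gauss)
  interpret gt: prob_space "gauss (t - s) :: (real^'d) measure" using s by (intro prob_space_gauss) auto
  interpret P: pair_sigma_finite "gauss (t - s) :: (real^'d) measure" "gauss s :: (real^'d) measure"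
    by (intro pair_sigma_finite.intro gs.sigma_finite_measure_axioms gt.sigma_finite_measure_axioms)
  have [measurable]: "W s \<in> borel_measurable (F s)" using s by (intro adapted) auto
  have sets_eq: "sets ((gauss s :: (real^'d) measure) \<Otimes>\<^sub>M (gauss (t - s) :: (real^'d) measure)) = sets (borel \<Otimes>\<^sub>M borel)"
    "sets ((gauss (t - s) :: (real^'d) measure) \<Otimes>\<^sub>M (gauss s :: (real^'d) measure)) = sets (borel \<Otimes>\<^sub>M borel)"
    "sets ((borel :: (real^'d) measure) \<Otimes>\<^sub>M (gauss (t - s) :: (real^'d) measure)) = sets (borel \<Otimes>\<^sub>M borel)"
    by (rule sets_pair_measure_cong; simp)+
  have "(\<lambda>(\<omega>, x). H (W s \<omega>, x)) \<in> borel_measurable (F s \<Otimes>\<^sub>M borel)" by measurable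
  from increment_freezing[OF _ s(2) this] s(1)
  have "(\<integral>\<^sup>+\<omega>. H (W s \<omega>, W t \<omega> - W s \<omega>) \<partial>M) = (\<integral>\<^sup>+\<omega>. (\<integral>\<^sup>+z. H (W s \<omega>, z) \<partial>gauss (t - s)) \<partial>M)"
    by simp
  also have "\<dots> = (\<integral>\<^sup>+w. (\<integral>\<^sup>+z. H (w, z) \<partial>gauss (t - s)) \<partial>gauss s)"
  proof (rule W_law[OF s(1)])
    show "(\<lambda>w. \<integral>\<^sup>+z. H (w, z) \<partial>gauss (t - s)) \<in> borel_measurable borel"
      by (rule gt.borel_measurable_nn_integral) (simp add: measurable_cong_sets[OF sets_eq(3) refl])
  qed
  also have "\<dots> = (\<integral>\<^sup>+z. (\<integral>\<^sup>+w. H (w, z) \<partial>gauss s) \<partial>gauss (t - s))"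
    by (rule P.Fubini') (simp only: measurable_cong_sets[OF sets_eq(2) refl], measurable)
  finally show ?thesis .
qed

lemma W_exp_moment:
  assumes "0 \<le> t" "t \<le> T"
  shows "(\<integral>\<^sup>+\<omega>. ennreal (exp (l * norm (W t \<omega>))) \<partial>M) \<le> ennreal (exp (T * l\<^sup>2) * sqrt 2 ^ CARD('d))"
proof (cases "t = 0")
  case True
  have "(\<integral>\<^sup>+\<omega>. ennreal (exp (l * norm (W t \<omega>))) \<partial>M) = (\<integral>\<^sup>+\<omega>. 1 \<partial>M)"
    using start True by (intro nn_integral_cong_AE) auto
  also have "\<dots> = 1" using emeasure_space_1 by simp
  also have "\<dots> = ennreal (1 * 1)" by simp
  also have "\<dots> \<le> ennreal (exp (T * l\<^sup>2) * sqrt 2 ^ CARD('d))"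
    using assms by (intro ennreal_leI mult_mono one_le_power) auto
  finally show ?thesis .
next
  case False
  then have t: "0 < t" using assms by simp
  have "(\<integral>\<^sup>+\<omega>. ennreal (exp (l * norm (W t \<omega>))) \<partial>M) = (\<integral>\<^sup>+x. ennreal (exp (l * norm x)) \<partial>(gauss t :: (real^'d) measure))"
    by (rule W_law[OF t]) measurable
  also have "\<dots> \<le> ennreal (exp (t * l\<^sup>2) * sqrt 2 ^ CARD('d))"
    by (rule nn_integral_gauss_exp_norm[OF t])
  also have "\<dots> \<le> ennreal (exp (T * l\<^sup>2) * sqrt 2 ^ CARD('d))"
    using assms by (intro ennreal_leI mult_right_mono) (auto simp: mult_right_mono)
  finally show ?thesis .
qed

lemma W_increment_mean:
  assumes "0 \<le> s" "s \<le> t"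
  shows "(\<integral>\<^sup>+\<omega>. ennreal (norm (W t \<omega> - W s \<omega>)) \<partial>M) \<le> ennreal (sqrt (4 * (t - s) * sqrt 2 ^ CARD('d)))"
proof (cases "s = t")
  case False
  then have st: "s < t" using assms by simp
  have [measurable]: "W t \<in> borel_measurable M" "W s \<in> borel_measurable M"
    using assms by (auto intro: W_measurable)
  have "(\<integral>\<^sup>+\<omega>. ennreal ((norm (W t \<omega> - W s \<omega>))\<^sup>2) \<partial>M) = (\<integral>\<^sup>+x. ennreal ((norm x)\<^sup>2) \<partial>distr M borel (\<lambda>\<omega>. W t \<omega> - W s \<omega>))"
    by (rule nn_integral_distr[symmetric]) auto
  also have "\<dots> = (\<integral>\<^sup>+x. ennreal ((norm x)\<^sup>2) \<partial>(gauss (t - s) :: (real^'d) measure))"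
    by (simp add: increment_law[OF assms(1) st])
  also have "\<dots> \<le> ennreal (4 * (t - s) * sqrt 2 ^ CARD('d))"
    using st by (intro nn_integral_gauss_norm_square) simp
  finally have sq: "(\<integral>\<^sup>+\<omega>. ennreal ((norm (W t \<omega> - W s \<omega>))\<^sup>2) \<partial>M) \<le> ennreal (4 * (t - s) * sqrt 2 ^ CARD('d))" .
  have one: "(\<integral>\<^sup>+\<omega>. ennreal (1\<^sup>2) \<partial>M) \<le> ennreal 1"
    using emeasure_space_1 by simp
  have "(\<integral>\<^sup>+\<omega>. ennreal (norm (W t \<omega> - W s \<omega>) * 1) \<partial>M) \<le> ennreal (sqrt (4 * (t - s) * sqrt 2 ^ CARD('d)) * sqrt 1)"
    using assms by (intro nn_integral_Cauchy_Schwarz_real sq one) auto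
  then show ?thesis by simp
qed simp

end

section \<open>A discretised Girsanov transform for the solution\<close>

lemma nn_integral_density_inverse:
  assumes [measurable]: "D \<in> borel_measurable M" "D' \<in> borel_measurable M" "A \<in> borel_measurable M"
    and "\<And>\<omega>. D \<omega> * D' \<omega> = (1::real)" "\<And>\<omega>. 0 \<le> D \<omega>" "\<And>\<omega>. 0 \<le> D' \<omega>"
  shows "(\<integral>\<^sup>+\<omega>. ennreal (D' \<omega>) * A \<omega> \<partial>density M (\<lambda>\<omega>. ennreal (D \<omega>))) = (\<integral>\<^sup>+\<omega>. A \<omega> \<partial>M)"
proof -
  have "(\<integral>\<^sup>+\<omega>. ennreal (D' \<omega>) * A \<omega> \<partial>density M (\<lambda>\<omega>. ennreal (D \<omega>))) = (\<integral>\<^sup>+\<omega>. ennreal (D \<omega>) * (ennreal (D' \<omega>) * A \<omega>) \<partial>M)"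
    by (rule nn_integral_density) auto
  also have "\<dots> = (\<integral>\<^sup>+\<omega>. A \<omega> \<partial>M)"
    by (intro nn_integral_cong) (simp add: mult.assoc[symmetric] ennreal_mult[symmetric] assms(4,5,6))
  finally show ?thesis .
qed

text \<open>The matrix \<open>\<sigma>'\<close>, an inverse of \<open>\<sigma>\<close>, translates a drift of the solution into a drift of the driving
  noise. Through it the bound \<open>B\<close> on the drift becomes the bound \<open>c' * B\<close> in the densities.\<close>

locale additive_sde = brownian_motion M F W + nondegenerate_matrix \<sigma> c J
  for M :: "'w measure" and F and W :: "real \<Rightarrow> 'w \<Rightarrow> real^'d" and \<sigma> :: "real^'d^'d" and c J +
  fixes T :: real and x0 :: "real^'d" and b :: "real^'d \<Rightarrow> real^'d" and B :: real
    and \<sigma>' :: "real^'d^'d" and c' :: real and X :: "real \<Rightarrow> 'w \<Rightarrow> real^'d"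
  assumes T_pos: "0 < T" and \<sigma>_inverse: "\<sigma> ** \<sigma>' = mat 1"
    and c'_nonneg: "0 \<le> c'" and norm_inverse_le: "\<And>v. norm (\<sigma>' *v v) \<le> c' * norm v"
    and b_measurable [measurable]: "b \<in> borel_measurable borel" and b_bound: "\<And>x. norm (b x) \<le> B"
    and X_adapted: "\<And>t. t \<in> {0..T} \<Longrightarrow> X t \<in> borel_measurable (F t)"
    and X_continuous: "\<And>\<omega>. \<omega> \<in> space M \<Longrightarrow> continuous_on {0..T} (\<lambda>t. X t \<omega>)"
    and X_equation: "AE \<omega> in M. \<forall>t\<in>{0..T}. X t \<omega> = x0 + (LINT s:{0..t}|lborel. b (X s \<omega>)) + \<sigma> *v W t \<omega>"
begin

lemma B_nonneg: "0 \<le> B"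
  using order_trans[OF norm_ge_zero b_bound] .

lemma X_measurable: "t \<in> {0..T} \<Longrightarrow> X t \<in> borel_measurable M"
  by (rule measurable_F_M[OF X_adapted]) auto

lemma X_jointly_measurable:
  assumes "0 \<le> t" "t \<le> T"
  shows "(\<lambda>(r, \<omega>). X (max 0 (min t r)) \<omega>) \<in> borel_measurable (borel \<Otimes>\<^sub>M F t)"
proof (rule continuous_process_jointly_measurable[OF assms(1)])
  show "X r \<in> borel_measurable (F t)" if "r \<in> {0..t}" for r
    by (rule measurable_F_mono[OF X_adapted]) (use that assms in auto)
  show "continuous_on {0..t} (\<lambda>t. X t \<omega>)" if "\<omega> \<in> space (F t)" for \<omega>
    by (rule continuous_on_subset[OF X_continuous]) (use that space_F[OF assms(1)] assms in auto)
qed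

lemma X_jointly_measurable_M: "(\<lambda>(r, \<omega>). X (max 0 (min T r)) \<omega>) \<in> borel_measurable (borel \<Otimes>\<^sub>M M)"
  using T_pos by (intro continuous_process_jointly_measurable X_measurable X_continuous) auto

lemma X_path_measurable:
  assumes "\<omega> \<in> space M"
  shows "(\<lambda>r. X (max 0 (min T r)) \<omega>) \<in> borel_measurable borel"
  using measurable_compose[OF measurable_Pair2'[OF assms] X_jointly_measurable_M] by simp

text \<open>The value 0 outside the sample space only serves to make the bounds below unconditional.\<close>

definition drift :: "real \<Rightarrow> 'w \<Rightarrow> real^'d" where
  "drift t \<omega> = (if \<omega> \<in> space M then LINT s:{0..t}|lborel. b (X s \<omega>) else 0)"

lemma drift_measurable:
  assumes "0 \<le> t" "t \<le> T"
  shows "drift t \<in> borel_measurable (F t)"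
proof -
  have [measurable]: "(\<lambda>(\<omega>, r). X (max 0 (min t r)) \<omega>) \<in> borel_measurable (F t \<Otimes>\<^sub>M borel)"
    using measurable_compose[OF measurable_pair_swap' X_jointly_measurable[OF assms]] by (simp add: split_beta')
  have "(\<lambda>(\<omega>, r). indicator {0..t} r *\<^sub>R b (X (max 0 (min t r)) \<omega>)) \<in> borel_measurable (F t \<Otimes>\<^sub>M borel)"
    by measurable
  then have "(\<lambda>\<omega>. LINT r|lborel. indicator {0..t} r *\<^sub>R b (X (max 0 (min t r)) \<omega>)) \<in> borel_measurable (F t)"
    by (intro lborel.borel_measurable_lebesgue_integral) simp
  also have "(\<lambda>\<omega>. LINT r|lborel. indicator {0..t} r *\<^sub>R b (X (max 0 (min t r)) \<omega>)) = (\<lambda>\<omega>. LINT s:{0..t}|lborel. b (X s \<omega>))"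
    unfolding set_lebesgue_integral_def
    by (intro ext Bochner_Integration.integral_cong) (auto simp: indicator_def)
  finally show ?thesis
    by (rule measurable_cong[THEN iffD1, rotated]) (simp add: drift_def space_F[OF assms(1)])
qed

lemma integrable_drift:
  assumes "\<omega> \<in> space M" "0 \<le> s" "t \<le> T" and A: "A \<in> sets borel" "A \<subseteq> {s..t}"
  shows "integrable lborel (\<lambda>r. indicator A r *\<^sub>R b (X r \<omega>))"
proof -
  have [measurable]: "(\<lambda>r. b (X (max 0 (min T r)) \<omega>)) \<in> borel_measurable borel"
    by (rule measurable_compose[OF X_path_measurable[OF assms(1)] b_measurable])
  have "emeasure lborel A \<le> emeasure lborel {s..t}"
    using A by (intro emeasure_mono) auto
  also have "\<dots> < \<infinity>" using emeasure_lborel_Icc_eq[of s t] by simp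
  finally have "integrable lborel (\<lambda>r. indicator A r *\<^sub>R b (X (max 0 (min T r)) \<omega>))"
    using A b_bound by (intro integrableI_bounded_set_indicator[where B = B]) auto
  also have "(\<lambda>r. indicator A r *\<^sub>R b (X (max 0 (min T r)) \<omega>)) = (\<lambda>r. indicator A r *\<^sub>R b (X r \<omega>))"
    using A(2) assms(2,3) by (intro ext) (auto simp: indicator_def dest!: subsetD)
  finally show ?thesis .
qed

lemma drift_diff:
  assumes "\<omega> \<in> space M" "0 \<le> s" "s \<le> t" "t \<le> T"
  shows "drift t \<omega> - drift s \<omega> = (LINT r|lborel. indicator {s<..t} r *\<^sub>R b (X r \<omega>))"
proof -
  have "integrable lborel (\<lambda>r. indicator {0..t} r *\<^sub>R b (X r \<omega>))" "integrable lborel (\<lambda>r. indicator {0..s} r *\<^sub>R b (X r \<omega>))"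
    using assms integrable_drift[of \<omega> 0 t "{0..t}"] integrable_drift[of \<omega> 0 s "{0..s}"] by auto
  then have "drift t \<omega> - drift s \<omega> = (LINT r|lborel. indicator {0..t} r *\<^sub>R b (X r \<omega>) - indicator {0..s} r *\<^sub>R b (X r \<omega>))"
    using assms(1) by (simp add: drift_def set_lebesgue_integral_def)
  also have "\<dots> = (LINT r|lborel. indicator {s<..t} r *\<^sub>R b (X r \<omega>))"
    using assms by (intro Bochner_Integration.integral_cong) (auto simp: indicator_def)
  finally show ?thesis .
qed

lemma drift_diff_approx:
  assumes "\<omega> \<in> space M" "0 \<le> s" "s \<le> t" "t \<le> T"
  shows "ennreal (norm (drift t \<omega> - drift s \<omega> - (t - s) *\<^sub>R y)) \<le> (\<integral>\<^sup>+r. indicator {s<..t} r * ennreal (norm (b (X r \<omega>) - y)) \<partial>lborel)"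
proof -
  have i1: "integrable lborel (\<lambda>r. indicator {s<..t} r *\<^sub>R b (X r \<omega>))"
    using assms by (intro integrable_drift[of \<omega> s t]) auto
  have i2: "integrable lborel (\<lambda>r. indicator {s<..t} r *\<^sub>R y)"
    using assms by (intro integrable_scaleR_left integrable_real_indicator) auto
  have "(LINT r|lborel. indicator {s<..t} r *\<^sub>R y) = (t - s) *\<^sub>R y"
    using assms by simp
  then have "drift t \<omega> - drift s \<omega> - (t - s) *\<^sub>R y = (LINT r|lborel. indicator {s<..t} r *\<^sub>R b (X r \<omega>) - indicator {s<..t} r *\<^sub>R y)"
    using i1 i2 by (simp add: drift_diff[OF assms])
  then have "ennreal (norm (drift t \<omega> - drift s \<omega> - (t - s) *\<^sub>R y)) \<le> (\<integral>\<^sup>+r. ennreal (norm (indicator {s<..t} r *\<^sub>R b (X r \<omega>) - indicator {s<..t} r *\<^sub>R y)) \<partial>lborel)"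
    using integral_norm_bound_ennreal[OF Bochner_Integration.integrable_diff[OF i1 i2]] by simp
  also have "\<dots> = (\<integral>\<^sup>+r. indicator {s<..t} r * ennreal (norm (b (X r \<omega>) - y)) \<partial>lborel)"
    by (intro nn_integral_cong) (auto simp: indicator_def)
  finally show ?thesis .
qed

lemma drift_lipschitz:
  assumes "0 \<le> s" "s \<le> t" "t \<le> T"
  shows "norm (drift t \<omega> - drift s \<omega>) \<le> B * (t - s)"
proof (cases "\<omega> \<in> space M")
  case True
  have "ennreal (norm (drift t \<omega> - drift s \<omega>)) \<le> (\<integral>\<^sup>+r. indicator {s<..t} r * ennreal (norm (b (X r \<omega>) - 0)) \<partial>lborel)"
    using drift_diff_approx[OF True assms, of 0] by simp
  also have "\<dots> \<le> (\<integral>\<^sup>+r. ennreal B * indicator {s<..t} r \<partial>lborel)"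
    using b_bound by (intro nn_integral_mono) (auto simp: indicator_def ennreal_leI)
  also have "\<dots> = ennreal (B * (t - s))"
    using assms B_nonneg by (simp add: nn_integral_cmult ennreal_mult)
  finally show ?thesis
    using assms B_nonneg by (subst (asm) ennreal_le_iff) auto
next
  case False
  then show ?thesis using assms B_nonneg by (simp add: drift_def)
qed

lemma drift_0: "drift 0 \<omega> = 0"
proof -
  have "(LINT s:{0..0::real}|lborel. b (X s \<omega>)) = 0"
    unfolding set_lebesgue_integral_def
    by (rule integral_eq_zero_AE, rule AE_mp[OF AE_lborel_singleton[of 0]]) (auto intro!: AE_I2 simp: indicator_def)
  then show ?thesis by (simp add: drift_def)
qed

text \<open>The drift is replaced by its average over the preceding interval, which is known at the
  beginning of the current one. The resulting chain differs from the solution only by the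
  drift accumulated over a single step. Subtraction on the natural numbers is truncated, so
  that the drift of the very first step is 0.\<close>

definition stp :: "nat \<Rightarrow> real" where
  "stp N = T / real N"

definition noise :: "nat \<Rightarrow> nat \<Rightarrow> 'w \<Rightarrow> real^'d" where
  "noise N k \<omega> = W (real (Suc k) * stp N) \<omega> - W (real k * stp N) \<omega>"

definition delayed_drift :: "nat \<Rightarrow> nat \<Rightarrow> 'w \<Rightarrow> real^'d" where
  "delayed_drift N k \<omega> = \<sigma>' *v ((1 / stp N) *\<^sub>R (drift (real k * stp N) \<omega> - drift (real (k - 1) * stp N) \<omega>))"

definition shifted_noise :: "nat \<Rightarrow> nat \<Rightarrow> 'w \<Rightarrow> real^'d" where
  "shifted_noise N k \<omega> = noise N k \<omega> + stp N *\<^sub>R delayed_drift N k \<omega>"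

definition chain :: "nat \<Rightarrow> nat \<Rightarrow> 'w \<Rightarrow> real^'d" where
  "chain N k \<omega> = x0 + \<sigma> *v (\<Sum>j<k. shifted_noise N j \<omega>)"

text \<open>The measure under which the chain has no drift.\<close>

definition Q :: "nat \<Rightarrow> 'w measure" where
  "Q N = density M (\<lambda>\<omega>. ennreal (girsanov_density (stp N) (\<lambda>k \<omega>. - delayed_drift N k \<omega>) (noise N) N \<omega>))"

lemma stp_pos: "1 \<le> N \<Longrightarrow> 0 < stp N"
  using T_pos by (simp add: stp_def)

lemma stp_mult: "1 \<le> N \<Longrightarrow> stp N * real N = T" "1 \<le> N \<Longrightarrow> real N * stp N = T"
  by (simp_all add: stp_def)

lemma grid_nonneg: "1 \<le> N \<Longrightarrow> 0 \<le> real k * stp N"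
  using stp_pos[of N] by simp

lemma grid_le:
  assumes "1 \<le> N" "k \<le> N"
  shows "real k * stp N \<le> T"
proof -
  have "real k * stp N \<le> real N * stp N"
    using assms stp_pos[of N] by (intro mult_right_mono) auto
  then show ?thesis using assms by (simp add: stp_mult)
qed

lemma grid_pred: "1 \<le> N \<Longrightarrow> real (k - 1) * stp N \<le> real k * stp N" "1 \<le> N \<Longrightarrow> real k * stp N - real (k - 1) * stp N \<le> stp N"
proof -
  assume N: "1 \<le> N"
  show "real (k - 1) * stp N \<le> real k * stp N" using stp_pos[OF N] by (intro mult_right_mono) auto
  have "(real k - real (k - 1)) * stp N \<le> 1 * stp N" using stp_pos[OF N] by (intro mult_right_mono) auto
  then show "real k * stp N - real (k - 1) * stp N \<le> stp N" by (simp add: left_diff_distrib)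
qed

lemma noise_walk: "1 \<le> N \<Longrightarrow> gaussian_walk M (\<lambda>k. F (real k * stp N)) (noise N) (stp N) N"
  using gaussian_walk_increments[OF stp_pos, of N N] unfolding noise_def[abs_def] .

lemma delayed_drift_measurable:
  assumes "1 \<le> N" "k \<le> N"
  shows "delayed_drift N k \<in> borel_measurable (F (real k * stp N))"
proof -
  have [measurable]: "drift (real k * stp N) \<in> borel_measurable (F (real k * stp N))"
    using assms by (intro drift_measurable grid_nonneg grid_le)
  have "drift (real (k - 1) * stp N) \<in> borel_measurable (F (real (k - 1) * stp N))"
    using assms by (intro drift_measurable grid_nonneg grid_le) auto
  then have [measurable]: "drift (real (k - 1) * stp N) \<in> borel_measurable (F (real k * stp N))"
    by (rule measurable_F_mono[OF _ grid_nonneg[OF assms(1)] grid_pred(1)[OF assms(1)]])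
  show ?thesis unfolding delayed_drift_def by measurable
qed

lemma delayed_drift_bound:
  assumes "1 \<le> N" "k \<le> N"
  shows "norm (delayed_drift N k \<omega>) \<le> c' * B"
proof -
  have "norm (drift (real k * stp N) \<omega> - drift (real (k - 1) * stp N) \<omega>) \<le> B * (real k * stp N - real (k - 1) * stp N)"
    using assms by (intro drift_lipschitz grid_nonneg grid_pred grid_le)
  also have "\<dots> \<le> B * stp N"
    using grid_pred(2)[OF assms(1)] by (intro mult_left_mono B_nonneg)
  finally have "norm ((1 / stp N) *\<^sub>R (drift (real k * stp N) \<omega> - drift (real (k - 1) * stp N) \<omega>)) \<le> B"
    unfolding norm_scaleR using stp_pos[OF assms(1)] by (simp add: pos_divide_le_eq)
  then show ?thesis
    unfolding delayed_drift_def using c'_nonneg by (intro order_trans[OF norm_inverse_le] mult_left_mono)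
qed

lemma Q_density_measurable:
  assumes "1 \<le> N"
  shows "girsanov_density (stp N) (\<lambda>k \<omega>. - delayed_drift N k \<omega>) (noise N) N \<in> borel_measurable M"
proof -
  interpret gaussian_walk M "\<lambda>k. F (real k * stp N)" "noise N" "stp N" N by (rule noise_walk[OF assms])
  show ?thesis
  proof (rule past_measurable_P[OF girsanov_density_measurable])
    show "(\<lambda>\<omega>. - delayed_drift N j \<omega>) \<in> borel_measurable (F (real j * stp N))" if "j < N" for j
      using delayed_drift_measurable[OF assms, of j] that by simp
  qed auto
qed

text \<open>The density takes away the drift that was added to the noise; this is legitimate because the delayed
  drift of a step belongs to the past of that step.\<close>

lemma shifted_noise_walk:
  assumes "1 \<le> N"
  shows "gaussian_walk (Q N) (\<lambda>k. F (real k * stp N)) (shifted_noise N) (stp N) N"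
proof -
  interpret gaussian_walk M "\<lambda>k. F (real k * stp N)" "noise N" "stp N" N by (rule noise_walk[OF assms])
  have "(\<lambda>\<omega>. - delayed_drift N j \<omega>) \<in> borel_measurable (F (real j * stp N))" if "j < N" for j
    using delayed_drift_measurable[OF assms, of j] that by simp
  from girsanov[OF this] show ?thesis
    unfolding Q_def shifted_noise_def[abs_def] by simp
qed

lemma space_Q [simp]: "space (Q N) = space M" and sets_Q [measurable_cong]: "sets (Q N) = sets M"
  by (simp_all add: Q_def)

lemma back_density_measurable:
  assumes "1 \<le> N"
  shows "girsanov_density (stp N) (delayed_drift N) (shifted_noise N) N \<in> borel_measurable M"
proof -
  note walk = shifted_noise_walk[OF assms]
  have "girsanov_density (stp N) (delayed_drift N) (shifted_noise N) N \<in> borel_measurable (Q N)"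
    by (rule gaussian_walk.past_measurable_P[OF walk gaussian_walk.girsanov_density_measurable[OF walk]])
       (use delayed_drift_measurable[OF assms] in auto)
  then show ?thesis by (simp add: measurable_cong_sets[OF sets_Q refl])
qed

lemma nn_integral_M_via_Q:
  assumes "1 \<le> N" "A \<in> borel_measurable M"
  shows "(\<integral>\<^sup>+\<omega>. A \<omega> \<partial>M) = (\<integral>\<^sup>+\<omega>. ennreal (girsanov_density (stp N) (delayed_drift N) (shifted_noise N) N \<omega>) * A \<omega> \<partial>Q N)"
  unfolding Q_def
proof (rule nn_integral_density_inverse[symmetric])
  show "girsanov_density (stp N) (\<lambda>k \<omega>. - delayed_drift N k \<omega>) (noise N) N \<omega> * girsanov_density (stp N) (delayed_drift N) (shifted_noise N) N \<omega> = 1" for \<omega>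
    unfolding shifted_noise_def[abs_def] by (rule girsanov_density_inverse)
qed (use assms Q_density_measurable back_density_measurable in auto)

lemma Q_as_M:
  assumes "1 \<le> N" "A \<in> borel_measurable M"
  shows "(\<integral>\<^sup>+\<omega>. A \<omega> \<partial>Q N) = (\<integral>\<^sup>+\<omega>. ennreal (girsanov_density (stp N) (\<lambda>k \<omega>. - delayed_drift N k \<omega>) (noise N) N \<omega>) * A \<omega> \<partial>M)"
  unfolding Q_def using Q_density_measurable[OF assms(1)] assms(2) by (intro nn_integral_density) auto

lemma shifted_noise_law:
  assumes "1 \<le> N" "\<Theta> \<in> borel_measurable (\<Pi>\<^sub>M i\<in>{..<N}. borel)"
  shows "(\<integral>\<^sup>+\<omega>. \<Theta> (\<lambda>i\<in>{..<N}. shifted_noise N i \<omega>) \<partial>Q N) = (\<integral>\<^sup>+\<omega>. \<Theta> (\<lambda>i\<in>{..<N}. noise N i \<omega>) \<partial>M)"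
  using gaussian_walk.increments_law[OF shifted_noise_walk[OF assms(1)] assms(2)]
    gaussian_walk.increments_law[OF noise_walk[OF assms(1)] assms(2)] by simp

lemma sum_noise: "(\<Sum>j<k. noise N j \<omega>) = W (real k * stp N) \<omega> - W 0 \<omega>"
  by (induction k) (simp_all add: noise_def)

text \<open>The chain under \<open>Q N\<close> and the driftless process under \<open>M\<close> are the same function of a Gaussian walk.\<close>

lemma chain_law:
  assumes N: "1 \<le> N" and "j \<le> N" "k \<le> N" and f: "f \<in> borel_measurable (borel \<Otimes>\<^sub>M borel)"
  shows "(\<integral>\<^sup>+\<omega>. f (chain N j \<omega>, chain N k \<omega>) \<partial>Q N) = (\<integral>\<^sup>+\<omega>. f (x0 + \<sigma> *v W (real j * stp N) \<omega>, x0 + \<sigma> *v W (real k * stp N) \<omega>) \<partial>M)"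
proof -
  define \<Theta> where "\<Theta> = (\<lambda>w. f (x0 + \<sigma> *v (\<Sum>i<j. w i), x0 + \<sigma> *v (\<Sum>i<k. w i)))"
  have [measurable]: "(\<lambda>w. \<Sum>i<l. w i) \<in> borel_measurable (\<Pi>\<^sub>M i\<in>{..<N}. (borel :: (real^'d) measure))" if "l \<le> N" for l
    using that by (intro borel_measurable_sum measurable_component_singleton) auto
  have "(\<lambda>w. (x0 + \<sigma> *v (\<Sum>i<j. w i), x0 + \<sigma> *v (\<Sum>i<k. w i))) \<in> (\<Pi>\<^sub>M i\<in>{..<N}. borel) \<rightarrow>\<^sub>M borel \<Otimes>\<^sub>M borel"
    using assms(2,3) by measurable
  from measurable_compose[OF this f] have \<Theta>: "\<Theta> \<in> borel_measurable (\<Pi>\<^sub>M i\<in>{..<N}. borel)"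
    unfolding \<Theta>_def .
  have sums: "(\<Sum>i<l. (\<lambda>i\<in>{..<N}. w i) i) = (\<Sum>i<l. w i)" if "l \<le> N" for l and w :: "nat \<Rightarrow> real^'d"
    using that by (intro sum.cong) auto
  have "(\<integral>\<^sup>+\<omega>. f (chain N j \<omega>, chain N k \<omega>) \<partial>Q N) = (\<integral>\<^sup>+\<omega>. \<Theta> (\<lambda>i\<in>{..<N}. shifted_noise N i \<omega>) \<partial>Q N)"
    unfolding \<Theta>_def sums[OF assms(2)] sums[OF assms(3)] chain_def ..
  also have "\<dots> = (\<integral>\<^sup>+\<omega>. \<Theta> (\<lambda>i\<in>{..<N}. noise N i \<omega>) \<partial>M)"
    by (rule shifted_noise_law[OF N \<Theta>])
  also have "\<dots> = (\<integral>\<^sup>+\<omega>. f (x0 + \<sigma> *v W (real j * stp N) \<omega>, x0 + \<sigma> *v W (real k * stp N) \<omega>) \<partial>M)"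
    unfolding \<Theta>_def sums[OF assms(2)] sums[OF assms(3)] sum_noise
    using start by (intro nn_integral_cong_AE) auto
  finally show ?thesis .
qed

lemma chain_measurable:
  assumes "1 \<le> N" "k \<le> N"
  shows "chain N k \<in> borel_measurable (F (real k * stp N))"
proof -
  have [measurable]: "shifted_noise N j \<in> borel_measurable (F (real k * stp N))" if "j \<in> {..<k}" for j
    by (rule gaussian_walk.increment_measurable_past[OF shifted_noise_walk[OF assms(1)]]) (use that assms in auto)
  show ?thesis unfolding chain_def by measurable
qed

lemma chain_measurable_M: "1 \<le> N \<Longrightarrow> k \<le> N \<Longrightarrow> chain N k \<in> borel_measurable M"
  by (rule measurable_F_M[OF chain_measurable]) (auto intro: grid_nonneg)

text \<open>The delayed drifts telescope to the drift accumulated up to the previous grid point.\<close>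

lemma chain_eq:
  assumes N: "1 \<le> N"
  shows "chain N k \<omega> = x0 + \<sigma> *v (W (real k * stp N) \<omega> - W 0 \<omega>) + drift (real (k - 1) * stp N) \<omega>"
proof (induction k)
  case 0
  then show ?case by (simp add: chain_def drift_0)
next
  case (Suc k)
  have "\<sigma> *v (stp N *\<^sub>R delayed_drift N k \<omega>) = \<sigma> *v (\<sigma>' *v (stp N *\<^sub>R ((1 / stp N) *\<^sub>R (drift (real k * stp N) \<omega> - drift (real (k - 1) * stp N) \<omega>))))"
    unfolding delayed_drift_def by (simp only: matrix_vector_mult_scaleR)
  also have "\<dots> = drift (real k * stp N) \<omega> - drift (real (k - 1) * stp N) \<omega>"
    using stp_pos[OF N] by (simp add: matrix_vector_mul_assoc \<sigma>_inverse)
  finally have d: "\<sigma> *v (stp N *\<^sub>R delayed_drift N k \<omega>) = drift (real k * stp N) \<omega> - drift (real (k - 1) * stp N) \<omega>" .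
  have "chain N (Suc k) \<omega> = chain N k \<omega> + \<sigma> *v noise N k \<omega> + \<sigma> *v (stp N *\<^sub>R delayed_drift N k \<omega>)"
    by (simp add: chain_def shifted_noise_def matrix_vector_right_distrib add.assoc)
  also have "\<dots> = x0 + \<sigma> *v (W (real k * stp N) \<omega> - W 0 \<omega> + noise N k \<omega>) + drift (real k * stp N) \<omega>"
    unfolding Suc.IH d by (simp add: matrix_vector_right_distrib algebra_simps)
  also have "W (real k * stp N) \<omega> - W 0 \<omega> + noise N k \<omega> = W (real (Suc k) * stp N) \<omega> - W 0 \<omega>"
    by (simp add: noise_def)
  finally show ?case by simp
qed

lemma X_eq_drift: "AE \<omega> in M. \<forall>t\<in>{0..T}. X t \<omega> = x0 + drift t \<omega> + \<sigma> *v W t \<omega>"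
  using X_equation by (rule AE_mp) (auto intro!: AE_I2 simp: drift_def)

lemma chain_near_X:
  assumes N: "1 \<le> N"
  shows "AE \<omega> in M. \<forall>k\<le>N. norm (X (real k * stp N) \<omega> - chain N k \<omega>) \<le> B * stp N"
  using X_eq_drift start
proof eventually_elim
  case (elim \<omega>)
  show ?case
  proof (intro allI impI)
    fix k assume k: "k \<le> N"
    have "X (real k * stp N) \<omega> - chain N k \<omega> = drift (real k * stp N) \<omega> - drift (real (k - 1) * stp N) \<omega>"
      using elim grid_nonneg[OF N] grid_le[OF N k] by (simp add: chain_eq[OF N])
    also have "norm \<dots> \<le> B * (real k * stp N - real (k - 1) * stp N)"
      using k N by (intro drift_lipschitz grid_nonneg grid_pred grid_le)
    also have "\<dots> \<le> B * stp N"
      using grid_pred(2)[OF N] by (intro mult_left_mono B_nonneg)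
    finally show "norm (X (real k * stp N) \<omega> - chain N k \<omega>) \<le> B * stp N" .
  qed
qed

lemma drift_bound: "0 \<le> t \<Longrightarrow> t \<le> T \<Longrightarrow> norm (drift t \<omega>) \<le> B * T"
  using drift_lipschitz[of 0 t \<omega>] mult_left_mono[OF _ B_nonneg, of t T] by (simp add: drift_0)

lemma X_bound: "AE \<omega> in M. \<forall>t\<in>{0..T}. norm (X t \<omega>) \<le> norm x0 + B * T + c * norm (W t \<omega>)"
  using X_eq_drift
proof eventually_elim
  case (elim \<omega>)
  show ?case
  proof
    fix t assume t: "t \<in> {0..T}"
    have "norm (X t \<omega>) \<le> norm x0 + norm (drift t \<omega>) + norm (\<sigma> *v W t \<omega>)"
      using elim t by (simp add: norm_triangle_le[OF add_mono[OF norm_triangle_ineq order_refl]])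
    also have "\<dots> \<le> norm x0 + B * T + c * norm (W t \<omega>)"
      using t by (intro add_mono drift_bound norm_mult_le) auto
    finally show "norm (X t \<omega>) \<le> norm x0 + B * T + c * norm (W t \<omega>)" .
  qed
qed

lemma chain_bound:
  assumes N: "1 \<le> N"
  shows "AE \<omega> in M. \<forall>k\<le>N. norm (chain N k \<omega>) \<le> norm x0 + B * T + c * norm (W (real k * stp N) \<omega>)"
  using start
proof eventually_elim
  case (elim \<omega>)
  show ?case
  proof (intro allI impI)
    fix k assume k: "k \<le> N"
    have "chain N k \<omega> = x0 + drift (real (k - 1) * stp N) \<omega> + \<sigma> *v W (real k * stp N) \<omega>"
      using elim by (simp add: chain_eq[OF N])
    then have "norm (chain N k \<omega>) \<le> norm x0 + norm (drift (real (k - 1) * stp N) \<omega>) + norm (\<sigma> *v W (real k * stp N) \<omega>)"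
      by (simp add: norm_triangle_le[OF add_mono[OF norm_triangle_ineq order_refl]])
    also have "\<dots> \<le> norm x0 + B * T + c * norm (W (real k * stp N) \<omega>)"
      using k N by (intro add_mono drift_bound norm_mult_le grid_nonneg grid_le order_refl) auto
    finally show "norm (chain N k \<omega>) \<le> norm x0 + B * T + c * norm (W (real k * stp N) \<omega>)" .
  qed
qed

text \<open>A common bound for the exponential moments of the solution, the chain and \<open>x0 + \<sigma> *v W\<close>.\<close>

definition exp_moment :: "real \<Rightarrow> real" where
  "exp_moment l = exp (l * (norm x0 + B * T)) * (exp (T * (l * c)\<^sup>2) * sqrt 2 ^ CARD('d))"

lemma exp_moment_nonneg [simp]: "0 \<le> exp_moment l"
  by (simp add: exp_moment_def)

lemma nn_integral_exp_moment:
  assumes "0 \<le> l" and t: "0 \<le> t" "t \<le> T" and Z: "AE \<omega> in M. norm (Z \<omega>) \<le> norm x0 + B * T + c * norm (W t \<omega>)"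
  shows "(\<integral>\<^sup>+\<omega>. ennreal (exp (l * norm (Z \<omega>))) \<partial>M) \<le> ennreal (exp_moment l)"
proof -
  have [measurable]: "W t \<in> borel_measurable M" by (rule W_measurable[OF t(1)])
  have "(\<integral>\<^sup>+\<omega>. ennreal (exp (l * norm (Z \<omega>))) \<partial>M) \<le> (\<integral>\<^sup>+\<omega>. ennreal (exp (l * (norm x0 + B * T))) * ennreal (exp (l * c * norm (W t \<omega>))) \<partial>M)"
  proof (rule nn_integral_mono_AE, use Z in eventually_elim)
    case (elim \<omega>)
    have "l * norm (Z \<omega>) \<le> l * (norm x0 + B * T + c * norm (W t \<omega>))"
      by (rule mult_left_mono[OF elim assms(1)])
    also have "\<dots> = l * (norm x0 + B * T) + l * c * norm (W t \<omega>)" by (simp add: distrib_left)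
    finally have "exp (l * norm (Z \<omega>)) \<le> exp (l * (norm x0 + B * T)) * exp (l * c * norm (W t \<omega>))"
      unfolding exp_add[symmetric] by (subst exp_le_cancel_iff)
    then show ?case by (simp add: ennreal_mult[symmetric] ennreal_leI)
  qed
  also have "\<dots> = ennreal (exp (l * (norm x0 + B * T))) * (\<integral>\<^sup>+\<omega>. ennreal (exp (l * c * norm (W t \<omega>))) \<partial>M)"
    by (rule nn_integral_cmult) measurable
  also have "\<dots> \<le> ennreal (exp (l * (norm x0 + B * T))) * ennreal (exp (T * (l * c)\<^sup>2) * sqrt 2 ^ CARD('d))"
    by (intro mult_left_mono W_exp_moment t) auto
  also have "\<dots> = ennreal (exp_moment l)"
    unfolding exp_moment_def by (rule ennreal_mult[symmetric]) auto
  finally show ?thesis .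
qed

lemma X_exp_moment:
  assumes "0 \<le> l" "t \<in> {0..T}"
  shows "(\<integral>\<^sup>+\<omega>. ennreal (exp (l * norm (X t \<omega>))) \<partial>M) \<le> ennreal (exp_moment l)"
proof (rule nn_integral_exp_moment[OF assms(1), of t])
  show "AE \<omega> in M. norm (X t \<omega>) \<le> norm x0 + B * T + c * norm (W t \<omega>)"
    using X_bound by (rule AE_mp) (use assms in \<open>auto intro!: AE_I2\<close>)
qed (use assms in auto)

lemma chain_exp_moment:
  assumes "0 \<le> l" "1 \<le> N" "k \<le> N"
  shows "(\<integral>\<^sup>+\<omega>. ennreal (exp (l * norm (chain N k \<omega>))) \<partial>M) \<le> ennreal (exp_moment l)"
proof (rule nn_integral_exp_moment[OF assms(1) grid_nonneg grid_le])
  show "AE \<omega> in M. norm (chain N k \<omega>) \<le> norm x0 + B * T + c * norm (W (real k * stp N) \<omega>)"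
    using chain_bound[OF assms(2)] by (rule AE_mp) (use assms in \<open>auto intro!: AE_I2\<close>)
qed (use assms in auto)

lemma driftless_exp_moment:
  assumes "0 \<le> l" "0 \<le> t" "t \<le> T"
  shows "(\<integral>\<^sup>+\<omega>. ennreal (exp (l * norm (x0 + \<sigma> *v W t \<omega>))) \<partial>M) \<le> ennreal (exp_moment l)"
proof (rule nn_integral_exp_moment[OF assms(1), of t])
  have "norm (x0 + \<sigma> *v W t \<omega>) \<le> norm x0 + B * T + c * norm (W t \<omega>)" for \<omega>
    using norm_triangle_ineq[of x0 "\<sigma> *v W t \<omega>"] norm_mult_le[of "W t \<omega>"] mult_nonneg_nonneg[OF B_nonneg, of T] T_pos
    by linarith
  then show "AE \<omega> in M. norm (x0 + \<sigma> *v W t \<omega>) \<le> norm x0 + B * T + c * norm (W t \<omega>)"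
    by (intro AE_I2)
qed (use assms in auto)

lemma back_density_moment:
  assumes "1 \<le> N" "1 \<le> p"
  shows "(\<integral>\<^sup>+\<omega>. ennreal (girsanov_density (stp N) (delayed_drift N) (shifted_noise N) N \<omega> ^ p) \<partial>Q N)
    \<le> ennreal (exp ((real p ^ 2 - real p) / 2 * T * (c' * B)\<^sup>2))"
proof -
  have "(\<integral>\<^sup>+\<omega>. ennreal (girsanov_density (stp N) (delayed_drift N) (shifted_noise N) N \<omega> ^ p) \<partial>Q N)
    \<le> ennreal (exp ((real p ^ 2 - real p) / 2 * (stp N * real N) * (c' * B)\<^sup>2))"
    by (rule gaussian_walk.girsanov_density_moment[OF shifted_noise_walk[OF assms(1)]])
       (use assms delayed_drift_measurable delayed_drift_bound in auto)
  then show ?thesis by (simp add: stp_mult[OF assms(1)])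
qed

text \<open>A Krylov type estimate: the chain charges a set only as far as the driftless process does.
  Under \<open>Q N\<close> the chain has the law of the driftless process on the grid, and the density between
  the two measures has a second moment that does not depend on \<open>N\<close>, so Cauchy--Schwarz applies.
  The pair of times makes the same bound available for increments.\<close>

lemma chain_krylov_pair:
  assumes N: "1 \<le> N" and jk: "j \<le> N" "k \<le> N" and \<psi>_meas: "\<psi> \<in> borel_measurable (borel \<Otimes>\<^sub>M borel)" and \<psi>: "\<And>x. 0 \<le> \<psi> x"
    and a: "(\<integral>\<^sup>+\<omega>. ennreal ((\<psi> (x0 + \<sigma> *v W (real j * stp N) \<omega>, x0 + \<sigma> *v W (real k * stp N) \<omega>))\<^sup>2) \<partial>M) \<le> ennreal a" "0 \<le> a"
  shows "(\<integral>\<^sup>+\<omega>. ennreal (\<psi> (chain N j \<omega>, chain N k \<omega>)) \<partial>M) \<le> ennreal (sqrt a * sqrt (exp (T * (c' * B)\<^sup>2)))"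
proof -
  let ?D = "girsanov_density (stp N) (delayed_drift N) (shifted_noise N) N"
  have [measurable]: "\<psi> \<in> borel_measurable (borel \<Otimes>\<^sub>M borel)" by fact
  have [measurable]: "chain N j \<in> borel_measurable M" "chain N k \<in> borel_measurable M"
    using jk by (auto intro: chain_measurable_M[OF N])
  have [measurable]: "?D \<in> borel_measurable M" by (rule back_density_measurable[OF N])
  have sq: "(\<integral>\<^sup>+\<omega>. ennreal ((\<psi> (chain N j \<omega>, chain N k \<omega>))\<^sup>2) \<partial>Q N) \<le> ennreal a"
    using chain_law[OF N jk, of "\<lambda>p. ennreal ((\<psi> p)\<^sup>2)"] a(1) by simp
  have D2: "(\<integral>\<^sup>+\<omega>. ennreal ((?D \<omega>)\<^sup>2) \<partial>Q N) \<le> ennreal (exp (T * (c' * B)\<^sup>2))"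
    using back_density_moment[OF N, of 2] by simp
  have "(\<integral>\<^sup>+\<omega>. ennreal (\<psi> (chain N j \<omega>, chain N k \<omega>)) \<partial>M) = (\<integral>\<^sup>+\<omega>. ennreal (?D \<omega>) * ennreal (\<psi> (chain N j \<omega>, chain N k \<omega>)) \<partial>Q N)"
    by (rule nn_integral_M_via_Q[OF N]) measurable
  also have "\<dots> = (\<integral>\<^sup>+\<omega>. ennreal (\<psi> (chain N j \<omega>, chain N k \<omega>) * ?D \<omega>) \<partial>Q N)"
    using \<psi> by (simp add: ennreal_mult mult.commute)
  also have "\<dots> \<le> ennreal (sqrt a * sqrt (exp (T * (c' * B)\<^sup>2)))"
    using a(2) \<psi> by (intro nn_integral_Cauchy_Schwarz_real sq D2) auto
  finally show ?thesis .
qed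

lemma chain_krylov:
  assumes N: "1 \<le> N" and k: "k \<le> N" and [measurable]: "\<psi> \<in> borel_measurable borel" and \<psi>: "\<And>x. 0 \<le> \<psi> x"
    and a: "(\<integral>\<^sup>+\<omega>. ennreal ((\<psi> (x0 + \<sigma> *v W (real k * stp N) \<omega>))\<^sup>2) \<partial>M) \<le> ennreal a" "0 \<le> a"
  shows "(\<integral>\<^sup>+\<omega>. ennreal (\<psi> (chain N k \<omega>)) \<partial>M) \<le> ennreal (sqrt a * sqrt (exp (T * (c' * B)\<^sup>2)))"
  using chain_krylov_pair[OF N k k, of "\<lambda>p. \<psi> (fst p)" a] \<psi> a by simp

end

section \<open>Convergence of the chain to the solution\<close>

lemma tendsto_0_ennrealI:
  fixes f :: "'a \<Rightarrow> ennreal"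
  assumes "\<And>e::real. 0 < e \<Longrightarrow> eventually (\<lambda>n. f n \<le> ennreal e) G"
  shows "(f \<longlongrightarrow> 0) G"
proof (rule order_tendstoI)
  fix a :: ennreal assume "0 < a"
  then obtain e :: real where e: "0 < e" "ennreal e < a"
  proof (cases a)
    case (real r)
    then show ?thesis using \<open>0 < a\<close> that[of "r / 2"] by (simp add: ennreal_less_iff)
  next
    case top
    then show ?thesis using that[of 1] by simp
  qed
  show "eventually (\<lambda>n. f n < a) G"
    using assms[OF e(1)] by (rule eventually_mono) (use e(2) in auto)
qed auto

text \<open>At times bounded away from 0 the driftless process is dominated by its law at the final time, so
  that an approximation made for one law serves for all of them.\<close>

lemma gauss_density_compare:
  fixes x :: "real^'d"
  assumes "0 < t" "t \<le> T"
  shows "gauss_density t x \<le> sqrt (T / t) ^ CARD('d) * gauss_density T x"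
proof -
  have "(norm x)\<^sup>2 / (2 * T) \<le> (norm x)\<^sup>2 / (2 * t)"
    using assms by (intro divide_left_mono) auto
  then have "exp (- (norm x)\<^sup>2 / (2 * t)) \<le> exp (- (norm x)\<^sup>2 / (2 * T))" by simp
  then have "(1 / sqrt (2 * pi * t)) ^ CARD('d) * exp (- (norm x)\<^sup>2 / (2 * t)) \<le> (1 / sqrt (2 * pi * t)) ^ CARD('d) * exp (- (norm x)\<^sup>2 / (2 * T))"
    using assms by (intro mult_left_mono) auto
  also have "\<dots> = sqrt (T / t) ^ CARD('d) * ((1 / sqrt (2 * pi * T)) ^ CARD('d) * exp (- (norm x)\<^sup>2 / (2 * T)))"
  proof -
    have q: "1 / sqrt (2 * pi * t) = sqrt (T / t) * (1 / sqrt (2 * pi * T))"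
      using assms by (simp add: real_sqrt_mult real_sqrt_divide)
    show ?thesis unfolding q power_mult_distrib by (rule mult.assoc)
  qed
  finally show ?thesis
    unfolding gauss_density_def .
qed

text \<open>A function that is approximated under the sum of two laws is approximated under both at once.\<close>

lemma (in prob_space) sum_of_two_laws:
  fixes Z Z' :: "'a \<Rightarrow> 'b::topological_space"
  assumes [measurable]: "Z \<in> borel_measurable M" "Z' \<in> borel_measurable M"
  shows "\<exists>\<mu>. finite_measure \<mu> \<and> sets \<mu> = sets borel \<and>
    (\<forall>f\<in>borel_measurable borel. (\<integral>\<^sup>+x. f x \<partial>\<mu>) = (\<integral>\<^sup>+\<omega>. f (Z \<omega>) \<partial>M) + (\<integral>\<^sup>+\<omega>. f (Z' \<omega>) \<partial>M))"
proof -
  interpret cs: sigma_finite_measure "count_space (UNIV :: bool set)"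
    by (rule sigma_finite_measure_count_space_finite) simp
  define V where "V = (\<lambda>(\<omega>, i). if i then Z \<omega> else Z' \<omega>)"
  define \<mu> where "\<mu> = distr (M \<Otimes>\<^sub>M count_space (UNIV :: bool set)) borel V"
  have [measurable]: "V \<in> borel_measurable (M \<Otimes>\<^sub>M count_space (UNIV :: bool set))"
    unfolding V_def by measurable
  have int: "(\<integral>\<^sup>+x. f x \<partial>\<mu>) = (\<integral>\<^sup>+\<omega>. f (Z \<omega>) \<partial>M) + (\<integral>\<^sup>+\<omega>. f (Z' \<omega>) \<partial>M)" if [measurable]: "f \<in> borel_measurable borel" for f
  proof -
    have "(\<integral>\<^sup>+x. f x \<partial>\<mu>) = (\<integral>\<^sup>+p. f (V p) \<partial>(M \<Otimes>\<^sub>M count_space (UNIV :: bool set)))"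
      unfolding \<mu>_def by (rule nn_integral_distr) auto
    also have "\<dots> = (\<integral>\<^sup>+\<omega>. (\<integral>\<^sup>+i. f (V (\<omega>, i)) \<partial>count_space (UNIV :: bool set)) \<partial>M)"
      by (rule cs.nn_integral_fst[symmetric]) measurable
    also have "\<dots> = (\<integral>\<^sup>+\<omega>. f (Z \<omega>) + f (Z' \<omega>) \<partial>M)"
      by (intro nn_integral_cong) (simp add: nn_integral_count_space_finite UNIV_bool V_def add.commute)
    also have "\<dots> = (\<integral>\<^sup>+\<omega>. f (Z \<omega>) \<partial>M) + (\<integral>\<^sup>+\<omega>. f (Z' \<omega>) \<partial>M)"
      by (rule nn_integral_add) auto
    finally show ?thesis .
  qed
  have "sets \<mu> = sets borel" by (simp add: \<mu>_def)
  moreover have "finite_measure \<mu>"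
  proof
    have "emeasure \<mu> (space \<mu>) = 1 + 1"
      using int[of "\<lambda>_. 1"] emeasure_space_1 by simp
    then show "emeasure \<mu> (space \<mu>) \<noteq> \<infinity>" by simp
  qed
  ultimately show ?thesis using int by (intro exI[of _ \<mu>]) auto
qed

context additive_sde
begin

lemma driftless_compare:
  assumes "0 < t" "t \<le> T" and [measurable]: "f \<in> borel_measurable borel"
  shows "(\<integral>\<^sup>+\<omega>. f (x0 + \<sigma> *v W t \<omega>) \<partial>M) \<le> ennreal (sqrt (T / t) ^ CARD('d)) * (\<integral>\<^sup>+\<omega>. f (x0 + \<sigma> *v W T \<omega>) \<partial>M)"
proof -
  have "(\<integral>\<^sup>+\<omega>. f (x0 + \<sigma> *v W t \<omega>) \<partial>M) = (\<integral>\<^sup>+w. ennreal (gauss_density t w) * f (x0 + \<sigma> *v w) \<partial>lborel)"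
    using W_law[OF assms(1), of "\<lambda>w. f (x0 + \<sigma> *v w)"] by (simp add: nn_integral_gauss)
  also have "\<dots> \<le> (\<integral>\<^sup>+w. ennreal (sqrt (T / t) ^ CARD('d)) * (ennreal (gauss_density T w) * f (x0 + \<sigma> *v w)) \<partial>lborel)"
  proof (rule nn_integral_mono)
    fix w :: "real^'d"
    have "ennreal (gauss_density t w) \<le> ennreal (sqrt (T / t) ^ CARD('d) * gauss_density T w)"
      by (intro ennreal_leI gauss_density_compare assms)
    also have "\<dots> = ennreal (sqrt (T / t) ^ CARD('d)) * ennreal (gauss_density T w)"
      using assms by (intro ennreal_mult) auto
    finally show "ennreal (gauss_density t w) * f (x0 + \<sigma> *v w) \<le> ennreal (sqrt (T / t) ^ CARD('d)) * (ennreal (gauss_density T w) * f (x0 + \<sigma> *v w))"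
      unfolding mult.assoc[symmetric] by (rule mult_right_mono) simp
  qed
  also have "\<dots> = ennreal (sqrt (T / t) ^ CARD('d)) * (\<integral>\<^sup>+w. ennreal (gauss_density T w) * f (x0 + \<sigma> *v w) \<partial>lborel)"
    by (rule nn_integral_cmult) measurable
  also have "(\<integral>\<^sup>+w. ennreal (gauss_density T w) * f (x0 + \<sigma> *v w) \<partial>lborel) = (\<integral>\<^sup>+\<omega>. f (x0 + \<sigma> *v W T \<omega>) \<partial>M)"
    using W_law[OF T_pos, of "\<lambda>w. f (x0 + \<sigma> *v w)"] by (simp add: nn_integral_gauss)
  finally show ?thesis .
qed

definition X_modulus :: "real \<Rightarrow> real" where
  "X_modulus d = B * d + c * sqrt (4 * d * sqrt 2 ^ CARD('d))"

lemma X_increment_mean: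
  assumes "0 \<le> s" "s \<le> t" "t \<le> T"
  shows "(\<integral>\<^sup>+\<omega>. ennreal (norm (X t \<omega> - X s \<omega>)) \<partial>M) \<le> ennreal (X_modulus (t - s))"
proof -
  have [measurable]: "W t \<in> borel_measurable M" "W s \<in> borel_measurable M"
    using assms by (auto intro: W_measurable)
  have "(\<integral>\<^sup>+\<omega>. ennreal (norm (X t \<omega> - X s \<omega>)) \<partial>M) \<le> (\<integral>\<^sup>+\<omega>. ennreal (B * (t - s)) + ennreal c * ennreal (norm (W t \<omega> - W s \<omega>)) \<partial>M)"
  proof (rule nn_integral_mono_AE, use X_eq_drift in eventually_elim)
    case (elim \<omega>)
    have "X t \<omega> - X s \<omega> = (drift t \<omega> - drift s \<omega>) + \<sigma> *v (W t \<omega> - W s \<omega>)"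
      using elim assms by (simp add: matrix_vector_mult_diff_distrib)
    also have "norm \<dots> \<le> B * (t - s) + c * norm (W t \<omega> - W s \<omega>)"
      by (intro norm_triangle_le add_mono drift_lipschitz assms norm_mult_le)
    finally have "ennreal (norm (X t \<omega> - X s \<omega>)) \<le> ennreal (B * (t - s) + c * norm (W t \<omega> - W s \<omega>))"
      by (rule ennreal_leI)
    then show ?case using assms B_nonneg c_pos by (simp add: ennreal_plus ennreal_mult)
  qed
  also have "\<dots> = ennreal (B * (t - s)) + ennreal c * (\<integral>\<^sup>+\<omega>. ennreal (norm (W t \<omega> - W s \<omega>)) \<partial>M)"
    using emeasure_space_1 by (simp add: nn_integral_add nn_integral_cmult)
  also have "\<dots> \<le> ennreal (B * (t - s)) + ennreal c * ennreal (sqrt (4 * (t - s) * sqrt 2 ^ CARD('d)))"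
    using assms by (intro add_left_mono mult_left_mono W_increment_mean) auto
  also have "\<dots> = ennreal (X_modulus (t - s))"
    unfolding X_modulus_def using assms B_nonneg c_pos by (simp add: ennreal_plus ennreal_mult)
  finally show ?thesis .
qed

lemma X_increment_mean_abs:
  assumes "s \<in> {0..T}" "t \<in> {0..T}"
  shows "(\<integral>\<^sup>+\<omega>. ennreal (norm (X t \<omega> - X s \<omega>)) \<partial>M) \<le> ennreal (X_modulus \<bar>t - s\<bar>)"
proof (cases "s \<le> t")
  case True
  then show ?thesis using X_increment_mean[of s t] assms by simp
next
  case False
  then show ?thesis using X_increment_mean[of t s] assms by (simp add: norm_minus_commute)
qed

lemma X_modulus_tendsto: "(d \<longlongrightarrow> 0) G \<Longrightarrow> ((\<lambda>n. X_modulus (d n)) \<longlongrightarrow> 0) G"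
proof -
  assume d: "(d \<longlongrightarrow> 0) G"
  have "((\<lambda>n. B * d n + c * sqrt (4 * d n * sqrt 2 ^ CARD('d))) \<longlongrightarrow> B * 0 + c * sqrt (4 * 0 * sqrt 2 ^ CARD('d))) G"
    by (intro tendsto_intros d)
  then show ?thesis by (simp add: X_modulus_def)
qed

lemma stp_tendsto: "stp \<longlonglongrightarrow> 0"
  unfolding stp_def[abs_def] by (rule lim_const_over_n)

text \<open>The function is replaced by a Lipschitz function, for which the distance between the chain and
  the solution is small. The error is controlled at the solution by the choice of the Lipschitz
  function, made with respect to the unknown law of the solution, and at the chain by the
  Krylov estimate, through a single Gaussian law as long as the time stays away from 0.\<close>

lemma chain_converges:
  assumes [measurable]: "\<phi> \<in> borel_measurable borel" and K: "0 \<le> K" "\<And>x. \<bar>\<phi> x\<bar> \<le> K * exp (K * norm x)"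
    and r: "0 < r" "r < T" and k: "\<And>N. 1 \<le> N \<Longrightarrow> k N \<le> N" "(\<lambda>N. real (k N) * stp N) \<longlonglongrightarrow> r"
  shows "(\<lambda>N. \<integral>\<^sup>+\<omega>. ennreal \<bar>\<phi> (X r \<omega>) - \<phi> (chain N (k N) \<omega>)\<bar> \<partial>M) \<longlonglongrightarrow> 0"
proof (rule tendsto_0_ennrealI)
  fix e :: real assume e: "0 < e"
  have X_r[measurable]: "X r \<in> borel_measurable M" using r by (intro X_measurable) auto
  have W_T[measurable]: "W T \<in> borel_measurable M" using T_pos by (intro W_measurable) auto
  obtain \<mu> where \<mu>: "finite_measure \<mu>" "sets \<mu> = sets borel"
    and \<mu>_int: "\<forall>f\<in>borel_measurable borel. (\<integral>\<^sup>+x. f x \<partial>\<mu>) = (\<integral>\<^sup>+\<omega>. f (X r \<omega>) \<partial>M) + (\<integral>\<^sup>+\<omega>. f (x0 + \<sigma> *v W T \<omega>) \<partial>M)"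
    using sum_of_two_laws[of "X r" "\<lambda>\<omega>. x0 + \<sigma> *v W T \<omega>"] by auto
  have sq: "ennreal ((\<phi> x)\<^sup>2) \<le> ennreal (K\<^sup>2) * ennreal (exp (2 * K * norm x))" for x
    using exp_bounded_square[OF K(2)] by (simp add: ennreal_mult[symmetric] ennreal_leI)
  have "(\<integral>\<^sup>+x. ennreal ((\<phi> x)\<^sup>2) \<partial>\<mu>) = (\<integral>\<^sup>+\<omega>. ennreal ((\<phi> (X r \<omega>))\<^sup>2) \<partial>M) + (\<integral>\<^sup>+\<omega>. ennreal ((\<phi> (x0 + \<sigma> *v W T \<omega>))\<^sup>2) \<partial>M)"
    using \<mu>_int by simp
  also have "\<dots> \<le> (\<integral>\<^sup>+\<omega>. ennreal (K\<^sup>2) * ennreal (exp (2 * K * norm (X r \<omega>))) \<partial>M) + (\<integral>\<^sup>+\<omega>. ennreal (K\<^sup>2) * ennreal (exp (2 * K * norm (x0 + \<sigma> *v W T \<omega>))) \<partial>M)"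
    by (intro add_mono nn_integral_mono sq)
  also have "\<dots> = ennreal (K\<^sup>2) * (\<integral>\<^sup>+\<omega>. ennreal (exp (2 * K * norm (X r \<omega>))) \<partial>M) + ennreal (K\<^sup>2) * (\<integral>\<^sup>+\<omega>. ennreal (exp (2 * K * norm (x0 + \<sigma> *v W T \<omega>))) \<partial>M)"
    by (simp add: nn_integral_cmult)
  also have "\<dots> \<le> ennreal (K\<^sup>2) * ennreal (exp_moment (2 * K)) + ennreal (K\<^sup>2) * ennreal (exp_moment (2 * K))"
    using K(1) r T_pos by (intro add_mono mult_left_mono X_exp_moment driftless_exp_moment) auto
  also have "\<dots> < \<infinity>" by (simp add: ennreal_mult_less_top)
  finally have L2: "(\<integral>\<^sup>+x. ennreal ((\<phi> x)\<^sup>2) \<partial>\<mu>) < \<infinity>" .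
  have approx: "lipschitz_approximable \<mu> \<phi>"
    by (rule lipschitz_approximable_square_integrable[OF \<mu> _ L2]) (simp add: measurable_cong_sets[OF \<mu>(2) refl])
  define \<rho> where "\<rho> = 1 + sqrt (T / (r / 2)) ^ CARD('d)"
  have \<rho>: "1 \<le> \<rho>" using r T_pos by (simp add: \<rho>_def)
  define D where "D = 1 + sqrt (exp (T * (c' * B)\<^sup>2))"
  have D: "1 \<le> D" by (simp add: D_def)
  \<comment> \<open>\<open>\<rho>\<close> compares Gaussian laws after time \<open>r / 2\<close> with the one at time \<open>T\<close>, and \<open>D\<close> bounds the density\<close>
  define \<eta> where "\<eta> = (e / (3 * D))\<^sup>2 / \<rho>"
  have \<eta>: "0 < \<eta>" using e D \<rho> by (simp add: \<eta>_def)
  obtain \<psi> L where \<psi>: "L-lipschitz_on UNIV \<psi>" and \<psi>_int: "(\<integral>\<^sup>+x. ennreal ((\<phi> x - \<psi> x)\<^sup>2) \<partial>\<mu>) \<le> ennreal \<eta>"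
    using approx[unfolded lipschitz_approximable_def, rule_format, OF \<eta>] by auto
  have L: "0 \<le> L" using \<psi> by (rule lipschitz_on_nonneg)
  have [measurable]: "\<psi> \<in> borel_measurable borel" by (rule lipschitz_borel_measurable[OF \<psi>])
  have sum: "(\<integral>\<^sup>+\<omega>. ennreal ((\<phi> (X r \<omega>) - \<psi> (X r \<omega>))\<^sup>2) \<partial>M) + (\<integral>\<^sup>+\<omega>. ennreal ((\<phi> (x0 + \<sigma> *v W T \<omega>) - \<psi> (x0 + \<sigma> *v W T \<omega>))\<^sup>2) \<partial>M) \<le> ennreal \<eta>"
    using \<psi>_int \<mu>_int by simp
  have sq1: "(\<integral>\<^sup>+\<omega>. ennreal (\<bar>\<phi> (X r \<omega>) - \<psi> (X r \<omega>)\<bar>\<^sup>2) \<partial>M) \<le> ennreal \<eta>"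
    using order_trans[OF add_increasing2[OF zero_le order_refl] sum] by simp
  have sq2: "(\<integral>\<^sup>+\<omega>. ennreal ((\<phi> (x0 + \<sigma> *v W T \<omega>) - \<psi> (x0 + \<sigma> *v W T \<omega>))\<^sup>2) \<partial>M) \<le> ennreal \<eta>"
    using order_trans[OF add_increasing[OF zero_le order_refl] sum] by simp
  have root: "sqrt (\<rho> * \<eta>) = e / (3 * D)"
    using e D \<rho> by (simp add: \<eta>_def)
  have t1: "(\<integral>\<^sup>+\<omega>. ennreal \<bar>\<phi> (X r \<omega>) - \<psi> (X r \<omega>)\<bar> \<partial>M) \<le> ennreal (e / 3)"
  proof -
    have "(\<integral>\<^sup>+\<omega>. ennreal \<bar>\<phi> (X r \<omega>) - \<psi> (X r \<omega>)\<bar> \<partial>M) \<le> ennreal (sqrt \<eta>)"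
      using \<eta> by (intro nn_integral_sqrt_le prob_space_axioms sq1) auto
    also have "\<dots> \<le> ennreal (e / 3)"
    proof (rule ennreal_leI)
      have "sqrt \<eta> \<le> sqrt (\<rho> * \<eta>)" using \<rho> \<eta> by (intro real_sqrt_le_mono) simp
      also have "\<dots> = e / (3 * D)" by (rule root)
      also have "\<dots> \<le> e / 3" using D e by (intro divide_left_mono) auto
      finally show "sqrt \<eta> \<le> e / 3" .
    qed
    finally show ?thesis .
  qed
  have "((\<lambda>N. r - real (k N) * stp N) \<longlongrightarrow> r - r) sequentially" by (intro tendsto_intros k(2))
  then have "((\<lambda>N. \<bar>r - real (k N) * stp N\<bar>) \<longlongrightarrow> 0) sequentially"
    by (intro tendsto_rabs_zero) simp
  then have "((\<lambda>N. L * (X_modulus \<bar>r - real (k N) * stp N\<bar> + B * stp N)) \<longlongrightarrow> L * (0 + B * 0)) sequentially"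
    by (intro tendsto_mult tendsto_const tendsto_add X_modulus_tendsto stp_tendsto)
  then have ev1: "eventually (\<lambda>N. L * (X_modulus \<bar>r - real (k N) * stp N\<bar> + B * stp N) < e / 3) sequentially"
    using e by (intro order_tendstoD(2)) auto
  have ev2: "eventually (\<lambda>N. r / 2 < real (k N) * stp N) sequentially"
    using k(2) r by (intro order_tendstoD(1)) auto
  show "eventually (\<lambda>N. (\<integral>\<^sup>+\<omega>. ennreal \<bar>\<phi> (X r \<omega>) - \<phi> (chain N (k N) \<omega>)\<bar> \<partial>M) \<le> ennreal e) sequentially"
    using ev1 ev2 eventually_ge_at_top[of 1]
  proof eventually_elim
    case (elim N)
    define t where "t = real (k N) * stp N"
    have N: "1 \<le> N" and kN: "k N \<le> N" using elim k(1) by auto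
    have t: "0 \<le> t" "t \<le> T" "r / 2 < t" "0 < t"
      using elim grid_le[OF N kN] grid_nonneg[OF N] r by (auto simp: t_def)
    have [measurable]: "chain N (k N) \<in> borel_measurable M" by (rule chain_measurable_M[OF N kN])
    have [measurable]: "X t \<in> borel_measurable M" using t by (intro X_measurable) auto
    have t2: "(\<integral>\<^sup>+\<omega>. ennreal \<bar>\<psi> (X r \<omega>) - \<psi> (chain N (k N) \<omega>)\<bar> \<partial>M) \<le> ennreal (e / 3)"
    proof -
      have "(\<integral>\<^sup>+\<omega>. ennreal \<bar>\<psi> (X r \<omega>) - \<psi> (chain N (k N) \<omega>)\<bar> \<partial>M) \<le> (\<integral>\<^sup>+\<omega>. ennreal L * (ennreal (norm (X r \<omega> - X t \<omega>)) + ennreal (B * stp N)) \<partial>M)"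
      proof (rule nn_integral_mono_AE, use chain_near_X[OF N] in eventually_elim)
        case (elim \<omega>)
        have "\<bar>\<psi> (X r \<omega>) - \<psi> (chain N (k N) \<omega>)\<bar> \<le> L * norm (X r \<omega> - chain N (k N) \<omega>)"
          using lipschitz_onD[OF \<psi>, of "X r \<omega>" "chain N (k N) \<omega>"] by (simp add: dist_norm)
        also have "norm (X r \<omega> - chain N (k N) \<omega>) \<le> norm (X r \<omega> - X t \<omega>) + norm (X t \<omega> - chain N (k N) \<omega>)"
          using norm_triangle_ineq[of "X r \<omega> - X t \<omega>" "X t \<omega> - chain N (k N) \<omega>"] by simp
        also have "norm (X t \<omega> - chain N (k N) \<omega>) \<le> B * stp N"
          using elim kN unfolding t_def by blast
        finally have "\<bar>\<psi> (X r \<omega>) - \<psi> (chain N (k N) \<omega>)\<bar> \<le> L * (norm (X r \<omega> - X t \<omega>) + B * stp N)"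
          using L by (simp add: mult_left_mono)
        then have "ennreal \<bar>\<psi> (X r \<omega>) - \<psi> (chain N (k N) \<omega>)\<bar> \<le> ennreal (L * (norm (X r \<omega> - X t \<omega>) + B * stp N))"
          by (rule ennreal_leI)
        also have "\<dots> = ennreal L * (ennreal (norm (X r \<omega> - X t \<omega>)) + ennreal (B * stp N))"
          using L B_nonneg stp_pos[OF N] by (simp add: ennreal_mult ennreal_plus)
        finally show ?case .
      qed
      also have "\<dots> = ennreal L * ((\<integral>\<^sup>+\<omega>. ennreal (norm (X r \<omega> - X t \<omega>)) \<partial>M) + ennreal (B * stp N))"
        using emeasure_space_1 by (simp add: nn_integral_cmult nn_integral_add)
      also have "\<dots> \<le> ennreal L * (ennreal (X_modulus \<bar>r - t\<bar>) + ennreal (B * stp N))"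
        using r t by (intro mult_left_mono add_right_mono X_increment_mean_abs) auto
      also have "\<dots> = ennreal (L * (X_modulus \<bar>r - t\<bar> + B * stp N))"
        using L B_nonneg stp_pos[OF N] c_pos by (simp add: ennreal_mult ennreal_plus X_modulus_def)
      also have "\<dots> \<le> ennreal (e / 3)"
        using elim(1) by (intro ennreal_leI) (simp add: t_def)
      finally show ?thesis .
    qed
    have t3: "(\<integral>\<^sup>+\<omega>. ennreal \<bar>\<phi> (chain N (k N) \<omega>) - \<psi> (chain N (k N) \<omega>)\<bar> \<partial>M) \<le> ennreal (e / 3)"
    proof -
      have "(\<integral>\<^sup>+\<omega>. ennreal (\<bar>\<phi> (x0 + \<sigma> *v W t \<omega>) - \<psi> (x0 + \<sigma> *v W t \<omega>)\<bar>\<^sup>2) \<partial>M)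
        \<le> ennreal (sqrt (T / t) ^ CARD('d)) * (\<integral>\<^sup>+\<omega>. ennreal (\<bar>\<phi> (x0 + \<sigma> *v W T \<omega>) - \<psi> (x0 + \<sigma> *v W T \<omega>)\<bar>\<^sup>2) \<partial>M)"
        using driftless_compare[OF t(4,2), of "\<lambda>x. ennreal (\<bar>\<phi> x - \<psi> x\<bar>\<^sup>2)"] by simp
      also have "\<dots> \<le> ennreal \<rho> * ennreal \<eta>"
      proof (intro mult_mono ennreal_leI)
        have "T / t \<le> T / (r / 2)" using t r T_pos by (intro divide_left_mono) auto
        then have "sqrt (T / t) ^ CARD('d) \<le> sqrt (T / (r / 2)) ^ CARD('d)"
          using t T_pos by (intro power_mono real_sqrt_le_mono) auto
        then show "sqrt (T / t) ^ CARD('d) \<le> \<rho>" by (simp add: \<rho>_def)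
        show "(\<integral>\<^sup>+\<omega>. ennreal (\<bar>\<phi> (x0 + \<sigma> *v W T \<omega>) - \<psi> (x0 + \<sigma> *v W T \<omega>)\<bar>\<^sup>2) \<partial>M) \<le> ennreal \<eta>"
          using sq2 by simp
      qed auto
      also have "\<dots> = ennreal (\<rho> * \<eta>)" using \<rho> \<eta> by (simp add: ennreal_mult)
      finally have a: "(\<integral>\<^sup>+\<omega>. ennreal (\<bar>\<phi> (x0 + \<sigma> *v W t \<omega>) - \<psi> (x0 + \<sigma> *v W t \<omega>)\<bar>\<^sup>2) \<partial>M) \<le> ennreal (\<rho> * \<eta>)" .
      have "(\<integral>\<^sup>+\<omega>. ennreal \<bar>\<phi> (chain N (k N) \<omega>) - \<psi> (chain N (k N) \<omega>)\<bar> \<partial>M) \<le> ennreal (sqrt (\<rho> * \<eta>) * sqrt (exp (T * (c' * B)\<^sup>2)))"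
        by (rule chain_krylov[OF N kN, of "\<lambda>x. \<bar>\<phi> x - \<psi> x\<bar>"]) (use a \<rho> \<eta> in \<open>auto simp: t_def\<close>)
      also have "\<dots> \<le> ennreal (e / 3)"
      proof (rule ennreal_leI)
        have "sqrt (\<rho> * \<eta>) * sqrt (exp (T * (c' * B)\<^sup>2)) \<le> e / (3 * D) * D"
          unfolding root using e D by (intro mult_left_mono) (auto simp: D_def)
        also have "\<dots> = e / 3" using D by simp
        finally show "sqrt (\<rho> * \<eta>) * sqrt (exp (T * (c' * B)\<^sup>2)) \<le> e / 3" .
      qed
      finally show ?thesis .
    qed
    have "(\<integral>\<^sup>+\<omega>. ennreal \<bar>\<phi> (X r \<omega>) - \<phi> (chain N (k N) \<omega>)\<bar> \<partial>M)
      \<le> (\<integral>\<^sup>+\<omega>. ennreal \<bar>\<phi> (X r \<omega>) - \<psi> (X r \<omega>)\<bar> + ennreal \<bar>\<psi> (X r \<omega>) - \<psi> (chain N (k N) \<omega>)\<bar> + ennreal \<bar>\<phi> (chain N (k N) \<omega>) - \<psi> (chain N (k N) \<omega>)\<bar> \<partial>M)"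
    proof (rule nn_integral_mono)
      fix \<omega>
      have "\<bar>\<phi> (X r \<omega>) - \<phi> (chain N (k N) \<omega>)\<bar> \<le> \<bar>\<phi> (X r \<omega>) - \<psi> (X r \<omega>)\<bar> + \<bar>\<psi> (X r \<omega>) - \<psi> (chain N (k N) \<omega>)\<bar> + \<bar>\<phi> (chain N (k N) \<omega>) - \<psi> (chain N (k N) \<omega>)\<bar>"
        by linarith
      then have "ennreal \<bar>\<phi> (X r \<omega>) - \<phi> (chain N (k N) \<omega>)\<bar> \<le> ennreal (\<bar>\<phi> (X r \<omega>) - \<psi> (X r \<omega>)\<bar> + \<bar>\<psi> (X r \<omega>) - \<psi> (chain N (k N) \<omega>)\<bar> + \<bar>\<phi> (chain N (k N) \<omega>) - \<psi> (chain N (k N) \<omega>)\<bar>)"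
        by (rule ennreal_leI)
      then show "ennreal \<bar>\<phi> (X r \<omega>) - \<phi> (chain N (k N) \<omega>)\<bar> \<le> ennreal \<bar>\<phi> (X r \<omega>) - \<psi> (X r \<omega>)\<bar> + ennreal \<bar>\<psi> (X r \<omega>) - \<psi> (chain N (k N) \<omega>)\<bar> + ennreal \<bar>\<phi> (chain N (k N) \<omega>) - \<psi> (chain N (k N) \<omega>)\<bar>"
        by (simp add: ennreal_plus)
    qed
    also have "\<dots> = (\<integral>\<^sup>+\<omega>. ennreal \<bar>\<phi> (X r \<omega>) - \<psi> (X r \<omega>)\<bar> \<partial>M) + (\<integral>\<^sup>+\<omega>. ennreal \<bar>\<psi> (X r \<omega>) - \<psi> (chain N (k N) \<omega>)\<bar> \<partial>M) + (\<integral>\<^sup>+\<omega>. ennreal \<bar>\<phi> (chain N (k N) \<omega>) - \<psi> (chain N (k N) \<omega>)\<bar> \<partial>M)"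
      by (simp add: nn_integral_add)
    also have "\<dots> \<le> ennreal (e / 3) + ennreal (e / 3) + ennreal (e / 3)"
      by (intro add_mono t1 t2 t3)
    also have "\<dots> = ennreal e" using e by (simp add: ennreal_plus[symmetric] del: ennreal_plus)
    finally show ?case .
  qed
qed

definition grid_index :: "nat \<Rightarrow> real \<Rightarrow> nat" where
  "grid_index N r = nat \<lfloor>r / stp N\<rfloor>"

lemma grid_index_bounds:
  assumes "1 \<le> N" "0 \<le> r"
  shows "real (grid_index N r) * stp N \<le> r" "r < real (Suc (grid_index N r)) * stp N"
proof -
  have "0 \<le> r / stp N" using assms stp_pos[OF assms(1)] by simp
  then have "real (grid_index N r) = of_int \<lfloor>r / stp N\<rfloor>"
    unfolding grid_index_def by simp
  then have "real (grid_index N r) \<le> r / stp N" "r / stp N < real (grid_index N r) + 1"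
    by linarith+
  then show "real (grid_index N r) * stp N \<le> r" "r < real (Suc (grid_index N r)) * stp N"
    using stp_pos[OF assms(1)] by (simp_all add: pos_le_divide_eq pos_divide_less_eq add.commute)
qed

lemma grid_index_less:
  assumes "1 \<le> N" "0 \<le> r" "r < T"
  shows "grid_index N r < N"
proof -
  have "real (grid_index N r) * stp N < real N * stp N"
    using grid_index_bounds(1)[OF assms(1,2)] assms(3) stp_mult(2)[OF assms(1)] by linarith
  then have "real (grid_index N r) < real N"
    using stp_pos[OF assms(1)] by simp
  then show ?thesis by simp
qed

lemma grid_index_eqI:
  assumes "1 \<le> N" "real k * stp N \<le> r" "r < real (Suc k) * stp N"
  shows "grid_index N r = k"
proof -
  have "\<lfloor>r / stp N\<rfloor> = int k"
    using assms(2,3) stp_pos[OF assms(1)]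
    by (intro floor_unique) (auto simp: pos_le_divide_eq pos_divide_less_eq add.commute)
  then show ?thesis by (simp add: grid_index_def)
qed

lemma grid_index_measurable [measurable]: "grid_index N \<in> measurable borel (count_space UNIV)"
  unfolding grid_index_def[abs_def] by measurable

lemma chain_jointly_measurable:
  assumes "1 \<le> N"
  shows "(\<lambda>(r, \<omega>). chain N (min N (grid_index N r + p)) \<omega>) \<in> borel_measurable (borel \<Otimes>\<^sub>M M)"
proof -
  have "(\<lambda>q. chain N (min N (grid_index N (fst q) + p)) (snd q)) \<in> borel_measurable (borel \<Otimes>\<^sub>M M)"
  proof (rule measurable_compose_countable[where g = "\<lambda>q. grid_index N (fst q)" and f = "\<lambda>i q. chain N (min N (i + p)) (snd q)"])
    show "(\<lambda>q. chain N (min N (i + p)) (snd q)) \<in> borel_measurable (borel \<Otimes>\<^sub>M M)" for i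
      using assms by (intro measurable_compose[OF measurable_snd chain_measurable_M]) auto
    show "(\<lambda>q. grid_index N (fst q)) \<in> measurable (borel \<Otimes>\<^sub>M M) (count_space UNIV)"
      by measurable
  qed
  then show ?thesis by (simp add: split_beta')
qed

lemma chain_error_jointly_measurable:
  assumes "1 \<le> N" "p \<le> 1" and f: "f \<in> borel_measurable (borel \<Otimes>\<^sub>M borel)"
  shows "(\<lambda>(r, \<omega>). indicator {0<..<T} r * (f (X r \<omega>, chain N (grid_index N r + p) \<omega>) :: ennreal)) \<in> borel_measurable (borel \<Otimes>\<^sub>M M)"
proof -
  have "(\<lambda>q. (X (max 0 (min T (fst q))) (snd q), chain N (min N (grid_index N (fst q) + p)) (snd q))) \<in> borel \<Otimes>\<^sub>M M \<rightarrow>\<^sub>M borel \<Otimes>\<^sub>M borel"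
    using X_jointly_measurable_M chain_jointly_measurable[OF assms(1), of p] by (intro measurable_Pair) (simp_all add: split_beta')
  from measurable_compose[OF this f]
  have [measurable]: "(\<lambda>q. f (X (max 0 (min T (fst q))) (snd q), chain N (min N (grid_index N (fst q) + p)) (snd q))) \<in> borel_measurable (borel \<Otimes>\<^sub>M M)" .
  have "(\<lambda>q. indicator {0<..<T} (fst q) * f (X (max 0 (min T (fst q))) (snd q), chain N (min N (grid_index N (fst q) + p)) (snd q))) \<in> borel_measurable (borel \<Otimes>\<^sub>M M)"
    by measurable
  also have "(\<lambda>q. indicator {0<..<T} (fst q) * f (X (max 0 (min T (fst q))) (snd q), chain N (min N (grid_index N (fst q) + p)) (snd q)))
      = (\<lambda>(r, \<omega>). indicator {0<..<T} r * f (X r \<omega>, chain N (grid_index N r + p) \<omega>))"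
  proof (rule ext)
    fix q :: "real \<times> 'w"
    obtain r \<omega> where q: "q = (r, \<omega>)" by (cases q)
    have "grid_index N r + p \<le> N" if "r \<in> {0<..<T}"
      using grid_index_less[OF assms(1), of r] that assms(2) by simp
    then show "indicator {0<..<T} (fst q) * f (X (max 0 (min T (fst q))) (snd q), chain N (min N (grid_index N (fst q) + p)) (snd q))
      = (\<lambda>(r, \<omega>). indicator {0<..<T} r * f (X r \<omega>, chain N (grid_index N r + p) \<omega>)) q"
      by (cases "r \<in> {0<..<T}") (simp_all add: q min_absorb2)
  qed
  finally show ?thesis .
qed

lemma chain_error_measurable:
  assumes "1 \<le> N" "p \<le> 1" and f: "f \<in> borel_measurable (borel \<Otimes>\<^sub>M borel)"
  shows "(\<lambda>r. indicator {0<..<T} r * (\<integral>\<^sup>+\<omega>. f (X r \<omega>, chain N (grid_index N r + p) \<omega>) \<partial>M)) \<in> borel_measurable borel"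
proof -
  have "(\<lambda>r. \<integral>\<^sup>+\<omega>. indicator {0<..<T} r * f (X r \<omega>, chain N (grid_index N r + p) \<omega>) \<partial>M) \<in> borel_measurable borel"
    using chain_error_jointly_measurable[OF assms] by (rule borel_measurable_nn_integral)
  also have "(\<lambda>r. \<integral>\<^sup>+\<omega>. indicator {0<..<T} r * f (X r \<omega>, chain N (grid_index N r + p) \<omega>) \<partial>M)
      = (\<lambda>r. indicator {0<..<T} r * (\<integral>\<^sup>+\<omega>. f (X r \<omega>, chain N (grid_index N r + p) \<omega>) \<partial>M))"
    by (rule ext) (simp add: indicator_def)
  finally show ?thesis .
qed

lemma exp_bounded_mean:
  assumes "0 \<le> K" "\<And>x. \<bar>\<phi> x\<bar> \<le> K * exp (K * norm x)"
    and Z: "Z \<in> borel_measurable M" "(\<integral>\<^sup>+\<omega>. ennreal (exp (K * norm (Z \<omega>))) \<partial>M) \<le> ennreal (exp_moment K)"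
  shows "(\<integral>\<^sup>+\<omega>. ennreal \<bar>\<phi> (Z \<omega>)\<bar> \<partial>M) \<le> ennreal (K * exp_moment K)"
proof -
  have [measurable]: "Z \<in> borel_measurable M" by (rule Z)
  have "(\<integral>\<^sup>+\<omega>. ennreal \<bar>\<phi> (Z \<omega>)\<bar> \<partial>M) \<le> (\<integral>\<^sup>+\<omega>. ennreal K * ennreal (exp (K * norm (Z \<omega>))) \<partial>M)"
    using assms by (intro nn_integral_mono) (simp add: ennreal_mult[symmetric] ennreal_leI)
  also have "\<dots> = ennreal K * (\<integral>\<^sup>+\<omega>. ennreal (exp (K * norm (Z \<omega>))) \<partial>M)"
    by (rule nn_integral_cmult) measurable
  also have "\<dots> \<le> ennreal K * ennreal (exp_moment K)"
    by (intro mult_left_mono Z) auto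
  also have "\<dots> = ennreal (K * exp_moment K)"
    using assms(1) by (simp add: ennreal_mult)
  finally show ?thesis .
qed

text \<open>The offset \<open>p\<close> selects the left or the right end of a cell: a Riemann sum uses the left end, and
  the drift averaged over a cell is compared with the value at the right end, where the chain arrives.
  Exponential moments dominate the integrand. The number of steps is a successor
  because a grid without steps is meaningless.\<close>

lemma chain_converges_integrated:
  assumes [measurable]: "\<phi> \<in> borel_measurable borel" and K: "0 \<le> K" "\<And>x. \<bar>\<phi> x\<bar> \<le> K * exp (K * norm x)"
    and p: "p \<le> 1"
  shows "(\<lambda>N. \<integral>\<^sup>+r. indicator {0<..<T} r * (\<integral>\<^sup>+\<omega>. ennreal \<bar>\<phi> (X r \<omega>) - \<phi> (chain (Suc N) (grid_index (Suc N) r + p) \<omega>)\<bar> \<partial>M) \<partial>lborel) \<longlonglongrightarrow> 0"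
proof -
  let ?E = "\<lambda>N r. indicator {0<..<T} r * (\<integral>\<^sup>+\<omega>. ennreal \<bar>\<phi> (X r \<omega>) - \<phi> (chain (Suc N) (grid_index (Suc N) r + p) \<omega>)\<bar> \<partial>M)"
  have idx: "grid_index (Suc N) r + p \<le> Suc N" if "r \<in> {0<..<T}" for N r
    using grid_index_less[of "Suc N" r] that p by simp
  have "(\<lambda>N. \<integral>\<^sup>+r. ?E N r \<partial>lborel) \<longlonglongrightarrow> (\<integral>\<^sup>+r. 0 \<partial>(lborel :: real measure))"
  proof (rule nn_integral_dominated_convergence[where w = "\<lambda>r. ennreal (2 * (K * exp_moment K)) * indicator {0<..<T} r"])
    show "?E N \<in> borel_measurable lborel" for N
    proof -
      have "(\<lambda>q. ennreal \<bar>\<phi> (fst q) - \<phi> (snd q)\<bar>) \<in> borel_measurable (borel \<Otimes>\<^sub>M borel)"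
        by measurable
      from chain_error_measurable[OF _ p this, of "Suc N"] show ?thesis by simp
    qed
    show "AE r in lborel. (\<lambda>N. ?E N r) \<longlonglongrightarrow> 0"
    proof (rule AE_I2)
      fix r :: real
      show "(\<lambda>N. ?E N r) \<longlonglongrightarrow> 0"
      proof (cases "r \<in> {0<..<T}")
        case True
        have "(\<lambda>N. \<integral>\<^sup>+\<omega>. ennreal \<bar>\<phi> (X r \<omega>) - \<phi> (chain N (grid_index N r + p) \<omega>)\<bar> \<partial>M) \<longlonglongrightarrow> 0"
        proof (rule chain_converges[OF _ K])
          show "grid_index N r + p \<le> N" if "1 \<le> N" for N
            using idx[OF True, of "N - 1"] that by simp
          show "(\<lambda>N. real (grid_index N r + p) * stp N) \<longlonglongrightarrow> r"
          proof (rule tendsto_sandwich)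
            show "(\<lambda>N. r - stp N) \<longlonglongrightarrow> r"
              using tendsto_diff[OF tendsto_const stp_tendsto, of r] by simp
            show "(\<lambda>N. r + stp N) \<longlonglongrightarrow> r"
              using tendsto_add[OF tendsto_const stp_tendsto, of r] by simp
            show "\<forall>\<^sub>F N in sequentially. r - stp N \<le> real (grid_index N r + p) * stp N"
              using eventually_ge_at_top[of 1]
            proof eventually_elim
              case (elim N)
              have "0 \<le> real p * stp N" using stp_pos[OF elim] by simp
              then show ?case
                using grid_index_bounds(2)[OF elim, of r] True by (simp add: distrib_right)
            qed
            show "\<forall>\<^sub>F N in sequentially. real (grid_index N r + p) * stp N \<le> r + stp N"
              using eventually_ge_at_top[of 1]
            proof eventually_elim
              case (elim N)
              have "real p * stp N \<le> 1 * stp N" using stp_pos[OF elim] p by (intro mult_right_mono) auto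
              then show ?case
                using grid_index_bounds(1)[OF elim, of r] True by (simp add: distrib_right)
            qed
          qed
        qed (use True in auto)
        from LIMSEQ_Suc[OF this] True show ?thesis by simp
      qed simp
    qed
    show "AE r in lborel. ?E N r \<le> ennreal (2 * (K * exp_moment K)) * indicator {0<..<T} r" for N
    proof (rule AE_I2)
      fix r :: real
      show "?E N r \<le> ennreal (2 * (K * exp_moment K)) * indicator {0<..<T} r"
      proof (cases "r \<in> {0<..<T}")
        case True
        let ?Z = "chain (Suc N) (grid_index (Suc N) r + p)"
        have [measurable]: "X r \<in> borel_measurable M" using True by (intro X_measurable) auto
        have [measurable]: "?Z \<in> borel_measurable M" using idx[OF True] by (intro chain_measurable_M) auto
        have "(\<integral>\<^sup>+\<omega>. ennreal \<bar>\<phi> (X r \<omega>) - \<phi> (?Z \<omega>)\<bar> \<partial>M) \<le> (\<integral>\<^sup>+\<omega>. ennreal \<bar>\<phi> (X r \<omega>)\<bar> + ennreal \<bar>\<phi> (?Z \<omega>)\<bar> \<partial>M)"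
          by (intro nn_integral_mono) (simp add: ennreal_plus[symmetric] ennreal_leI del: ennreal_plus)
        also have "\<dots> = (\<integral>\<^sup>+\<omega>. ennreal \<bar>\<phi> (X r \<omega>)\<bar> \<partial>M) + (\<integral>\<^sup>+\<omega>. ennreal \<bar>\<phi> (?Z \<omega>)\<bar> \<partial>M)"
          by (rule nn_integral_add) measurable
        also have "\<dots> \<le> ennreal (K * exp_moment K) + ennreal (K * exp_moment K)"
          using True idx[OF True] K(1)
          by (intro add_mono exp_bounded_mean[OF K] X_exp_moment chain_exp_moment) auto
        also have "\<dots> = ennreal (2 * (K * exp_moment K))"
          using K(1) by (simp add: ennreal_plus[symmetric] del: ennreal_plus)
        finally show ?thesis using True by simp
      qed simp
    qed
    show "(\<integral>\<^sup>+r. ennreal (2 * (K * exp_moment K)) * indicator {0<..<T} r \<partial>lborel) < \<infinity>"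
      using T_pos by (simp add: nn_integral_cmult ennreal_mult_less_top)
  qed auto
  then show ?thesis by simp
qed

end

context additive_sde
begin

lemma chain_converges_vec:
  assumes [measurable]: "\<phi> \<in> borel_measurable borel" and K: "0 \<le> K" "\<And>x. norm (\<phi> x) \<le> K * exp (K * norm x)"
    and p: "p \<le> 1" and e: "0 < e"
  shows "\<exists>N0. \<forall>N\<ge>N0. (\<integral>\<^sup>+r. indicator {0<..<T} r * (\<integral>\<^sup>+\<omega>. ennreal (norm (\<phi> (X r \<omega>) - (\<phi> (chain N (grid_index N r + p) \<omega>) :: real^'d))) \<partial>M) \<partial>lborel) \<le> ennreal e"
proof -
  let ?E = "\<lambda>j N r. indicator {0<..<T} r * (\<integral>\<^sup>+\<omega>. ennreal \<bar>\<phi> (X r \<omega>) $ j - \<phi> (chain N (grid_index N r + p) \<omega>) $ j\<bar> \<partial>M)"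
  let ?V = "\<lambda>N. \<integral>\<^sup>+r. indicator {0<..<T} r * (\<integral>\<^sup>+\<omega>. ennreal (norm (\<phi> (X r \<omega>) - \<phi> (chain N (grid_index N r + p) \<omega>))) \<partial>M) \<partial>lborel"
  have nth_measurable[measurable]: "(\<lambda>x. \<phi> x $ j) \<in> borel_measurable borel" for j
  proof -
    have "(\<lambda>x. \<phi> x \<bullet> axis j 1) \<in> borel_measurable borel" by measurable
    then show ?thesis by (simp add: inner_axis)
  qed
  have E_meas: "?E j (Suc N) \<in> borel_measurable lborel" for j N
  proof -
    have "(\<lambda>q. ennreal \<bar>\<phi> (fst q) $ j - \<phi> (snd q) $ j\<bar>) \<in> borel_measurable (borel \<Otimes>\<^sub>M borel)"
      by measurable
    from chain_error_measurable[OF _ p this, of "Suc N"] show ?thesis by simp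
  qed
  have "(\<lambda>N. \<integral>\<^sup>+r. ?E j (Suc N) r \<partial>lborel) \<longlonglongrightarrow> 0" for j
  proof (rule chain_converges_integrated[OF nth_measurable K(1) _ p])
    show "\<bar>\<phi> x $ j\<bar> \<le> K * exp (K * norm x)" for x
      using component_le_norm_cart[of "\<phi> x" j] K(2)[of x] by linarith
  qed
  then have "(\<lambda>N. \<Sum>j\<in>UNIV. \<integral>\<^sup>+r. ?E j (Suc N) r \<partial>lborel) \<longlonglongrightarrow> (\<Sum>j\<in>(UNIV :: 'd set). 0)"
    by (rule tendsto_sum)
  then have "eventually (\<lambda>N. (\<Sum>j\<in>UNIV. \<integral>\<^sup>+r. ?E j (Suc N) r \<partial>lborel) < ennreal e) sequentially"
    using e by (intro order_tendstoD(2)) auto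
  then obtain N0 where N0': "\<forall>N\<ge>N0. (\<Sum>j\<in>UNIV. \<integral>\<^sup>+r. ?E j (Suc N) r \<partial>lborel) < ennreal e"
    unfolding eventually_sequentially by (rule exE)
  note N0 = N0'[rule_format]
  have "?V (Suc N) \<le> (\<Sum>j\<in>UNIV. \<integral>\<^sup>+r. ?E j (Suc N) r \<partial>lborel)" for N
  proof -
    have "?V (Suc N) \<le> (\<integral>\<^sup>+r. (\<Sum>j\<in>UNIV. ?E j (Suc N) r) \<partial>lborel)"
    proof (rule nn_integral_mono)
      fix r :: real
      show "indicator {0<..<T} r * (\<integral>\<^sup>+\<omega>. ennreal (norm (\<phi> (X r \<omega>) - \<phi> (chain (Suc N) (grid_index (Suc N) r + p) \<omega>))) \<partial>M) \<le> (\<Sum>j\<in>UNIV. ?E j (Suc N) r)"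
      proof (cases "r \<in> {0<..<T}")
        case True
        let ?Z = "chain (Suc N) (grid_index (Suc N) r + p)"
        have [measurable]: "X r \<in> borel_measurable M" using True by (intro X_measurable) auto
        have [measurable]: "?Z \<in> borel_measurable M"
          using grid_index_less[of "Suc N" r] True p by (intro chain_measurable_M) auto
        have "(\<integral>\<^sup>+\<omega>. ennreal (norm (\<phi> (X r \<omega>) - \<phi> (?Z \<omega>))) \<partial>M) \<le> (\<integral>\<^sup>+\<omega>. (\<Sum>j\<in>UNIV. ennreal \<bar>\<phi> (X r \<omega>) $ j - \<phi> (?Z \<omega>) $ j\<bar>) \<partial>M)"
        proof (rule nn_integral_mono)
          fix \<omega>
          have "norm (\<phi> (X r \<omega>) - \<phi> (?Z \<omega>)) \<le> (\<Sum>j\<in>UNIV. \<bar>\<phi> (X r \<omega>) $ j - \<phi> (?Z \<omega>) $ j\<bar>)"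
            using norm_le_l1_cart[of "\<phi> (X r \<omega>) - \<phi> (?Z \<omega>)"] by simp
          then show "ennreal (norm (\<phi> (X r \<omega>) - \<phi> (?Z \<omega>))) \<le> (\<Sum>j\<in>UNIV. ennreal \<bar>\<phi> (X r \<omega>) $ j - \<phi> (?Z \<omega>) $ j\<bar>)"
            by (simp add: ennreal_leI)
        qed
        also have "\<dots> = (\<Sum>j\<in>UNIV. \<integral>\<^sup>+\<omega>. ennreal \<bar>\<phi> (X r \<omega>) $ j - \<phi> (?Z \<omega>) $ j\<bar> \<partial>M)"
          by (rule nn_integral_sum) measurable
        finally show ?thesis using True by simp
      qed simp
    qed
    also have "\<dots> = (\<Sum>j\<in>UNIV. \<integral>\<^sup>+r. ?E j (Suc N) r \<partial>lborel)"
      by (rule nn_integral_sum) (rule E_meas)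
    finally show ?thesis .
  qed
  note V_le = this
  show ?thesis
  proof (intro exI[of _ "Suc N0"] allI impI)
    fix N assume "Suc N0 \<le> N"
    then obtain N' where N': "N = Suc N'" "N0 \<le> N'" by (cases N) auto
    show "?V N \<le> ennreal e"
      unfolding N'(1) by (rule order_trans[OF V_le less_imp_le[OF N0[OF N'(2)]]])
  qed
qed

lemma swap_time_expectation:
  assumes "(\<lambda>(r, \<omega>). f r \<omega>) \<in> borel_measurable (borel \<Otimes>\<^sub>M M)"
  shows "(\<integral>\<^sup>+\<omega>. (\<integral>\<^sup>+r. f r \<omega> \<partial>lborel) \<partial>M) = (\<integral>\<^sup>+r. (\<integral>\<^sup>+\<omega>. f r \<omega> \<partial>M) \<partial>(lborel :: real measure))"
proof -
  interpret P: pair_sigma_finite "lborel :: real measure" M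
    by (intro pair_sigma_finite.intro sigma_finite_lborel sigma_finite_measure_axioms)
  have "sets ((lborel :: real measure) \<Otimes>\<^sub>M M) = sets (borel \<Otimes>\<^sub>M M)"
    by (rule sets_pair_measure_cong) auto
  then have "(\<lambda>(r, \<omega>). f r \<omega>) \<in> borel_measurable ((lborel :: real measure) \<Otimes>\<^sub>M M)"
    using assms by (subst measurable_cong_sets[OF _ refl])
  then show ?thesis by (rule P.Fubini')
qed

lemma sum_grid_integral_le:
  assumes N: "1 \<le> N" and f: "\<And>k. k < N \<Longrightarrow> (\<lambda>r. indicator {real k * stp N<..<real (Suc k) * stp N} r * f k r) \<in> borel_measurable borel"
  shows "(\<Sum>k<N. \<integral>\<^sup>+r. indicator {real k * stp N<..<real (Suc k) * stp N} r * (f k r :: ennreal) \<partial>lborel)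
    \<le> (\<integral>\<^sup>+r. indicator {0<..<T} r * f (grid_index N r) r \<partial>lborel)"
proof -
  let ?I = "\<lambda>k r. indicator {real k * stp N<..<real (Suc k) * stp N} r * f k r"
  have "(\<Sum>k<N. \<integral>\<^sup>+r. ?I k r \<partial>lborel) = (\<integral>\<^sup>+r. (\<Sum>k<N. ?I k r) \<partial>lborel)"
    using f by (intro nn_integral_sum[symmetric]) simp
  also have "\<dots> \<le> (\<integral>\<^sup>+r. indicator {0<..<T} r * f (grid_index N r) r \<partial>lborel)"
  proof (rule nn_integral_mono)
    fix r :: real
    have in_range: "r \<in> {0<..<T}" if "k < N" "r \<in> {real k * stp N<..<real (Suc k) * stp N}" for k
    proof -
      have "0 \<le> real k * stp N" by (rule grid_nonneg[OF N])
      moreover have "real (Suc k) * stp N \<le> T" using that(1) by (intro grid_le[OF N]) simp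
      ultimately show ?thesis using that(2) by auto
    qed
    have "(\<Sum>k<N. ?I k r) \<le> (\<Sum>k<N. if k = grid_index N r then indicator {0<..<T} r * f k r else 0)"
    proof (rule sum_mono)
      fix k assume "k \<in> {..<N}"
      show "?I k r \<le> (if k = grid_index N r then indicator {0<..<T} r * f k r else 0)"
      proof (cases "r \<in> {real k * stp N<..<real (Suc k) * stp N}")
        case True
        then have "grid_index N r = k" by (intro grid_index_eqI[OF N]) auto
        moreover have "r \<in> {0<..<T}" using in_range True \<open>k \<in> {..<N}\<close> by auto
        ultimately show ?thesis using True by simp
      qed simp
    qed
    also have "\<dots> \<le> indicator {0<..<T} r * f (grid_index N r) r"
      by simp
    finally show "(\<Sum>k<N. ?I k r) \<le> indicator {0<..<T} r * f (grid_index N r) r" .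
  qed
  finally show ?thesis .
qed

lemma grid_integral_le_sum:
  assumes N: "1 \<le> N"
  shows "(\<integral>\<^sup>+r. indicator {0<..<T} r * (h (grid_index N r) :: ennreal) \<partial>lborel) \<le> (\<Sum>k<N. ennreal (stp N) * h k)"
proof -
  have "(\<integral>\<^sup>+r. indicator {0<..<T} r * h (grid_index N r) \<partial>lborel)
    \<le> (\<integral>\<^sup>+r. (\<Sum>k<N. h k * indicator {real k * stp N..<real (Suc k) * stp N} r) \<partial>lborel)"
  proof (rule nn_integral_mono)
    fix r :: real
    show "indicator {0<..<T} r * h (grid_index N r) \<le> (\<Sum>k<N. h k * indicator {real k * stp N..<real (Suc k) * stp N} r)"
    proof (cases "r \<in> {0<..<T}")
      case True
      then have "grid_index N r \<in> {..<N}" using grid_index_less[OF N, of r] by simp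
      moreover have "r \<in> {real (grid_index N r) * stp N..<real (Suc (grid_index N r)) * stp N}"
        using grid_index_bounds[OF N, of r] True by auto
      ultimately show ?thesis
        using True member_le_sum[of "grid_index N r" "{..<N}" "\<lambda>k. h k * indicator {real k * stp N..<real (Suc k) * stp N} r"] by simp
    qed simp
  qed
  also have "\<dots> = (\<Sum>k<N. \<integral>\<^sup>+r. h k * indicator {real k * stp N..<real (Suc k) * stp N} r \<partial>lborel)"
    by (rule nn_integral_sum) measurable
  also have "\<dots> = (\<Sum>k<N. ennreal (stp N) * h k)"
  proof (rule sum.cong[OF refl])
    fix k
    have "real (Suc k) * stp N - real k * stp N = stp N" "real k * stp N \<le> real (Suc k) * stp N"
      using stp_pos[OF N] by (simp_all add: algebra_simps)
    then show "(\<integral>\<^sup>+r. h k * indicator {real k * stp N..<real (Suc k) * stp N} r \<partial>lborel) = ennreal (stp N) * h k"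
      by (subst nn_integral_cmult) (simp_all add: mult.commute)
  qed
  finally show ?thesis .
qed

lemma indicator_X_measurable:
  assumes "\<omega> \<in> space M" "A \<in> sets borel" "A \<subseteq> {0..T}" and f: "f \<in> borel_measurable borel"
  shows "(\<lambda>r. indicator A r * (f (X r \<omega>) :: ennreal)) \<in> borel_measurable borel"
proof -
  have [measurable]: "(\<lambda>r. f (X (max 0 (min T r)) \<omega>)) \<in> borel_measurable borel"
    by (rule measurable_compose[OF X_path_measurable[OF assms(1)] f])
  have [measurable]: "A \<in> sets borel" by fact
  have "(\<lambda>r. indicator A r * f (X (max 0 (min T r)) \<omega>)) \<in> borel_measurable borel"
    by measurable
  also have "(\<lambda>r. indicator A r * f (X (max 0 (min T r)) \<omega>)) = (\<lambda>r. indicator A r * f (X r \<omega>))"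
    using assms(3) by (intro ext) (auto simp: indicator_def dest!: subsetD)
  finally show ?thesis .
qed

text \<open>The average over a cell is close to the value at the right end of the cell, by the convergence of
  the chain. Only the first step has no preceding cell; its contribution is of the size of the step.\<close>

lemma delayed_drift_error:
  assumes e: "0 < e"
  shows "\<exists>N0. \<forall>N\<ge>N0. 1 \<le> N \<longrightarrow> ennreal (stp N) * (\<Sum>k<N. \<integral>\<^sup>+\<omega>. ennreal (norm (delayed_drift N k \<omega> - \<sigma>' *v b (chain N k \<omega>))) \<partial>M) \<le> ennreal e"
proof -
  define e' where "e' = e / (2 * (c' + 1))"
  have e': "0 < e'" using e c'_nonneg by (simp add: e'_def)
  have b_exp: "norm (b x) \<le> B * exp (B * norm x)" for x
  proof -
    have "B * 1 \<le> B * exp (B * norm x)" using B_nonneg by (intro mult_left_mono) auto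
    then show ?thesis using b_bound[of x] by simp
  qed
  from chain_converges_vec[OF b_measurable B_nonneg b_exp order_refl e']
  obtain N1 where N1: "\<forall>N\<ge>N1. (\<integral>\<^sup>+r. indicator {0<..<T} r * (\<integral>\<^sup>+\<omega>. ennreal (norm (b (X r \<omega>) - b (chain N (grid_index N r + 1) \<omega>))) \<partial>M) \<partial>lborel) \<le> ennreal e'"
    by (rule exE)
  have "(\<lambda>N. c' * B * stp N) \<longlonglongrightarrow> c' * B * 0" by (intro tendsto_intros stp_tendsto)
  then have "eventually (\<lambda>N. c' * B * stp N < e / 2) sequentially"
    using e by (intro order_tendstoD(2)) auto
  then obtain N2 where N2: "\<And>N. N2 \<le> N \<Longrightarrow> c' * B * stp N < e / 2"
    unfolding eventually_sequentially by blast
  have "ennreal (stp N) * (\<Sum>k<N. \<integral>\<^sup>+\<omega>. ennreal (norm (delayed_drift N k \<omega> - \<sigma>' *v b (chain N k \<omega>))) \<partial>M) \<le> ennreal e"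
    if N: "1 \<le> N" "max N1 N2 \<le> N" for N
  proof -
    obtain N' where N': "N = Suc N'" using N(1) by (cases N) auto
    define s where "s = stp N"
    have s: "0 < s" using stp_pos[OF N(1)] by (simp add: s_def)
    define R where "R = (\<lambda>k \<omega>. norm (delayed_drift N k \<omega> - \<sigma>' *v b (chain N k \<omega>)))"
    define f where "f = (\<lambda>k r \<omega>. ennreal (norm (b (X r \<omega>) - b (chain N (k + 1) \<omega>))))"
    have R_meas[measurable]: "R k \<in> borel_measurable M" if "k \<le> N" for k
    proof -
      have [measurable]: "delayed_drift N k \<in> borel_measurable M"
        by (rule measurable_F_M[OF delayed_drift_measurable[OF N(1) that] grid_nonneg[OF N(1)]])
      have [measurable]: "chain N k \<in> borel_measurable M" by (rule chain_measurable_M[OF N(1) that])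
      show ?thesis unfolding R_def by measurable
    qed
    have R_eq: "s * R k \<omega> \<le> c' * norm (drift (real k * s) \<omega> - drift (real (k - 1) * s) \<omega> - s *\<^sub>R b (chain N k \<omega>))" for k \<omega>
    proof -
      let ?d = "drift (real k * s) \<omega> - drift (real (k - 1) * s) \<omega>"
      have "delayed_drift N k \<omega> - \<sigma>' *v b (chain N k \<omega>) = \<sigma>' *v ((1 / s) *\<^sub>R (?d - s *\<^sub>R b (chain N k \<omega>)))"
        using s by (simp add: delayed_drift_def s_def matrix_vector_mult_diff_distrib scaleR_right_diff_distrib)
      then have "R k \<omega> \<le> c' * norm ((1 / s) *\<^sub>R (?d - s *\<^sub>R b (chain N k \<omega>)))"
        unfolding R_def by (simp only: norm_inverse_le)
      also have "\<dots> = c' * norm (?d - s *\<^sub>R b (chain N k \<omega>)) / s"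
        unfolding norm_scaleR using s by simp
      finally show ?thesis using s by (simp add: pos_le_divide_eq mult.commute)
    qed
    have first: "ennreal s * (\<integral>\<^sup>+\<omega>. ennreal (R 0 \<omega>) \<partial>M) \<le> ennreal (e / 2)"
    proof -
      have "s * R 0 \<omega> \<le> c' * B * s" for \<omega>
      proof -
        have "s * R 0 \<omega> \<le> c' * norm (s *\<^sub>R b (chain N 0 \<omega>))" using R_eq[of 0 \<omega>] by simp
        also have "\<dots> \<le> c' * (s * B)"
          unfolding norm_scaleR using s b_bound c'_nonneg by (intro mult_left_mono mult_mono) auto
        finally show ?thesis by (simp add: mult_ac)
      qed
      then have "(\<integral>\<^sup>+\<omega>. ennreal s * ennreal (R 0 \<omega>) \<partial>M) \<le> (\<integral>\<^sup>+\<omega>. ennreal (c' * B * s) \<partial>M)"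
        using s by (intro nn_integral_mono) (simp add: ennreal_mult[symmetric] R_def ennreal_leI)
      also have "\<dots> = ennreal (c' * B * s)" using emeasure_space_1 by simp
      also have "\<dots> \<le> ennreal (e / 2)" using N2[of N] N by (intro ennreal_leI) (simp add: s_def)
      finally show ?thesis by (subst (asm) nn_integral_cmult) auto
    qed
    have rest: "ennreal s * (\<Sum>k<N'. \<integral>\<^sup>+\<omega>. ennreal (R (Suc k) \<omega>) \<partial>M) \<le> ennreal (e / 2)"
    proof -
      have Rk: "ennreal s * ennreal (R (Suc k) \<omega>) \<le> ennreal c' * (\<integral>\<^sup>+r. indicator {real k * s<..<real (Suc k) * s} r * f k r \<omega> \<partial>lborel)"
        if \<omega>: "\<omega> \<in> space M" and k: "k < N'" for k \<omega>
      proof -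
        let ?y = "b (chain N (Suc k) \<omega>)"
        have d: "real (Suc k) * s - real k * s = s" by (simp add: distrib_right)
        have "ennreal s * ennreal (R (Suc k) \<omega>) \<le> ennreal c' * ennreal (norm (drift (real (Suc k) * s) \<omega> - drift (real k * s) \<omega> - s *\<^sub>R ?y))"
          using R_eq[of "Suc k" \<omega>] s c'_nonneg by (simp add: ennreal_mult[symmetric] R_def ennreal_leI)
        also have "ennreal (norm (drift (real (Suc k) * s) \<omega> - drift (real k * s) \<omega> - s *\<^sub>R ?y))
            \<le> (\<integral>\<^sup>+r. indicator {real k * s<..real (Suc k) * s} r * ennreal (norm (b (X r \<omega>) - ?y)) \<partial>lborel)"
        proof -
          have "0 \<le> real k * s" unfolding s_def by (rule grid_nonneg[OF N(1)])
          moreover have "real k * s \<le> real (Suc k) * s" using s by (intro mult_right_mono) auto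
          moreover have "real (Suc k) * s \<le> T" unfolding s_def using k N' by (intro grid_le[OF N(1)]) simp
          ultimately show ?thesis using drift_diff_approx[OF \<omega>, of "real k * s" "real (Suc k) * s" ?y] unfolding d by (simp only: simp_thms)
        qed
        also have "\<dots> = (\<integral>\<^sup>+r. indicator {real k * s<..<real (Suc k) * s} r * f k r \<omega> \<partial>lborel)"
          by (rule nn_integral_cong_AE, rule AE_mp[OF AE_lborel_singleton[of "real (Suc k) * s"]])
             (auto intro!: AE_I2 simp: indicator_def f_def simp del: of_nat_Suc)
        finally show ?thesis by (simp add: mult_left_mono)
      qed
      have "ennreal s * (\<Sum>k<N'. \<integral>\<^sup>+\<omega>. ennreal (R (Suc k) \<omega>) \<partial>M) = (\<integral>\<^sup>+\<omega>. (\<Sum>k<N'. ennreal s * ennreal (R (Suc k) \<omega>)) \<partial>M)"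
      proof -
        have [measurable]: "R (Suc k) \<in> borel_measurable M" if "k \<in> {..<N'}" for k
          using that N' by (intro R_meas) auto
        have "(\<integral>\<^sup>+\<omega>. (\<Sum>k<N'. ennreal s * ennreal (R (Suc k) \<omega>)) \<partial>M) = (\<Sum>k<N'. \<integral>\<^sup>+\<omega>. ennreal s * ennreal (R (Suc k) \<omega>) \<partial>M)"
          by (rule nn_integral_sum) measurable
        also have "\<dots> = (\<Sum>k<N'. ennreal s * (\<integral>\<^sup>+\<omega>. ennreal (R (Suc k) \<omega>) \<partial>M))"
          by (intro sum.cong refl nn_integral_cmult) auto
        finally show ?thesis by (simp only: sum_distrib_left)
      qed
      also have "\<dots> \<le> (\<integral>\<^sup>+\<omega>. ennreal c' * (\<integral>\<^sup>+r. indicator {0<..<T} r * f (grid_index N r) r \<omega> \<partial>lborel) \<partial>M)"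
      proof (rule nn_integral_mono)
        fix \<omega> assume \<omega>: "\<omega> \<in> space M"
        have "(\<Sum>k<N'. ennreal s * ennreal (R (Suc k) \<omega>)) \<le> (\<Sum>k<N'. ennreal c' * (\<integral>\<^sup>+r. indicator {real k * s<..<real (Suc k) * s} r * f k r \<omega> \<partial>lborel))"
          using Rk[OF \<omega>] by (intro sum_mono) simp
        also have "\<dots> \<le> (\<Sum>k<N. ennreal c' * (\<integral>\<^sup>+r. indicator {real k * s<..<real (Suc k) * s} r * f k r \<omega> \<partial>lborel))"
          unfolding N' by (rule sum_mono2) auto
        also have "\<dots> = ennreal c' * (\<Sum>k<N. \<integral>\<^sup>+r. indicator {real k * s<..<real (Suc k) * s} r * f k r \<omega> \<partial>lborel)"
          by (rule sum_distrib_left[symmetric])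
        also have "(\<Sum>k<N. \<integral>\<^sup>+r. indicator {real k * s<..<real (Suc k) * s} r * f k r \<omega> \<partial>lborel) \<le> (\<integral>\<^sup>+r. indicator {0<..<T} r * f (grid_index N r) r \<omega> \<partial>lborel)"
          unfolding s_def
        proof (rule sum_grid_integral_le[OF N(1)])
          fix k assume k: "k < N"
          have "{real k * stp N<..<real (Suc k) * stp N} \<subseteq> {0..T}"
            using grid_nonneg[OF N(1), of k] grid_le[OF N(1), of "Suc k"] k by (auto simp del: of_nat_Suc)
          then show "(\<lambda>r. indicator {real k * stp N<..<real (Suc k) * stp N} r * f k r \<omega>) \<in> borel_measurable borel"
            unfolding f_def by (intro indicator_X_measurable[OF \<omega>]) auto
        qed
        finally show "(\<Sum>k<N'. ennreal s * ennreal (R (Suc k) \<omega>)) \<le> ennreal c' * (\<integral>\<^sup>+r. indicator {0<..<T} r * f (grid_index N r) r \<omega> \<partial>lborel)"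
          by (simp add: mult_left_mono)
      qed
      also have "\<dots> = ennreal c' * (\<integral>\<^sup>+r. indicator {0<..<T} r * (\<integral>\<^sup>+\<omega>. f (grid_index N r) r \<omega> \<partial>M) \<partial>lborel)"
      proof -
        have "(\<lambda>q. ennreal (norm (b (fst q) - b (snd q)))) \<in> borel_measurable (borel \<Otimes>\<^sub>M borel)"
          by measurable
        from chain_error_jointly_measurable[OF N(1) order_refl this]
        have joint: "(\<lambda>(r, \<omega>). indicator {0<..<T} r * f (grid_index N r) r \<omega>) \<in> borel_measurable (borel \<Otimes>\<^sub>M M)"
          by (simp add: f_def)
        have "(\<lambda>(\<omega>, r). indicator {0<..<T} r * f (grid_index N r) r \<omega>) \<in> borel_measurable (M \<Otimes>\<^sub>M lborel)"
          using measurable_compose[OF measurable_pair_swap' joint] by (simp add: split_beta')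
        then have "(\<lambda>\<omega>. \<integral>\<^sup>+r. indicator {0<..<T} r * f (grid_index N r) r \<omega> \<partial>lborel) \<in> borel_measurable M"
          by (rule lborel.borel_measurable_nn_integral)
        then have "(\<integral>\<^sup>+\<omega>. ennreal c' * (\<integral>\<^sup>+r. indicator {0<..<T} r * f (grid_index N r) r \<omega> \<partial>lborel) \<partial>M)
            = ennreal c' * (\<integral>\<^sup>+\<omega>. (\<integral>\<^sup>+r. indicator {0<..<T} r * f (grid_index N r) r \<omega> \<partial>lborel) \<partial>M)"
          by (rule nn_integral_cmult)
        also have "(\<integral>\<^sup>+\<omega>. (\<integral>\<^sup>+r. indicator {0<..<T} r * f (grid_index N r) r \<omega> \<partial>lborel) \<partial>M) = (\<integral>\<^sup>+r. (\<integral>\<^sup>+\<omega>. indicator {0<..<T} r * f (grid_index N r) r \<omega> \<partial>M) \<partial>lborel)"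
          by (rule swap_time_expectation[OF joint])
        also have "\<dots> = (\<integral>\<^sup>+r. indicator {0<..<T} r * (\<integral>\<^sup>+\<omega>. f (grid_index N r) r \<omega> \<partial>M) \<partial>lborel)"
          by (intro nn_integral_cong) (simp add: indicator_def)
        finally show ?thesis .
      qed
      also have "\<dots> \<le> ennreal c' * ennreal e'"
        using N1[rule_format, of N] N(2) by (intro mult_left_mono) (simp_all add: f_def)
      also have "\<dots> = ennreal (c' * e')" using c'_nonneg e' by (simp add: ennreal_mult)
      also have "\<dots> \<le> ennreal (e / 2)"
      proof (rule ennreal_leI)
        have "c' * e' \<le> (c' + 1) * e'" using e' by simp
        also have "\<dots> = e / 2"
        proof -
          define q where "q = c' + 1"
          have "0 < q" using c'_nonneg by (simp add: q_def)
          then show ?thesis unfolding e'_def q_def[symmetric] by simp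
        qed
        finally show "c' * e' \<le> e / 2" .
      qed
      finally show ?thesis .
    qed
    have "ennreal s * (\<Sum>k<N. \<integral>\<^sup>+\<omega>. ennreal (R k \<omega>) \<partial>M) = ennreal s * (\<integral>\<^sup>+\<omega>. ennreal (R 0 \<omega>) \<partial>M) + ennreal s * (\<Sum>k<N'. \<integral>\<^sup>+\<omega>. ennreal (R (Suc k) \<omega>) \<partial>M)"
      unfolding N' by (simp only: sum.lessThan_Suc_shift distrib_left)
    also have "\<dots> \<le> ennreal (e / 2) + ennreal (e / 2)" by (rule add_mono[OF first rest])
    also have "\<dots> = ennreal e" using e by (simp add: ennreal_plus[symmetric] del: ennreal_plus)
    finally show ?thesis by (simp add: R_def s_def)
  qed
  then show ?thesis by (intro exI[of _ "max N1 N2"] allI impI)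
qed

section \<open>Increments of the driftless process\<close>

lemma driftless_increment:
  assumes "\<phi> \<in> class_B \<beta>" and \<beta>: "0 < \<beta>" "\<beta> \<le> 1"
  shows "\<exists>C\<ge>0. \<forall>s t. 0 < s \<longrightarrow> s < t \<longrightarrow> t \<le> T \<longrightarrow>
    (\<integral>\<^sup>+\<omega>. ennreal ((norm (\<phi> (x0 + \<sigma> *v W t \<omega>) - \<phi> (x0 + \<sigma> *v W s \<omega>)))\<^sup>2) \<partial>M) \<le> ennreal (C * ((t - s) powr \<beta> + s powr (- 1 / 2) * sqrt (t - s)))"
proof -
  have \<phi>[measurable]: "\<phi> \<in> borel_measurable borel" using assms(1) by (simp add: class_B_def)
  from class_B_increment_bound[OF assms(1) \<beta> T_pos, of x0] obtain C where C: "0 \<le> C"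
    and bound: "\<forall>s \<tau>. 0 < s \<longrightarrow> s \<le> T \<longrightarrow> 0 < \<tau> \<longrightarrow> \<tau> \<le> T \<longrightarrow>
     (\<integral>\<^sup>+z. (\<integral>\<^sup>+w. ennreal ((norm (\<phi> (x0 + \<sigma> *v w + \<sigma> *v z) - \<phi> (x0 + \<sigma> *v w)))\<^sup>2) \<partial>gauss s) \<partial>gauss \<tau>)
       \<le> ennreal (C * (\<tau> powr \<beta> + s powr (- 1 / 2) * sqrt \<tau>))"
    by (elim exE conjE)
  have "(\<integral>\<^sup>+\<omega>. ennreal ((norm (\<phi> (x0 + \<sigma> *v W t \<omega>) - \<phi> (x0 + \<sigma> *v W s \<omega>)))\<^sup>2) \<partial>M) \<le> ennreal (C * ((t - s) powr \<beta> + s powr (- 1 / 2) * sqrt (t - s)))"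
    if st: "0 < s" "s < t" "t \<le> T" for s t
  proof -
    let ?H = "\<lambda>q. ennreal ((norm (\<phi> (x0 + \<sigma> *v fst q + \<sigma> *v snd q) - \<phi> (x0 + \<sigma> *v fst q)))\<^sup>2)"
    have H: "?H \<in> borel_measurable (borel \<Otimes>\<^sub>M borel)" by measurable
    have "(\<integral>\<^sup>+\<omega>. ennreal ((norm (\<phi> (x0 + \<sigma> *v W t \<omega>) - \<phi> (x0 + \<sigma> *v W s \<omega>)))\<^sup>2) \<partial>M) = (\<integral>\<^sup>+\<omega>. ?H (W s \<omega>, W t \<omega> - W s \<omega>) \<partial>M)"
      by (simp add: matrix_vector_mult_diff_distrib)
    also have "\<dots> = (\<integral>\<^sup>+z. (\<integral>\<^sup>+w. ?H (w, z) \<partial>gauss s) \<partial>gauss (t - s))"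
      by (rule W_pair_law[OF st(1,2) H])
    also have "\<dots> \<le> ennreal (C * ((t - s) powr \<beta> + s powr (- 1 / 2) * sqrt (t - s)))"
      using bound[rule_format, of s "t - s"] st by simp
    finally show ?thesis .
  qed
  then show ?thesis using C by (intro exI[of _ C] conjI allI impI)
qed

lemma driftless_square_bound:
  assumes [measurable]: "\<phi> \<in> borel_measurable borel" and K: "0 \<le> K" "\<And>x. norm (\<phi> x) \<le> K * exp (K * norm x)"
    and "0 \<le> s" "s \<le> T" "0 \<le> t" "t \<le> T"
  shows "(\<integral>\<^sup>+\<omega>. ennreal ((norm (\<phi> (x0 + \<sigma> *v W t \<omega>) - (\<phi> (x0 + \<sigma> *v W s \<omega>) :: real^'d)))\<^sup>2) \<partial>M) \<le> ennreal (4 * K\<^sup>2 * exp_moment (2 * K))"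
proof -
  have [measurable]: "W t \<in> borel_measurable M" "W s \<in> borel_measurable M" using assms by (auto intro: W_measurable)
  have one: "(\<integral>\<^sup>+\<omega>. ennreal ((norm (\<phi> (x0 + \<sigma> *v W r \<omega>)))\<^sup>2) \<partial>M) \<le> ennreal (K\<^sup>2 * exp_moment (2 * K))" if "0 \<le> r" "r \<le> T" for r
  proof -
    have [measurable]: "W r \<in> borel_measurable M" by (rule W_measurable[OF that(1)])
    have "(\<integral>\<^sup>+\<omega>. ennreal ((norm (\<phi> (x0 + \<sigma> *v W r \<omega>)))\<^sup>2) \<partial>M) \<le> (\<integral>\<^sup>+\<omega>. ennreal (K\<^sup>2) * ennreal (exp (2 * K * norm (x0 + \<sigma> *v W r \<omega>))) \<partial>M)"
      using K(2) by (intro nn_integral_mono) (simp add: ennreal_mult[symmetric] ennreal_leI exp_bounded_square)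
    also have "\<dots> = ennreal (K\<^sup>2) * (\<integral>\<^sup>+\<omega>. ennreal (exp (2 * K * norm (x0 + \<sigma> *v W r \<omega>))) \<partial>M)"
      by (rule nn_integral_cmult) measurable
    also have "\<dots> \<le> ennreal (K\<^sup>2) * ennreal (exp_moment (2 * K))"
      using K(1) that by (intro mult_left_mono driftless_exp_moment) auto
    finally show ?thesis by (simp add: ennreal_mult)
  qed
  have "(\<integral>\<^sup>+\<omega>. ennreal ((norm (\<phi> (x0 + \<sigma> *v W t \<omega>) - \<phi> (x0 + \<sigma> *v W s \<omega>)))\<^sup>2) \<partial>M)
    \<le> (\<integral>\<^sup>+\<omega>. ennreal ((norm (\<phi> (x0 + \<sigma> *v W t \<omega>)) + norm (\<phi> (x0 + \<sigma> *v W s \<omega>)))\<^sup>2) \<partial>M)"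
    by (intro nn_integral_mono ennreal_leI power_mono norm_triangle_ineq4) auto
  also have "\<dots> \<le> ennreal (2 * (K\<^sup>2 * exp_moment (2 * K)) + 2 * (K\<^sup>2 * exp_moment (2 * K)))"
    using assms by (intro nn_integral_square_add one) auto
  finally show ?thesis by (simp add: mult.assoc)
qed

text \<open>In the cell that begins at time \<open>j * stp n\<close> the singular term is at most \<open>1 / sqrt j\<close>, and the sum of
  these over \<open>j < n\<close> is of order \<open>sqrt n\<close>, which after multiplication by the step becomes
  \<open>sqrt (stp n)\<close>. In the first cell, where the singular term is useless, the moments of the
  function are bounded and the length of the cell is gained.\<close>

lemma driftless_grid_increments:
  assumes "\<phi> \<in> class_B \<beta>" and \<beta>: "0 < \<beta>" "\<beta> \<le> 1"
  shows "\<exists>C\<ge>0. \<forall>n m. 1 \<le> n \<longrightarrow> 1 \<le> m \<longrightarrow> (\<exists>a. (\<forall>k. 0 \<le> a k) \<and>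
    (\<forall>k<n * m. (\<integral>\<^sup>+\<omega>. ennreal ((norm (\<phi> (x0 + \<sigma> *v W (real k * stp (n * m)) \<omega>) - \<phi> (x0 + \<sigma> *v W (real (k div m * m) * stp (n * m)) \<omega>)))\<^sup>2) \<partial>M) \<le> ennreal (a k)) \<and>
    stp (n * m) * (\<Sum>k<n * m. a k) \<le> C * (stp n powr \<beta> + sqrt (stp n)))"
proof -
  have \<phi>[measurable]: "\<phi> \<in> borel_measurable borel" using assms(1) by (simp add: class_B_def)
  obtain K where K: "0 < K" "\<And>x. norm (\<phi> x) \<le> K * exp (K * norm x)"
    using class_B_exp_bound[OF assms] by blast
  define C0 where "C0 = 4 * K\<^sup>2 * exp_moment (2 * K)"
  have C0: "0 \<le> C0" by (simp add: C0_def)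
  from driftless_increment[OF assms] obtain C1 where C1: "0 \<le> C1"
    and bound: "\<forall>s t. 0 < s \<longrightarrow> s < t \<longrightarrow> t \<le> T \<longrightarrow>
    (\<integral>\<^sup>+\<omega>. ennreal ((norm (\<phi> (x0 + \<sigma> *v W t \<omega>) - \<phi> (x0 + \<sigma> *v W s \<omega>)))\<^sup>2) \<partial>M) \<le> ennreal (C1 * ((t - s) powr \<beta> + s powr (- 1 / 2) * sqrt (t - s)))"
    by (elim exE conjE)
  define C where "C = C0 * sqrt T + C1 * T + 2 * C1 * sqrt T"
  have C: "0 \<le> C" using C0 C1 T_pos by (simp add: C_def)
  have main: "\<exists>a. (\<forall>k. 0 \<le> a k) \<and>
    (\<forall>k<n * m. (\<integral>\<^sup>+\<omega>. ennreal ((norm (\<phi> (x0 + \<sigma> *v W (real k * stp (n * m)) \<omega>) - \<phi> (x0 + \<sigma> *v W (real (k div m * m) * stp (n * m)) \<omega>)))\<^sup>2) \<partial>M) \<le> ennreal (a k)) \<and>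
    stp (n * m) * (\<Sum>k<n * m. a k) \<le> C * (stp n powr \<beta> + sqrt (stp n))"
    if n: "1 \<le> n" and m: "1 \<le> m" for n m :: nat
  proof -
    define h where "h = stp n"
    have h: "0 < h" using stp_pos[OF n] by (simp add: h_def)
    have nm: "1 \<le> n * m" using n m by simp
    have hm: "real m * stp (n * m) = h" using n m by (simp add: h_def stp_def)
    have coarse: "real (j * m) * stp (n * m) = real j * h" for j
      using hm by (simp add: mult.assoc)
    define a' where "a' = (\<lambda>j::nat. if j = 0 then C0 else C1 * (h powr \<beta> + 1 / sqrt (real j)))"
    have a': "0 \<le> a' j" for j using C0 C1 by (simp add: a'_def)
    define a where "a = (\<lambda>k. a' (k div m))"
    have est: "(\<integral>\<^sup>+\<omega>. ennreal ((norm (\<phi> (x0 + \<sigma> *v W (real k * stp (n * m)) \<omega>) - \<phi> (x0 + \<sigma> *v W (real (k div m * m) * stp (n * m)) \<omega>)))\<^sup>2) \<partial>M) \<le> ennreal (a k)"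
      if k: "k < n * m" for k
    proof -
      define j where "j = k div m"
      define s t where "s = real (j * m) * stp (n * m)" and "t = real k * stp (n * m)"
      have jm: "j * m \<le> k" "k < j * m + m"
      proof -
        have "k div m * m + k mod m = k" "k mod m < m" using m by simp_all
        then show "j * m \<le> k" "k < j * m + m" unfolding j_def by linarith+
      qed
      have st: "s \<le> t" "t \<le> T" "0 \<le> s"
        using jm(1) k nm stp_pos[OF nm] by (auto simp: s_def t_def intro!: grid_le mult_right_mono simp del: of_nat_mult)
      have "t - s = real (k - j * m) * stp (n * m)"
        using jm(1) by (simp add: s_def t_def of_nat_diff left_diff_distrib)
      also have "\<dots> \<le> real m * stp (n * m)"
      proof (rule mult_right_mono)
        have "k - j * m \<le> m" using jm(2) by linarith
        then show "real (k - j * m) \<le> real m" by (rule of_nat_mono)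
      qed (use stp_pos[OF nm] in simp)
      finally have ts: "t - s \<le> h" by (simp add: hm)
      show ?thesis
      proof (cases "j = 0 \<or> s = t")
        case True
        show ?thesis
        proof (cases "j = 0")
          case True
          then have "a k = C0" by (simp add: a_def a'_def j_def)
          then show ?thesis
            using driftless_square_bound[OF \<phi> _ K(2), of s t] K(1) st unfolding s_def t_def j_def C0_def by simp
        next
          case False
          then have "s = t" using \<open>j = 0 \<or> s = t\<close> by simp
          then have "(\<integral>\<^sup>+\<omega>. ennreal ((norm (\<phi> (x0 + \<sigma> *v W t \<omega>) - \<phi> (x0 + \<sigma> *v W s \<omega>)))\<^sup>2) \<partial>M) \<le> ennreal (a k)"
            by simp
          then show ?thesis unfolding s_def t_def j_def .
        qed
      next
        case False
        then have j: "1 \<le> j" and "s < t" using st by auto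
        have s: "s = real j * h" unfolding s_def by (rule coarse)
        have "0 < s" using j h by (simp add: s)
        have "(\<integral>\<^sup>+\<omega>. ennreal ((norm (\<phi> (x0 + \<sigma> *v W t \<omega>) - \<phi> (x0 + \<sigma> *v W s \<omega>)))\<^sup>2) \<partial>M) \<le> ennreal (C1 * ((t - s) powr \<beta> + s powr (- 1 / 2) * sqrt (t - s)))"
          using bound \<open>0 < s\<close> \<open>s < t\<close> st(2) by simp
        also have "\<dots> \<le> ennreal (a k)"
        proof (rule ennreal_leI)
          have "(t - s) powr \<beta> \<le> h powr \<beta>" using ts \<open>s < t\<close> \<beta> by (intro powr_mono2) auto
          moreover have "s powr (- 1 / 2) * sqrt (t - s) \<le> s powr (- 1 / 2) * sqrt h"
            using ts by (intro mult_left_mono) auto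
          moreover have "s powr (- 1 / 2) * sqrt h = 1 / sqrt (real j)"
          proof -
            have "s powr (- (1 / 2)) = 1 / sqrt s"
              unfolding powr_minus_divide by (subst powr_half_sqrt) (use \<open>0 < s\<close> in auto)
            then show ?thesis using h j by (simp add: s real_sqrt_mult)
          qed
          ultimately have "C1 * ((t - s) powr \<beta> + s powr (- 1 / 2) * sqrt (t - s)) \<le> C1 * (h powr \<beta> + 1 / sqrt (real j))"
            using C1 by (intro mult_left_mono add_mono) auto
          also have "\<dots> = a k" using j by (simp add: a_def a'_def j_def[symmetric])
          finally show "C1 * ((t - s) powr \<beta> + s powr (- 1 / 2) * sqrt (t - s)) \<le> a k" .
        qed
        finally show ?thesis unfolding s_def t_def j_def .
      qed
    qed
    have "(\<Sum>k<n * m. a k) = (\<Sum>j<n. sum a {j * m..<j * m + m})"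
      by (rule sum.nat_group[symmetric])
    also have "\<dots> = (\<Sum>j<n. real m * a' j)"
    proof (rule sum.cong[OF refl])
      fix j
      have "sum a {j * m..<j * m + m} = (\<Sum>k\<in>{j * m..<j * m + m}. a' j)"
      proof (rule sum.cong[OF refl])
        fix k assume "k \<in> {j * m..<j * m + m}"
        then have "k div m = j" by (intro div_nat_eqI) (auto simp: mult.commute)
        then show "a k = a' j" by (simp add: a_def)
      qed
      then show "sum a {j * m..<j * m + m} = real m * a' j" by simp
    qed
    finally have sum_a: "stp (n * m) * (\<Sum>k<n * m. a k) = h * (\<Sum>j<n. a' j)"
      by (simp add: sum_distrib_left[symmetric] hm[symmetric] mult_ac)
    obtain n' where n': "n = Suc n'" using n by (cases n) auto
    have "(\<Sum>j<n. a' j) \<le> (\<Sum>j<n. (if j = 0 then C0 else 0) + C1 * h powr \<beta> + C1 * (if j = 0 then 0 else 1 / sqrt (real j)))"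
      using C1 C0 by (intro sum_mono) (auto simp: a'_def distrib_left)
    also have "\<dots> = C0 + real n * (C1 * h powr \<beta>) + C1 * (\<Sum>j<Suc n'. if j = 0 then 0 else 1 / sqrt (real j))"
      unfolding sum.distrib n' by (simp add: sum_distrib_left[symmetric])
    also have "\<dots> \<le> C0 + real n * (C1 * h powr \<beta>) + C1 * (2 * sqrt (real n))"
    proof -
      have "(\<Sum>j<Suc n'. if j = 0 then 0 else 1 / sqrt (real j)) \<le> 2 * sqrt (real n)"
      proof (rule order_trans[OF sum_inverse_sqrt_le])
        have "sqrt (real n') \<le> sqrt (real n)" using n' by (intro real_sqrt_le_mono) simp
        then show "2 * sqrt (real n') \<le> 2 * sqrt (real n)" by simp
      qed
      then show ?thesis using C1 by (intro add_left_mono mult_left_mono)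
    qed
    finally have "h * (\<Sum>j<n. a' j) \<le> h * (C0 + real n * (C1 * h powr \<beta>) + C1 * (2 * sqrt (real n)))"
      using h by (intro mult_left_mono) auto
    also have "\<dots> = C0 * h + C1 * (h * real n) * h powr \<beta> + 2 * C1 * (h * sqrt (real n))"
      by (simp add: algebra_simps)
    also have "h * real n = T" unfolding h_def by (rule stp_mult[OF n])
    also have "h * sqrt (real n) = sqrt T * sqrt h"
    proof -
      have "h * sqrt (real n) = sqrt h * (sqrt h * sqrt (real n))" using h by (simp add: mult.assoc[symmetric])
      also have "sqrt h * sqrt (real n) = sqrt T" unfolding real_sqrt_mult[symmetric] \<open>h * real n = T\<close> ..
      finally show ?thesis by (simp add: mult.commute)
    qed
    also have "C0 * h + C1 * T * h powr \<beta> + 2 * C1 * (sqrt T * sqrt h) \<le> C * (h powr \<beta> + sqrt h)"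
    proof -
      have "h \<le> T" using grid_le[OF n, of 1] n by (simp add: h_def)
      then have "sqrt h * sqrt h \<le> sqrt T * sqrt h" using h by (intro mult_right_mono) auto
      then have "C0 * h \<le> C0 * (sqrt T * sqrt h)" using C0 h by (intro mult_left_mono) auto
      moreover have "0 \<le> (C0 * sqrt T + 2 * C1 * sqrt T) * h powr \<beta>" "0 \<le> C1 * T * sqrt h"
        using C0 C1 T_pos h by auto
      ultimately show ?thesis by (simp add: C_def algebra_simps)
    qed
    finally have "stp (n * m) * (\<Sum>k<n * m. a k) \<le> C * (stp n powr \<beta> + sqrt (stp n))"
      unfolding sum_a h_def by simp
    then show ?thesis using est a' by (intro exI[of _ a] conjI allI impI) (simp_all add: a_def)
  qed
  show ?thesis
    by (rule exI[of _ C], intro conjI allI impI C) (rule main)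
qed

end

section \<open>The Euler scheme under a change of measure\<close>

lemma (in gaussian_walk) increments_distr:
  "distr P (\<Pi>\<^sub>M i\<in>{..<N}. borel) (\<lambda>\<omega>. \<lambda>i\<in>{..<N}. \<xi> i \<omega>) = distr (\<Pi>\<^sub>M i\<in>{..<N}. gauss \<delta>) (\<Pi>\<^sub>M i\<in>{..<N}. borel) (\<lambda>x. x)"
proof (rule measure_eqI)
  fix A assume "A \<in> sets (distr P (\<Pi>\<^sub>M i\<in>{..<N}. borel) (\<lambda>\<omega>. \<lambda>i\<in>{..<N}. \<xi> i \<omega>))"
  then have A: "A \<in> sets (\<Pi>\<^sub>M i\<in>{..<N}. (borel :: (real^'d) measure))" by simp
  have m1: "(\<lambda>\<omega>. \<lambda>i\<in>{..<N}. \<xi> i \<omega>) \<in> P \<rightarrow>\<^sub>M (\<Pi>\<^sub>M i\<in>{..<N}. borel)"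
    by (intro measurable_restrict increment_measurable_P) auto
  have m2: "(\<lambda>x. x) \<in> (\<Pi>\<^sub>M i\<in>{..<N}. (gauss \<delta> :: (real^'d) measure)) \<rightarrow>\<^sub>M (\<Pi>\<^sub>M i\<in>{..<N}. borel)"
    by (rule measurable_ident_sets, rule sets_PiM_cong) auto
  have ind: "(indicator A :: _ \<Rightarrow> ennreal) \<in> borel_measurable (\<Pi>\<^sub>M i\<in>{..<N}. (borel :: (real^'d) measure))"
    using A by (rule borel_measurable_indicator)
  have "emeasure (distr P (\<Pi>\<^sub>M i\<in>{..<N}. borel) (\<lambda>\<omega>. \<lambda>i\<in>{..<N}. \<xi> i \<omega>)) A = (\<integral>\<^sup>+x. indicator A x \<partial>distr P (\<Pi>\<^sub>M i\<in>{..<N}. borel) (\<lambda>\<omega>. \<lambda>i\<in>{..<N}. \<xi> i \<omega>))"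
    using A by simp
  also have "\<dots> = (\<integral>\<^sup>+\<omega>. indicator A (\<lambda>i\<in>{..<N}. \<xi> i \<omega>) \<partial>P)"
    by (rule nn_integral_distr[OF m1]) (use ind in simp)
  also have "\<dots> = (\<integral>\<^sup>+x. indicator A x \<partial>(\<Pi>\<^sub>M i\<in>{..<N}. gauss \<delta>))"
    by (rule increments_law[OF ind order_refl])
  also have "\<dots> = (\<integral>\<^sup>+x. indicator A x \<partial>distr (\<Pi>\<^sub>M i\<in>{..<N}. gauss \<delta>) (\<Pi>\<^sub>M i\<in>{..<N}. borel) (\<lambda>x. x))"
    by (rule nn_integral_distr[OF m2, symmetric]) (use ind in simp)
  also have "\<dots> = emeasure (distr (\<Pi>\<^sub>M i\<in>{..<N}. gauss \<delta>) (\<Pi>\<^sub>M i\<in>{..<N}. borel) (\<lambda>x. x)) A"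
    using A by simp
  finally show "emeasure (distr P (\<Pi>\<^sub>M i\<in>{..<N}. borel) (\<lambda>\<omega>. \<lambda>i\<in>{..<N}. \<xi> i \<omega>)) A
    = emeasure (distr (\<Pi>\<^sub>M i\<in>{..<N}. gauss \<delta>) (\<Pi>\<^sub>M i\<in>{..<N}. borel) (\<lambda>x. x)) A" .
qed simp

lemma gaussian_walk_integral_eq:
  fixes \<xi> :: "nat \<Rightarrow> 'w \<Rightarrow> real^'d" and \<xi>' :: "nat \<Rightarrow> 'w \<Rightarrow> real^'d" and \<Theta> :: "(nat \<Rightarrow> real^'d) \<Rightarrow> real"
  assumes w: "gaussian_walk P G \<xi> \<delta> N" and w': "gaussian_walk P' G' \<xi>' \<delta> N"
    and \<Theta>: "\<Theta> \<in> borel_measurable (\<Pi>\<^sub>M i\<in>{..<N}. borel)"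
  shows "(\<integral>\<omega>. \<Theta> (\<lambda>i\<in>{..<N}. \<xi> i \<omega>) \<partial>P) = (\<integral>\<omega>. \<Theta> (\<lambda>i\<in>{..<N}. \<xi>' i \<omega>) \<partial>P')"
proof -
  have m: "(\<lambda>\<omega>. \<lambda>i\<in>{..<N}. \<xi> i \<omega>) \<in> P \<rightarrow>\<^sub>M (\<Pi>\<^sub>M i\<in>{..<N}. borel)"
    by (intro measurable_restrict gaussian_walk.increment_measurable_P[OF w]) auto
  have m': "(\<lambda>\<omega>. \<lambda>i\<in>{..<N}. \<xi>' i \<omega>) \<in> P' \<rightarrow>\<^sub>M (\<Pi>\<^sub>M i\<in>{..<N}. borel)"
    by (intro measurable_restrict gaussian_walk.increment_measurable_P[OF w']) auto
  show ?thesis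
    unfolding integral_distr[OF m \<Theta>, symmetric] integral_distr[OF m' \<Theta>, symmetric]
      gaussian_walk.increments_distr[OF w] gaussian_walk.increments_distr[OF w'] ..
qed

text \<open>The Euler scheme as a function of the noise, when each of its steps consists of \<open>m\<close> increments.\<close>

primrec euler_map :: "nat \<Rightarrow> real \<Rightarrow> (real^'d \<Rightarrow> real^'d) \<Rightarrow> real^'d^'d \<Rightarrow> real^'d \<Rightarrow> (nat \<Rightarrow> real^'d) \<Rightarrow> nat \<Rightarrow> real^'d" where
  "euler_map m h b \<sigma> x0 w 0 = x0"
| "euler_map m h b \<sigma> x0 w (Suc j) = euler_map m h b \<sigma> x0 w j + h *\<^sub>R b (euler_map m h b \<sigma> x0 w j) + \<sigma> *v (\<Sum>i<m. w (j * m + i))"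

lemma euler_map_cong:
  "(\<And>i. i < j * m \<Longrightarrow> w i = w' i) \<Longrightarrow> euler_map m h b \<sigma> x0 w j = euler_map m h b \<sigma> x0 w' j"
proof (induction j)
  case (Suc j)
  have "(\<Sum>i<m. w (j * m + i)) = (\<Sum>i<m. w' (j * m + i))"
    using Suc.prems by (intro sum.cong) auto
  moreover have "euler_map m h b \<sigma> x0 w j = euler_map m h b \<sigma> x0 w' j"
    using Suc.prems by (intro Suc.IH) auto
  ultimately show ?case by simp
qed simp

lemma euler_map_measurable:
  fixes b :: "real^'d \<Rightarrow> real^'d"
  assumes [measurable]: "b \<in> borel_measurable borel" and "j * m \<le> N"
  shows "(\<lambda>w. euler_map m h b \<sigma> x0 w j) \<in> borel_measurable (\<Pi>\<^sub>M i\<in>{..<N}. borel)"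
  using assms(2)
proof (induction j)
  case (Suc j)
  have [measurable]: "(\<lambda>w. euler_map m h b \<sigma> x0 w j) \<in> borel_measurable (\<Pi>\<^sub>M i\<in>{..<N}. borel)"
    using Suc by simp
  have [measurable]: "(\<lambda>w. \<Sum>i<m. w (j * m + i)) \<in> borel_measurable (\<Pi>\<^sub>M i\<in>{..<N}. (borel :: (real^'d) measure))"
    using Suc.prems by (intro borel_measurable_sum measurable_component_singleton) auto
  show ?case by simp
qed simp

context additive_sde
begin

lemma sum_noise_block:
  assumes "1 \<le> n" "1 \<le> m"
  shows "(\<Sum>i<m. noise (n * m) (j * m + i) \<omega>) = noise n j \<omega>"
proof -
  have block: "(\<Sum>i<m'. noise N (l + i) \<omega>) = W (real (l + m') * stp N) \<omega> - W (real l * stp N) \<omega>" for N l m'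
    by (induction m') (simp_all add: noise_def)
  have mN: "real m * stp (n * m) = stp n" using assms by (simp add: stp_def)
  have "real (j * m) * stp (n * m) = real j * stp n"
    using mN by (simp only: of_nat_mult mult.assoc)
  moreover have "real (j * m + m) * stp (n * m) = real (Suc j) * stp n"
    using mN by (simp only: of_nat_mult of_nat_add of_nat_Suc distrib_right mult.assoc mult_1_left add.commute)
  ultimately show ?thesis unfolding block unfolding noise_def by (simp only:)
qed

lemma euler_map_refine:
  assumes "1 \<le> n" "1 \<le> m"
  shows "euler_map m (stp n) b \<sigma> x0 (\<lambda>k. noise (n * m) k \<omega>) j = euler_map 1 (stp n) b \<sigma> x0 (\<lambda>k. noise n k \<omega>) j"
  by (induction j) (simp_all add: sum_noise_block[OF assms])

definition euler_drift :: "nat \<Rightarrow> nat \<Rightarrow> nat \<Rightarrow> 'w \<Rightarrow> real^'d" where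
  "euler_drift n m k \<omega> = \<sigma>' *v b (chain (n * m) (k div m * m) \<omega>)"

text \<open>Under this measure the chain is the Euler scheme driven by a Gaussian walk.\<close>

definition Q_euler :: "nat \<Rightarrow> nat \<Rightarrow> 'w measure" where
  "Q_euler n m = density (Q (n * m)) (\<lambda>\<omega>. ennreal (girsanov_density (stp (n * m)) (euler_drift n m) (shifted_noise (n * m)) (n * m) \<omega>))"

lemma block_start_le: "k div m * m \<le> (k :: nat)"
  by (rule div_times_less_eq_dividend)

lemma euler_drift_measurable:
  assumes "1 \<le> n * m" "k \<le> n * m"
  shows "euler_drift n m k \<in> borel_measurable (F (real k * stp (n * m)))"
proof -
  have [measurable]: "chain (n * m) (k div m * m) \<in> borel_measurable (F (real k * stp (n * m)))"
  proof (rule measurable_F_mono[OF chain_measurable[OF assms(1)] grid_nonneg[OF assms(1)]])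
    show "k div m * m \<le> n * m" using block_start_le assms(2) by (rule order_trans)
    show "real (k div m * m) * stp (n * m) \<le> real k * stp (n * m)"
      using stp_pos[OF assms(1)] by (intro mult_right_mono of_nat_mono block_start_le) auto
  qed
  show ?thesis unfolding euler_drift_def by measurable
qed

lemma euler_drift_bound: "norm (euler_drift n m k \<omega>) \<le> c' * B"
  unfolding euler_drift_def using c'_nonneg by (intro order_trans[OF norm_inverse_le] mult_left_mono b_bound)

lemma euler_density_measurable:
  assumes "1 \<le> n * m"
  shows "girsanov_density (stp (n * m)) (euler_drift n m) (shifted_noise (n * m)) (n * m) \<in> borel_measurable M"
proof -
  note walk = shifted_noise_walk[OF assms]
  have "girsanov_density (stp (n * m)) (euler_drift n m) (shifted_noise (n * m)) (n * m) \<in> borel_measurable (Q (n * m))"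
    by (rule gaussian_walk.past_measurable_P[OF walk gaussian_walk.girsanov_density_measurable[OF walk]])
       (use euler_drift_measurable[OF assms] in auto)
  then show ?thesis by (simp add: measurable_cong_sets[OF sets_Q refl])
qed

lemma Q_euler_walk:
  assumes "1 \<le> n * m"
  shows "gaussian_walk (Q_euler n m) (\<lambda>k. F (real k * stp (n * m)))
    (\<lambda>k \<omega>. shifted_noise (n * m) k \<omega> - stp (n * m) *\<^sub>R euler_drift n m k \<omega>) (stp (n * m)) (n * m)"
  unfolding Q_euler_def
  by (rule gaussian_walk.girsanov[OF shifted_noise_walk[OF assms]]) (use euler_drift_measurable[OF assms] in auto)

text \<open>The Euler drift is constant on each block of \<open>m\<close> steps. Taking it out of the noise and putting it back
  through the Euler recursion reproduces the chain at the ends of the blocks.\<close>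

lemma chain_is_euler:
  assumes n: "1 \<le> n" and m: "1 \<le> m"
  shows "euler_map m (stp n) b \<sigma> x0 (\<lambda>k. shifted_noise (n * m) k \<omega> - stp (n * m) *\<^sub>R euler_drift n m k \<omega>) j = chain (n * m) (j * m) \<omega>"
proof (induction j)
  case 0
  then show ?case by (simp add: chain_def)
next
  case (Suc j)
  let ?N = "n * m" and ?y = "b (chain (n * m) (j * m) \<omega>)"
  have mN: "real m * stp ?N = stp n" using n m by (simp add: stp_def)
  have chain_add: "chain ?N (l + m') \<omega> = chain ?N l \<omega> + \<sigma> *v (\<Sum>i<m'. shifted_noise ?N (l + i) \<omega>)" for l m'
    by (induction m') (simp_all add: chain_def matrix_vector_right_distrib add.assoc)
  have "(\<Sum>i<m. shifted_noise ?N (j * m + i) \<omega> - stp ?N *\<^sub>R euler_drift n m (j * m + i) \<omega>)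
      = (\<Sum>i<m. shifted_noise ?N (j * m + i) \<omega> - stp ?N *\<^sub>R (\<sigma>' *v ?y))"
  proof (rule sum.cong[OF refl])
    fix i assume "i \<in> {..<m}"
    then have "(j * m + i) div m = j" by simp
    then show "shifted_noise ?N (j * m + i) \<omega> - stp ?N *\<^sub>R euler_drift n m (j * m + i) \<omega> = shifted_noise ?N (j * m + i) \<omega> - stp ?N *\<^sub>R (\<sigma>' *v ?y)"
      by (simp add: euler_drift_def)
  qed
  also have "\<dots> = (\<Sum>i<m. shifted_noise ?N (j * m + i) \<omega>) - stp n *\<^sub>R (\<sigma>' *v ?y)"
  proof -
    have "(\<Sum>i<m. stp ?N *\<^sub>R (\<sigma>' *v ?y)) = (real m * stp ?N) *\<^sub>R (\<sigma>' *v ?y)"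
      unfolding sum_constant_scaleR by (simp only: card_lessThan scaleR_scaleR)
    then show ?thesis unfolding sum_subtractf mN by (simp only:)
  qed
  finally have "\<sigma> *v (\<Sum>i<m. shifted_noise ?N (j * m + i) \<omega> - stp ?N *\<^sub>R euler_drift n m (j * m + i) \<omega>)
      = \<sigma> *v (\<Sum>i<m. shifted_noise ?N (j * m + i) \<omega>) - stp n *\<^sub>R ?y"
    by (simp add: matrix_vector_mult_diff_distrib matrix_vector_mult_scaleR matrix_vector_mul_assoc \<sigma>_inverse)
  then have "euler_map m (stp n) b \<sigma> x0 (\<lambda>k. shifted_noise ?N k \<omega> - stp ?N *\<^sub>R euler_drift n m k \<omega>) (Suc j) = chain ?N (j * m + m) \<omega>"
    using Suc.IH by (simp add: chain_add)
  then show ?case by (simp add: add.commute)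
qed

text \<open>The Euler scheme is a function of its Gaussian noise. Its expectation can therefore be computed
  under \<open>M\<close> with the increments of \<open>W\<close>, or under \<open>Q_euler\<close>, where the scheme is the chain.\<close>

lemma euler_expectation:
  assumes n: "1 \<le> n" and m: "1 \<le> m" and f: "f \<in> borel_measurable borel" and g: "g \<in> borel_measurable borel"
  shows "(\<integral>\<omega>. f (\<Sum>j<n. stp n *\<^sub>R g (euler_map 1 (stp n) b \<sigma> x0 (\<lambda>k. noise n k \<omega>) j)) \<partial>M)
    = (\<integral>\<omega>. (f (\<Sum>j<n. stp n *\<^sub>R (g (chain (n * m) (j * m) \<omega>) :: real^'d)) :: real) \<partial>Q_euler n m)"
proof -
  have nm: "1 \<le> n * m" using n m by simp
  define \<Theta> where "\<Theta> = (\<lambda>w. f (\<Sum>j<n. stp n *\<^sub>R g (euler_map m (stp n) b \<sigma> x0 w j)))"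
  have \<Theta>: "\<Theta> \<in> borel_measurable (\<Pi>\<^sub>M i\<in>{..<n * m}. borel)"
  proof -
    have [measurable]: "(\<lambda>w. euler_map m (stp n) b \<sigma> x0 w j) \<in> borel_measurable (\<Pi>\<^sub>M i\<in>{..<n * m}. borel)" if "j \<in> {..<n}" for j
      using that by (intro euler_map_measurable) auto
    have [measurable]: "f \<in> borel_measurable borel" "g \<in> borel_measurable borel" by fact+
    show ?thesis unfolding \<Theta>_def by measurable
  qed
  have restrict: "\<Theta> (\<lambda>i\<in>{..<n * m}. w i) = \<Theta> w" for w
  proof -
    have "euler_map m (stp n) b \<sigma> x0 (\<lambda>i\<in>{..<n * m}. w i) j = euler_map m (stp n) b \<sigma> x0 w j" if "j < n" for j
    proof (rule euler_map_cong)
      fix i assume "i < j * m"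
      also have "j * m \<le> n * m" using that by (intro mult_right_mono) auto
      finally show "(\<lambda>i\<in>{..<n * m}. w i) i = w i" by simp
    qed
    then show ?thesis unfolding \<Theta>_def by (intro arg_cong[of _ _ f] sum.cong) auto
  qed
  have "(\<integral>\<omega>. f (\<Sum>j<n. stp n *\<^sub>R g (euler_map 1 (stp n) b \<sigma> x0 (\<lambda>k. noise n k \<omega>) j)) \<partial>M) = (\<integral>\<omega>. \<Theta> (\<lambda>i\<in>{..<n * m}. noise (n * m) i \<omega>) \<partial>M)"
    unfolding restrict unfolding \<Theta>_def euler_map_refine[OF n m] ..
  also have "\<dots> = (\<integral>\<omega>. \<Theta> (\<lambda>i\<in>{..<n * m}. shifted_noise (n * m) i \<omega> - stp (n * m) *\<^sub>R euler_drift n m i \<omega>) \<partial>Q_euler n m)"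
    by (rule gaussian_walk_integral_eq[OF noise_walk[OF nm] Q_euler_walk[OF nm] \<Theta>])
  also have "\<dots> = (\<integral>\<omega>. f (\<Sum>j<n. stp n *\<^sub>R g (chain (n * m) (j * m) \<omega>)) \<partial>Q_euler n m)"
    unfolding restrict unfolding \<Theta>_def chain_is_euler[OF n m] ..
  finally show ?thesis .
qed

lemma M_eq_density:
  assumes "1 \<le> N"
  shows "M = density (Q N) (\<lambda>\<omega>. ennreal (girsanov_density (stp N) (delayed_drift N) (shifted_noise N) N \<omega>))"
proof (rule measure_eqI)
  have [measurable]: "girsanov_density (stp N) (delayed_drift N) (shifted_noise N) N \<in> borel_measurable (Q N)"
    using back_density_measurable[OF assms] by (simp add: measurable_cong_sets[OF sets_Q refl])
  show "sets M = sets (density (Q N) (\<lambda>\<omega>. ennreal (girsanov_density (stp N) (delayed_drift N) (shifted_noise N) N \<omega>)))"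
    by (simp add: sets_Q)
  fix A assume A: "A \<in> sets M"
  then have "emeasure M A = (\<integral>\<^sup>+\<omega>. indicator A \<omega> \<partial>M)" by simp
  also have "\<dots> = (\<integral>\<^sup>+\<omega>. ennreal (girsanov_density (stp N) (delayed_drift N) (shifted_noise N) N \<omega>) * indicator A \<omega> \<partial>Q N)"
    using A by (intro nn_integral_M_via_Q assms) auto
  also have "\<dots> = emeasure (density (Q N) (\<lambda>\<omega>. ennreal (girsanov_density (stp N) (delayed_drift N) (shifted_noise N) N \<omega>))) A"
    using A by (intro emeasure_density[symmetric]) (auto simp: sets_Q)
  finally show "emeasure M A = emeasure (density (Q N) (\<lambda>\<omega>. ennreal (girsanov_density (stp N) (delayed_drift N) (shifted_noise N) N \<omega>))) A" .
qed

definition stability_const :: "real \<Rightarrow> real" where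
  "stability_const K = sqrt (8 * sqrt 2 ^ CARD('d) + 2 * (c' * B)\<^sup>2 * T)
     * sqrt (sqrt (1 + exp_moment (4 * K)) * sqrt (16 * exp (6 * T * (c' * B)\<^sup>2)))"

lemma stability_const_nonneg: "0 \<le> stability_const K"
  unfolding stability_const_def using T_pos by (intro mult_nonneg_nonneg) auto

text \<open>The functional is dominated by a constant plus a sum of exponentials of single values of the
  chain, so it suffices to apply the stability estimate to each of these.\<close>

lemma change_of_measure_error:
  assumes n: "1 \<le> n" and m: "1 \<le> m" and f: "L-lipschitz_on UNIV f"
    and g: "g \<in> borel_measurable borel" and K: "0 \<le> K" "\<And>x. norm (g x :: real^'d) \<le> K * exp (K * norm x)"
    and E: "ennreal (stp (n * m)) * (\<Sum>k<n * m. \<integral>\<^sup>+\<omega>. ennreal ((norm (delayed_drift (n * m) k \<omega> - euler_drift n m k \<omega>))\<^sup>2) \<partial>Q (n * m)) \<le> ennreal E" "0 \<le> E"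
  shows "integrable M (\<lambda>\<omega>. (f (\<Sum>j<n. stp n *\<^sub>R g (chain (n * m) (j * m) \<omega>)) :: real))"
    and "\<bar>(\<integral>\<omega>. f (\<Sum>j<n. stp n *\<^sub>R g (chain (n * m) (j * m) \<omega>)) \<partial>M) - (\<integral>\<omega>. f (\<Sum>j<n. stp n *\<^sub>R g (chain (n * m) (j * m) \<omega>)) \<partial>Q_euler n m)\<bar>
      \<le> (\<bar>f 0\<bar> + L * K * T) * stability_const K * sqrt E"
proof -
  define N where "N = n * m"
  have N: "1 \<le> N" using n m by (simp add: N_def)
  have L: "0 \<le> L" using f by (rule lipschitz_on_nonneg)
  let ?Du = "girsanov_density (stp N) (delayed_drift N) (shifted_noise N) N"
  let ?Dv = "girsanov_density (stp N) (euler_drift n m) (shifted_noise N) N"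
  define \<Phi> where "\<Phi> = (\<lambda>\<omega>. f (\<Sum>j<n. stp n *\<^sub>R g (chain N (j * m) \<omega>)))"
  have jm: "j * m \<le> N" if "j < n" for j using that by (simp add: N_def)
  have Du_M[measurable]: "?Du \<in> borel_measurable M" by (rule back_density_measurable[OF N])
  have Dv_M[measurable]: "?Dv \<in> borel_measurable M"
    using euler_density_measurable[of n m] N unfolding N_def .
  have chain_M[measurable]: "chain N (j * m) \<in> borel_measurable M" if "j \<in> {..<n}" for j
    using jm that by (intro chain_measurable_M[OF N]) auto
  have [measurable]: "f \<in> borel_measurable borel" "g \<in> borel_measurable borel"
    using lipschitz_borel_measurable[OF f] g by auto
  have \<Phi>_M[measurable]: "\<Phi> \<in> borel_measurable M" unfolding \<Phi>_def by measurable
  have Q_meas: "F \<in> borel_measurable (Q N)" if "F \<in> borel_measurable M" for F :: "'w \<Rightarrow> real"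
    using that by (simp add: measurable_cong_sets[OF sets_Q refl])
  define e where "e = (\<lambda>j \<omega>. exp (K * norm (chain N (j * m) \<omega>)))"
  have e_M[measurable]: "e j \<in> borel_measurable M" if "j \<in> {..<n}" for j
    unfolding e_def using that by measurable
  have \<Phi>_le: "\<bar>\<Phi> \<omega>\<bar> \<le> \<bar>f 0\<bar> + (\<Sum>j<n. (L * K * stp n) * e j \<omega>)" for \<omega>
  proof -
    let ?I = "\<Sum>j<n. stp n *\<^sub>R g (chain N (j * m) \<omega>)"
    have I: "norm ?I \<le> (\<Sum>j<n. stp n * (K * e j \<omega>))"
    proof (rule sum_norm_le)
      fix j
      show "norm (stp n *\<^sub>R g (chain N (j * m) \<omega>)) \<le> stp n * (K * e j \<omega>)"
        unfolding norm_scaleR e_def using stp_pos[OF n] K(2) by (simp add: mult_left_mono)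
    qed
    have "\<bar>\<Phi> \<omega>\<bar> \<le> \<bar>f 0\<bar> + \<bar>f ?I - f 0\<bar>" unfolding \<Phi>_def by linarith
    also have "\<bar>f ?I - f 0\<bar> \<le> L * norm ?I"
      using lipschitz_onD[OF f, of ?I 0] by (simp add: dist_norm)
    also have "L * norm ?I \<le> L * (\<Sum>j<n. stp n * (K * e j \<omega>))"
      by (rule mult_left_mono[OF I L])
    also have "\<dots> = (\<Sum>j<n. (L * K * stp n) * e j \<omega>)"
      unfolding sum_distrib_left by (intro sum.cong refl) (simp only: mult_ac)
    finally show ?thesis by simp
  qed
  have stp_sum: "(\<Sum>j<n. L * K * stp n) = L * K * T"
    using stp_mult(2)[OF n] by (simp add: mult_ac)
  have bound_by: "(\<integral>\<^sup>+\<omega>. ennreal (\<bar>\<Phi> \<omega>\<bar> * D \<omega>) \<partial>R) \<le> ennreal ((\<bar>f 0\<bar> + L * K * T) * S)"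
    if sets_R: "sets R = sets M" and D: "D \<in> borel_measurable M" "\<And>\<omega>. 0 \<le> D \<omega>" and S: "0 \<le> S"
      and one: "(\<integral>\<^sup>+\<omega>. ennreal (1 * D \<omega>) \<partial>R) \<le> ennreal S"
      and ej: "\<And>j. j < n \<Longrightarrow> (\<integral>\<^sup>+\<omega>. ennreal (e j \<omega> * D \<omega>) \<partial>R) \<le> ennreal S" for R D S
  proof -
    have R_meas: "F \<in> borel_measurable R" if "F \<in> borel_measurable M" for F :: "'w \<Rightarrow> real"
      using that by (simp add: measurable_cong_sets[OF sets_R refl])
    have [measurable]: "D \<in> borel_measurable R" by (rule R_meas[OF D(1)])
    have [measurable]: "e j \<in> borel_measurable R" if "j \<in> {..<n}" for j by (rule R_meas[OF e_M[OF that]])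
    have "(\<integral>\<^sup>+\<omega>. ennreal (\<bar>\<Phi> \<omega>\<bar> * D \<omega>) \<partial>R) \<le> (\<integral>\<^sup>+\<omega>. ennreal \<bar>f 0\<bar> * ennreal (1 * D \<omega>) + (\<Sum>j<n. ennreal (L * K * stp n) * ennreal (e j \<omega> * D \<omega>)) \<partial>R)"
    proof (rule nn_integral_mono)
      fix \<omega>
      have e0: "0 \<le> e j \<omega>" for j by (simp add: e_def)
      have c0: "0 \<le> L * K * stp n" using L K(1) stp_pos[OF n] by simp
      have eD0: "0 \<le> e j \<omega> * D \<omega>" for j using e0 D(2) by simp
      have ceD0: "0 \<le> (L * K * stp n) * (e j \<omega> * D \<omega>)" for j by (rule mult_nonneg_nonneg[OF c0 eD0])
      have "\<bar>\<Phi> \<omega>\<bar> * D \<omega> \<le> (\<bar>f 0\<bar> + (\<Sum>j<n. (L * K * stp n) * e j \<omega>)) * D \<omega>"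
        by (rule mult_right_mono[OF \<Phi>_le D(2)])
      also have "\<dots> = \<bar>f 0\<bar> * (1 * D \<omega>) + (\<Sum>j<n. (L * K * stp n) * (e j \<omega> * D \<omega>))"
        by (simp add: distrib_right sum_distrib_right mult.assoc)
      finally have "ennreal (\<bar>\<Phi> \<omega>\<bar> * D \<omega>) \<le> ennreal (\<bar>f 0\<bar> * (1 * D \<omega>) + (\<Sum>j<n. (L * K * stp n) * (e j \<omega> * D \<omega>)))"
        by (rule ennreal_leI)
      also have "\<dots> = ennreal (\<bar>f 0\<bar> * (1 * D \<omega>)) + ennreal (\<Sum>j<n. (L * K * stp n) * (e j \<omega> * D \<omega>))"
        using D(2) by (intro ennreal_plus sum_nonneg ceD0) simp
      also have "ennreal (\<Sum>j<n. (L * K * stp n) * (e j \<omega> * D \<omega>)) = (\<Sum>j<n. ennreal ((L * K * stp n) * (e j \<omega> * D \<omega>)))"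
        by (rule sum_ennreal[symmetric], rule ceD0)
      also have "\<dots> = (\<Sum>j<n. ennreal (L * K * stp n) * ennreal (e j \<omega> * D \<omega>))"
        by (intro sum.cong refl ennreal_mult c0 eD0)
      also have "ennreal (\<bar>f 0\<bar> * (1 * D \<omega>)) = ennreal \<bar>f 0\<bar> * ennreal (1 * D \<omega>)"
        using D(2) by (intro ennreal_mult) auto
      finally show "ennreal (\<bar>\<Phi> \<omega>\<bar> * D \<omega>) \<le> ennreal \<bar>f 0\<bar> * ennreal (1 * D \<omega>) + (\<Sum>j<n. ennreal (L * K * stp n) * ennreal (e j \<omega> * D \<omega>))" .
    qed
    also have "\<dots> = (\<integral>\<^sup>+\<omega>. ennreal \<bar>f 0\<bar> * ennreal (1 * D \<omega>) \<partial>R) + (\<integral>\<^sup>+\<omega>. (\<Sum>j<n. ennreal (L * K * stp n) * ennreal (e j \<omega> * D \<omega>)) \<partial>R)"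
      by (rule nn_integral_add) measurable
    also have "(\<integral>\<^sup>+\<omega>. (\<Sum>j<n. ennreal (L * K * stp n) * ennreal (e j \<omega> * D \<omega>)) \<partial>R) = (\<Sum>j<n. \<integral>\<^sup>+\<omega>. ennreal (L * K * stp n) * ennreal (e j \<omega> * D \<omega>) \<partial>R)"
      by (rule nn_integral_sum) measurable
    also have "\<dots> = (\<Sum>j<n. ennreal (L * K * stp n) * (\<integral>\<^sup>+\<omega>. ennreal (e j \<omega> * D \<omega>) \<partial>R))"
    proof (rule sum.cong[OF refl])
      fix j assume j[measurable]: "j \<in> {..<n}"
      have [measurable]: "e j \<in> borel_measurable R" by (rule R_meas[OF e_M[OF j]])
      show "(\<integral>\<^sup>+\<omega>. ennreal (L * K * stp n) * ennreal (e j \<omega> * D \<omega>) \<partial>R) = ennreal (L * K * stp n) * (\<integral>\<^sup>+\<omega>. ennreal (e j \<omega> * D \<omega>) \<partial>R)"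
        by (rule nn_integral_cmult) measurable
    qed
    also have "(\<integral>\<^sup>+\<omega>. ennreal \<bar>f 0\<bar> * ennreal (1 * D \<omega>) \<partial>R) = ennreal \<bar>f 0\<bar> * (\<integral>\<^sup>+\<omega>. ennreal (1 * D \<omega>) \<partial>R)"
      by (rule nn_integral_cmult) measurable
    also have "ennreal \<bar>f 0\<bar> * (\<integral>\<^sup>+\<omega>. ennreal (1 * D \<omega>) \<partial>R) + (\<Sum>j<n. ennreal (L * K * stp n) * (\<integral>\<^sup>+\<omega>. ennreal (e j \<omega> * D \<omega>) \<partial>R))
      \<le> ennreal \<bar>f 0\<bar> * ennreal S + (\<Sum>j<n. ennreal (L * K * stp n) * ennreal S)"
      by (intro add_mono mult_left_mono sum_mono one ej) auto
    also have "(\<Sum>j<n. ennreal (L * K * stp n) * ennreal S) = ennreal (L * K * T) * ennreal S"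
    proof -
      have "(\<Sum>j<n. ennreal (L * K * stp n)) = ennreal (L * K * T)"
        unfolding stp_sum[symmetric] using L K(1) stp_pos[OF n] by (intro sum_ennreal) auto
      then show ?thesis by (simp only: sum_distrib_right[symmetric])
    qed
    also have "ennreal \<bar>f 0\<bar> * ennreal S + ennreal (L * K * T) * ennreal S = ennreal ((\<bar>f 0\<bar> + L * K * T) * S)"
      using S L K(1) T_pos by (simp add: ennreal_mult ennreal_plus distrib_right)
    finally show ?thesis .
  qed
  have int_M: "integrable M \<Phi>"
  proof (rule integrableI_bounded[OF \<Phi>_M])
    have "(\<integral>\<^sup>+\<omega>. ennreal (\<bar>\<Phi> \<omega>\<bar> * (\<lambda>_. 1) \<omega>) \<partial>M) \<le> ennreal ((\<bar>f 0\<bar> + L * K * T) * (1 + exp_moment K))"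
    proof (rule bound_by)
      have "(\<integral>\<^sup>+\<omega>. ennreal (1 * (\<lambda>_. 1) \<omega>) \<partial>M) = ennreal 1" using emeasure_space_1 by simp
      also have "\<dots> \<le> ennreal (1 + exp_moment K)" by (rule ennreal_leI) simp
      finally show "(\<integral>\<^sup>+\<omega>. ennreal (1 * (\<lambda>_. 1) \<omega>) \<partial>M) \<le> ennreal (1 + exp_moment K)" .
      fix j assume j: "j < n"
      have "(\<integral>\<^sup>+\<omega>. ennreal (e j \<omega> * (\<lambda>_. 1) \<omega>) \<partial>M) \<le> ennreal (exp_moment K)"
        using chain_exp_moment[OF K(1) N jm[OF j]] by (simp add: e_def)
      also have "\<dots> \<le> ennreal (1 + exp_moment K)" by (rule ennreal_leI) simp
      finally show "(\<integral>\<^sup>+\<omega>. ennreal (e j \<omega> * (\<lambda>_. 1) \<omega>) \<partial>M) \<le> ennreal (1 + exp_moment K)" .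
    qed auto
    also have "\<dots> < \<infinity>" by simp
    finally show "(\<integral>\<^sup>+\<omega>. ennreal (norm (\<Phi> \<omega>)) \<partial>M) < \<infinity>" by simp
  qed
  then show "integrable M (\<lambda>\<omega>. f (\<Sum>j<n. stp n *\<^sub>R g (chain (n * m) (j * m) \<omega>)))"
    by (simp add: \<Phi>_def N_def)
  define S where "S = stability_const K * sqrt E"
  have S: "0 \<le> S" using stability_const_nonneg E(2) by (simp add: S_def)
  have stab: "(\<integral>\<^sup>+\<omega>. ennreal (\<Psi> \<omega> * \<bar>?Du \<omega> - ?Dv \<omega>\<bar>) \<partial>Q N) \<le> ennreal S"
    if \<Psi>: "\<Psi> \<in> borel_measurable M" "\<And>\<omega>. 0 \<le> \<Psi> \<omega>" and A: "(\<integral>\<^sup>+\<omega>. ennreal (\<Psi> \<omega> ^ 4) \<partial>Q N) \<le> ennreal (1 + exp_moment (4 * K))" for \<Psi>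
  proof -
    have "(\<integral>\<^sup>+\<omega>. ennreal (\<Psi> \<omega> * \<bar>?Du \<omega> - ?Dv \<omega>\<bar>) \<partial>Q N)
      \<le> ennreal (sqrt (8 * sqrt 2 ^ CARD('d) + 2 * (c' * B)\<^sup>2 * (stp N * real N)) * sqrt E
        * sqrt (sqrt (1 + exp_moment (4 * K)) * sqrt (16 * exp (6 * (stp N * real N) * (c' * B)\<^sup>2))))"
    proof (rule gaussian_walk.girsanov_density_stability[OF shifted_noise_walk[OF N]])
      show "delayed_drift N j \<in> borel_measurable (F (real j * stp N))" if "j < N" for j
        using delayed_drift_measurable[OF N] that by simp
      show "euler_drift n m j \<in> borel_measurable (F (real j * stp N))" if "j < N" for j
        using euler_drift_measurable[of n m j] that N unfolding N_def by simp
      show "norm (delayed_drift N j \<omega>) \<le> c' * B" if "j < N" for j \<omega>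
        using that by (intro delayed_drift_bound N) simp
      show "norm (euler_drift n m j \<omega>) \<le> c' * B" for j \<omega> by (rule euler_drift_bound)
      show "0 \<le> c' * B" using c'_nonneg B_nonneg by simp
      show "\<Psi> \<in> borel_measurable (Q N)" by (rule Q_meas[OF \<Psi>(1)])
      show "0 \<le> 1 + exp_moment (4 * K)" by (simp add: add_nonneg_nonneg)
    qed (use \<Psi> A E in \<open>simp_all add: N_def\<close>)
    also have "sqrt (8 * sqrt 2 ^ CARD('d) + 2 * (c' * B)\<^sup>2 * (stp N * real N)) * sqrt E
        * sqrt (sqrt (1 + exp_moment (4 * K)) * sqrt (16 * exp (6 * (stp N * real N) * (c' * B)\<^sup>2))) = S"
      unfolding stp_mult(1)[OF N] S_def stability_const_def by (simp only: mult_ac)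
    finally show ?thesis .
  qed
  interpret QN: prob_space "Q N" using shifted_noise_walk[OF N] by (rule gaussian_walk.axioms(1))
  have diff: "(\<integral>\<^sup>+\<omega>. ennreal (\<bar>\<Phi> \<omega>\<bar> * \<bar>?Du \<omega> - ?Dv \<omega>\<bar>) \<partial>Q N) \<le> ennreal ((\<bar>f 0\<bar> + L * K * T) * S)"
  proof (rule bound_by[OF sets_Q _ _ S])
    have "(\<integral>\<^sup>+\<omega>. ennreal (1 ^ 4) \<partial>Q N) = ennreal 1" using QN.emeasure_space_1 by simp
    also have "\<dots> \<le> ennreal (1 + exp_moment (4 * K))" by (rule ennreal_leI) simp
    finally show "(\<integral>\<^sup>+\<omega>. ennreal (1 * \<bar>?Du \<omega> - ?Dv \<omega>\<bar>) \<partial>Q N) \<le> ennreal S"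
      by (intro stab) auto
    fix j assume j: "j < n"
    show "(\<integral>\<^sup>+\<omega>. ennreal (e j \<omega> * \<bar>?Du \<omega> - ?Dv \<omega>\<bar>) \<partial>Q N) \<le> ennreal S"
    proof (rule stab)
      have "(\<integral>\<^sup>+\<omega>. ennreal (e j \<omega> ^ 4) \<partial>Q N) = (\<integral>\<^sup>+\<omega>. ennreal (exp (4 * K * norm (chain N (j * m) \<omega>))) \<partial>Q N)"
        unfolding e_def exp_of_nat_mult[symmetric] by (simp add: mult.assoc)
      also have "\<dots> = (\<integral>\<^sup>+\<omega>. ennreal (exp (4 * K * norm (x0 + \<sigma> *v W (real (j * m) * stp N) \<omega>))) \<partial>M)"
        using chain_law[OF N jm[OF j] jm[OF j], of "\<lambda>q. ennreal (exp (4 * K * norm (fst q)))"] by simp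
      also have "\<dots> \<le> ennreal (exp_moment (4 * K))"
        using K(1) by (intro driftless_exp_moment grid_nonneg[OF N] grid_le[OF N] jm[OF j]) auto
      also have "\<dots> \<le> ennreal (1 + exp_moment (4 * K))" by (rule ennreal_leI) simp
      finally show "(\<integral>\<^sup>+\<omega>. ennreal (e j \<omega> ^ 4) \<partial>Q N) \<le> ennreal (1 + exp_moment (4 * K))" .
    qed (use e_M j in \<open>auto simp: e_def\<close>)
  qed auto
  have DuQ: "integrable (Q N) (\<lambda>\<omega>. ?Du \<omega> *\<^sub>R \<Phi> \<omega>)"
  proof -
    have "integrable (density (Q N) (\<lambda>\<omega>. ennreal (?Du \<omega>))) \<Phi>"
      using int_M unfolding M_eq_density[OF N, symmetric] .
    then show ?thesis
      by (subst (asm) integrable_density) (auto intro: Q_meas)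
  qed
  have norm_eq: "norm ((?Du \<omega> - ?Dv \<omega>) *\<^sub>R \<Phi> \<omega>) = \<bar>\<Phi> \<omega>\<bar> * \<bar>?Du \<omega> - ?Dv \<omega>\<bar>" for \<omega>
    unfolding real_norm_def real_scaleR_def abs_mult by (rule mult.commute)
  have LS: "0 \<le> (\<bar>f 0\<bar> + L * K * T) * S" using S L K(1) T_pos by simp
  have diffQ: "integrable (Q N) (\<lambda>\<omega>. (?Du \<omega> - ?Dv \<omega>) *\<^sub>R \<Phi> \<omega>)"
  proof (rule integrableI_bounded)
    show "(\<lambda>\<omega>. (?Du \<omega> - ?Dv \<omega>) *\<^sub>R \<Phi> \<omega>) \<in> borel_measurable (Q N)" by (rule Q_meas) measurable
    have "(\<integral>\<^sup>+\<omega>. ennreal (norm ((?Du \<omega> - ?Dv \<omega>) *\<^sub>R \<Phi> \<omega>)) \<partial>Q N) = (\<integral>\<^sup>+\<omega>. ennreal (\<bar>\<Phi> \<omega>\<bar> * \<bar>?Du \<omega> - ?Dv \<omega>\<bar>) \<partial>Q N)"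
      unfolding norm_eq ..
    also have "\<dots> \<le> ennreal ((\<bar>f 0\<bar> + L * K * T) * S)" by (rule diff)
    also have "\<dots> < \<infinity>" by simp
    finally show "(\<integral>\<^sup>+\<omega>. ennreal (norm ((?Du \<omega> - ?Dv \<omega>) *\<^sub>R \<Phi> \<omega>)) \<partial>Q N) < \<infinity>" .
  qed
  have DvQ: "integrable (Q N) (\<lambda>\<omega>. ?Dv \<omega> *\<^sub>R \<Phi> \<omega>)"
    using Bochner_Integration.integrable_diff[OF DuQ diffQ] by (simp add: left_diff_distrib)
  have "(\<integral>\<omega>. \<Phi> \<omega> \<partial>M) = (\<integral>\<omega>. \<Phi> \<omega> \<partial>density (Q N) (\<lambda>\<omega>. ennreal (?Du \<omega>)))"
    using M_eq_density[OF N] by simp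
  also have "\<dots> = (\<integral>\<omega>. ?Du \<omega> *\<^sub>R \<Phi> \<omega> \<partial>Q N)"
    by (rule integral_density) (auto intro: Q_meas)
  finally have M_int: "(\<integral>\<omega>. \<Phi> \<omega> \<partial>M) = (\<integral>\<omega>. ?Du \<omega> *\<^sub>R \<Phi> \<omega> \<partial>Q N)" .
  have QE_int: "(\<integral>\<omega>. \<Phi> \<omega> \<partial>Q_euler n m) = (\<integral>\<omega>. ?Dv \<omega> *\<^sub>R \<Phi> \<omega> \<partial>Q N)"
    unfolding Q_euler_def N_def[symmetric] by (rule integral_density) (auto intro: Q_meas)
  have eq: "(\<integral>\<omega>. \<Phi> \<omega> \<partial>M) - (\<integral>\<omega>. \<Phi> \<omega> \<partial>Q_euler n m) = (\<integral>\<omega>. (?Du \<omega> - ?Dv \<omega>) *\<^sub>R \<Phi> \<omega> \<partial>Q N)"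
    unfolding M_int QE_int scaleR_diff_left by (rule Bochner_Integration.integral_diff[OF DuQ DvQ, symmetric])
  have "ennreal (norm (\<integral>\<omega>. (?Du \<omega> - ?Dv \<omega>) *\<^sub>R \<Phi> \<omega> \<partial>Q N)) \<le> (\<integral>\<^sup>+\<omega>. ennreal (\<bar>\<Phi> \<omega>\<bar> * \<bar>?Du \<omega> - ?Dv \<omega>\<bar>) \<partial>Q N)"
    using integral_norm_bound_ennreal[OF diffQ] unfolding norm_eq .
  from order_trans[OF this diff]
  have "norm ((\<integral>\<omega>. \<Phi> \<omega> \<partial>M) - (\<integral>\<omega>. \<Phi> \<omega> \<partial>Q_euler n m)) \<le> (\<bar>f 0\<bar> + L * K * T) * S"
    unfolding eq ennreal_le_iff[OF LS] .
  then show "\<bar>(\<integral>\<omega>. f (\<Sum>j<n. stp n *\<^sub>R g (chain (n * m) (j * m) \<omega>)) \<partial>M) - (\<integral>\<omega>. f (\<Sum>j<n. stp n *\<^sub>R g (chain (n * m) (j * m) \<omega>)) \<partial>Q_euler n m)\<bar>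
      \<le> (\<bar>f 0\<bar> + L * K * T) * stability_const K * sqrt E"
    unfolding \<Phi>_def N_def S_def real_norm_def by (simp only: mult.assoc)
qed

end

section \<open>Errors on the coarse grid\<close>

context additive_sde
begin

text \<open>For a bounded variable the mean controls the mean square, and the density of \<open>Q N\<close> has a second moment
  that does not depend on \<open>N\<close>.\<close>

lemma Q_bound_by_M:
  assumes N: "1 \<le> N" and Z: "Z \<in> borel_measurable M" "\<And>\<omega>. 0 \<le> Z \<omega>" "\<And>\<omega>. Z \<omega> \<le> A"
    and e: "(\<integral>\<^sup>+\<omega>. ennreal (Z \<omega>) \<partial>M) \<le> ennreal e" "0 \<le> e"
  shows "(\<integral>\<^sup>+\<omega>. ennreal (Z \<omega>) \<partial>Q N) \<le> ennreal (sqrt (A * e) * sqrt (exp (T * (c' * B)\<^sup>2)))"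
proof -
  let ?D = "girsanov_density (stp N) (\<lambda>k \<omega>. - delayed_drift N k \<omega>) (noise N) N"
  have [measurable]: "?D \<in> borel_measurable M" by (rule Q_density_measurable[OF N])
  have [measurable]: "Z \<in> borel_measurable M" by (rule Z)
  have A: "0 \<le> A" using Z(2,3) by (rule order_trans)
  have "(\<integral>\<^sup>+\<omega>. ennreal (?D \<omega> ^ 2) \<partial>M) \<le> ennreal (exp ((real 2 ^ 2 - real 2) / 2 * (stp N * real N) * (c' * B)\<^sup>2))"
  proof (rule gaussian_walk.girsanov_density_moment[OF noise_walk[OF N]])
    show "(\<lambda>\<omega>. - delayed_drift N j \<omega>) \<in> borel_measurable (F (real j * stp N))" if "j < N" for j
      using delayed_drift_measurable[OF N, of j] that by simp
    show "norm (- delayed_drift N j \<omega>) \<le> c' * B" if "j < N" for j \<omega>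
      using delayed_drift_bound[OF N, of j] that by simp
  qed simp
  then have D2: "(\<integral>\<^sup>+\<omega>. ennreal ((?D \<omega>)\<^sup>2) \<partial>M) \<le> ennreal (exp (T * (c' * B)\<^sup>2))"
    by (simp add: stp_mult[OF N])
  have "(\<integral>\<^sup>+\<omega>. ennreal ((Z \<omega>)\<^sup>2) \<partial>M) \<le> (\<integral>\<^sup>+\<omega>. ennreal A * ennreal (Z \<omega>) \<partial>M)"
  proof (rule nn_integral_mono)
    fix \<omega>
    have "(Z \<omega>)\<^sup>2 \<le> A * Z \<omega>"
      unfolding power2_eq_square by (rule mult_right_mono[OF Z(3) Z(2)])
    then show "ennreal ((Z \<omega>)\<^sup>2) \<le> ennreal A * ennreal (Z \<omega>)"
      using A Z(2) by (simp add: ennreal_mult[symmetric] ennreal_leI)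
  qed
  also have "\<dots> = ennreal A * (\<integral>\<^sup>+\<omega>. ennreal (Z \<omega>) \<partial>M)"
    by (rule nn_integral_cmult) measurable
  also have "\<dots> \<le> ennreal A * ennreal e"
    by (rule mult_left_mono[OF e(1)]) simp
  also have "\<dots> = ennreal (A * e)" using A e(2) by (simp add: ennreal_mult)
  finally have Z2: "(\<integral>\<^sup>+\<omega>. ennreal ((Z \<omega>)\<^sup>2) \<partial>M) \<le> ennreal (A * e)" .
  have "(\<integral>\<^sup>+\<omega>. ennreal (Z \<omega>) \<partial>Q N) = (\<integral>\<^sup>+\<omega>. ennreal (?D \<omega>) * ennreal (Z \<omega>) \<partial>M)"
    by (rule Q_as_M[OF N]) measurable
  also have "\<dots> = (\<integral>\<^sup>+\<omega>. ennreal (Z \<omega> * ?D \<omega>) \<partial>M)"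
    using Z(2) by (simp add: ennreal_mult mult.commute)
  also have "\<dots> \<le> ennreal (sqrt (A * e) * sqrt (exp (T * (c' * B)\<^sup>2)))"
    using A e(2) Z(2) by (intro nn_integral_Cauchy_Schwarz_real Z2 D2) auto
  finally show ?thesis .
qed

text \<open>Between the two drifts lies the drift evaluated at the present position of the chain. Its distance
  from the delayed drift vanishes as \<open>m\<close> grows; its distance from the Euler drift is, under \<open>Q\<close>, an
  increment of \<open>b\<close> along the driftless process.\<close>

lemma drift_gap:
  assumes b: "b \<in> class_B \<alpha>" and \<alpha>: "0 < \<alpha>" "\<alpha> \<le> 1"
  shows "\<exists>C\<ge>0. \<forall>n\<ge>1. \<forall>e>0. \<exists>m0. \<forall>m\<ge>m0. 1 \<le> m \<longrightarrow>
    ennreal (stp (n * m)) * (\<Sum>k<n * m. \<integral>\<^sup>+\<omega>. ennreal ((norm (delayed_drift (n * m) k \<omega> - euler_drift n m k \<omega>))\<^sup>2) \<partial>Q (n * m))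
      \<le> ennreal (e + C * (stp n powr \<alpha> + sqrt (stp n)))"
proof -
  from driftless_grid_increments[OF b \<alpha>] obtain C where C: "0 \<le> C"
    and inc: "\<forall>n m. 1 \<le> n \<longrightarrow> 1 \<le> m \<longrightarrow> (\<exists>a. (\<forall>k. 0 \<le> a k) \<and>
      (\<forall>k<n * m. (\<integral>\<^sup>+\<omega>. ennreal ((norm (b (x0 + \<sigma> *v W (real k * stp (n * m)) \<omega>) - b (x0 + \<sigma> *v W (real (k div m * m) * stp (n * m)) \<omega>)))\<^sup>2) \<partial>M) \<le> ennreal (a k)) \<and>
      stp (n * m) * (\<Sum>k<n * m. a k) \<le> C * (stp n powr \<alpha> + sqrt (stp n)))"
    by (elim exE conjE)
  \<comment> \<open>up to the summand 1, which makes it positive, the factor of the square root of the error under \<open>M\<close>\<close>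
  define q where "q = 4 * c' * B * sqrt (2 * c' * B * T) * sqrt (exp (T * (c' * B)\<^sup>2)) + 1"
  have c'B: "0 \<le> c' * B" using c'_nonneg B_nonneg by simp
  have q: "1 \<le> q" using c'_nonneg B_nonneg T_pos by (simp add: q_def)
  have main: "\<exists>m0. \<forall>m\<ge>m0. 1 \<le> m \<longrightarrow>
    ennreal (stp (n * m)) * (\<Sum>k<n * m. \<integral>\<^sup>+\<omega>. ennreal ((norm (delayed_drift (n * m) k \<omega> - euler_drift n m k \<omega>))\<^sup>2) \<partial>Q (n * m))
      \<le> ennreal (e + 2 * c'\<^sup>2 * C * (stp n powr \<alpha> + sqrt (stp n)))" if n: "1 \<le> n" and e: "0 < e" for n e
  proof -
    define e' where "e' = (e / q)\<^sup>2"
    have e': "0 < e'" using e q by (simp add: e'_def)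
    from delayed_drift_error[OF e'] obtain N0 where N0: "\<forall>N\<ge>N0. 1 \<le> N \<longrightarrow>
        ennreal (stp N) * (\<Sum>k<N. \<integral>\<^sup>+\<omega>. ennreal (norm (delayed_drift N k \<omega> - \<sigma>' *v b (chain N k \<omega>))) \<partial>M) \<le> ennreal e'"
      by (rule exE)
    have "ennreal (stp (n * m)) * (\<Sum>k<n * m. \<integral>\<^sup>+\<omega>. ennreal ((norm (delayed_drift (n * m) k \<omega> - euler_drift n m k \<omega>))\<^sup>2) \<partial>Q (n * m))
      \<le> ennreal (e + 2 * c'\<^sup>2 * C * (stp n powr \<alpha> + sqrt (stp n)))" if m: "N0 \<le> m" "1 \<le> m" for m
    proof -
      define N where "N = n * m"
      have N: "1 \<le> N" using n m by (simp add: N_def)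
      have "1 * m \<le> n * m" using n by (rule mult_right_mono) simp
      then have N_ge: "N0 \<le> N" using m(1) unfolding N_def mult_1_left by linarith
      define s where "s = stp N"
      have s: "0 < s" using stp_pos[OF N] by (simp add: s_def)
      from inc[rule_format, OF n m(2)] obtain a where a: "\<forall>k. (0::real) \<le> a k"
        "\<forall>k<N. (\<integral>\<^sup>+\<omega>. ennreal ((norm (b (x0 + \<sigma> *v W (real k * stp N) \<omega>) - b (x0 + \<sigma> *v W (real (k div m * m) * stp N) \<omega>)))\<^sup>2) \<partial>M) \<le> ennreal (a k)"
        "s * (\<Sum>k<N. a k) \<le> C * (stp n powr \<alpha> + sqrt (stp n))"
        unfolding N_def[symmetric] s_def[symmetric] by (elim exE conjE)
      define R where "R = (\<lambda>k \<omega>. norm (delayed_drift N k \<omega> - \<sigma>' *v b (chain N k \<omega>)))"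
      define V where "V = (\<lambda>k \<omega>. norm (b (chain N k \<omega>) - b (chain N (k div m * m) \<omega>)))"
      have chain_M[measurable]: "chain N k \<in> borel_measurable M" if "k \<le> N" for k
        by (rule chain_measurable_M[OF N that])
      have start: "k div m * m \<le> N" if "k < N" for k
        using block_start_le[of k m] that by linarith
      have R_M: "R k \<in> borel_measurable M" if "k < N" for k
      proof -
        have [measurable]: "delayed_drift N k \<in> borel_measurable M"
          by (rule measurable_F_M[OF delayed_drift_measurable[OF N less_imp_le[OF that]] grid_nonneg[OF N]])
        have [measurable]: "chain N k \<in> borel_measurable M" using that by (intro chain_M) simp
        show ?thesis unfolding R_def by measurable
      qed
      have V_M: "V k \<in> borel_measurable M" if "k < N" for k
      proof -
        have [measurable]: "chain N k \<in> borel_measurable M" "chain N (k div m * m) \<in> borel_measurable M"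
          using that start by (auto intro: chain_M)
        show ?thesis unfolding V_def by measurable
      qed
      have toQ: "F \<in> borel_measurable (Q N)" if "F \<in> borel_measurable M" for F :: "'w \<Rightarrow> real"
        using that by (simp add: measurable_cong_sets[OF sets_Q refl])
      have R_le: "R k \<omega> \<le> 2 * (c' * B)" if "k < N" for k \<omega>
      proof -
        have "R k \<omega> \<le> norm (delayed_drift N k \<omega>) + norm (\<sigma>' *v b (chain N k \<omega>))"
          unfolding R_def by (rule norm_triangle_ineq4)
        also have "norm (delayed_drift N k \<omega>) \<le> c' * B"
          using that by (intro delayed_drift_bound N) simp
        also have "norm (\<sigma>' *v b (chain N k \<omega>)) \<le> c' * B"
          using c'_nonneg by (intro order_trans[OF norm_inverse_le] mult_left_mono b_bound)
        finally show ?thesis by (simp only: mult_2)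
      qed
      have square: "(norm (delayed_drift N k \<omega> - euler_drift n m k \<omega>))\<^sup>2 \<le> (4 * c' * B) * R k \<omega> + (2 * c'\<^sup>2) * (V k \<omega>)\<^sup>2" if k: "k < N" for k \<omega>
      proof -
        have R0: "0 \<le> R k \<omega>" by (simp add: R_def)
        have "norm (delayed_drift N k \<omega> - euler_drift n m k \<omega>) \<le> R k \<omega> + norm (\<sigma>' *v b (chain N k \<omega>) - euler_drift n m k \<omega>)"
          unfolding R_def by (rule norm_diff_triangle_ineq[of _ "\<sigma>' *v b (chain N k \<omega>)" "\<sigma>' *v b (chain N k \<omega>)", simplified])
        also have "\<sigma>' *v b (chain N k \<omega>) - euler_drift n m k \<omega> = \<sigma>' *v (b (chain N k \<omega>) - b (chain N (k div m * m) \<omega>))"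
          by (simp add: euler_drift_def N_def matrix_vector_mult_diff_distrib)
        also have "norm \<dots> \<le> c' * V k \<omega>" unfolding V_def by (rule norm_inverse_le)
        finally have "norm (delayed_drift N k \<omega> - euler_drift n m k \<omega>) \<le> R k \<omega> + c' * V k \<omega>" by simp
        then have "(norm (delayed_drift N k \<omega> - euler_drift n m k \<omega>))\<^sup>2 \<le> (R k \<omega> + c' * V k \<omega>)\<^sup>2"
          by (intro power_mono) auto
        also have "\<dots> \<le> 2 * (R k \<omega>)\<^sup>2 + 2 * (c' * V k \<omega>)\<^sup>2"
          using sum_squares_bound[of "R k \<omega>" "c' * V k \<omega>"] by (simp add: power2_sum)
        also have "2 * (R k \<omega>)\<^sup>2 \<le> 2 * (2 * (c' * B) * R k \<omega>)"
          unfolding power2_eq_square using mult_right_mono[OF R_le[OF k, of \<omega>] R0] by (rule mult_left_mono) simp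
        finally show ?thesis by (simp add: power_mult_distrib mult.assoc)
      qed
      have first: "(\<integral>\<^sup>+\<omega>. ennreal (\<Sum>k<N. s * R k \<omega>) \<partial>Q N) \<le> ennreal (sqrt ((2 * c' * B * T) * e') * sqrt (exp (T * (c' * B)\<^sup>2)))"
      proof (rule Q_bound_by_M[OF N])
        show "(\<lambda>\<omega>. \<Sum>k<N. s * R k \<omega>) \<in> borel_measurable M"
          using R_M by (intro borel_measurable_sum borel_measurable_times) auto
        show "0 \<le> (\<Sum>k<N. s * R k \<omega>)" for \<omega>
          using s by (intro sum_nonneg) (simp add: R_def)
        show "(\<Sum>k<N. s * R k \<omega>) \<le> 2 * c' * B * T" for \<omega>
        proof -
          have "(\<Sum>k<N. s * R k \<omega>) \<le> (\<Sum>k<N. s * (2 * (c' * B)))"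
            using s R_le by (intro sum_mono mult_left_mono) auto
          also have "\<dots> = (real N * s) * (2 * (c' * B))" by simp
          also have "real N * s = T" using stp_mult(2)[OF N] by (simp add: s_def)
          finally show ?thesis by (simp add: mult_ac)
        qed
        have "(\<integral>\<^sup>+\<omega>. ennreal (\<Sum>k<N. s * R k \<omega>) \<partial>M) = (\<integral>\<^sup>+\<omega>. (\<Sum>k<N. ennreal s * ennreal (R k \<omega>)) \<partial>M)"
        proof (rule nn_integral_cong)
          fix \<omega>
          have "(\<Sum>k<N. ennreal (s * R k \<omega>)) = ennreal (\<Sum>k<N. s * R k \<omega>)"
            using s by (intro sum_ennreal) (simp add: R_def)
          then show "ennreal (\<Sum>k<N. s * R k \<omega>) = (\<Sum>k<N. ennreal s * ennreal (R k \<omega>))"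
            using s by (simp add: ennreal_mult R_def)
        qed
        also have "\<dots> = ennreal s * (\<Sum>k<N. \<integral>\<^sup>+\<omega>. ennreal (R k \<omega>) \<partial>M)"
          using R_M by (intro nn_integral_scaled_sum[symmetric] measurable_compose[OF _ measurable_ennreal]) auto
        also have "\<dots> \<le> ennreal e'"
          using N0[rule_format, OF N_ge N] by (simp add: s_def R_def)
        finally show "(\<integral>\<^sup>+\<omega>. ennreal (\<Sum>k<N. s * R k \<omega>) \<partial>M) \<le> ennreal e'" .
      qed (use e' in simp)
      have VQ: "(\<integral>\<^sup>+\<omega>. ennreal ((V k \<omega>)\<^sup>2) \<partial>Q N) \<le> ennreal (a k)" if k: "k < N" for k
      proof -
        have "(\<lambda>p. ennreal ((norm (b (fst p) - b (snd p)))\<^sup>2)) \<in> borel_measurable (borel \<Otimes>\<^sub>M borel)"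
          by measurable
        from chain_law[OF N less_imp_le[OF k] start[OF k] this]
        have "(\<integral>\<^sup>+\<omega>. ennreal ((V k \<omega>)\<^sup>2) \<partial>Q N)
          = (\<integral>\<^sup>+\<omega>. ennreal ((norm (b (x0 + \<sigma> *v W (real k * stp N) \<omega>) - b (x0 + \<sigma> *v W (real (k div m * m) * stp N) \<omega>)))\<^sup>2) \<partial>M)"
          by (simp only: V_def fst_conv snd_conv)
        then show ?thesis using a(2) k by simp
      qed
      have "ennreal s * (\<Sum>k<N. \<integral>\<^sup>+\<omega>. ennreal ((norm (delayed_drift N k \<omega> - euler_drift n m k \<omega>))\<^sup>2) \<partial>Q N)
        \<le> ennreal s * (\<Sum>k<N. ennreal (4 * c' * B) * (\<integral>\<^sup>+\<omega>. ennreal (R k \<omega>) \<partial>Q N) + ennreal (2 * c'\<^sup>2) * ennreal (a k))"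
      proof (intro mult_left_mono sum_mono)
        fix k assume "k \<in> {..<N}"
        then have k: "k < N" by simp
        have [measurable]: "R k \<in> borel_measurable (Q N)" "V k \<in> borel_measurable (Q N)"
          using toQ[OF R_M[OF k]] toQ[OF V_M[OF k]] by auto
        have "(\<integral>\<^sup>+\<omega>. ennreal ((norm (delayed_drift N k \<omega> - euler_drift n m k \<omega>))\<^sup>2) \<partial>Q N)
          \<le> (\<integral>\<^sup>+\<omega>. ennreal (4 * c' * B) * ennreal (R k \<omega>) + ennreal (2 * c'\<^sup>2) * ennreal ((V k \<omega>)\<^sup>2) \<partial>Q N)"
        proof (rule nn_integral_mono)
          fix \<omega>
          have "0 \<le> 4 * c' * B" using c'_nonneg B_nonneg by simp
          then show "ennreal ((norm (delayed_drift N k \<omega> - euler_drift n m k \<omega>))\<^sup>2) \<le> ennreal (4 * c' * B) * ennreal (R k \<omega>) + ennreal (2 * c'\<^sup>2) * ennreal ((V k \<omega>)\<^sup>2)"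
            using square[OF k, of \<omega>] by (simp add: ennreal_mult[symmetric] ennreal_plus[symmetric] R_def ennreal_leI del: ennreal_plus)
        qed
        also have "\<dots> = ennreal (4 * c' * B) * (\<integral>\<^sup>+\<omega>. ennreal (R k \<omega>) \<partial>Q N) + ennreal (2 * c'\<^sup>2) * (\<integral>\<^sup>+\<omega>. ennreal ((V k \<omega>)\<^sup>2) \<partial>Q N)"
          by (subst nn_integral_add) (simp_all add: nn_integral_cmult)
        also have "\<dots> \<le> ennreal (4 * c' * B) * (\<integral>\<^sup>+\<omega>. ennreal (R k \<omega>) \<partial>Q N) + ennreal (2 * c'\<^sup>2) * ennreal (a k)"
          by (intro add_left_mono mult_left_mono VQ k) simp
        finally show "(\<integral>\<^sup>+\<omega>. ennreal ((norm (delayed_drift N k \<omega> - euler_drift n m k \<omega>))\<^sup>2) \<partial>Q N)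
          \<le> ennreal (4 * c' * B) * (\<integral>\<^sup>+\<omega>. ennreal (R k \<omega>) \<partial>Q N) + ennreal (2 * c'\<^sup>2) * ennreal (a k)" .
      qed simp
      also have "\<dots> = ennreal (4 * c' * B) * (ennreal s * (\<Sum>k<N. \<integral>\<^sup>+\<omega>. ennreal (R k \<omega>) \<partial>Q N)) + ennreal (2 * c'\<^sup>2) * (ennreal s * (\<Sum>k<N. ennreal (a k)))"
        unfolding sum.distrib sum_distrib_left[symmetric] distrib_left by (simp only: mult.left_commute)
      also have "ennreal s * (\<Sum>k<N. \<integral>\<^sup>+\<omega>. ennreal (R k \<omega>) \<partial>Q N) = (\<integral>\<^sup>+\<omega>. (\<Sum>k<N. ennreal s * ennreal (R k \<omega>)) \<partial>Q N)"
        using toQ[OF R_M] by (intro nn_integral_scaled_sum measurable_compose[OF _ measurable_ennreal]) auto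
      also have "\<dots> = (\<integral>\<^sup>+\<omega>. ennreal (\<Sum>k<N. s * R k \<omega>) \<partial>Q N)"
      proof (rule nn_integral_cong)
        fix \<omega>
        have "(\<Sum>k<N. ennreal (s * R k \<omega>)) = ennreal (\<Sum>k<N. s * R k \<omega>)"
          using s by (intro sum_ennreal) (simp add: R_def)
        then show "(\<Sum>k<N. ennreal s * ennreal (R k \<omega>)) = ennreal (\<Sum>k<N. s * R k \<omega>)"
          using s by (simp add: ennreal_mult R_def)
      qed
      also have "ennreal s * (\<Sum>k<N. ennreal (a k)) = ennreal (s * (\<Sum>k<N. a k))"
        using s a(1) by (simp add: ennreal_mult sum_nonneg sum_ennreal)
      also have "ennreal (4 * c' * B) * (\<integral>\<^sup>+\<omega>. ennreal (\<Sum>k<N. s * R k \<omega>) \<partial>Q N) + ennreal (2 * c'\<^sup>2) * ennreal (s * (\<Sum>k<N. a k))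
        \<le> ennreal (4 * c' * B) * ennreal (sqrt ((2 * c' * B * T) * e') * sqrt (exp (T * (c' * B)\<^sup>2))) + ennreal (2 * c'\<^sup>2) * ennreal (C * (stp n powr \<alpha> + sqrt (stp n)))"
        by (intro add_mono mult_left_mono first ennreal_leI a(3)) auto
      also have "\<dots> = ennreal (4 * c' * B * (sqrt ((2 * c' * B * T) * e') * sqrt (exp (T * (c' * B)\<^sup>2))) + 2 * c'\<^sup>2 * (C * (stp n powr \<alpha> + sqrt (stp n))))"
      proof -
        have "0 \<le> 4 * c' * B" "0 \<le> 2 * c' * B * T" "0 \<le> C * (stp n powr \<alpha> + sqrt (stp n))"
          using c'_nonneg B_nonneg T_pos C stp_pos[OF n] by auto
        then show ?thesis using e' by (simp add: ennreal_mult[symmetric] ennreal_plus[symmetric] del: ennreal_plus)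
      qed
      also have "\<dots> \<le> ennreal (e + 2 * c'\<^sup>2 * C * (stp n powr \<alpha> + sqrt (stp n)))"
      proof (rule ennreal_leI)
        have "sqrt e' = e / q" using e q by (simp add: e'_def)
        then have "4 * c' * B * (sqrt ((2 * c' * B * T) * e') * sqrt (exp (T * (c' * B)\<^sup>2))) = (q - 1) * (e / q)"
          unfolding real_sqrt_mult[of "2 * c' * B * T" e'] q_def by (simp only: add_diff_cancel_right' mult_ac)
        also have "\<dots> \<le> q * (e / q)" using e q by (intro mult_right_mono) auto
        also have "\<dots> = e" using q by simp
        finally show "4 * c' * B * (sqrt ((2 * c' * B * T) * e') * sqrt (exp (T * (c' * B)\<^sup>2))) + 2 * c'\<^sup>2 * (C * (stp n powr \<alpha> + sqrt (stp n)))
          \<le> e + 2 * c'\<^sup>2 * C * (stp n powr \<alpha> + sqrt (stp n))"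
          by (simp only: mult.assoc add_right_mono)
      qed
      finally show ?thesis by (simp only: N_def s_def)
    qed
    then show ?thesis by (intro exI[of _ N0] allI impI)
  qed
  show ?thesis
    using C main by (intro exI[of _ "2 * c'\<^sup>2 * C"] conjI allI impI) (simp, simp only: simp_thms)
qed

lemma step_function_integral:
  fixes y :: "nat \<Rightarrow> real^'d"
  assumes n: "1 \<le> n"
  shows "has_bochner_integral lborel (\<lambda>r. indicator {0..real j * stp n} r *\<^sub>R y (grid_index n r)) (\<Sum>i<j. stp n *\<^sub>R y i)"
proof -
  have s: "0 < stp n" by (rule stp_pos[OF n])
  have cells: "has_bochner_integral lborel (\<lambda>r. \<Sum>i<j. indicator {real i * stp n..<real (Suc i) * stp n} r *\<^sub>R y i) (\<Sum>i<j. stp n *\<^sub>R y i)"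
  proof (rule has_bochner_integral_sum)
    fix i
    have len: "real (Suc i) * stp n - real i * stp n = stp n" by (simp add: distrib_right)
    have le: "real i * stp n \<le> real (Suc i) * stp n" using s by (intro mult_right_mono) auto
    have "has_bochner_integral lborel (\<lambda>r. indicator {real i * stp n..<real (Suc i) * stp n} r *\<^sub>R y i) (measure lborel {real i * stp n..<real (Suc i) * stp n} *\<^sub>R y i)"
      by (rule has_bochner_integral_indicator, simp, simp only: emeasure_lborel_Ico[OF le] ennreal_less_top infinity_ennreal_def)
    then show "has_bochner_integral lborel (\<lambda>r. indicator {real i * stp n..<real (Suc i) * stp n} r *\<^sub>R y i) (stp n *\<^sub>R y i)"
      using measure_lborel_Ico[OF le] len by (simp only:)
  qed
  have ae: "AE r in lborel. indicator {0..real j * stp n} r *\<^sub>R y (grid_index n r) = (\<Sum>i<j. indicator {real i * stp n..<real (Suc i) * stp n} r *\<^sub>R y i)"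
  proof (rule AE_mp[OF AE_lborel_singleton[of "real j * stp n"]], rule AE_I2, rule impI)
    fix r assume r: "r \<noteq> real j * stp n"
    have cell: "indicator {real i * stp n..<real (Suc i) * stp n} r = (if 0 \<le> r \<and> grid_index n r = i then 1 else (0::real))" for i
    proof -
      have "0 \<le> real i * stp n" by (rule grid_nonneg[OF n])
      then have "r \<in> {real i * stp n..<real (Suc i) * stp n} \<longleftrightarrow> 0 \<le> r \<and> grid_index n r = i"
        using grid_index_eqI[OF n, of i r] grid_index_bounds[OF n, of r] by (auto simp del: of_nat_Suc)
      then show ?thesis unfolding indicator_def by (simp only: of_bool_def)
    qed
    have "0 \<le> r \<Longrightarrow> r < real j * stp n \<longleftrightarrow> grid_index n r < j"
    proof
      assume r0: "0 \<le> r" and "r < real j * stp n"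
      then have "real (grid_index n r) * stp n < real j * stp n" using grid_index_bounds(1)[OF n r0] by linarith
      then show "grid_index n r < j" using s by simp
    next
      assume r0: "0 \<le> r" and "grid_index n r < j"
      then have "real (Suc (grid_index n r)) * stp n \<le> real j * stp n" using s by (intro mult_right_mono) auto
      then show "r < real j * stp n" using grid_index_bounds(2)[OF n r0] by linarith
    qed
    then have "indicator {0..real j * stp n} r = (if 0 \<le> r \<and> grid_index n r < j then 1 else (0::real))"
      using r by (auto simp: indicator_def)
    then show "indicator {0..real j * stp n} r *\<^sub>R y (grid_index n r) = (\<Sum>i<j. indicator {real i * stp n..<real (Suc i) * stp n} r *\<^sub>R y i)"
      unfolding cell by (cases "0 \<le> r") (simp_all add: if_distrib[of "\<lambda>c. c *\<^sub>R _"] sum.delta' cong: if_cong)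
  qed
  have meas: "(\<lambda>r. indicator {0..real j * stp n} r *\<^sub>R y (grid_index n r)) \<in> borel_measurable lborel"
  proof -
    have [measurable]: "(\<lambda>r. y (grid_index n r)) \<in> borel_measurable lborel"
      by (rule measurable_compose[of "grid_index n" _ "count_space UNIV"]) simp_all
    show ?thesis by measurable
  qed
  show ?thesis
    using has_bochner_integral_cong_AE[OF meas borel_measurable_has_bochner_integral[OF cells] ae] cells by (simp only:)
qed

lemma integrable_along_X:
  fixes g :: "real^'d \<Rightarrow> real^'d"
  assumes [measurable]: "g \<in> borel_measurable borel" and K: "0 \<le> K" "\<And>x. norm (g x) \<le> K * exp (K * norm x)"
    and \<omega>: "\<omega> \<in> space M"
  shows "integrable lborel (\<lambda>r. indicator {0..T} r *\<^sub>R g (X r \<omega>))"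
proof -
  have "compact ((\<lambda>r. X r \<omega>) ` {0..T})"
    by (rule compact_continuous_image[OF X_continuous[OF \<omega>] compact_Icc])
  then obtain R where R: "\<And>r. r \<in> {0..T} \<Longrightarrow> norm (X r \<omega>) \<le> R"
    using compact_imp_bounded bounded_iff by (metis imageI)
  have [measurable]: "(\<lambda>r. g (X (max 0 (min T r)) \<omega>)) \<in> borel_measurable borel"
    by (rule measurable_compose[OF X_path_measurable[OF \<omega>] assms(1)])
  have "integrable lborel (\<lambda>r. indicator {0..T} r *\<^sub>R g (X (max 0 (min T r)) \<omega>))"
  proof (rule integrableI_bounded_set_indicator[where B = "K * exp (K * R)"])
    show "AE r in lborel. r \<in> {0..T} \<longrightarrow> norm (g (X (max 0 (min T r)) \<omega>)) \<le> K * exp (K * R)"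
    proof (rule AE_I2, rule impI)
      fix r assume r: "r \<in> {0..T}"
      then have "norm (X (max 0 (min T r)) \<omega>) \<le> R" using R[of r] by simp
      then have "K * exp (K * norm (X (max 0 (min T r)) \<omega>)) \<le> K * exp (K * R)"
        using K(1) by (intro mult_left_mono) (simp_all add: mult_left_mono)
      then show "norm (g (X (max 0 (min T r)) \<omega>)) \<le> K * exp (K * R)" using K(2) by (rule order_trans[rotated])
    qed
  qed (auto simp: emeasure_lborel_Icc_eq)
  also have "(\<lambda>r. indicator {0..T} r *\<^sub>R g (X (max 0 (min T r)) \<omega>)) = (\<lambda>r. indicator {0..T} r *\<^sub>R g (X r \<omega>))"
    by (intro ext) (auto simp: indicator_def)
  finally show ?thesis .
qed

lemma functional_measurable:
  fixes g :: "real^'d \<Rightarrow> real^'d"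
  assumes g: "g \<in> borel_measurable borel"
  shows "(\<lambda>\<omega>. LINT s:{0..T}|lborel. g (X s \<omega>)) \<in> borel_measurable M"
proof -
  have joint: "(\<lambda>q. g (X (max 0 (min T (snd q))) (fst q))) \<in> borel_measurable (M \<Otimes>\<^sub>M lborel)"
    using measurable_compose[OF measurable_compose[OF measurable_pair_swap' X_jointly_measurable_M] g]
    by (simp add: split_beta')
  have "(\<lambda>(\<omega>, s). indicator {0..T} s *\<^sub>R g (X (max 0 (min T s)) \<omega>)) \<in> borel_measurable (M \<Otimes>\<^sub>M lborel)"
    unfolding split_beta' by (rule borel_measurable_scaleR[OF _ joint]) measurable
  then have "(\<lambda>\<omega>. LINT s|lborel. indicator {0..T} s *\<^sub>R g (X (max 0 (min T s)) \<omega>)) \<in> borel_measurable M"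
    by (rule lborel.borel_measurable_lebesgue_integral)
  also have "(\<lambda>\<omega>. LINT s|lborel. indicator {0..T} s *\<^sub>R g (X (max 0 (min T s)) \<omega>)) = (\<lambda>\<omega>. LINT s:{0..T}|lborel. g (X s \<omega>))"
    unfolding set_lebesgue_integral_def by (intro ext Bochner_Integration.integral_cong) (auto simp: indicator_def)
  finally show ?thesis .
qed

lemma grid_index_block_start:
  assumes n: "1 \<le> n" and m: "1 \<le> m" and r: "0 \<le> r"
  shows "grid_index (n * m) r div m = grid_index n r"
proof -
  have nm: "1 \<le> n * m" using n m by simp
  have mN: "real m * stp (n * m) = stp n" using n m by (simp add: stp_def)
  define k where "k = grid_index (n * m) r"
  have "k div m * m \<le> k" "Suc k \<le> Suc (k div m) * m"
    using m div_times_less_eq_dividend[of k m] dividend_less_div_times[of m k] by auto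
  then have "real (k div m * m) * stp (n * m) \<le> real k * stp (n * m)" "real (Suc k) * stp (n * m) \<le> real (Suc (k div m) * m) * stp (n * m)"
    using stp_pos[OF nm] by (intro mult_right_mono of_nat_mono; simp)+
  moreover have "real (i * m) * stp (n * m) = real i * stp n" for i
    using mN by (simp only: of_nat_mult mult.assoc)
  ultimately have "real (k div m) * stp n \<le> real k * stp (n * m)" "real (Suc k) * stp (n * m) \<le> real (Suc (k div m)) * stp n"
    by (simp_all only:)
  then have "real (k div m) * stp n \<le> r" "r < real (Suc (k div m)) * stp n"
    using grid_index_bounds[OF nm r] unfolding k_def by linarith+
  then have "grid_index n r = k div m" by (rule grid_index_eqI[OF n])
  then show ?thesis by (simp add: k_def)
qed

text \<open>The solution is first replaced by the chain on the fine grid, with an error that vanishes as \<open>m\<close>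
  grows, and then by the chain at the beginning of the coarse cell. The second error is an increment
  of \<open>g\<close> along the chain, estimated through the Gaussian law of the chain under \<open>Q\<close>.\<close>

lemma time_discretisation_error:
  assumes g: "g \<in> class_B \<beta>" and \<beta>: "0 < \<beta>" "\<beta> \<le> 1"
  shows "\<exists>C\<ge>0. \<forall>n\<ge>1. \<forall>e>0. \<exists>m0. \<forall>m\<ge>m0. 1 \<le> m \<longrightarrow>
    (\<integral>\<^sup>+\<omega>. ennreal (norm ((LINT s:{0..T}|lborel. g (X s \<omega>)) - (\<Sum>j<n. stp n *\<^sub>R g (chain (n * m) (j * m) \<omega>)))) \<partial>M)
      \<le> ennreal (e + C * sqrt (stp n powr \<beta> + sqrt (stp n)))"
proof -
  have g_borel[measurable]: "g \<in> borel_measurable borel" using g by (simp add: class_B_def)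
  from class_B_exp_bound[OF g \<beta>] obtain K where K: "0 < K" "\<forall>x. norm (g x) \<le> K * exp (K * norm x)"
    by (elim exE conjE)
  from driftless_grid_increments[OF g \<beta>] obtain C where C: "0 \<le> C"
    and inc: "\<forall>n m. 1 \<le> n \<longrightarrow> 1 \<le> m \<longrightarrow> (\<exists>a. (\<forall>k. 0 \<le> a k) \<and>
      (\<forall>k<n * m. (\<integral>\<^sup>+\<omega>. ennreal ((norm (g (x0 + \<sigma> *v W (real k * stp (n * m)) \<omega>) - g (x0 + \<sigma> *v W (real (k div m * m) * stp (n * m)) \<omega>)))\<^sup>2) \<partial>M) \<le> ennreal (a k)) \<and>
      stp (n * m) * (\<Sum>k<n * m. a k) \<le> C * (stp n powr \<beta> + sqrt (stp n)))"
    by (elim exE conjE)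
  define G where "G = sqrt (exp (T * (c' * B)\<^sup>2))"
  have G: "0 \<le> G" by (simp add: G_def)
  have main: "\<exists>m0. \<forall>m\<ge>m0. 1 \<le> m \<longrightarrow>
    (\<integral>\<^sup>+\<omega>. ennreal (norm ((LINT s:{0..T}|lborel. g (X s \<omega>)) - (\<Sum>j<n. stp n *\<^sub>R g (chain (n * m) (j * m) \<omega>)))) \<partial>M)
      \<le> ennreal (e + (G * sqrt T * sqrt C) * sqrt (stp n powr \<beta> + sqrt (stp n)))" if n: "1 \<le> n" and e: "0 < e" for n e
  proof -
    from chain_converges_vec[OF g_borel less_imp_le[OF K(1)] K(2)[rule_format] zero_le_one e]
    obtain N0 where N0: "\<forall>N\<ge>N0. (\<integral>\<^sup>+r. indicator {0<..<T} r * (\<integral>\<^sup>+\<omega>. ennreal (norm (g (X r \<omega>) - g (chain N (grid_index N r + 0) \<omega>))) \<partial>M) \<partial>lborel) \<le> ennreal e"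
      by (rule exE)
    have "(\<integral>\<^sup>+\<omega>. ennreal (norm ((LINT s:{0..T}|lborel. g (X s \<omega>)) - (\<Sum>j<n. stp n *\<^sub>R g (chain (n * m) (j * m) \<omega>)))) \<partial>M)
      \<le> ennreal (e + (G * sqrt T * sqrt C) * sqrt (stp n powr \<beta> + sqrt (stp n)))" if m: "N0 \<le> m" "1 \<le> m" for m
    proof -
      define N where "N = n * m"
      have N: "1 \<le> N" using n m by (simp add: N_def)
      have "1 * m \<le> n * m" using n by (rule mult_right_mono) simp
      then have N_ge: "N0 \<le> N" using m(1) unfolding N_def mult_1_left by linarith
      define s where "s = stp N"
      have s: "0 < s" using stp_pos[OF N] by (simp add: s_def)
      from inc[rule_format, OF n m(2)] obtain a where a: "\<forall>k. (0::real) \<le> a k"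
        "\<forall>k<N. (\<integral>\<^sup>+\<omega>. ennreal ((norm (g (x0 + \<sigma> *v W (real k * stp N) \<omega>) - g (x0 + \<sigma> *v W (real (k div m * m) * stp N) \<omega>)))\<^sup>2) \<partial>M) \<le> ennreal (a k)"
        "s * (\<Sum>k<N. a k) \<le> C * (stp n powr \<beta> + sqrt (stp n))"
        unfolding N_def[symmetric] s_def[symmetric] by (elim exE conjE)
      define V where "V = (\<lambda>k \<omega>. norm (g (chain N k \<omega>) - g (chain N (k div m * m) \<omega>)))"
      have start: "k div m * m \<le> N" if "k < N" for k
        using block_start_le[of k m] that by linarith
      have V_M: "V k \<in> borel_measurable M" if "k < N" for k
      proof -
        have [measurable]: "chain N k \<in> borel_measurable M" "chain N (k div m * m) \<in> borel_measurable M"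
          using that start by (auto intro: chain_measurable_M[OF N])
        show ?thesis unfolding V_def by measurable
      qed
      define D where "D = (\<lambda>r \<omega>. indicator {0<..<T} r * ennreal (norm (g (X r \<omega>) - g (chain N (grid_index N r + 0) \<omega>))))"
      have "(\<lambda>p. ennreal (norm (g (fst p) - g (snd p)))) \<in> borel_measurable (borel \<Otimes>\<^sub>M borel)"
        by measurable
      from chain_error_jointly_measurable[OF N zero_le_one this]
      have D_joint: "(\<lambda>(r, \<omega>). D r \<omega>) \<in> borel_measurable (borel \<Otimes>\<^sub>M M)"
        by (simp add: D_def)
      have "(\<lambda>(\<omega>, r). D r \<omega>) \<in> borel_measurable (M \<Otimes>\<^sub>M lborel)"
        using measurable_compose[OF measurable_pair_swap' D_joint] by (simp add: split_beta')
      then have D_M: "(\<lambda>\<omega>. \<integral>\<^sup>+r. D r \<omega> \<partial>lborel) \<in> borel_measurable M"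
        by (rule lborel.borel_measurable_nn_integral)
      have pathwise: "ennreal (norm ((LINT s:{0..T}|lborel. g (X s \<omega>)) - (\<Sum>j<n. stp n *\<^sub>R g (chain N (j * m) \<omega>))))
        \<le> (\<integral>\<^sup>+r. D r \<omega> \<partial>lborel) + (\<Sum>k<N. ennreal s * ennreal (V k \<omega>))" if \<omega>: "\<omega> \<in> space M" for \<omega>
      proof -
        let ?y = "\<lambda>j. g (chain N (j * m) \<omega>)"
        note gX = integrable_along_X[OF g_borel less_imp_le[OF K(1)] K(2)[rule_format] \<omega>]
        have step: "has_bochner_integral lborel (\<lambda>r. indicator {0..T} r *\<^sub>R ?y (grid_index n r)) (\<Sum>j<n. stp n *\<^sub>R ?y j)"
          using step_function_integral[OF n, of n ?y] unfolding stp_mult(2)[OF n] .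
        have eq: "(LINT s:{0..T}|lborel. g (X s \<omega>)) - (\<Sum>j<n. stp n *\<^sub>R ?y j)
          = (LINT r|lborel. indicator {0..T} r *\<^sub>R g (X r \<omega>) - indicator {0..T} r *\<^sub>R ?y (grid_index n r))"
          unfolding set_lebesgue_integral_def
          using Bochner_Integration.integral_diff[OF gX integrable.intros[OF step]] has_bochner_integral_integral_eq[OF step] by simp
        have "ennreal (norm ((LINT s:{0..T}|lborel. g (X s \<omega>)) - (\<Sum>j<n. stp n *\<^sub>R ?y j)))
          \<le> (\<integral>\<^sup>+r. ennreal (norm (indicator {0..T} r *\<^sub>R g (X r \<omega>) - indicator {0..T} r *\<^sub>R ?y (grid_index n r))) \<partial>lborel)"
          unfolding eq
          by (rule integral_norm_bound_ennreal[OF Bochner_Integration.integrable_diff[OF gX integrable.intros[OF step]]])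
        also have "\<dots> \<le> (\<integral>\<^sup>+r. D r \<omega> + indicator {0<..<T} r * ennreal (V (grid_index N r) \<omega>) \<partial>lborel)"
        proof (rule nn_integral_mono_AE)
          have "AE r in lborel. r \<noteq> 0 \<and> r \<noteq> T"
            using AE_lborel_singleton[of 0] AE_lborel_singleton[of T] by (rule AE_conjI)
          then show "AE r in lborel. ennreal (norm (indicator {0..T} r *\<^sub>R g (X r \<omega>) - indicator {0..T} r *\<^sub>R ?y (grid_index n r)))
            \<le> D r \<omega> + indicator {0<..<T} r * ennreal (V (grid_index N r) \<omega>)"
          proof (rule AE_mp[OF _ AE_I2[OF impI]])
            fix r assume r: "r \<noteq> 0 \<and> r \<noteq> T"
            show "ennreal (norm (indicator {0..T} r *\<^sub>R g (X r \<omega>) - indicator {0..T} r *\<^sub>R ?y (grid_index n r)))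
              \<le> D r \<omega> + indicator {0<..<T} r * ennreal (V (grid_index N r) \<omega>)"
            proof (cases "r \<in> {0<..<T}")
              case True
              then have gi: "grid_index N r div m = grid_index n r"
                unfolding N_def using grid_index_block_start[OF n m(2), of r] by simp
              have "norm (g (X r \<omega>) - ?y (grid_index n r)) \<le> norm (g (X r \<omega>) - g (chain N (grid_index N r + 0) \<omega>)) + V (grid_index N r) \<omega>"
                unfolding V_def gi add_0_right 
                using norm_triangle_ineq[of "g (X r \<omega>) - g (chain N (grid_index N r) \<omega>)" "g (chain N (grid_index N r) \<omega>) - ?y (grid_index n r)"]
                by (simp only: diff_add_cancel add_diff_eq)
              then show ?thesis using True
                by (simp add: D_def V_def ennreal_plus[symmetric] ennreal_leI del: ennreal_plus)
            next
              case False
              then show ?thesis using r by (auto simp: indicator_def)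
            qed
          qed
        qed
        also have "\<dots> = (\<integral>\<^sup>+r. D r \<omega> \<partial>lborel) + (\<integral>\<^sup>+r. indicator {0<..<T} r * ennreal (V (grid_index N r) \<omega>) \<partial>lborel)"
        proof (rule nn_integral_add)
          show "(\<lambda>r. D r \<omega>) \<in> borel_measurable lborel"
            using measurable_compose[OF measurable_Pair2'[OF \<omega>] D_joint] by simp
          have [measurable]: "(\<lambda>r. ennreal (V (grid_index N r) \<omega>)) \<in> borel_measurable lborel"
            by (rule measurable_compose[of "grid_index N" _ "count_space UNIV"]) simp_all
          show "(\<lambda>r. indicator {0<..<T} r * ennreal (V (grid_index N r) \<omega>)) \<in> borel_measurable lborel" by measurable
        qed
        also have "\<dots> \<le> (\<integral>\<^sup>+r. D r \<omega> \<partial>lborel) + (\<Sum>k<N. ennreal s * ennreal (V k \<omega>))"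
          unfolding s_def by (intro add_left_mono grid_integral_le_sum[OF N])
        finally show ?thesis .
      qed
      have "(\<integral>\<^sup>+\<omega>. ennreal (norm ((LINT s:{0..T}|lborel. g (X s \<omega>)) - (\<Sum>j<n. stp n *\<^sub>R g (chain N (j * m) \<omega>)))) \<partial>M)
        \<le> (\<integral>\<^sup>+\<omega>. (\<integral>\<^sup>+r. D r \<omega> \<partial>lborel) + (\<Sum>k<N. ennreal s * ennreal (V k \<omega>)) \<partial>M)"
        by (rule nn_integral_mono[OF pathwise])
      also have "\<dots> = (\<integral>\<^sup>+\<omega>. (\<integral>\<^sup>+r. D r \<omega> \<partial>lborel) \<partial>M) + (\<integral>\<^sup>+\<omega>. (\<Sum>k<N. ennreal s * ennreal (V k \<omega>)) \<partial>M)"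
        using V_M by (intro nn_integral_add D_M borel_measurable_sum borel_measurable_times measurable_compose[OF _ measurable_ennreal]) auto
      also have "(\<integral>\<^sup>+\<omega>. (\<Sum>k<N. ennreal s * ennreal (V k \<omega>)) \<partial>M) = ennreal s * (\<Sum>k<N. \<integral>\<^sup>+\<omega>. ennreal (V k \<omega>) \<partial>M)"
        using V_M by (intro nn_integral_scaled_sum[symmetric] measurable_compose[OF _ measurable_ennreal]) auto
      also have "(\<integral>\<^sup>+\<omega>. (\<integral>\<^sup>+r. D r \<omega> \<partial>lborel) \<partial>M) \<le> ennreal e"
      proof -
        have "(\<integral>\<^sup>+\<omega>. (\<integral>\<^sup>+r. D r \<omega> \<partial>lborel) \<partial>M) = (\<integral>\<^sup>+r. (\<integral>\<^sup>+\<omega>. D r \<omega> \<partial>M) \<partial>lborel)"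
          by (rule swap_time_expectation[OF D_joint])
        also have "\<dots> = (\<integral>\<^sup>+r. indicator {0<..<T} r * (\<integral>\<^sup>+\<omega>. ennreal (norm (g (X r \<omega>) - g (chain N (grid_index N r + 0) \<omega>))) \<partial>M) \<partial>lborel)"
          unfolding D_def by (intro nn_integral_cong) (simp add: indicator_def)
        also have "\<dots> \<le> ennreal e" by (rule N0[rule_format, OF N_ge])
        finally show ?thesis .
      qed
      also have "ennreal s * (\<Sum>k<N. \<integral>\<^sup>+\<omega>. ennreal (V k \<omega>) \<partial>M) \<le> ennreal ((G * sqrt T * sqrt C) * sqrt (stp n powr \<beta> + sqrt (stp n)))"
      proof -
        have VM: "(\<integral>\<^sup>+\<omega>. ennreal (V k \<omega>) \<partial>M) \<le> ennreal (sqrt (a k) * G)" if k: "k < N" for k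
        proof -
          have "(\<lambda>p. norm (g (fst p) - g (snd p))) \<in> borel_measurable (borel \<Otimes>\<^sub>M borel)"
            by measurable
          from chain_krylov_pair[OF N less_imp_le[OF k] start[OF k] this, of "a k"]
          show ?thesis using a(1,2) k unfolding V_def G_def by (simp only: fst_conv snd_conv norm_ge_zero)
        qed
        have "ennreal s * (\<Sum>k<N. \<integral>\<^sup>+\<omega>. ennreal (V k \<omega>) \<partial>M) \<le> ennreal s * (\<Sum>k<N. ennreal (sqrt (a k) * G))"
          using VM by (intro mult_left_mono sum_mono) auto
        also have "\<dots> = ennreal (s * (\<Sum>k<N. sqrt (a k) * G))"
          unfolding ennreal_mult'[OF less_imp_le[OF s]] using a(1) G by (subst sum_ennreal) auto
        also have "s * (\<Sum>k<N. sqrt (a k) * G) = G * (\<Sum>k<N. s * sqrt (a k))"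
          unfolding sum_distrib_left by (intro sum.cong refl) (simp only: mult_ac)
        also have "ennreal \<dots> \<le> ennreal (G * (sqrt (s * real N) * sqrt (s * (\<Sum>k<N. a k))))"
          using G s a(1) by (intro ennreal_leI mult_left_mono sum_sqrt_le) auto
        also have "s * real N = T" unfolding s_def by (rule stp_mult(1)[OF N])
        also have "ennreal (G * (sqrt T * sqrt (s * (\<Sum>k<N. a k)))) \<le> ennreal (G * (sqrt T * sqrt (C * (stp n powr \<beta> + sqrt (stp n)))))"
          using G T_pos by (intro ennreal_leI mult_left_mono real_sqrt_le_mono a(3)) auto
        also have "G * (sqrt T * sqrt (C * (stp n powr \<beta> + sqrt (stp n)))) = (G * sqrt T * sqrt C) * sqrt (stp n powr \<beta> + sqrt (stp n))"
          unfolding real_sqrt_mult[of C] by (simp only: mult.assoc)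
        finally show ?thesis .
      qed
      finally have "(\<integral>\<^sup>+\<omega>. ennreal (norm ((LINT s:{0..T}|lborel. g (X s \<omega>)) - (\<Sum>j<n. stp n *\<^sub>R g (chain N (j * m) \<omega>)))) \<partial>M)
        \<le> ennreal e + ennreal ((G * sqrt T * sqrt C) * sqrt (stp n powr \<beta> + sqrt (stp n)))"
        by (simp add: add_mono)
      also have "\<dots> = ennreal (e + (G * sqrt T * sqrt C) * sqrt (stp n powr \<beta> + sqrt (stp n)))"
      proof -
        have "0 \<le> (G * sqrt T * sqrt C) * sqrt (stp n powr \<beta> + sqrt (stp n))"
          using G T_pos C stp_pos[OF n] by (intro mult_nonneg_nonneg) auto
        then show ?thesis using e by (intro ennreal_plus[symmetric]) auto
      qed
      finally show ?thesis by (simp only: N_def)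
    qed
    then show ?thesis by (intro exI[of _ N0] allI impI)
  qed
  have "0 \<le> G * sqrt T * sqrt C" using G T_pos C by simp
  then show ?thesis
    by (intro exI[of _ "G * sqrt T * sqrt C"] conjI allI impI main)
qed

end

text \<open>The factor \<open>1 + T\<close> accounts for steps longer than 1, for which a larger exponent is worse.\<close>

lemma sqrt_rate_le:
  fixes h T a \<rho> :: real
  assumes h: "0 < h" "h \<le> T" and a: "a \<le> 1" and \<rho>: "\<rho> \<le> a / 2" "\<rho> \<le> 1 / 4" "0 \<le> \<rho>"
  shows "sqrt (h powr a + sqrt h) \<le> 2 * (1 + T) * h powr \<rho>"
proof -
  have rate: "h powr q \<le> (1 + T) * h powr \<rho>" if "\<rho> \<le> q" "q \<le> 1" for q
  proof -
    have "h powr (q - \<rho>) \<le> (1 + T) powr (q - \<rho>)"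
      using h that by (intro powr_mono2) auto
    also have "\<dots> \<le> (1 + T) powr 1"
      using h that \<rho> by (intro powr_mono) auto
    finally have "h powr (q - \<rho>) * h powr \<rho> \<le> (1 + T) * h powr \<rho>"
      using h by (intro mult_right_mono) auto
    then show ?thesis using h by (simp add: powr_add[symmetric])
  qed
  have root: "sqrt (h powr q) = h powr (q / 2)" for q
    using h by (simp add: powr_half_sqrt[symmetric] powr_powr)
  have "sqrt (h powr a + sqrt h) = sqrt (h powr a + h powr (1 / 2))"
    using h by (simp add: powr_half_sqrt)
  also have "\<dots> \<le> sqrt (h powr a) + sqrt (h powr (1 / 2))"
    by (rule sqrt_add_le_add_sqrt) auto
  also have "\<dots> = h powr (a / 2) + h powr (1 / 4)" unfolding root by simp
  also have "\<dots> \<le> (1 + T) * h powr \<rho> + (1 + T) * h powr \<rho>"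
    using a \<rho> by (intro add_mono rate) auto
  finally show ?thesis by (simp add: algebra_simps)
qed

context additive_sde
begin

text \<open>For each \<open>n\<close> the refinement \<open>m\<close> is taken so large that the errors of the fine grid do not exceed the
  errors of the coarse one, which carry the rate.\<close>

lemma functional_error:
  fixes f :: "real^'d \<Rightarrow> real"
  assumes b: "b \<in> class_B \<alpha>" and \<alpha>: "0 < \<alpha>" "\<alpha> \<le> 1"
    and g: "g \<in> class_B \<beta>" and \<beta>: "0 < \<beta>" "\<beta> \<le> 1"
    and f: "L-lipschitz_on UNIV f"
  shows "\<exists>C. \<forall>n\<ge>1. \<bar>(\<integral>\<omega>. f (LINT s:{0..T}|lborel. g (X s \<omega>)) \<partial>M)
      - (\<integral>\<omega>. f (\<Sum>j<n. stp n *\<^sub>R g (euler_map 1 (stp n) b \<sigma> x0 (\<lambda>k. noise n k \<omega>) j)) \<partial>M)\<bar>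
    \<le> C * stp n powr (min (\<alpha> / 2) (min (\<beta> / 2) (1 / 4)))"
proof -
  define \<rho> where "\<rho> = min (\<alpha> / 2) (min (\<beta> / 2) (1 / 4))"
  have \<rho>: "\<rho> \<le> \<alpha> / 2" "\<rho> \<le> \<beta> / 2" "\<rho> \<le> 1 / 4" "0 \<le> \<rho>"
    using \<alpha> \<beta> by (auto simp: \<rho>_def)
  have g_borel: "g \<in> borel_measurable borel" using g by (simp add: class_B_def)
  have f_borel: "f \<in> borel_measurable borel" by (rule lipschitz_borel_measurable[OF f])
  have L: "0 \<le> L" using f by (rule lipschitz_on_nonneg)
  from class_B_exp_bound[OF g \<beta>] obtain K where K: "0 < K" "\<forall>x. norm (g x) \<le> K * exp (K * norm x)"
    by (elim exE conjE)
  from time_discretisation_error[OF g \<beta>] obtain C1 where C1: "0 \<le> C1"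
    and time: "\<forall>n\<ge>1. \<forall>e>0. \<exists>m0. \<forall>m\<ge>m0. 1 \<le> m \<longrightarrow>
    (\<integral>\<^sup>+\<omega>. ennreal (norm ((LINT s:{0..T}|lborel. g (X s \<omega>)) - (\<Sum>j<n. stp n *\<^sub>R g (chain (n * m) (j * m) \<omega>)))) \<partial>M)
      \<le> ennreal (e + C1 * sqrt (stp n powr \<beta> + sqrt (stp n)))"
    by (elim exE conjE)
  from drift_gap[OF b \<alpha>] obtain C2 where C2: "0 \<le> C2"
    and gap: "\<forall>n\<ge>1. \<forall>e>0. \<exists>m0. \<forall>m\<ge>m0. 1 \<le> m \<longrightarrow>
    ennreal (stp (n * m)) * (\<Sum>k<n * m. \<integral>\<^sup>+\<omega>. ennreal ((norm (delayed_drift (n * m) k \<omega> - euler_drift n m k \<omega>))\<^sup>2) \<partial>Q (n * m))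
      \<le> ennreal (e + C2 * (stp n powr \<alpha> + sqrt (stp n)))"
    by (elim exE conjE)
  define S where "S = (\<bar>f 0\<bar> + L * K * T) * stability_const K"
  have S: "0 \<le> S" using L K(1) T_pos stability_const_nonneg by (simp add: S_def)
  define C where "C = L * (1 + C1) * (2 * (1 + T)) + S * sqrt (1 + C2) * (2 * (1 + T))"
  have main: "\<bar>(\<integral>\<omega>. f (LINT s:{0..T}|lborel. g (X s \<omega>)) \<partial>M)
      - (\<integral>\<omega>. f (\<Sum>j<n. stp n *\<^sub>R g (euler_map 1 (stp n) b \<sigma> x0 (\<lambda>k. noise n k \<omega>) j)) \<partial>M)\<bar>
    \<le> C * stp n powr \<rho>" if n: "1 \<le> n" for n
  proof -
    define h where "h = stp n"
    have h: "0 < h" "h \<le> T"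
      using stp_pos[OF n] grid_le[OF n n] by (simp_all add: h_def)
    define e1 where "e1 = sqrt (h powr \<beta> + sqrt h)"
    define e2 where "e2 = h powr \<alpha> + sqrt h"
    have e: "0 < e1" "0 < e2" using h(1) by (simp_all add: e1_def e2_def add_pos_pos)
    from time[rule_format, OF n e(1)] obtain m1 where m1: "\<forall>m\<ge>m1. 1 \<le> m \<longrightarrow>
      (\<integral>\<^sup>+\<omega>. ennreal (norm ((LINT s:{0..T}|lborel. g (X s \<omega>)) - (\<Sum>j<n. stp n *\<^sub>R g (chain (n * m) (j * m) \<omega>)))) \<partial>M)
        \<le> ennreal (e1 + C1 * e1)"
      unfolding h_def[symmetric] e1_def[symmetric] by (elim exE)
    from gap[rule_format, OF n e(2)] obtain m2 where m2: "\<forall>m\<ge>m2. 1 \<le> m \<longrightarrow>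
      ennreal (stp (n * m)) * (\<Sum>k<n * m. \<integral>\<^sup>+\<omega>. ennreal ((norm (delayed_drift (n * m) k \<omega> - euler_drift n m k \<omega>))\<^sup>2) \<partial>Q (n * m))
        \<le> ennreal (e2 + C2 * e2)"
      unfolding h_def[symmetric] e2_def[symmetric] by (elim exE)
    define m where "m = Suc (max m1 m2)"
    have m: "1 \<le> m" "m1 \<le> m" "m2 \<le> m" by (simp_all add: m_def)
    have nm: "1 \<le> n * m" using n m(1) by simp
    define Y where "Y = (\<lambda>\<omega>. LINT s:{0..T}|lborel. g (X s \<omega>))"
    define Z where "Z = (\<lambda>\<omega>. \<Sum>j<n. stp n *\<^sub>R g (chain (n * m) (j * m) \<omega>))"
    have te: "(\<integral>\<^sup>+\<omega>. ennreal (norm (Y \<omega> - Z \<omega>)) \<partial>M) \<le> ennreal (e1 + C1 * e1)"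
      unfolding Y_def Z_def by (rule m1[rule_format, OF m(2,1)])
    have E: "0 \<le> e2 + C2 * e2" using e C2 by simp
    have Y_eq: "(LINT s:{0..T}|lborel. g (X s \<omega>)) = Y \<omega>" for \<omega>
      by (simp only: Y_def)
    have Z_eq: "(\<Sum>j<n. stp n *\<^sub>R g (chain (n * m) (j * m) \<omega>)) = Z \<omega>" for \<omega>
      by (simp only: Z_def)
    note change = change_of_measure_error[OF n m(1) f g_borel less_imp_le[OF K(1)] K(2)[rule_format] m2[rule_format, OF m(3,1)] E,
        unfolded Z_eq]
    have [measurable]: "Y \<in> borel_measurable M" unfolding Y_def by (rule functional_measurable[OF g_borel])
    have [measurable]: "Z \<in> borel_measurable M"
    proof -
      have [measurable]: "chain (n * m) (j * m) \<in> borel_measurable M" if "j \<in> {..<n}" for j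
        using that by (intro chain_measurable_M[OF nm] mult_right_mono) auto
      have [measurable]: "g \<in> borel_measurable borel" by (rule g_borel)
      show ?thesis unfolding Z_def by measurable
    qed
    have [measurable]: "f \<in> borel_measurable borel" by (rule f_borel)
    have fYZ: "(\<integral>\<^sup>+\<omega>. ennreal (norm (f (Y \<omega>) - f (Z \<omega>))) \<partial>M) \<le> ennreal (L * (e1 + C1 * e1))"
    proof -
      have "(\<integral>\<^sup>+\<omega>. ennreal (norm (f (Y \<omega>) - f (Z \<omega>))) \<partial>M) \<le> (\<integral>\<^sup>+\<omega>. ennreal L * ennreal (norm (Y \<omega> - Z \<omega>)) \<partial>M)"
      proof (rule nn_integral_mono)
        fix \<omega>
        have "norm (f (Y \<omega>) - f (Z \<omega>)) \<le> L * norm (Y \<omega> - Z \<omega>)"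
          using lipschitz_onD[OF f, of "Y \<omega>" "Z \<omega>"] by (simp add: dist_norm)
        then show "ennreal (norm (f (Y \<omega>) - f (Z \<omega>))) \<le> ennreal L * ennreal (norm (Y \<omega> - Z \<omega>))"
          using L by (simp add: ennreal_mult[symmetric] ennreal_leI)
      qed
      also have "\<dots> = ennreal L * (\<integral>\<^sup>+\<omega>. ennreal (norm (Y \<omega> - Z \<omega>)) \<partial>M)"
        by (rule nn_integral_cmult) measurable
      also have "\<dots> \<le> ennreal L * ennreal (e1 + C1 * e1)" by (rule mult_left_mono[OF te]) simp
      also have "\<dots> = ennreal (L * (e1 + C1 * e1))" using L e C1 by (simp add: ennreal_mult)
      finally show ?thesis .
    qed
    have diff: "integrable M (\<lambda>\<omega>. f (Y \<omega>) - f (Z \<omega>))"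
    proof (rule integrableI_bounded)
      show "(\<integral>\<^sup>+\<omega>. ennreal (norm (f (Y \<omega>) - f (Z \<omega>))) \<partial>M) < \<infinity>"
        using fYZ by (rule order_le_less_trans) simp
    qed measurable
    have fY: "integrable M (\<lambda>\<omega>. f (Y \<omega>))"
      using Bochner_Integration.integrable_add[OF diff change(1)] by simp
    have eq: "(\<integral>\<omega>. f (Y \<omega>) \<partial>M) - (\<integral>\<omega>. f (Z \<omega>) \<partial>M) = (\<integral>\<omega>. f (Y \<omega>) - f (Z \<omega>) \<partial>M)"
      by (rule Bochner_Integration.integral_diff[OF fY change(1), symmetric])
    have Le: "0 \<le> L * (e1 + C1 * e1)" using L e C1 by simp
    from order_trans[OF integral_norm_bound_ennreal[OF diff] fYZ]
    have "norm (\<integral>\<omega>. f (Y \<omega>) - f (Z \<omega>) \<partial>M) \<le> L * (e1 + C1 * e1)"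
      unfolding ennreal_le_iff[OF Le] .
    then have part1: "\<bar>(\<integral>\<omega>. f (Y \<omega>) \<partial>M) - (\<integral>\<omega>. f (Z \<omega>) \<partial>M)\<bar> \<le> L * (e1 + C1 * e1)"
      unfolding eq real_norm_def .
    have part2: "\<bar>(\<integral>\<omega>. f (Z \<omega>) \<partial>M) - (\<integral>\<omega>. f (Z \<omega>) \<partial>Q_euler n m)\<bar> \<le> S * sqrt (e2 + C2 * e2)"
      using change(2) unfolding S_def .
    have euler: "(\<integral>\<omega>. f (\<Sum>j<n. stp n *\<^sub>R g (euler_map 1 (stp n) b \<sigma> x0 (\<lambda>k. noise n k \<omega>) j)) \<partial>M) = (\<integral>\<omega>. f (Z \<omega>) \<partial>Q_euler n m)"
      unfolding Z_def by (rule euler_expectation[OF n m(1) f_borel g_borel])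
    have rate1: "e1 \<le> 2 * (1 + T) * h powr \<rho>"
      unfolding e1_def using h \<beta> \<rho> by (intro sqrt_rate_le) auto
    have rate2: "sqrt e2 \<le> 2 * (1 + T) * h powr \<rho>"
      unfolding e2_def using h \<alpha> \<rho> by (intro sqrt_rate_le) auto
    have "L * (e1 + C1 * e1) = L * (1 + C1) * e1" by (simp add: distrib_left distrib_right)
    also have "\<dots> \<le> L * (1 + C1) * (2 * (1 + T) * h powr \<rho>)"
      using L C1 by (intro mult_left_mono rate1) auto
    finally have b1: "L * (e1 + C1 * e1) \<le> L * (1 + C1) * (2 * (1 + T) * h powr \<rho>)" .
    have "S * sqrt (e2 + C2 * e2) = S * sqrt (1 + C2) * sqrt e2"
      by (simp add: real_sqrt_mult[symmetric] distrib_right)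
    also have "\<dots> \<le> S * sqrt (1 + C2) * (2 * (1 + T) * h powr \<rho>)"
      using S C2 by (intro mult_left_mono rate2) auto
    finally have b2: "S * sqrt (e2 + C2 * e2) \<le> S * sqrt (1 + C2) * (2 * (1 + T) * h powr \<rho>)" .
    have "C * h powr \<rho> = L * (1 + C1) * (2 * (1 + T) * h powr \<rho>) + S * sqrt (1 + C2) * (2 * (1 + T) * h powr \<rho>)"
      unfolding C_def by (simp only: distrib_right mult.assoc)
    then show ?thesis
      unfolding Y_eq euler unfolding h_def[symmetric] using part1 part2 b1 b2 by linarith
  qed
  show ?thesis
    unfolding \<rho>_def[symmetric] by (intro exI[of _ C] allI impI main)
qed

section \<open>The Euler--Maruyama approximation at the grid points\<close>

lemma grid_floor_index:
  assumes n: "1 \<le> n" and "0 \<le> s"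
  shows "grid_floor (stp n) s = real (grid_index n s) * stp n"
  using grid_index_bounds[OF assms] stp_pos[OF n] by (intro grid_floor_eq) (simp_all add: add.commute)

lemma grid_floor_integral:
  fixes y :: "real \<Rightarrow> real^'d"
  assumes n: "1 \<le> n"
  shows "(LINT s:{0..real j * stp n}|lborel. y (grid_floor (stp n) s)) = (\<Sum>i<j. stp n *\<^sub>R y (real i * stp n))"
proof -
  have "(LINT s:{0..real j * stp n}|lborel. y (grid_floor (stp n) s))
    = (LINT s|lborel. indicator {0..real j * stp n} s *\<^sub>R y (real (grid_index n s) * stp n))"
    unfolding set_lebesgue_integral_def
    by (intro Bochner_Integration.integral_cong refl) (simp add: indicator_def grid_floor_index[OF n])
  also have "\<dots> = (\<Sum>i<j. stp n *\<^sub>R y (real i * stp n))"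
    by (rule has_bochner_integral_integral_eq[OF step_function_integral[OF n]])
  finally show ?thesis .
qed

lemma euler_maruyama_grid:
  assumes n: "1 \<le> n" and Y: "euler_maruyama T b \<sigma> x0 M W (stp n) Y"
  shows "AE \<omega> in M. \<forall>j\<le>n. Y (real j * stp n) \<omega> = euler_map 1 (stp n) b \<sigma> x0 (\<lambda>k. noise n k \<omega>) j"
proof -
  have "AE \<omega> in M. \<forall>t\<in>{0..T}. Y t \<omega> = x0 + (LINT s:{0..t}|lborel. b (Y (grid_floor (stp n) s) \<omega>)) + \<sigma> *v W t \<omega>"
    using Y by (simp add: euler_maruyama_def)
  with start show ?thesis
  proof eventually_elim
    case (elim \<omega>)
    have eq: "Y (real j * stp n) \<omega> = x0 + (\<Sum>i<j. stp n *\<^sub>R b (Y (real i * stp n) \<omega>)) + \<sigma> *v W (real j * stp n) \<omega>" if "j \<le> n" for j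
      using elim(2)[rule_format, of "real j * stp n"] grid_nonneg[OF n, of j] grid_le[OF n that]
      unfolding grid_floor_integral[OF n, where y = "\<lambda>s. b (Y s \<omega>)" and j = j] by simp
    have "j \<le> n \<longrightarrow> Y (real j * stp n) \<omega> = euler_map 1 (stp n) b \<sigma> x0 (\<lambda>k. noise n k \<omega>) j" for j
    proof (induction j)
      case 0
      show ?case using eq[of 0] elim(1) by simp
    next
      case (Suc j)
      show ?case
      proof
        assume j: "Suc j \<le> n"
        have "Y (real (Suc j) * stp n) \<omega> = Y (real j * stp n) \<omega> + stp n *\<^sub>R b (Y (real j * stp n) \<omega>) + \<sigma> *v noise n j \<omega>"
          unfolding eq[OF j] noise_def matrix_vector_mult_diff_distrib sum.lessThan_Suc
          using eq[of j] j by (simp del: of_nat_Suc)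
        also have "Y (real j * stp n) \<omega> = euler_map 1 (stp n) b \<sigma> x0 (\<lambda>k. noise n k \<omega>) j"
          using Suc.IH j by simp
        finally show "Y (real (Suc j) * stp n) \<omega> = euler_map 1 (stp n) b \<sigma> x0 (\<lambda>k. noise n k \<omega>) (Suc j)"
          by simp
      qed
    qed
    then show ?case by simp
  qed
qed

lemma euler_scheme_measurable:
  assumes n: "1 \<le> n" and j: "j \<le> n"
  shows "(\<lambda>\<omega>. euler_map 1 (stp n) b \<sigma> x0 (\<lambda>k. noise n k \<omega>) j) \<in> borel_measurable M"
proof -
  have "(\<lambda>\<omega>. \<lambda>i\<in>{..<n}. noise n i \<omega>) \<in> M \<rightarrow>\<^sub>M (\<Pi>\<^sub>M i\<in>{..<n}. borel)"
    by (intro measurable_restrict gaussian_walk.increment_measurable_P[OF noise_walk[OF n]]) auto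
  then have "(\<lambda>\<omega>. euler_map 1 (stp n) b \<sigma> x0 (\<lambda>i\<in>{..<n}. noise n i \<omega>) j) \<in> borel_measurable M"
    by (rule measurable_compose) (use j in \<open>auto intro: euler_map_measurable\<close>)
  also have "(\<lambda>\<omega>. euler_map 1 (stp n) b \<sigma> x0 (\<lambda>i\<in>{..<n}. noise n i \<omega>) j) = (\<lambda>\<omega>. euler_map 1 (stp n) b \<sigma> x0 (\<lambda>k. noise n k \<omega>) j)"
    using j by (intro ext euler_map_cong) auto
  finally show ?thesis .
qed

lemma euler_maruyama_expectation:
  fixes f :: "real^'d \<Rightarrow> real"
  assumes n: "1 \<le> n" and Y: "euler_maruyama T b \<sigma> x0 M W (stp n) Y"
    and f: "f \<in> borel_measurable borel" and g: "g \<in> borel_measurable borel"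
  shows "(\<integral>\<omega>. f (LINT s:{0..T}|lborel. g (Y (grid_floor (stp n) s) \<omega>)) \<partial>M)
    = (\<integral>\<omega>. f (\<Sum>j<n. stp n *\<^sub>R g (euler_map 1 (stp n) b \<sigma> x0 (\<lambda>k. noise n k \<omega>) j)) \<partial>M)"
proof -
  have [measurable]: "f \<in> borel_measurable borel" "g \<in> borel_measurable borel" by fact+
  have sums: "(LINT s:{0..T}|lborel. g (Y (grid_floor (stp n) s) \<omega>)) = (\<Sum>j<n. stp n *\<^sub>R g (Y (real j * stp n) \<omega>))" for \<omega>
    using grid_floor_integral[OF n, where y = "\<lambda>s. g (Y s \<omega>)" and j = n] unfolding stp_mult(2)[OF n] .
  have [measurable]: "Y (real j * stp n) \<in> borel_measurable M" if "j \<in> {..<n}" for j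
    using Y grid_nonneg[OF n, of j] grid_le[OF n, of j] that by (simp add: euler_maruyama_def)
  have [measurable]: "(\<lambda>\<omega>. euler_map 1 (stp n) b \<sigma> x0 (\<lambda>k. noise n k \<omega>) j) \<in> borel_measurable M" if "j \<in> {..<n}" for j
    using that by (intro euler_scheme_measurable[OF n]) simp
  show ?thesis
    unfolding sums
  proof (rule integral_cong_AE)
    show "AE \<omega> in M. f (\<Sum>j<n. stp n *\<^sub>R g (Y (real j * stp n) \<omega>)) = f (\<Sum>j<n. stp n *\<^sub>R g (euler_map 1 (stp n) b \<sigma> x0 (\<lambda>k. noise n k \<omega>) j))"
      using euler_maruyama_grid[OF n Y] by eventually_elim simp
  qed measurable
qed

end

theorem corollary2p8:
  fixes T \<alpha> \<beta> :: real
    and x0 :: "real^'d"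
    and \<sigma> :: "real^'d^'d"
    and b g :: "real^'d \<Rightarrow> real^'d"
    and f :: "real^'d \<Rightarrow> real"
    and M :: "'w measure"
    and F :: "real \<Rightarrow> 'w measure"
    and W X :: "real \<Rightarrow> 'w \<Rightarrow> real^'d"
    and Xh :: "nat \<Rightarrow> real \<Rightarrow> 'w \<Rightarrow> real^'d"
  assumes "0 < T"
    and "\<alpha> \<in> {0<..1}" and "\<beta> \<in> {0<..1}"
    and "brownian_motion M F W"
    and "uniformly_elliptic \<sigma>"
    and "weak_existence T b \<sigma> x0" and "uniqueness_in_law T b \<sigma> x0"
    and "weak_solution T b \<sigma> x0 M F W X"
    and "\<And>n. n \<ge> 1 \<Longrightarrow> euler_maruyama T b \<sigma> x0 M W (T / real n) (Xh n)"
    and "b \<in> class_B \<alpha>" and "bounded (range b)"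
    and "\<exists>L. L-lipschitz_on UNIV f"
    and "g \<in> class_B \<beta>"
  shows "\<exists>C. \<forall>n\<ge>1.
    \<bar>(\<integral>\<omega>. f (LINT s:{0..T}|lborel. g (X s \<omega>)) \<partial>M)
      - (\<integral>\<omega>. f (LINT s:{0..T}|lborel. g (Xh n (grid_floor (T / real n) s) \<omega>)) \<partial>M)\<bar>
    \<le> C * (T / real n) powr (min (\<alpha> / 2) (min (\<beta> / 2) (1 / 4)))"
proof -
  obtain \<sigma>' where \<sigma>': "\<sigma> ** \<sigma>' = mat 1" "\<sigma>' ** \<sigma> = mat 1"
    by (rule uniformly_elliptic_imp_invertible[OF assms(5)])
  from nondegenerate_matrix_exists[OF \<sigma>'] obtain c J where cJ: "nondegenerate_matrix \<sigma> c J"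
    by (elim exE)
  obtain c' where c': "0 < c'" "\<And>v. norm (\<sigma>' *v v) \<le> norm v * c'"
    using bounded_linear.pos_bounded[OF matrix_vector_mul_bounded_linear[of \<sigma>']] by blast
  obtain B where B: "\<And>x. norm (b x) \<le> B"
    using assms(11) unfolding bounded_iff by auto
  obtain L where L: "L-lipschitz_on UNIV f" using assms(12) by (elim exE)
  have b_borel: "b \<in> borel_measurable borel" using assms(10) by (simp add: class_B_def)
  have g_borel: "g \<in> borel_measurable borel" using assms(13) by (simp add: class_B_def)
  have sol: "\<forall>t\<in>{0..T}. X t \<in> borel_measurable (F t)" "\<forall>\<omega>\<in>space M. continuous_on {0..T} (\<lambda>t. X t \<omega>)"
    "AE \<omega> in M. \<forall>t\<in>{0..T}. X t \<omega> = x0 + (LINT s:{0..t}|lborel. b (X s \<omega>)) + \<sigma> *v W t \<omega>"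
    using assms(8) unfolding weak_solution_def by - (elim conjE, assumption)+
  interpret additive_sde M F W \<sigma> c J T x0 b B \<sigma>' c' X
    by (intro additive_sde.intro additive_sde_axioms.intro assms(4) cJ)
       (use assms(1) \<sigma>' c' B b_borel sol in \<open>auto simp: mult.commute\<close>)
  have "0 < \<alpha>" "\<alpha> \<le> 1" "0 < \<beta>" "\<beta> \<le> 1" using assms(2,3) by auto
  from functional_error[OF assms(10) this(1,2) assms(13) this(3,4) L]
  obtain C where C: "\<forall>n\<ge>1. \<bar>(\<integral>\<omega>. f (LINT s:{0..T}|lborel. g (X s \<omega>)) \<partial>M)
      - (\<integral>\<omega>. f (\<Sum>j<n. stp n *\<^sub>R g (euler_map 1 (stp n) b \<sigma> x0 (\<lambda>k. noise n k \<omega>) j)) \<partial>M)\<bar>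
    \<le> C * stp n powr (min (\<alpha> / 2) (min (\<beta> / 2) (1 / 4)))"
    by (rule exE)
  have "\<bar>(\<integral>\<omega>. f (LINT s:{0..T}|lborel. g (X s \<omega>)) \<partial>M)
      - (\<integral>\<omega>. f (LINT s:{0..T}|lborel. g (Xh n (grid_floor (T / real n) s) \<omega>)) \<partial>M)\<bar>
    \<le> C * (T / real n) powr (min (\<alpha> / 2) (min (\<beta> / 2) (1 / 4)))" if n: "1 \<le> n" for n
  proof -
    have "euler_maruyama T b \<sigma> x0 M W (stp n) (Xh n)" using assms(9)[OF n] unfolding stp_def .
    from euler_maruyama_expectation[OF n this lipschitz_borel_measurable[OF L] g_borel] C[rule_format, OF n]
    show ?thesis unfolding stp_def[symmetric] by (simp only:)
  qed
  then show ?thesis by (intro exI[of _ C] allI impI)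
qed

end
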